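(* Let $\kappa_{\mathbb R}$ be a real infinitesimal class and let $\mathcal S$ be a finite set of branches of real analytic curves at $(\mathbb R^2,0)$. Then there exists a germ of real meromorphic function $h$ at $(\mathbb R^2,0)$ whose indeterminacy structure is given by $\kappa_{\mathbb R}$ and such that the set of all branches of $h=0$ and $h=\infty$ equals $\mathcal S$.
   Context: A sequence of real quadratic blow-ups $\pi_{\mathbb R}:(\tilde M_{\mathbb R},\mathcal D_{\mathbb R})\to(\mathbb R^2,0)$ is a finite composition of real point blow-ups, the first centred at $0$ and each next one at a point of the exceptional divisor already obtained; the irreducible components of $\mathcal D_{\mathbb R}=\pi_{\mathbb R}^{-1}(0)$ are called components. Branches are irreducible germs at $0\in\mathbb R^2$ of one-dimensional real analytic curves; the branches of $h=0$ and $h=\infty$ are taken in $\mathbb R^2$ (real factors of numerator or denominator whose zero set is just the origin give no branch). A germ of real meromorphic function is a quotient of two germs of real analytic functions at $(\mathbb R^2,0)$. For a component $D\subset\mathcal D_{\mathbb R}$, the real infinitesimal class $\kappa(D)$ consists, up to isomorphism of sequences of blow-ups over $(\mathbb R^2,0)$, of all pairs $(\pi',D')$ ($\pi'$ a sequence of real quadratic blow-ups, $D'$ a component of its divisor) such that either $\pi'=\pi_{\mathbb R}\circ\varsigma$ with $D'=\varsigma^*D$ or $\pi_{\mathbb R}=\pi'\circ\varsigma'$ with $D=\varsigma'^*D'$, for some sequence of real blow-ups $\varsigma$ or $\varsigma'$ ($^*$ denotes strict transform). For a union $\mathcal D^*$ of components, $\kappa(\mathcal D^* )$ is the family of sequences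 of real blow-ups that simultaneously realize all the classes $\kappa(D)$, $D\subset\mathcal D^*$, and such that no two of the components corresponding to components of $\mathcal D^*$ intersect. In the claim $\kappa_{\mathbb R}=\kappa(\mathcal D^* )$ for a union $\mathcal D^*$ of components of the exceptional divisor of some sequence of real quadratic blow-ups. Indeterminacy structure: consider the real analytic foliation defined by the levels of $h$ and its real reduction of singularities, i.e. a minimal sequence of real quadratic blow-ups after which the strict transform foliation has finitely many singularities over the divisor, all simple (linear part non-nilpotent, real eigenvalues with ratio outside $\mathbb Q_+$), has no singularities nor tangencies on non-invariant components, and no two non-invariant components meet. The non-invariant components are called dicritical (they are the components not contained in a level set of the lifted function). The indeterminacy structure of $h$ is given by $\kappa_{\mathbb R}$ when the dicritical components are exactly those determined by $\kappa_{\mathbb R}$, i.e. the real infinitesimal class of the union of the dicritical components is $\kappa_{\mathbb R}$. *)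

theory Defs
  imports "HOL-Analysis.Analysis"
begin

section \<open>Germs of real analytic and meromorphic functions at the origin of the plane\<close>

type_synonym plane = "real \<times> real"

text \<open>Germs at the origin are represented by functions (or sets) on the whole plane; only their
  behaviour near the origin matters.\<close>

definition analytic_germ :: "(plane \<Rightarrow> real) \<Rightarrow> bool" where
  "analytic_germ f \<longleftrightarrow>
    (\<exists>c :: nat \<Rightarrow> nat \<Rightarrow> real. \<exists>r > 0. \<forall>x y. \<bar>x\<bar> < r \<longrightarrow> \<bar>y\<bar> < r \<longrightarrow>
      ((\<lambda>(i, j). c i j * x ^ i * y ^ j) has_sum f (x, y)) UNIV)"

definition same_germ :: "(plane \<Rightarrow> 'a) \<Rightarrow> (plane \<Rightarrow> 'a) \<Rightarrow> bool" where
  "same_germ f g \<longleftrightarrow> (\<forall>\<^sub>F z in nhds 0. f z = g z)"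

definition germ_dvd :: "(plane \<Rightarrow> real) \<Rightarrow> (plane \<Rightarrow> real) \<Rightarrow> bool" where
  "germ_dvd d f \<longleftrightarrow> (\<exists>e. analytic_germ e \<and> same_germ f (\<lambda>z. d z * e z))"

text \<open>The units of the ring of analytic germs are the germs that do not vanish at the origin.\<close>

definition coprime_germs :: "(plane \<Rightarrow> real) \<Rightarrow> (plane \<Rightarrow> real) \<Rightarrow> bool" where
  "coprime_germs f g \<longleftrightarrow>
    (\<forall>d. analytic_germ d \<longrightarrow> germ_dvd d f \<longrightarrow> germ_dvd d g \<longrightarrow> d 0 \<noteq> 0)"

text \<open>A pair \<open>(f, g)\<close> stands for the quotient \<open>f / g\<close>. All notions below
  depend on the quotient only, not on the pair representing it.\<close>

type_synonym quotient_germ = "(plane \<Rightarrow> real) \<times> (plane \<Rightarrow> real)"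

definition meromorphic_germ :: "quotient_germ \<Rightarrow> bool" where
  "meromorphic_germ h \<longleftrightarrow>
    analytic_germ (fst h) \<and> analytic_germ (snd h) \<and> \<not> same_germ (snd h) (\<lambda>_. 0)"

definition reduced_form :: "quotient_germ \<Rightarrow> (plane \<Rightarrow> real) \<Rightarrow> (plane \<Rightarrow> real) \<Rightarrow> bool" where
  "reduced_form h f g \<longleftrightarrow>
    meromorphic_germ (f, g) \<and> coprime_germs f g \<and>
    same_germ (\<lambda>z. fst h z * g z) (\<lambda>z. f z * snd h z)"


section \<open>Branches\<close>

definition set_germ :: "plane set \<Rightarrow> plane set set" where
  "set_germ A = {B. same_germ (\<lambda>z. z \<in> A) (\<lambda>z. z \<in> B)}"

text \<open>Over the reals a finite system of equations is equivalent to a single one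
  (sum of squares), so one equation suffices.\<close>

definition analytic_set_germ :: "plane set \<Rightarrow> bool" where
  "analytic_set_germ A \<longleftrightarrow> (\<exists>f. analytic_germ f \<and> set_germ A = set_germ {z. f z = 0})"

definition irreducible_set_germ :: "plane set \<Rightarrow> bool" where
  "irreducible_set_germ A \<longleftrightarrow>
    (\<forall>B C. analytic_set_germ B \<longrightarrow> analytic_set_germ C \<longrightarrow> set_germ A = set_germ (B \<union> C) \<longrightarrow>
      set_germ A = set_germ B \<or> set_germ A = set_germ C)"

text \<open>An analytic germ in the plane has dimension one iff it is neither a full neighbourhood of the
  origin nor contained in the origin.\<close>

definition one_dimensional_germ :: "plane set \<Rightarrow> bool" where
  "one_dimensional_germ A \<longleftrightarrow> set_germ A \<noteq> set_germ UNIV \<and> 0 islimpt A"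

definition branches :: "plane set set set" where
  "branches = {set_germ A | A.
    analytic_set_germ A \<and> irreducible_set_germ A \<and> one_dimensional_germ A}"

definition branches_of :: "(plane \<Rightarrow> real) \<Rightarrow> plane set set set" where
  "branches_of f = {\<Gamma> \<in> branches. \<exists>A \<in> \<Gamma>. \<forall>z \<in> A. f z = 0}"

definition zero_branches :: "quotient_germ \<Rightarrow> plane set set set" where
  "zero_branches h = (\<Union>{branches_of f | f g. reduced_form h f g})"

definition pole_branches :: "quotient_germ \<Rightarrow> plane set set set" where
  "pole_branches h = (\<Union>{branches_of g | f g. reduced_form h f g})"


section \<open>Sequences of real quadratic blow-ups\<close>

text \<open>The blow-up of a surface \<open>M\<close> at \<open>p\<close> has the points of
  \<open>M - {p}\<close> together with the points \<open>Exc p d\<close>, where \<open>d\<close> runs over the real projective line of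
  tangent directions at \<open>p\<close>. Directions are expressed in the coordinates \<open>(u, v)\<close>
  of \<open>chart p\<close> below: \<open>Slope t\<close> is the direction of
  \<open>(1, t)\<close> and \<open>Vertical\<close> that of \<open>(0, 1)\<close>.\<close>

datatype direction = Slope real | Vertical

datatype point = Base plane | Exc point direction

primrec proj :: "point \<Rightarrow> plane" where
  "proj (Base a) = a"
| "proj (Exc p d) = proj p"

text \<open>\<open>chart q\<close> is the germ at the origin of an analytic parametrisation, with
  \<open>chart q 0 = q\<close>, of any of the iterated blow-ups containing \<open>q\<close>: the blow-down map is
  \<open>(u, v) \<mapsto> (u, u (t + v))\<close> near a direction of slope \<open>t\<close> and
  \<open>(u, v) \<mapsto> (u v, v)\<close> near the vertical one.
  Away from \<open>q\<close> its values may leave the surface under consideration,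
  so only small arguments are meaningful. A blow-up at another point does not change this germ.\<close>

primrec chart :: "point \<Rightarrow> plane \<Rightarrow> point" where
  "chart (Base a) = (\<lambda>z. Base (a + z))"
| "chart (Exc p d) = (\<lambda>(u, v). case d of
      Slope t \<Rightarrow>
        (if u = 0 then Exc p (Slope (t + v)) else chart p (u, u * (t + v)))
    | Vertical \<Rightarrow>
        (if v = 0 then Exc p (if u = 0 then Vertical else Slope (1 / u)) else chart p (u * v, v)))"

lemma chart_0 [simp]: "chart q 0 = q"
  by (cases q) (auto simp: zero_prod_def split: direction.splits)

definition blow_up :: "point set \<Rightarrow> point \<Rightarrow> point set" where
  "blow_up M p = (M - {p}) \<union> range (Exc p)"

text \<open>A sequence of blow-ups is the list of its centres. The composed map to the plane is
  \<open>proj\<close>.\<close>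

definition surface :: "point list \<Rightarrow> point set" where
  "surface cs = foldl blow_up (range Base) cs"

definition divisor :: "point list \<Rightarrow> point set" where
  "divisor cs = {q \<in> surface cs. proj q = 0}"

inductive blowup_seq :: "point list \<Rightarrow> bool" where
  Nil: "blowup_seq []"
| snoc: "blowup_seq cs \<Longrightarrow> p \<in> divisor cs \<Longrightarrow> blowup_seq (cs @ [p])"

definition surface_open :: "point list \<Rightarrow> point set \<Rightarrow> bool" where
  "surface_open cs U \<longleftrightarrow> U \<subseteq> surface cs \<and> (\<forall>q \<in> U. \<forall>\<^sub>F z in nhds 0. chart q z \<in> U)"

definition surface_topology :: "point list \<Rightarrow> point topology" where
  "surface_topology cs = topology (surface_open cs)"

lemma openin_surface_topology: "openin (surface_topology cs) = surface_open cs"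
proof -
  have "istopology (surface_open cs)"
    unfolding istopology_def
  proof (intro conjI allI impI)
    fix U V assume "surface_open cs U" "surface_open cs V"
    then show "surface_open cs (U \<inter> V)"
      unfolding surface_open_def by (auto intro: eventually_conj)
  next
    fix \<K> assume *: "\<forall>K\<in>\<K>. surface_open cs K"
    show "surface_open cs (\<Union>\<K>)"
      unfolding surface_open_def
    proof (intro conjI ballI)
      show "\<Union>\<K> \<subseteq> surface cs"
        using * by (auto simp: surface_open_def)
    next
      fix q assume "q \<in> \<Union>\<K>"
      then obtain K where "K \<in> \<K>" "q \<in> K" by blast
      with * have "\<forall>\<^sub>F z in nhds 0. chart q z \<in> K"
        by (auto simp: surface_open_def)
      then show "\<forall>\<^sub>F z in nhds 0. chart q z \<in> \<Union>\<K>"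
        by eventually_elim (use \<open>K \<in> \<K>\<close> in blast)
    qed
  qed
  then show ?thesis
    by (simp add: surface_topology_def topology_inverse')
qed

text \<open>\<open>strict_transform cs ds A\<close> is the strict transform of \<open>A \<subseteq> surface cs\<close>
  under the further blow-ups with centres \<open>ds\<close>. At each step the preimage of \<open>A - {p}\<close>
  under the blow-up at \<open>p\<close> is \<open>A - {p}\<close> itself.\<close>

fun strict_transform :: "point list \<Rightarrow> point list \<Rightarrow> point set \<Rightarrow> point set" where
  "strict_transform cs [] A = A"
| "strict_transform cs (p # ds) A =
    strict_transform (cs @ [p]) ds (surface_topology (cs @ [p]) closure_of (A - {p}))"

definition components :: "point list \<Rightarrow> point set set" where
  "components cs =
    {strict_transform (cs1 @ [p]) cs2 (range (Exc p)) | cs1 p cs2. cs = cs1 @ p # cs2}"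


section \<open>Real infinitesimal classes\<close>

definition analytic_map_on :: "point set \<Rightarrow> (point \<Rightarrow> point) \<Rightarrow> bool" where
  "analytic_map_on M \<Phi> \<longleftrightarrow>
    (\<forall>q \<in> M. \<exists>F G. analytic_germ F \<and> analytic_germ G \<and> F 0 = 0 \<and> G 0 = 0 \<and>
      (\<forall>\<^sub>F z in nhds 0. \<Phi> (chart q z) = chart (\<Phi> q) (F z, G z)))"

text \<open>An isomorphism over the germ of the plane at the origin extends uniquely to the whole
  surfaces, since the blow-ups are isomorphisms outside their divisors.\<close>

definition seq_isomorphism :: "point list \<Rightarrow> point list \<Rightarrow> (point \<Rightarrow> point) \<Rightarrow> bool" where
  "seq_isomorphism cs cs' \<Phi> \<longleftrightarrow>
    bij_betw \<Phi> (surface cs) (surface cs') \<and>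
    (\<forall>q \<in> surface cs. proj (\<Phi> q) = proj q) \<and>
    analytic_map_on (surface cs) \<Phi> \<and>
    analytic_map_on (surface cs') (inv_into (surface cs) \<Phi>)"

definition marked_seq :: "point list \<times> point set \<Rightarrow> bool" where
  "marked_seq x \<longleftrightarrow> blowup_seq (fst x) \<and> snd x \<in> components (fst x)"

text \<open>Up to isomorphism, the second sequence is the first one followed by further blow-ups, and the
  second component is the strict transform of the first one.\<close>

definition refined_by :: "point list \<times> point set \<Rightarrow> point list \<times> point set \<Rightarrow> bool" where
  "refined_by x y \<longleftrightarrow>
    (\<exists>ds \<Phi>. blowup_seq (fst x @ ds) \<and> seq_isomorphism (fst x @ ds) (fst y) \<Phi> \<and>
      \<Phi> ` strict_transform (fst x) ds (snd x) = snd y)"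

definition comparable :: "point list \<times> point set \<Rightarrow> point list \<times> point set \<Rightarrow> bool" where
  "comparable x y \<longleftrightarrow> marked_seq x \<and> marked_seq y \<and> (refined_by x y \<or> refined_by y x)"

text \<open>Comparability itself is not transitive: two sequences blowing up different points of the
  first exceptional curve are incomparable, but both refine the blow-up of the origin, and all three
  carry the same infinitesimal class. Hence the class of a component is the class of
  the equivalence relation generated by comparability.\<close>

definition component_class :: "point list \<Rightarrow> point set \<Rightarrow> (point list \<times> point set) set" where
  "component_class cs D = {y. marked_seq y \<and> comparable\<^sup>*\<^sup>* (cs, D) y}"

text \<open>A union of components is given as the set of these components. Each sequence in the class of
  a union is recorded together with its components that correspond to the given ones; the sequence
  alone does not determine them.\<close>

definition union_class :: "point list \<Rightarrow> point set set \<Rightarrow> (point list \<times> point set set) set" where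
  "union_class cs \<D> = {(cs', \<D>').
    blowup_seq cs' \<and>
    (\<forall>D \<in> \<D>. \<exists>D' \<in> components cs'. (cs', D') \<in> component_class cs D) \<and>
    \<D>' = {D' \<in> components cs'. \<exists>D \<in> \<D>. (cs', D') \<in> component_class cs D} \<and>
    pairwise disjnt \<D>'}"

definition real_infinitesimal_class :: "(point list \<times> point set set) set \<Rightarrow> bool" where
  "real_infinitesimal_class \<kappa> \<longleftrightarrow>
    (\<exists>cs \<D>. blowup_seq cs \<and> \<D> \<subseteq> components cs \<and> \<kappa> = union_class cs \<D>)"


section \<open>The foliation by levels and its reduction of singularities\<close>

definition partial_u :: "(plane \<Rightarrow> real) \<Rightarrow> plane \<Rightarrow> real" where
  "partial_u f = (\<lambda>(u, v). deriv (\<lambda>s. f (s, v)) u)"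

definition partial_v :: "(plane \<Rightarrow> real) \<Rightarrow> plane \<Rightarrow> real" where
  "partial_v f = (\<lambda>(u, v). deriv (\<lambda>s. f (u, s)) v)"

definition lift_germ :: "quotient_germ \<Rightarrow> point \<Rightarrow> quotient_germ" where
  "lift_germ h q = (\<lambda>z. fst h (proj (chart q z)), \<lambda>z. snd h (proj (chart q z)))"

text \<open>The coefficients of the one-form \<open>g df - f dg\<close>, which is
  \<open>g\<^sup>2 d(f / g)\<close>.\<close>

definition level_form :: "quotient_germ \<Rightarrow> (plane \<Rightarrow> real) \<times> (plane \<Rightarrow> real)" where
  "level_form h =
    (\<lambda>z. snd h z * partial_u (fst h) z - fst h z * partial_u (snd h) z,
     \<lambda>z. snd h z * partial_v (fst h) z - fst h z * partial_v (snd h) z)"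

definition nonconstant_germ :: "quotient_germ \<Rightarrow> bool" where
  "nonconstant_germ h \<longleftrightarrow>
    \<not> (same_germ (fst (level_form h)) (\<lambda>_. 0) \<and> same_germ (snd (level_form h)) (\<lambda>_. 0))"

text \<open>\<open>foliation_form h q a b\<close>: the strict transform foliation is defined near \<open>q\<close>, in the
  coordinates of \<open>chart q\<close>, by the form \<open>a du + b dv\<close> with coprime coefficients. It is
  obtained by dividing the pullback of \<open>g df - f dg\<close> (which is the corresponding form
  of the lifted function) by a common factor of its coefficients. It is unique up to a unit.\<close>

definition foliation_form ::
    "quotient_germ \<Rightarrow> point \<Rightarrow> (plane \<Rightarrow> real) \<Rightarrow> (plane \<Rightarrow> real) \<Rightarrow> bool" where
  "foliation_form h q a b \<longleftrightarrow>
    analytic_germ a \<and> analytic_germ b \<and> coprime_germs a b \<and>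
    (\<exists>k. analytic_germ k \<and> \<not> same_germ k (\<lambda>_. 0) \<and>
      same_germ (fst (level_form (lift_germ h q))) (\<lambda>z. k z * a z) \<and>
      same_germ (snd (level_form (lift_germ h q))) (\<lambda>z. k z * b z))"

definition singular_point :: "quotient_germ \<Rightarrow> point \<Rightarrow> bool" where
  "singular_point h q \<longleftrightarrow> (\<exists>a b. foliation_form h q a b \<and> a 0 = 0 \<and> b 0 = 0)"

text \<open>The linear part at the origin of the vector field with components \<open>(b, - a)\<close>, which
  spans the kernel of \<open>a du + b dv\<close>.\<close>

definition linear_part :: "(plane \<Rightarrow> real) \<Rightarrow> (plane \<Rightarrow> real) \<Rightarrow> real ^ 2 ^ 2" where
  "linear_part a b =
    vector [vector [partial_u b 0, partial_v b 0], vector [- partial_u a 0, - partial_v a 0]]"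

definition simple_singularity :: "quotient_germ \<Rightarrow> point \<Rightarrow> bool" where
  "simple_singularity h q \<longleftrightarrow>
    (\<exists>a b. foliation_form h q a b \<and> a 0 = 0 \<and> b 0 = 0 \<and>
      (\<exists>\<alpha> \<beta> :: real.
        (\<forall>x. det (linear_part a b - mat x) = (\<alpha> - x) * (\<beta> - x)) \<and>
        \<not> (\<alpha> = 0 \<and> \<beta> = 0) \<and>
        \<not> (\<exists>r \<in> \<rat>. r > 0 \<and> \<alpha> = r * \<beta>)))"

definition tangent_vector :: "point set \<Rightarrow> point \<Rightarrow> plane \<Rightarrow> bool" where
  "tangent_vector D q w \<longleftrightarrow>
    (\<exists>\<gamma> :: real \<Rightarrow> plane. \<gamma> 0 = 0 \<and> (\<gamma> has_vector_derivative w) (at 0) \<and>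
      (\<forall>\<^sub>F s in nhds 0. chart q (\<gamma> s) \<in> D))"

text \<open>The defining form vanishes on the tangent line of \<open>D\<close> at \<open>q\<close>; this includes the
  case that \<open>q\<close> is a singular point.\<close>

definition tangent_at :: "quotient_germ \<Rightarrow> point set \<Rightarrow> point \<Rightarrow> bool" where
  "tangent_at h D q \<longleftrightarrow>
    (\<exists>a b. foliation_form h q a b \<and>
      (\<forall>w. tangent_vector D q w \<longrightarrow> a 0 * fst w + b 0 * snd w = 0))"

definition invariant_component :: "quotient_germ \<Rightarrow> point set \<Rightarrow> bool" where
  "invariant_component h D \<longleftrightarrow> (\<forall>q \<in> D. tangent_at h D q)"

definition dicritical_components :: "quotient_germ \<Rightarrow> point list \<Rightarrow> point set set" where
  "dicritical_components h cs = {D \<in> components cs. \<not> invariant_component h D}"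

definition reduces_singularities :: "quotient_germ \<Rightarrow> point list \<Rightarrow> bool" where
  "reduces_singularities h cs \<longleftrightarrow>
    nonconstant_germ h \<and> blowup_seq cs \<and>
    finite {q \<in> divisor cs. singular_point h q} \<and>
    (\<forall>q \<in> divisor cs. singular_point h q \<longrightarrow> simple_singularity h q) \<and>
    (\<forall>D \<in> dicritical_components h cs. \<forall>q \<in> D. \<not> singular_point h q \<and> \<not> tangent_at h D q) \<and>
    pairwise disjnt (dicritical_components h cs)"

definition real_reduction :: "quotient_germ \<Rightarrow> point list \<Rightarrow> bool" where
  "real_reduction h cs \<longleftrightarrow>
    reduces_singularities h cs \<and>
    \<not> (\<exists>cs' ds \<Phi>. reduces_singularities h cs' \<and> ds \<noteq> [] \<and> blowup_seq (cs' @ ds) \<and>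
        seq_isomorphism (cs' @ ds) cs \<Phi>)"

definition indeterminacy_structure_given_by ::
    "quotient_germ \<Rightarrow> (point list \<times> point set set) set \<Rightarrow> bool" where
  "indeterminacy_structure_given_by h \<kappa> \<longleftrightarrow>
    (\<exists>cs. real_reduction h cs \<and> union_class cs (dicritical_components h cs) = \<kappa>)"

end

theory Submission
  imports Defs
begin

text \<open>Let \<open>P\<close> be the set of the centres that create the prescribed components. The function is
  \<open>h = f\<^sup>2 A / G\<close>, where \<open>f\<close> is an equation of the branches in \<open>S\<close> and \<open>A\<close>, \<open>G\<close> do not vanish outside the
  origin, so that \<open>S\<close> is the set of zero branches and there are no pole branches. Over the reals there are
  enough germs without zeros outside the origin (sums of squares) to prescribe the order of \<open>h\<close> along every
  component of a large sequence of blow-ups: it is made zero for the centres in \<open>P\<close> and positive for all others.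
  The latter components are then invariant, and they meet the former, on which \<open>h\<close> is therefore not constant.

  After more blow-ups, \<open>h - c\<close> is near every point of the divisor a unit times a product of powers of two
  transversal smooth functions. Hence the foliation is reduced and its dicritical components are those of \<open>P\<close>.
  A reduction of least length with centres among these has blown up all points of \<open>P\<close>, since blowing up
  nonsingular points and simple singularities never produces dicritical components.\<close>

text \<open>Signs shape the function. A germ without zeros off the origin has constant sign there,
  hence even order along every component. So \<open>f\<close> enters squared, and only then can its
  orders be cancelled. All even orders can be reached: each centre \<open>p\<close> contributes the
  sum of squares of local coordinates at \<open>p\<close>, which are themselves quotients of germs
  on the plane, and half the orders of these functions along the components form an integer matrix
  that is triangular with respect to depth, with ones on the diagonal.

  Order zero along a component does not yet make it dicritical, as the function could be constant on
  it. Therefore the two axis points over each prescribed centre are blown up as well. This separates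
  the prescribed components from each other and lets each of them meet a component of positive
  order.

  Sequences, isomorphisms and classes are controlled by the set of centres: the surface depends on
  this set only, isomorphisms over the plane preserve it, and the class of a component depends on
  its centre only. Minimality of a reduction and equality of classes thus become statements about
  finite sets of points.\<close>

unbundle no vec_syntax
unbundle fps_syntax
no_notation Infinite_Set_Sum.abs_summable_on (infix \<open>abs'_summable'_on\<close> 50)

section \<open>The ring of convergent power series in two variables\<close>

text \<open>Series in \<open>x\<close> whose coefficients are series in \<open>y\<close>. A
  geometric bound on the coefficients amounts to convergence near the origin, and it is easy to
  carry through ring operations, substitutions and recursions by estimating coefficients.\<close>

definition geometrically_bounded :: "real fps fps \<Rightarrow> bool" where
  "geometrically_bounded A \<longleftrightarrow> (\<exists>M R. \<forall>i j. \<bar>A $ i $ j\<bar> \<le> M * R ^ (i + j))"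

lemma geometrically_boundedE:
  assumes "geometrically_bounded A"
  obtains M R where "M > 0" "R \<ge> 1" "\<And>i j. \<bar>A $ i $ j\<bar> \<le> M * R ^ (i + j)"
proof -
  from assms obtain M R where *: "\<And>i j. \<bar>A $ i $ j\<bar> \<le> M * R ^ (i + j)"
    unfolding geometrically_bounded_def by blast
  have "\<bar>A $ i $ j\<bar> \<le> (\<bar>M\<bar> + 1) * max 1 \<bar>R\<bar> ^ (i + j)" for i j
  proof -
    have "M * R ^ (i + j) \<le> \<bar>M\<bar> * \<bar>R\<bar> ^ (i + j)"
      by (metis abs_ge_self abs_mult power_abs)
    also have "\<dots> \<le> (\<bar>M\<bar> + 1) * max 1 \<bar>R\<bar> ^ (i + j)"
      by (intro mult_mono power_mono) auto
    finally show ?thesis using *[of i j] by linarith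
  qed
  then show ?thesis by (intro that[of "\<bar>M\<bar> + 1" "max 1 \<bar>R\<bar>"]) auto
qed

lemma geometrically_boundedI:
  "(\<And>i j. \<bar>A $ i $ j\<bar> \<le> M * R ^ (i + j)) \<Longrightarrow> geometrically_bounded A"
  unfolding geometrically_bounded_def by blast

lemma geometrically_bounded_common:
  assumes "geometrically_bounded A" "geometrically_bounded B"
  obtains M R where "M > 0" "R \<ge> 1" "\<And>i j. \<bar>A $ i $ j\<bar> \<le> M * R ^ (i + j)"
    "\<And>i j. \<bar>B $ i $ j\<bar> \<le> M * R ^ (i + j)"
proof -
  obtain M R where 1: "M > 0" "R \<ge> 1" "\<And>i j. \<bar>A $ i $ j\<bar> \<le> M * R ^ (i + j)"
    using assms(1) by (rule geometrically_boundedE) blast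
  obtain M' R' where 2: "M' > 0" "R' \<ge> 1" "\<And>i j. \<bar>B $ i $ j\<bar> \<le> M' * R' ^ (i + j)"
    using assms(2) by (rule geometrically_boundedE) blast
  show ?thesis
  proof (rule that[of "max M M'" "max R R'"])
    show "\<bar>A $ i $ j\<bar> \<le> max M M' * max R R' ^ (i + j)" for i j
      by (rule order_trans[OF 1(3)], intro mult_mono power_mono) (use 1 2 in auto)
    show "\<bar>B $ i $ j\<bar> \<le> max M M' * max R R' ^ (i + j)" for i j
      by (rule order_trans[OF 2(3)], intro mult_mono power_mono) (use 1 2 in auto)
  qed (use 1 2 in auto)
qed

lemma of_nat_le_two_power: "real (n + 1) \<le> 2 ^ n"
proof -
  have "n + 1 \<le> 2 ^ n" using less_exp[of n] by (simp add: Suc_le_eq)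
  then show ?thesis by (metis of_nat_le_iff of_nat_numeral of_nat_power)
qed

lemma geometrically_bounded_add:
  assumes "geometrically_bounded A" "geometrically_bounded B"
  shows "geometrically_bounded (A + B)"
  using assms
proof (rule geometrically_bounded_common)
  fix M R :: real assume *: "M > 0" "R \<ge> 1" "\<And>i j. \<bar>A $ i $ j\<bar> \<le> M * R ^ (i + j)"
    "\<And>i j. \<bar>B $ i $ j\<bar> \<le> M * R ^ (i + j)"
  show ?thesis
  proof (rule geometrically_boundedI[of _ "2 * M" R])
    show "\<bar>(A + B) $ i $ j\<bar> \<le> 2 * M * R ^ (i + j)" for i j
      using *(3,4)[of i j] abs_triangle_ineq[of "A $ i $ j" "B $ i $ j"] by simp
  qed
qed

lemma geometrically_bounded_uminus: "geometrically_bounded A \<Longrightarrow> geometrically_bounded (- A)"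
  by (simp add: geometrically_bounded_def)

lemma fps_nth_mult2: "(A * B :: real fps fps) $ i $ j = (\<Sum>(k,l)\<in>{..i}\<times>{..j}. A $ k $ l * B $ (i - k) $ (j - l))"
  by (simp add: fps_mult_nth fps_sum_nth sum.cartesian_product atLeast0AtMost)

lemma geometrically_bounded_mult:
  assumes "geometrically_bounded A" "geometrically_bounded B"
  shows "geometrically_bounded (A * B)"
  using assms
proof (rule geometrically_bounded_common)
  fix M R :: real assume *: "M > 0" "R \<ge> 1" "\<And>i j. \<bar>A $ i $ j\<bar> \<le> M * R ^ (i + j)"
    "\<And>i j. \<bar>B $ i $ j\<bar> \<le> M * R ^ (i + j)"
  show ?thesis
  \<comment> \<open>The doubled ratio absorbs the number \<open>(i + 1) * (j + 1)\<close> of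
    summands.\<close>
  proof (rule geometrically_boundedI[of _ "M * M" "2 * R"])
    fix i j
    have "\<bar>(A * B) $ i $ j\<bar> \<le> (\<Sum>(k,l)\<in>{..i}\<times>{..j}. (M * M) * R ^ (i + j))"
      unfolding fps_nth_mult2
    proof (rule order_trans[OF sum_abs], rule sum_mono)
      fix p assume "p \<in> {..i} \<times> {..j}"
      then obtain k l where p: "p = (k, l)" and "k \<in> {..i}" "l \<in> {..j}" by auto
      then have e: "(k + l) + (i - k + (j - l)) = i + j" by auto
      have "\<bar>A $ k $ l * B $ (i - k) $ (j - l)\<bar> \<le> (M * R ^ (k + l)) * (M * R ^ (i - k + (j - l)))"
        unfolding abs_mult by (intro mult_mono *) (use *(1,2) in auto)
      also have "\<dots> = M * M * R ^ (i + j)"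
        unfolding e[symmetric] power_add by (simp add: mult_ac)
      finally show "\<bar>case p of (k, l) \<Rightarrow> A $ k $ l * B $ (i - k) $ (j - l)\<bar>
          \<le> (case p of (k, l) \<Rightarrow> M * M * R ^ (i + j))" by (simp add: p)
    qed
    also have "\<dots> = (real (i + 1) * real (j + 1)) * (M * M * R ^ (i + j))"
      by (simp add: algebra_simps)
    also have "\<dots> \<le> (2 ^ i * 2 ^ j) * (M * M * R ^ (i + j))"
      by (intro mult_right_mono mult_mono of_nat_le_two_power) (use *(1,2) in auto)
    also have "\<dots> = M * M * (2 * R) ^ (i + j)" by (simp add: power_add power_mult_distrib)
    finally show "\<bar>(A * B) $ i $ j\<bar> \<le> M * M * (2 * R) ^ (i + j)" .
  qed
qed

lemma geometrically_bounded_const: "geometrically_bounded (fps_const (fps_const c))"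
  by (rule geometrically_boundedI[of _ "\<bar>c\<bar>" 1]) simp

lemma geometrically_bounded_X: "geometrically_bounded fps_X"
  by (rule geometrically_boundedI[of _ 1 1]) (simp add: fps_X_def)

lemma geometrically_bounded_Y: "geometrically_bounded (fps_const fps_X)"
  by (rule geometrically_boundedI[of _ 1 1]) (simp add: fps_X_def)

text \<open>Germs become elements of an integral domain, where divisibility and cancellation are
  available; \<open>ev\<close> leads back to functions on the plane.\<close>

typedef germ = "{A. geometrically_bounded A}"
  morphisms ser mk_germ
  by (rule exI[of _ 0]) (simp add: geometrically_boundedI[of _ 0 0])

setup_lifting type_definition_germ

instantiation germ :: idom
begin
lift_definition zero_germ :: germ is 0 by (simp add: geometrically_boundedI[of _ 0 0])
lift_definition one_germ :: germ is 1 using geometrically_bounded_const[of 1] by simp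
lift_definition plus_germ :: "germ \<Rightarrow> germ \<Rightarrow> germ" is "(+)" by (rule geometrically_bounded_add)
lift_definition uminus_germ :: "germ \<Rightarrow> germ" is "uminus" by (rule geometrically_bounded_uminus)
lift_definition minus_germ :: "germ \<Rightarrow> germ \<Rightarrow> germ" is "(-)"
  by (metis geometrically_bounded_add geometrically_bounded_uminus uminus_add_conv_diff add.commute)
lift_definition times_germ :: "germ \<Rightarrow> germ \<Rightarrow> germ" is "(*)" by (rule geometrically_bounded_mult)
instance by standard (transfer; simp add: algebra_simps)+
end

lift_definition cst :: "real \<Rightarrow> germ" is "\<lambda>c. fps_const (fps_const c)"
  by (rule geometrically_bounded_const)
lift_definition gX :: germ is fps_X by (rule geometrically_bounded_X)
lift_definition gY :: germ is "fps_const fps_X" by (rule geometrically_bounded_Y)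

definition cf :: "germ \<Rightarrow> nat \<Rightarrow> nat \<Rightarrow> real" where "cf A i j = ser A $ i $ j"

lemma germ_eqI: "(\<And>i j. cf A i j = cf B i j) \<Longrightarrow> A = B"
  unfolding cf_def by (metis fps_ext ser_inject)

lemma cf_simps [simp]:
  "cf 0 i j = 0" "cf (A + B) i j = cf A i j + cf B i j" "cf (A - B) i j = cf A i j - cf B i j"
  "cf (- A) i j = - cf A i j"
  unfolding cf_def by (transfer; simp)+

lemma cf_mult: "cf (A * B) i j = (\<Sum>(k,l)\<in>{..i}\<times>{..j}. cf A k l * cf B (i - k) (j - l))"
  unfolding cf_def times_germ.rep_eq by (rule fps_nth_mult2)

lemma cf_cst: "cf (cst c) i j = (if i = 0 \<and> j = 0 then c else 0)"
  unfolding cf_def cst.rep_eq by simp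
lemma cf_one: "cf 1 i j = (if i = 0 \<and> j = 0 then 1 else 0)"
  unfolding cf_def one_germ.rep_eq by simp
lemma cf_gX: "cf gX i j = (if i = 1 \<and> j = 0 then 1 else 0)"
  unfolding cf_def gX.rep_eq by (simp add: fps_X_def)
lemma cf_gY: "cf gY i j = (if i = 0 \<and> j = 1 then 1 else 0)"
  unfolding cf_def gY.rep_eq by (simp add: fps_X_def)

lemma cst_0 [simp]: "cst 0 = 0" and cst_1 [simp]: "cst 1 = 1"
  by (rule germ_eqI, simp add: cf_cst cf_one)+
lemma cst_add: "cst (a + b) = cst a + cst b" and cst_diff: "cst (a - b) = cst a - cst b"
  by (rule germ_eqI, simp add: cf_cst)+

lemma cf_bound: obtains M R where "M > 0" "R \<ge> 1" "\<And>i j. \<bar>cf A i j\<bar> \<le> M * R ^ (i + j)"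
  using ser[of A] unfolding cf_def by (auto elim: geometrically_boundedE)

lemma mk_germ_cf: "geometrically_bounded A \<Longrightarrow> cf (mk_germ A) i j = A $ i $ j"
  by (simp add: cf_def mk_germ_inverse)

subsection \<open>Evaluation\<close>

definition ev :: "germ \<Rightarrow> plane \<Rightarrow> real" where
  "ev A z = (\<Sum>\<^sub>\<infinity>(i,j). cf A i j * fst z ^ i * snd z ^ j)"

lemma eventually_square:
  "(\<forall>\<^sub>F z in nhds (0 :: plane). P z) \<longleftrightarrow> (\<exists>r>0. \<forall>x y. \<bar>x\<bar> < r \<longrightarrow> \<bar>y\<bar> < r \<longrightarrow> P (x, y))"
proof
  assume "\<forall>\<^sub>F z in nhds (0 :: plane). P z"
  then obtain d where d: "d > 0" "\<And>z. dist z 0 < d \<Longrightarrow> P z"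
    unfolding eventually_nhds_metric by blast
  have "P (x, y)" if "\<bar>x\<bar> < d / 2" "\<bar>y\<bar> < d / 2" for x y
  proof (rule d(2))
    have "norm (x, y) \<le> \<bar>x\<bar> + \<bar>y\<bar>" by (metis norm_Pair_le real_norm_def)
    then show "dist (x, y) 0 < d" using that by simp
  qed
  then show "\<exists>r>0. \<forall>x y. \<bar>x\<bar> < r \<longrightarrow> \<bar>y\<bar> < r \<longrightarrow> P (x, y)"
    using d(1) by (intro exI[of _ "d / 2"]) auto
next
  assume "\<exists>r>0. \<forall>x y. \<bar>x\<bar> < r \<longrightarrow> \<bar>y\<bar> < r \<longrightarrow> P (x, y)"
  then obtain r where r: "r > 0" "\<And>x y. \<bar>x\<bar> < r \<Longrightarrow> \<bar>y\<bar> < r \<Longrightarrow> P (x, y)" by blast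
  have "P z" if "dist z 0 < r" for z
  proof -
    have "\<bar>fst z\<bar> < r" "\<bar>snd z\<bar> < r"
      using that norm_fst_le[of "fst z" "snd z"] norm_snd_le[of "snd z" "fst z"] by simp_all
    from r(2)[OF this] show ?thesis by simp
  qed
  then show "\<forall>\<^sub>F z in nhds 0. P z" unfolding eventually_nhds_metric using r(1) by blast
qed

lemma summable_geometric_pairs:
  fixes a b :: real assumes "0 \<le> a" "a < 1" "0 \<le> b" "b < 1"
  shows "(\<lambda>(i::nat, j::nat). a ^ i * b ^ j) summable_on UNIV"
proof -
  have s: "(\<lambda>j::nat. c ^ j) summable_on UNIV" if "0 \<le> c" "c < 1" for c :: real
    by (rule norm_summable_imp_summable_on) (use that in \<open>simp add: summable_geometric\<close>)
  have "(\<lambda>i::nat. a ^ i * (\<Sum>\<^sub>\<infinity>j::nat. b ^ j)) summable_on UNIV"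
    by (intro summable_on_cmult_left s assms)
  then have "(\<lambda>i. \<Sum>\<^sub>\<infinity>j::nat. a ^ i * b ^ j) summable_on UNIV"
    by (simp add: infsum_cmult_right')
  moreover have "(\<lambda>j. a ^ i * b ^ j) summable_on UNIV" for i :: nat
    by (intro summable_on_cmult_right s assms)
  ultimately show ?thesis
    using Infinite_Sum.abs_summable_on_Sigma_iff[of "\<lambda>(i::nat, j::nat). a ^ i * b ^ j" UNIV "\<lambda>_. UNIV"] assms
    by (simp add: case_prod_unfold infsum_nonneg)
qed

lemma eventually_abs_summable:
  "\<forall>\<^sub>F z in nhds 0. (\<lambda>(i,j). cf A i j * fst z ^ i * snd z ^ j) abs_summable_on UNIV"
proof -
  obtain M R where MR: "M > 0" "R \<ge> 1" "\<And>i j. \<bar>cf A i j\<bar> \<le> M * R ^ (i + j)" by (rule cf_bound) blast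
  show ?thesis unfolding eventually_square
  proof (intro exI[of _ "1 / R"] conjI allI impI)
    fix x y assume xy: "\<bar>x\<bar> < 1 / R" "\<bar>y\<bar> < 1 / R"
    have s: "(\<lambda>z. M * (case z of (i, j) \<Rightarrow> (R * \<bar>x\<bar>) ^ i * (R * \<bar>y\<bar>) ^ j)) summable_on UNIV"
      by (intro summable_on_cmult_right summable_geometric_pairs)
        (use MR xy in \<open>auto simp: field_simps\<close>)
    show "(\<lambda>(i,j). cf A i j * fst (x,y) ^ i * snd (x,y) ^ j) abs_summable_on UNIV"
    proof (rule Infinite_Sum.abs_summable_on_comparison_test'[OF s], clarify)
      fix i j
      have "norm (cf A i j * x ^ i * y ^ j) \<le> (M * R ^ (i + j)) * (\<bar>x\<bar> ^ i * \<bar>y\<bar> ^ j)"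
        using mult_right_mono[OF MR(3)[of i j], of "\<bar>x\<bar> ^ i * \<bar>y\<bar> ^ j"]
        by (simp add: abs_mult power_abs mult.assoc)
      then show "norm (cf A i j * fst (x,y) ^ i * snd (x,y) ^ j) \<le> M * ((R * \<bar>x\<bar>) ^ i * (R * \<bar>y\<bar>) ^ j)"
        by (simp add: power_add power_mult_distrib mult_ac)
    qed
  qed (use MR in auto)
qed

lemma ev_has_sumI:
  assumes "(\<lambda>(i,j). cf A i j * fst z ^ i * snd z ^ j) abs_summable_on UNIV"
  shows "((\<lambda>(i,j). cf A i j * fst z ^ i * snd z ^ j) has_sum ev A z) UNIV"
  unfolding ev_def by (rule has_sum_infsum) (rule abs_summable_summable[OF assms])

lemma eventually_ev_has_sum:
  "\<forall>\<^sub>F z in nhds 0. ((\<lambda>(i,j). cf A i j * fst z ^ i * snd z ^ j) has_sum ev A z) UNIV"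
  using eventually_abs_summable by eventually_elim (rule ev_has_sumI)

lemma ev_0: "ev A 0 = cf A 0 0"
proof -
  have "ev A 0 = (\<Sum>\<^sub>\<infinity>(i,j)\<in>{(0,0)}. cf A i j * fst (0::plane) ^ i * snd (0::plane) ^ j)"
    unfolding ev_def by (rule infsum_cong_neutral) (auto simp: power_0_left split: if_splits)
  then show ?thesis by simp
qed

lemma ev_add: "\<forall>\<^sub>F z in nhds 0. ev (A + B) z = ev A z + ev B z"
  using eventually_ev_has_sum[of A] eventually_ev_has_sum[of B] eventually_ev_has_sum[of "A + B"]
proof eventually_elim
  case (elim z)
  from has_sum_add[OF elim(1,2)] elim(3) show ?case
    by (intro has_sum_unique[OF elim(3)]) (auto simp: case_prod_unfold algebra_simps)
qed

lemma ev_uminus: "ev (- A) z = - ev A z"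
  unfolding ev_def by (simp add: infsum_uminus[symmetric] case_prod_unfold)

lemma ev_diff: "\<forall>\<^sub>F z in nhds 0. ev (A - B) z = ev A z - ev B z"
  using ev_add[of A "- B"] by (simp add: ev_uminus)

lemma ev_cst [simp]: "ev (cst c) z = c"
proof -
  have "ev (cst c) z = (\<Sum>\<^sub>\<infinity>(i,j)\<in>{(0,0)}. cf (cst c) i j * fst z ^ i * snd z ^ j)"
    unfolding ev_def by (rule infsum_cong_neutral) (auto simp: cf_cst split: if_splits)
  then show ?thesis by (simp add: cf_cst)
qed
lemma ev_one [simp]: "ev 1 z = 1" using ev_cst[of 1] by simp
lemma ev_zero [simp]: "ev 0 z = 0" using ev_cst[of 0] by simp
lemma ev_gX [simp]: "ev gX z = fst z"
proof -
  have "ev gX z = (\<Sum>\<^sub>\<infinity>(i,j)\<in>{(1,0)}. cf gX i j * fst z ^ i * snd z ^ j)"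
    unfolding ev_def by (rule infsum_cong_neutral) (auto simp: cf_gX split: if_splits)
  then show ?thesis by (simp add: cf_gX)
qed
lemma ev_gY [simp]: "ev gY z = snd z"
proof -
  have "ev gY z = (\<Sum>\<^sub>\<infinity>(i,j)\<in>{(0,1)}. cf gY i j * fst z ^ i * snd z ^ j)"
    unfolding ev_def by (rule infsum_cong_neutral) (auto simp: cf_gY split: if_splits)
  then show ?thesis by (simp add: cf_gY)
qed

lemma abs_summable_on_product_pairs:
  fixes f g :: "'a \<Rightarrow> real"
  assumes f: "f abs_summable_on A" and g: "g abs_summable_on A"
  shows "(\<lambda>(p,q). f p * g q) abs_summable_on (A \<times> A)"
proof -
  have "(\<lambda>q. f p * g q) abs_summable_on A" for p
    using summable_on_cmult_right[OF g, of "\<bar>f p\<bar>"] by (simp add: abs_mult)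
  moreover have "(\<lambda>p. \<bar>f p\<bar> * (\<Sum>\<^sub>\<infinity>q\<in>A. \<bar>g q\<bar>)) summable_on A"
    using summable_on_cmult_left[OF f] by simp
  ultimately show ?thesis
    using Infinite_Sum.abs_summable_on_Sigma_iff[of "\<lambda>(p,q). f p * g q" A "\<lambda>_. A"]
    by (simp add: abs_mult infsum_cmult_right' case_prod_unfold infsum_nonneg)
qed

lemma has_sum_product_pairs:
  fixes f g :: "'a \<Rightarrow> real"
  assumes "f abs_summable_on A" "g abs_summable_on A" "(f has_sum s) A" "(g has_sum t) A"
  shows "((\<lambda>(p,q). f p * g q) has_sum (s * t)) (A \<times> A)"
proof (rule has_sum_SigmaI[where g = "\<lambda>p. f p * t"])
  show "((\<lambda>q. case (p, q) of (p, q) \<Rightarrow> f p * g q) has_sum f p * t) A" for p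
    using has_sum_cmult_right[OF assms(4), of "f p"] by simp
  show "((\<lambda>p. f p * t) has_sum s * t) A"
    by (rule has_sum_cmult_left[OF assms(3)])
  show "(\<lambda>(p,q). f p * g q) summable_on A \<times> A"
    by (rule abs_summable_summable[OF abs_summable_on_product_pairs[OF assms(1,2)]])
qed

lemma ev_mult: "\<forall>\<^sub>F z in nhds 0. ev (A * B) z = ev A z * ev B z"
  using eventually_abs_summable[of A] eventually_abs_summable[of B] eventually_ev_has_sum[of "A * B"]
proof eventually_elim
  case (elim z)
  define t where "t = (\<lambda>C p. cf C (fst p) (snd p) * fst z ^ fst p * snd z ^ snd p)"
  have t: "(\<lambda>(i,j). cf C i j * fst z ^ i * snd z ^ j) = t C" for C
    by (auto simp: t_def)
  have "((\<lambda>(p,q). t A p * t B q) has_sum (ev A z * ev B z)) (UNIV \<times> UNIV)"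
    by (rule has_sum_product_pairs[OF elim(1)[unfolded t] elim(2)[unfolded t]
      ev_has_sumI[OF elim(1), unfolded t] ev_has_sumI[OF elim(2), unfolded t]])
  \<comment> \<open>Cauchy product: a pair of exponents is recorded as its sum together with its
    first entry.\<close>
  also have "?this \<longleftrightarrow> ((\<lambda>(p,q). t A q * t B (fst p - fst q, snd p - snd q)) has_sum (ev A z * ev B z))
      (SIGMA p:UNIV. {..fst p} \<times> {..snd p})"
    by (rule has_sum_reindex_bij_witness[where j = "\<lambda>(p,q). ((fst p + fst q, snd p + snd q), p)"
          and i = "\<lambda>(p,q). (q, (fst p - fst q, snd p - snd q))"]) auto
  finally have "((\<lambda>p. \<Sum>q\<in>{..fst p} \<times> {..snd p}. t A q * t B (fst p - fst q, snd p - snd q))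
      has_sum (ev A z * ev B z)) UNIV"
    by (rule has_sum_SigmaD) (auto intro!: has_sum_finite)
  moreover have "(\<Sum>q\<in>{..fst p} \<times> {..snd p}. t A q * t B (fst p - fst q, snd p - snd q)) = t (A * B) p" for p
  proof -
    have "(\<Sum>q\<in>{..fst p} \<times> {..snd p}. t A q * t B (fst p - fst q, snd p - snd q)) =
      (\<Sum>q\<in>{..fst p} \<times> {..snd p}. (cf A (fst q) (snd q) * cf B (fst p - fst q) (snd p - snd q)) * (fst z ^ fst p * snd z ^ snd p))"
    proof (rule sum.cong)
      fix q assume "q \<in> {..fst p} \<times> {..snd p}"
      then have "fst z ^ fst p = fst z ^ fst q * fst z ^ (fst p - fst q)"
        "snd z ^ snd p = snd z ^ snd q * snd z ^ (snd p - snd q)"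
        by (auto simp flip: power_add)
      then show "t A q * t B (fst p - fst q, snd p - snd q) =
        (cf A (fst q) (snd q) * cf B (fst p - fst q) (snd p - snd q)) * (fst z ^ fst p * snd z ^ snd p)"
        by (simp add: t_def mult_ac)
    qed simp
    then show ?thesis by (simp add: t_def cf_mult case_prod_unfold sum_distrib_right mult.assoc)
  qed
  ultimately have "(t (A * B) has_sum (ev A z * ev B z)) UNIV" by simp
  with elim(3)[unfolded t] show ?case by (rule has_sum_unique)
qed

lemma ev_power: "\<forall>\<^sub>F z in nhds 0. ev (A ^ n) z = ev A z ^ n"
proof (induction n)
  case (Suc n)
  show ?case using Suc ev_mult[of A "A ^ n"] by eventually_elim simp
qed simp

section \<open>Uniqueness of power series coefficients\<close>

lemma powser_eq_0:
  fixes a :: "nat \<Rightarrow> real"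
  assumes r: "r > 0" and s: "\<And>x. \<bar>x\<bar> < r \<Longrightarrow> (\<lambda>n. a n * x ^ n) sums 0"
  shows "a n = 0"
proof (induction n rule: less_induct)
  case (less n)
  have "(\<lambda>k. a (k + n) * x ^ k) sums 0" if "x \<noteq> 0" "norm x < r" for x
  proof -
    have "(\<lambda>k. a (k + n) * x ^ (k + n)) sums 0"
      using sums_split_initial_segment[OF s[of x], of n] that less by simp
    from sums_mult_D[of "x ^ n" "\<lambda>k. a (k + n) * x ^ k" 0] this that
    show ?thesis by (simp add: power_add mult_ac)
  qed
  from powser_limit_0_strong[OF r this] have "((\<lambda>_. 0) \<longlongrightarrow> a (0 + n)) (at (0::real))" by simp
  then show ?case
    using tendsto_unique[OF _ tendsto_const[of 0] ] by (metis add_0 at_neq_bot)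
qed

text \<open>The coefficient of \<open>x ^ i\<close> as a function of \<open>y\<close>. It reduces
  uniqueness and differentiation of double series to series in one variable.\<close>

definition row :: "germ \<Rightarrow> nat \<Rightarrow> real \<Rightarrow> real" where
  "row A i y = (\<Sum>\<^sub>\<infinity>j. cf A i j * y ^ j)"

lemma rows_sum:
  obtains r where "r > 0"
    "\<And>y i. \<bar>y\<bar> < r \<Longrightarrow> ((\<lambda>j. cf A i j * y ^ j) has_sum row A i y) UNIV"
    "\<And>x y. \<bar>x\<bar> < r \<Longrightarrow> \<bar>y\<bar> < r \<Longrightarrow> (\<lambda>i. row A i y * x ^ i) sums ev A (x, y)"
proof -
  obtain r where r: "r > 0" and s: "\<And>x y. \<bar>x\<bar> < r \<Longrightarrow> \<bar>y\<bar> < r \<Longrightarrow>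
      (\<lambda>(i,j). cf A i j * x ^ i * y ^ j) abs_summable_on UNIV"
    using eventually_abs_summable[of A] unfolding eventually_square by auto
  have hs: "((\<lambda>(i,j). cf A i j * x ^ i * y ^ j) has_sum ev A (x, y)) (UNIV \<times> UNIV)"
    if "\<bar>x\<bar> < r" "\<bar>y\<bar> < r" for x y
    using ev_has_sumI[of A "(x, y)"] s[OF that] by simp
  have 1: "((\<lambda>j. cf A i j * y ^ j) has_sum row A i y) UNIV" if "\<bar>y\<bar> < r" for y i
  proof -
    have "(\<lambda>(i,j). cf A i j * (r/2) ^ i * y ^ j) summable_on (UNIV \<times> UNIV)"
      using hs[of "r/2" y] that r by (auto simp: summable_on_def)
    from summable_on_SigmaD1[OF this, of i]
    have "(\<lambda>j. (2/r) ^ i * (cf A i j * (r/2) ^ i * y ^ j)) summable_on UNIV"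
      by (intro summable_on_cmult_right) auto
    moreover have "(2/r) ^ i * (cf A i j * (r/2) ^ i * y ^ j) = cf A i j * y ^ j" for j
      using r by (simp add: field_simps)
    ultimately show ?thesis unfolding row_def by (intro has_sum_infsum) simp
  qed
  have 2: "(\<lambda>i. row A i y * x ^ i) sums ev A (x, y)" if "\<bar>x\<bar> < r" "\<bar>y\<bar> < r" for x y
  proof (rule has_sum_imp_sums, rule has_sum_SigmaD[OF hs[OF that]])
    show "((\<lambda>j. case (i, j) of (i, j) \<Rightarrow> cf A i j * x ^ i * y ^ j) has_sum row A i y * x ^ i) UNIV" for i
      using has_sum_cmult_left[OF 1[OF that(2), of i], of "x ^ i"] by (simp add: mult_ac)
  qed
  from r 1 2 show ?thesis by (rule that)
qed

text \<open>Identity principle: all rows vanish as functions of \<open>y\<close>, hence so do all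
  their coefficients. Through it, identities of germs can be checked on values near the
  origin.\<close>

theorem ev_eq_0_imp: assumes "\<forall>\<^sub>F z in nhds 0. ev A z = 0" shows "A = 0"
proof -
  obtain r where r: "r > 0"
    "\<And>y i. \<bar>y\<bar> < r \<Longrightarrow> ((\<lambda>j. cf A i j * y ^ j) has_sum row A i y) UNIV"
    "\<And>x y. \<bar>x\<bar> < r \<Longrightarrow> \<bar>y\<bar> < r \<Longrightarrow> (\<lambda>i. row A i y * x ^ i) sums ev A (x, y)"
    by (rule rows_sum[of A]) blast
  obtain s where s: "s > 0" "\<And>x y. \<bar>x\<bar> < s \<Longrightarrow> \<bar>y\<bar> < s \<Longrightarrow> ev A (x, y) = 0"
    using assms unfolding eventually_square by blast
  define t where "t = min r s"
  have t: "t > 0" using r s by (simp add: t_def)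
  have row: "row A i y = 0" if "\<bar>y\<bar> < t" for i y
    by (rule powser_eq_0[OF t]) (use r(3) s(2) that in \<open>force simp: t_def\<close>)
  have "cf A i j = 0" for i j
  proof (rule powser_eq_0[OF t])
    show "(\<lambda>n. cf A i n * x ^ n) sums 0" if "\<bar>x\<bar> < t" for x
      using has_sum_imp_sums[OF r(2)[of x i]] row[OF that, of i] that by (simp add: t_def)
  qed
  then show ?thesis by (intro germ_eqI) simp
qed

lemma ev_eq_imp: assumes "\<forall>\<^sub>F z in nhds 0. ev A z = ev B z" shows "A = B"
proof -
  have "\<forall>\<^sub>F z in nhds 0. ev (A - B) z = 0"
    using assms ev_diff[of A B] by eventually_elim simp
  from ev_eq_0_imp[OF this] show ?thesis by simp
qed

text \<open>Summability at the single point \<open>(r/2, r/2)\<close> bounds the terms there, which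
  is the geometric bound with ratio \<open>2/r\<close>.\<close>

lemma analytic_germ_iff: "analytic_germ f \<longleftrightarrow> (\<exists>A. same_germ f (ev A))"
proof
  assume "analytic_germ f"
  then obtain c r where r: "r > 0" and c: "\<And>x y. \<bar>x\<bar> < r \<Longrightarrow> \<bar>y\<bar> < r \<Longrightarrow>
      ((\<lambda>(i, j). c i j * x ^ i * y ^ j) has_sum f (x, y)) UNIV"
    unfolding analytic_germ_def by blast
  define A where "A = Abs_fps (\<lambda>i. Abs_fps (c i))"
  have sm: "(\<lambda>(i, j). c i j * (r/2) ^ i * (r/2) ^ j) summable_on UNIV"
    using c[of "r/2" "r/2"] r by (auto simp: summable_on_def)
  have "bdd_above (sum (\<lambda>p. norm (case p of (i, j) \<Rightarrow> c i j * (r/2) ^ i * (r/2) ^ j)) ` {F. F \<subseteq> UNIV \<and> finite F})"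
    by (rule iffD1[OF abs_summable_iff_bdd_above iffD1[OF summable_on_iff_abs_summable_on_real sm]])
  then obtain M where M: "\<And>F. finite F \<Longrightarrow> sum (\<lambda>p. norm (case p of (i, j) \<Rightarrow> c i j * (r/2) ^ i * (r/2) ^ j)) F \<le> M"
    by (auto simp: bdd_above_def)
  have g: "geometrically_bounded A"
  proof (rule geometrically_boundedI)
    fix i j
    have "\<bar>c i j\<bar> * (r/2) ^ i * (r/2) ^ j \<le> M"
      using M[of "{(i,j)}"] r by (simp add: abs_mult)
    then show "\<bar>A $ i $ j\<bar> \<le> M * (2/r) ^ (i + j)"
      using r by (simp add: A_def power_add field_simps)
  qed
  have cf: "cf (mk_germ A) i j = c i j" for i j
    using mk_germ_cf[OF g] by (simp add: A_def)
  have "same_germ f (ev (mk_germ A))"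
    unfolding same_germ_def
  proof -
    have "\<forall>\<^sub>F z in nhds 0. ((\<lambda>(i, j). c i j * fst z ^ i * snd z ^ j) has_sum f z) UNIV"
      unfolding eventually_square using r c by auto
    then show "\<forall>\<^sub>F z in nhds 0. f z = ev (mk_germ A) z"
      using eventually_ev_has_sum[of "mk_germ A"]
      by eventually_elim (auto simp: cf intro: has_sum_unique)
  qed
  then show "\<exists>A. same_germ f (ev A)" by blast
next
  assume "\<exists>A. same_germ f (ev A)"
  then obtain A where "\<forall>\<^sub>F z in nhds 0. f z = ev A z" by (auto simp: same_germ_def)
  with eventually_ev_has_sum[of A]
  have "\<forall>\<^sub>F z in nhds 0. ((\<lambda>(i,j). cf A i j * fst z ^ i * snd z ^ j) has_sum f z) UNIV"
    by eventually_elim simp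
  then show "analytic_germ f"
    unfolding analytic_germ_def eventually_square by (auto intro!: exI[of _ "cf A"])
qed

lemma analytic_ev [simp, intro]: "analytic_germ (ev A)"
  unfolding analytic_germ_iff by (auto simp: same_germ_def intro!: exI[of _ A])

text \<open>The germ is split as its value plus \<open>x * A1 + y * A2\<close>, where
  \<open>A1\<close> and \<open>A2\<close> are bounded near the origin.\<close>

lemma isCont_0: "isCont (\<lambda>z. ev A z) (0 :: plane)"
proof -
  obtain M R where MR: "M > 0" "R \<ge> 1" "\<And>i j. \<bar>cf A i j\<bar> \<le> M * R ^ (i + j)" by (rule cf_bound) blast
  define A1 where "A1 = Abs_fps (\<lambda>i. Abs_fps (\<lambda>j. ser A $ Suc i $ j))"
  define A2 where "A2 = fps_const (Abs_fps (\<lambda>j. ser A $ 0 $ Suc j))"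
  have 1: "geometrically_bounded A1"
    by (rule geometrically_boundedI[of _ "M * R" R]) (use MR(3) in \<open>simp add: A1_def cf_def mult.assoc flip: power_Suc add_Suc\<close>)
  have 2: "geometrically_bounded A2"
  proof (rule geometrically_boundedI[of _ "M * R" R])
    show "\<bar>A2 $ i $ j\<bar> \<le> M * R * R ^ (i + j)" for i j
      using MR(1,2) MR(3)[of 0 "Suc j"] by (cases i) (auto simp: A2_def cf_def mult.assoc)
  qed
  have s12: "ser (mk_germ A1) = A1" "ser (mk_germ A2) = A2"
    using 1 2 by (simp_all add: mk_germ_inverse)
  have eq: "A = cst (val) + gX * mk_germ A1 + gY * mk_germ A2" if "val = cf A 0 0" for val
  proof (rule germ_eqI)
    fix i j
    show "cf A i j = cf (cst val + gX * mk_germ A1 + gY * mk_germ A2) i j"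
      unfolding cf_def plus_germ.rep_eq times_germ.rep_eq gX.rep_eq gY.rep_eq cst.rep_eq s12
      by (cases i; cases j) (auto simp: A1_def A2_def that cf_def)
  qed
  have bnd: "\<forall>\<^sub>F z in nhds 0. \<bar>ev C z\<bar> \<le> K" if "K = (\<Sum>\<^sub>\<infinity>(i,j). \<bar>cf C i j\<bar> * s ^ i * s ^ j)" "0 < s"
     "(\<lambda>(i,j). cf C i j * s ^ i * s ^ j) abs_summable_on UNIV" for C K s
    unfolding eventually_square
  proof (intro exI[of _ s] conjI allI impI that(2))
    fix x y assume xy: "\<bar>x\<bar> < s" "\<bar>y\<bar> < s"
    have S: "(\<lambda>p. norm (case p of (i,j) \<Rightarrow> cf C i j * s ^ i * s ^ j)) summable_on UNIV" by (rule that(3))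
    have le: "norm (case p of (i,j) \<Rightarrow> cf C i j * x ^ i * y ^ j) \<le> norm (case p of (i,j) \<Rightarrow> cf C i j * s ^ i * s ^ j)" for p
      using xy that(2) by (cases p) (auto simp: abs_mult power_abs intro!: mult_mono power_mono)
    have T: "(\<lambda>p. norm (case p of (i,j) \<Rightarrow> cf C i j * x ^ i * y ^ j)) summable_on UNIV"
      by (rule Infinite_Sum.abs_summable_on_comparison_test'[OF S le])
    have "\<bar>ev C (x, y)\<bar> \<le> (\<Sum>\<^sub>\<infinity>p. norm (case p of (i,j) \<Rightarrow> cf C i j * x ^ i * y ^ j))"
      unfolding ev_def using norm_infsum_bound[OF T] by simp
    also have "\<dots> \<le> (\<Sum>\<^sub>\<infinity>p. norm (case p of (i,j) \<Rightarrow> cf C i j * s ^ i * s ^ j))"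
      by (rule infsum_mono[OF T S le])
    also have "\<dots> = K" unfolding that(1) using that(2) by (auto simp: abs_mult intro!: infsum_cong)
    finally show "\<bar>ev C (x, y)\<bar> \<le> K" .
  qed
  have bd: "\<exists>K. \<forall>\<^sub>F z in nhds 0. \<bar>ev C z\<bar> \<le> K" for C
  proof -
    obtain r where r: "r > 0" and s: "\<And>x y. \<bar>x\<bar> < r \<Longrightarrow> \<bar>y\<bar> < r \<Longrightarrow>
        (\<lambda>(i,j). cf C i j * x ^ i * y ^ j) abs_summable_on UNIV"
      using eventually_abs_summable[of C] unfolding eventually_square by auto
    show ?thesis using bnd[OF refl, of "r/2" C] r s[of "r/2" "r/2"] by auto
  qed
  obtain K1 K2 where K: "\<forall>\<^sub>F z in nhds 0. \<bar>ev (mk_germ A1) z\<bar> \<le> K1" "\<forall>\<^sub>F z in nhds 0. \<bar>ev (mk_germ A2) z\<bar> \<le> K2"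
    using bd by blast
  have evA: "\<forall>\<^sub>F z in nhds 0. ev A z = cf A 0 0 + fst z * ev (mk_germ A1) z + snd z * ev (mk_germ A2) z"
    using ev_add[of "cst (cf A 0 0) + gX * mk_germ A1" "gY * mk_germ A2"] ev_add[of "cst (cf A 0 0)" "gX * mk_germ A1"]
      ev_mult[of gX "mk_germ A1"] ev_mult[of gY "mk_germ A2"]
    by eventually_elim (simp flip: eq[OF refl])
  have "((\<lambda>z. \<bar>fst z\<bar> * K1 + \<bar>snd z\<bar> * K2) \<longlongrightarrow> \<bar>fst (0::plane)\<bar> * K1 + \<bar>snd (0::plane)\<bar> * K2) (at 0)"
    by (intro tendsto_intros)
  then have lim: "((\<lambda>z::plane. \<bar>fst z\<bar> * K1 + \<bar>snd z\<bar> * K2) \<longlongrightarrow> 0) (at 0)" by simp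
  have "((\<lambda>z. ev A z - cf A 0 0) \<longlongrightarrow> 0) (at 0)"
  proof (rule Lim_null_comparison[OF _ lim])
    have "\<forall>\<^sub>F z in nhds 0. norm (ev A z - cf A 0 0) \<le> \<bar>fst z\<bar> * K1 + \<bar>snd z\<bar> * K2"
      using evA K
    proof eventually_elim
      case (elim z)
      have "\<bar>fst z * ev (mk_germ A1) z\<bar> \<le> \<bar>fst z\<bar> * K1" "\<bar>snd z * ev (mk_germ A2) z\<bar> \<le> \<bar>snd z\<bar> * K2"
        using elim unfolding abs_mult by (intro mult_left_mono; simp)+
      then show ?case using elim(1) by simp
    qed
    then show "\<forall>\<^sub>F z in at 0. norm (ev A z - cf A 0 0) \<le> \<bar>fst z\<bar> * K1 + \<bar>snd z\<bar> * K2"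
      unfolding eventually_at_filter by (rule eventually_mono) simp
  qed
  then show ?thesis unfolding isCont_def ev_0 using LIM_zero_cancel by blast
qed

subsection \<open>Substitutions and derivatives\<close>

definition val :: "germ \<Rightarrow> real" where "val A = cf A 0 0"

lemma val_simps [simp]: "val 0 = 0" "val 1 = 1" "val (A + B) = val A + val B" "val (A - B) = val A - val B"
  "val (- A) = - val A" "val (A * B) = val A * val B" "val (cst c) = c" "val gX = 0" "val gY = 0"
  by (simp_all add: val_def cf_one cf_mult cf_cst cf_gX cf_gY)

lemma val_power [simp]: "val (A ^ n) = val A ^ n" by (induction n) auto

lemma ev_at_0: "ev A 0 = val A" by (simp add: ev_0 val_def)

text \<open>Exchange of the two coordinates. The vertical chart, \<open>dY\<close> and the order
  along \<open>y = 0\<close> are defined through it, so that facts about them can be derived from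
  their counterparts for \<open>x\<close>.\<close>

lift_definition sw :: "germ \<Rightarrow> germ" is "\<lambda>A. Abs_fps (\<lambda>i. Abs_fps (\<lambda>j. A $ j $ i))"
  unfolding geometrically_bounded_def by (metis fps_nth_Abs_fps add.commute)

lemma cf_sw [simp]: "cf (sw A) i j = cf A j i" unfolding cf_def sw.rep_eq by simp
lemma sw_sw [simp]: "sw (sw A) = A" by (rule germ_eqI) simp
lemma sw_simps [simp]: "sw 0 = 0" "sw 1 = 1" "sw (A + B) = sw A + sw B" "sw (A - B) = sw A - sw B"
  "sw (- A) = - sw A" "sw gX = gY" "sw gY = gX" "sw (cst c) = cst c" "val (sw A) = val A"
  by (auto intro!: germ_eqI simp: val_def cf_gX cf_gY cf_cst cf_one)
lemma sw_mult [simp]: "sw (A * B) = sw A * sw B"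
proof (rule germ_eqI)
  fix i j
  show "cf (sw (A * B)) i j = cf (sw A * sw B) i j"
    by (simp add: cf_mult sum.cartesian_product[symmetric] sum.swap[of _ "{..j}" "{..i}"])
qed
lemma sw_power [simp]: "sw (A ^ n) = sw A ^ n" by (induction n) auto
lemma sw_eq_0_iff [simp]: "sw A = 0 \<longleftrightarrow> A = 0" by (metis sw_simps(1) sw_sw)
lemma sw_dvd_iff: "sw A dvd sw B \<longleftrightarrow> A dvd B" by (metis dvd_def sw_mult sw_sw)

lemma ev_sw: "ev (sw A) (x, y) = ev A (y, x)"
proof -
  have "ev (sw A) (x, y) = (\<Sum>\<^sub>\<infinity>p. (\<lambda>(i,j). cf A i j * y ^ i * x ^ j) (prod.swap p))"
    unfolding ev_def by (rule infsum_cong) (simp add: case_prod_unfold)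
  also have "\<dots> = ev A (y, x)"
    unfolding ev_def by (subst infsum_reindex_bij_betw) auto
  finally show ?thesis .
qed

text \<open>The homogeneous part of degree \<open>n\<close> restricted to the line
  \<open>x = 1\<close>; as a polynomial in the slope it governs the blow-up.\<close>

definition hpoly :: "germ \<Rightarrow> nat \<Rightarrow> real poly" where
  "hpoly A n = (\<Sum>j\<le>n. monom (cf A (n - j) j) j)"

lemma coeff_hpoly: "coeff (hpoly A n) j = (if j \<le> n then cf A (n - j) j else 0)"
  unfolding hpoly_def coeff_sum coeff_monom by simp

lemma degree_hpoly: "degree (hpoly A n) \<le> n"
  by (rule degree_le) (simp add: coeff_hpoly)

lemma coeff_linear_power_bound: "\<bar>coeff ([:t, 1:] ^ j) l\<bar> \<le> (\<bar>t\<bar> + 1 :: real) ^ j"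
proof (induction j arbitrary: l)
  case 0
  show ?case by simp
next
  case (Suc j)
  have "coeff ([:t, 1:] ^ Suc j) l = t * coeff ([:t, 1:] ^ j) l + (case l of 0 \<Rightarrow> 0 | Suc k \<Rightarrow> coeff ([:t, 1:] ^ j) k)"
    by (auto simp: coeff_pCons split: nat.split)
  also have "\<bar>\<dots>\<bar> \<le> \<bar>t\<bar> * (\<bar>t\<bar> + 1) ^ j + (\<bar>t\<bar> + 1) ^ j"
    using Suc.IH by (intro order_trans[OF abs_triangle_ineq] add_mono) (auto simp: abs_mult mult_left_mono split: nat.split)
  finally show ?case by (simp add: algebra_simps)
qed

lemma pcompose_hpoly: "pcompose (hpoly A n) q = (\<Sum>j\<le>n. smult (cf A (n - j) j) (q ^ j))"
proof -
  have "pcompose (monom c j) q = smult c (q ^ j)" for c j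
    by (induction j) (simp_all add: monom_Suc monom_0 pcompose_pCons)
  then show ?thesis unfolding hpoly_def pcompose_sum by simp
qed

text \<open>The substitution that turns \<open>A\<close> into \<open>A (u, u * (t + v))\<close>: the
  part of degree \<open>n\<close> contributes \<open>u ^ n\<close> times its polynomial at
  \<open>t + v\<close>. The coefficients of \<open>(t + v) ^ j\<close> are at most
  \<open>(\<bar>t\<bar> + 1) ^ j\<close>, which gives convergence.\<close>

lift_definition blow :: "real \<Rightarrow> germ \<Rightarrow> germ" is
  "\<lambda>t A. Abs_fps (\<lambda>n. fps_of_poly (\<Sum>j\<le>n. smult (A $ (n - j) $ j) ([:t, 1:] ^ j)))"
proof -
  fix t :: real and A
  assume "geometrically_bounded A"
  then obtain M R where MR: "M > 0" "R \<ge> 1" "\<And>i j. \<bar>A $ i $ j\<bar> \<le> M * R ^ (i + j)"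
    by (rule geometrically_boundedE) blast
  define K where "K = \<bar>t\<bar> + 1"
  have K: "K \<ge> 1" by (simp add: K_def)
  show "geometrically_bounded (Abs_fps (\<lambda>n. fps_of_poly (\<Sum>j\<le>n. smult (A $ (n - j) $ j) ([:t, 1:] ^ j))))"
  proof (rule geometrically_boundedI[of _ M "2 * (R * K)"])
    fix n l
    have "\<bar>coeff (\<Sum>j\<le>n. smult (A $ (n - j) $ j) ([:t, 1:] ^ j)) l\<bar> \<le> (\<Sum>j\<le>n. M * R ^ n * K ^ n)"
      unfolding coeff_sum coeff_smult
    proof (rule order_trans[OF sum_abs], rule sum_mono)
      fix j assume j: "j \<in> {..n}"
      have "\<bar>A $ (n - j) $ j * coeff ([:t, 1:] ^ j) l\<bar> \<le> (M * R ^ n) * K ^ j"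
        unfolding abs_mult K_def using MR(3)[of "n - j" j] j MR(1,2)
        by (intro mult_mono coeff_linear_power_bound) auto
      also have "\<dots> \<le> M * R ^ n * K ^ n"
        using MR K j by (intro mult_left_mono power_increasing) auto
      finally show "\<bar>A $ (n - j) $ j * coeff ([:t, 1:] ^ j) l\<bar> \<le> M * R ^ n * K ^ n" .
    qed
    also have "\<dots> = real (n + 1) * (M * (R * K) ^ n)" by (simp add: power_mult_distrib)
    also have "\<dots> \<le> 2 ^ n * (M * (R * K) ^ n)"
      by (intro mult_right_mono of_nat_le_two_power) (use MR K in auto)
    also have "\<dots> = M * (2 * (R * K)) ^ n" by (simp add: power_mult_distrib)
    also have "\<dots> \<le> M * (2 * (R * K)) ^ (n + l)"
    proof (intro mult_left_mono power_increasing)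
      have "1 * 1 \<le> R * K" using MR K by (intro mult_mono) auto
      then show "1 \<le> 2 * (R * K)" by simp
    qed (use MR in auto)
    finally show "\<bar>Abs_fps (\<lambda>n. fps_of_poly (\<Sum>j\<le>n. smult (A $ (n - j) $ j) ([:t, 1:] ^ j))) $ n $ l\<bar>
        \<le> M * (2 * (R * K)) ^ (n + l)" by simp
  qed
qed

lemma ser_blow: "ser (blow t A) $ n = fps_of_poly (pcompose (hpoly A n) [:t, 1:])"
  unfolding blow.rep_eq pcompose_hpoly by (simp add: cf_def)

lemma cf_blow: "cf (blow t A) n l = coeff (pcompose (hpoly A n) [:t, 1:]) l"
  unfolding cf_def ser_blow by simp

lemma tendsto_blow_map: "((\<lambda>z::plane. (fst z, fst z * (t + snd z))) \<longlongrightarrow> 0) (nhds 0)"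
proof -
  have "isCont (\<lambda>z::plane. (fst z, fst z * (t + snd z))) 0" by (intro continuous_intros)
  then have "((\<lambda>z::plane. (fst z, fst z * (t + snd z))) \<longlongrightarrow> (0, 0)) (at 0)"
    unfolding isCont_def by simp
  then show ?thesis
    using tendsto_at_iff_tendsto_nhds[of "\<lambda>z::plane. (fst z, fst z * (t + snd z))" 0]
    by (simp add: zero_prod_def)
qed

lemma eventually_blow_map:
  "\<forall>\<^sub>F z in nhds 0. P z \<Longrightarrow> \<forall>\<^sub>F z :: plane in nhds 0. P (fst z, fst z * (t + snd z))"
  using tendsto_blow_map unfolding filterlim_iff by blast

lemma eventually_swap: "\<forall>\<^sub>F z in nhds 0. P z \<Longrightarrow> \<forall>\<^sub>F z :: plane in nhds 0. P (snd z, fst z)"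
  unfolding eventually_square by auto

lemma poly_has_sum: "((\<lambda>l. coeff p l * v ^ l) has_sum poly p (v::real)) UNIV"
proof -
  have "((\<lambda>l. coeff p l * v ^ l) has_sum (\<Sum>l\<le>degree p. coeff p l * v ^ l)) {..degree p}"
    by (rule has_sum_finite) simp
  also have "?this \<longleftrightarrow> ?thesis"
    unfolding poly_altdef by (rule has_sum_cong_neutral) (auto simp: coeff_eq_0)
  finally show ?thesis .
qed

lemma ev_blow: "\<forall>\<^sub>F z in nhds 0. ev (blow t A) z = ev A (fst z, fst z * (t + snd z))"
  using eventually_ev_has_sum[of "blow t A"] eventually_blow_map[OF eventually_ev_has_sum[of A], of t]
proof eventually_elim
  case (elim z)
  obtain u v where z: "z = (u, v)" by (cases z)
  have "((\<lambda>n. u ^ n * poly (pcompose (hpoly A n) [:t, 1:]) v) has_sum ev (blow t A) z) UNIV"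
  proof (rule has_sum_SigmaD)
    show "((\<lambda>(n, l). cf (blow t A) n l * u ^ n * v ^ l) has_sum ev (blow t A) z) (UNIV \<times> UNIV)"
      using elim(1) by (simp add: z)
    show "((\<lambda>l. case (n, l) of (n, l) \<Rightarrow> cf (blow t A) n l * u ^ n * v ^ l) has_sum
        u ^ n * poly (pcompose (hpoly A n) [:t, 1:]) v) UNIV" for n
      using has_sum_cmult_right[OF poly_has_sum[of "pcompose (hpoly A n) [:t, 1:]" v], of "u ^ n"]
      by (simp add: cf_blow mult_ac)
  qed
  moreover have "((\<lambda>n. u ^ n * poly (pcompose (hpoly A n) [:t, 1:]) v) has_sum ev A (u, u * (t + v))) UNIV"
  proof (rule has_sum_SigmaD)
    have "((\<lambda>(i,j). cf A i j * u ^ i * (u * (t + v)) ^ j) has_sum ev A (u, u * (t + v))) UNIV"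
      using elim(2) by (simp add: z)
    also have "?this \<longleftrightarrow> ((\<lambda>(n,j). cf A (n - j) j * u ^ n * (t + v) ^ j) has_sum ev A (u, u * (t + v))) (SIGMA n:UNIV. {..n})"
      by (rule has_sum_reindex_bij_witness[where j = "\<lambda>(i,j). (i + j, j)" and i = "\<lambda>(n,j). (n - j, j)"])
        (auto simp: power_add power_mult_distrib)
    finally show "((\<lambda>(n,j). cf A (n - j) j * u ^ n * (t + v) ^ j) has_sum ev A (u, u * (t + v))) (SIGMA n:UNIV. {..n})" .
    show "((\<lambda>j. case (n, j) of (n, j) \<Rightarrow> cf A (n - j) j * u ^ n * (t + v) ^ j) has_sum
        u ^ n * poly (pcompose (hpoly A n) [:t, 1:]) v) {..n}" for n
      by (rule has_sum_finiteI) (auto simp: pcompose_hpoly poly_sum sum_distrib_left mult_ac intro!: sum.cong)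
  qed
  ultimately show ?case by (auto simp: z intro: has_sum_unique)
qed

text \<open>On values \<open>blow t\<close> is composition with a map, so compatibility with the
  ring operations follows from the identity principle without any work on coefficients.\<close>

lemma blow_add [simp]: "blow t (A + B) = blow t A + blow t B"
  using ev_blow[of t "A + B"] ev_blow[of t A] ev_blow[of t B] ev_add[of "blow t A" "blow t B"]
    eventually_blow_map[OF ev_add[of A B], of t]
  by (intro ev_eq_imp, eventually_elim) simp
lemma blow_mult [simp]: "blow t (A * B) = blow t A * blow t B"
  using ev_blow[of t "A * B"] ev_blow[of t A] ev_blow[of t B] ev_mult[of "blow t A" "blow t B"]
    eventually_blow_map[OF ev_mult[of A B], of t]
  by (intro ev_eq_imp, eventually_elim) simp
lemma blow_uminus [simp]: "blow t (- A) = - blow t A"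
  using ev_blow[of t "- A"] ev_blow[of t A]
  by (intro ev_eq_imp, eventually_elim) (simp add: ev_uminus)
lemma blow_diff [simp]: "blow t (A - B) = blow t A - blow t B"
  using blow_add[of t A "- B"] by simp
lemma blow_cst [simp]: "blow t (cst c) = cst c"
  using ev_blow[of t "cst c"] by (intro ev_eq_imp, eventually_elim) simp
lemma blow_0 [simp]: "blow t 0 = 0" and blow_1 [simp]: "blow t 1 = 1"
  using blow_cst[of t 0] blow_cst[of t 1] by simp_all
lemma blow_gX [simp]: "blow t gX = gX"
  using ev_blow[of t gX] by (intro ev_eq_imp, eventually_elim) simp
lemma blow_gY [simp]: "blow t gY = gX * (cst t + gY)"
  using ev_blow[of t gY] ev_mult[of gX "cst t + gY"] ev_add[of "cst t" gY]
  by (intro ev_eq_imp, eventually_elim) simp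
lemma blow_power [simp]: "blow t (A ^ n) = blow t A ^ n" by (induction n) auto
lemma val_blow [simp]: "val (blow t A) = val A"
  by (simp add: val_def cf_blow hpoly_def monom_0)

definition blowV :: "germ \<Rightarrow> germ" where "blowV A = sw (blow 0 (sw A))"

lemma ev_blowV: "\<forall>\<^sub>F z in nhds 0. ev (blowV A) z = ev A (fst z * snd z, snd z)"
  using eventually_swap[OF ev_blow[of 0 "sw A"]]
  by eventually_elim (auto simp: blowV_def ev_sw[of _ "fst z" "snd z" for z, simplified] ev_sw mult.commute)

lemma blowV_simps [simp]: "blowV (A + B) = blowV A + blowV B" "blowV (A * B) = blowV A * blowV B"
  "blowV (- A) = - blowV A" "blowV (A - B) = blowV A - blowV B" "blowV (cst c) = cst c" "blowV 0 = 0" "blowV 1 = 1"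
  "blowV gX = gX * gY" "blowV gY = gY" "blowV (A ^ n) = blowV A ^ n" "val (blowV A) = val A"
  by (simp_all add: blowV_def mult.commute)

section \<open>Partial derivatives and the chain rule\<close>

lift_definition dX :: "germ \<Rightarrow> germ" is fps_deriv
proof -
  fix A :: "real fps fps" assume "geometrically_bounded A"
  then obtain M R where MR: "M > 0" "R \<ge> 1" "\<And>i j. \<bar>A $ i $ j\<bar> \<le> M * R ^ (i + j)"
    by (rule geometrically_boundedE) blast
  show "geometrically_bounded (fps_deriv A)"
  proof (rule geometrically_boundedI[of _ "M * R" "2 * R"])
    fix i j
    have "\<bar>fps_deriv A $ i $ j\<bar> = real (i + 1) * \<bar>A $ Suc i $ j\<bar>"
      by (simp add: fps_mult_of_nat_nth(1)[of "Suc i", simplified] abs_mult del: of_nat_Suc)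
    also have "\<dots> \<le> 2 ^ (i + j) * (M * R ^ (Suc i + j))"
      by (intro mult_mono MR(3) order_trans[OF of_nat_le_two_power power_increasing]) (use MR in auto)
    finally show "\<bar>fps_deriv A $ i $ j\<bar> \<le> M * R * (2 * R) ^ (i + j)"
      by (simp add: power_mult_distrib mult_ac)
  qed
qed

lemma cf_dX: "cf (dX A) i j = real (i + 1) * cf A (Suc i) j"
  unfolding cf_def dX.rep_eq by (simp add: fps_mult_of_nat_nth(1)[of "Suc i", simplified] del: of_nat_Suc)

lemma dX_simps [simp]: "dX 0 = 0" "dX 1 = 0" "dX (A + B) = dX A + dX B" "dX (A - B) = dX A - dX B"
  "dX (- A) = - dX A" "dX (cst c) = 0" "dX gX = 1" "dX gY = 0"
  "dX (A * B) = A * dX B + dX A * B"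
  by (transfer; simp)+

definition dY :: "germ \<Rightarrow> germ" where "dY A = sw (dX (sw A))"

lemma cf_dY: "cf (dY A) i j = real (j + 1) * cf A i (Suc j)"
  by (simp add: dY_def cf_dX)

lemma dY_simps [simp]: "dY 0 = 0" "dY 1 = 0" "dY (A + B) = dY A + dY B" "dY (A - B) = dY A - dY B"
  "dY (- A) = - dY A" "dY (cst c) = 0" "dY gY = 1" "dY gX = 0"
  "dY (A * B) = A * dY B + dY A * B"
  by (simp_all add: dY_def)

lemma dX_power: "dX (A ^ Suc n) = cst (real (Suc n)) * A ^ n * dX A"
proof (induction n)
  case (Suc n)
  have "dX (A ^ Suc (Suc n)) = A * dX (A ^ Suc n) + dX A * A ^ Suc n"
    by (simp only: power_Suc[of A "Suc n"] dX_simps)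
  also have "\<dots> = (cst (real (Suc n)) + cst 1) * A ^ Suc n * dX A"
    unfolding Suc.IH by (simp add: algebra_simps)
  finally show ?case unfolding cst_add[symmetric] by (simp add: add.commute)
qed simp
lemma dY_power: "dY (A ^ Suc n) = cst (real (Suc n)) * A ^ n * dY A"
proof (induction n)
  case (Suc n)
  have "dY (A ^ Suc (Suc n)) = A * dY (A ^ Suc n) + dY A * A ^ Suc n"
    by (simp only: power_Suc[of A "Suc n"] dY_simps)
  also have "\<dots> = (cst (real (Suc n)) + cst 1) * A ^ Suc n * dY A"
    unfolding Suc.IH by (simp add: algebra_simps)
  finally show ?case unfolding cst_add[symmetric] by (simp add: add.commute)
qed simp

lemma dX_sw: "dX (sw A) = sw (dY A)" and dY_sw: "dY (sw A) = sw (dX A)"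
  by (simp_all add: dY_def)

lemma dY_blow: "dY (blow t A) = gX * blow t (dY A)"
proof (rule germ_eqI)
  fix n l
  have gXm: "cf (gX * C) n l = (if n = 0 then 0 else cf C (n - 1) l)" for C
    unfolding cf_def times_germ.rep_eq gX.rep_eq by simp
  have h: "hpoly (dY A) n = pderiv (hpoly A (Suc n))" for n
    by (rule poly_eqI) (auto simp: coeff_hpoly coeff_pderiv cf_dY Suc_diff_le)
  show "cf (dY (blow t A)) n l = cf (gX * blow t (dY A)) n l"
  proof (cases n)
    case 0
    then show ?thesis unfolding gXm by (simp add: cf_dY cf_blow hpoly_def monom_0)
  next
    case (Suc m)
    have "pderiv (pcompose (hpoly A (Suc m)) [:t, 1:]) = pcompose (hpoly (dY A) m) [:t, 1:]"
      by (simp add: pderiv_pcompose h pderiv_pCons)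
    from arg_cong[OF this, of "\<lambda>p. coeff p l"] show ?thesis
      unfolding gXm using Suc by (simp add: cf_dY cf_blow coeff_pderiv)
  qed
qed

lemma dX_blow: "dX (blow t A) = blow t (dX A) + (cst t + gY) * blow t (dY A)"
proof -
  have "ser (dX (blow t A)) $ n = ser (blow t (dX A) + (cst t + gY) * blow t (dY A)) $ n" for n
  proof -
    \<comment> \<open>Euler's identity for the homogeneous part of degree
      \<open>Suc n\<close>.\<close>
    have h: "hpoly (dX A) n + [:0, 1:] * hpoly (dY A) n = smult (real (Suc n)) (hpoly A (Suc n))"
    proof (rule poly_eqI)
      fix j
      show "coeff (hpoly (dX A) n + [:0, 1:] * hpoly (dY A) n) j = coeff (smult (real (Suc n)) (hpoly A (Suc n))) j"
        by (cases j) (auto simp: coeff_hpoly cf_dX cf_dY algebra_simps Suc_diff_le of_nat_diff coeff_pCons not_le not_less_eq_eq Suc_diff_Suc)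
    qed
    have "ser (cst t + gY) = fps_const (fps_of_poly [:t, 1:])"
      by (simp add: cst.rep_eq gY.rep_eq plus_germ.rep_eq fps_of_poly_linear add.commute)
    then have "ser (blow t (dX A) + (cst t + gY) * blow t (dY A)) $ n =
       fps_of_poly (pcompose (hpoly (dX A) n + [:0, 1:] * hpoly (dY A) n) [:t, 1:])"
      by (simp add: plus_germ.rep_eq times_germ.rep_eq ser_blow fps_of_poly_add fps_of_poly_mult pcompose_add pcompose_mult pcompose_pCons)
    also have "\<dots> = ser (dX (blow t A)) $ n"
      unfolding h dX.rep_eq fps_deriv_nth ser_blow pcompose_smult fps_of_poly_smult
      by (simp add: fps_of_nat fps_const_add[symmetric] del: of_nat_Suc fps_const_add)
    finally show ?thesis by simp
  qed
  then show ?thesis by (metis fps_ext ser_inject)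
qed

subsection \<open>Orders\<close>

text \<open>Restriction to \<open>x = 0\<close>, which is the exceptional line after a blow-up in a
  slope chart.\<close>

definition ax :: "germ \<Rightarrow> real fps" where "ax A = ser A $ 0"

lemma ax_simps [simp]: "ax 0 = 0" "ax 1 = 1" "ax (A + B) = ax A + ax B" "ax (A - B) = ax A - ax B"
  "ax (- A) = - ax A" "ax (A * B) = ax A * ax B" "ax gX = 0" "ax gY = fps_X" "ax (cst c) = fps_const c"
  unfolding ax_def by (transfer; simp)+
lemma ax_power [simp]: "ax (A ^ n) = ax A ^ n" by (induction n) auto
lemma ax_nth: "ax A $ j = cf A 0 j" by (simp add: ax_def cf_def)
lemma ax_nth_0 [simp]: "ax A $ 0 = val A" by (simp add: ax_nth val_def)

lemma geometrically_bounded_shift: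
  assumes "geometrically_bounded A" shows "geometrically_bounded (fps_shift n A)"
  using assms
proof (rule geometrically_boundedE)
  fix M R :: real assume *: "M > 0" "R \<ge> 1" "\<And>i j. \<bar>A $ i $ j\<bar> \<le> M * R ^ (i + j)"
  show ?thesis
    by (rule geometrically_boundedI[of _ "M * R ^ n" R]) (use *(3)[of "i + n" for i] in \<open>simp add: power_add mult_ac\<close>)
qed

definition xord :: "germ \<Rightarrow> nat" where "xord A = subdegree (ser A)"

lemma ser_eq_0_iff [simp]: "ser A = 0 \<longleftrightarrow> A = 0"
  by (metis ser_inject zero_germ.rep_eq)

lemma gX_decomp:
  assumes "n \<le> xord A" obtains B where "A = gX ^ n * B" "\<And>i j. cf B i j = cf A (i + n) j"
proof
  let ?B = "mk_germ (fps_shift n (ser A))"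
  have g: "ser ?B = fps_shift n (ser A)"
    by (simp add: mk_germ_inverse geometrically_bounded_shift[OF ser[THEN CollectD]])
  have p: "ser (gX ^ n) = fps_X ^ n" for n
    by (induction n) (auto simp: one_germ.rep_eq times_germ.rep_eq gX.rep_eq)
  have "ser (gX ^ n * ?B) = ser A"
    using fps_shift_times_fps_X_power[of n "ser A"] assms by (simp add: times_germ.rep_eq p g xord_def mult.commute)
  then show "A = gX ^ n * ?B" by (metis ser_inject)
  show "cf ?B i j = cf A (i + n) j" for i j by (simp add: cf_def g)
qed

lemma gX_nonzero [simp]: "gX \<noteq> 0" and gY_nonzero [simp]: "gY \<noteq> 0"
proof -
  have "cf gX 1 0 \<noteq> cf 0 1 0" "cf gY 0 1 \<noteq> cf 0 0 1" by (simp_all add: cf_gX cf_gY)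
  then show "gX \<noteq> 0" "gY \<noteq> 0" by metis+
qed

lemma gX_dvd_iff: "gX dvd A \<longleftrightarrow> ax A = 0"
proof
  assume 0: "ax A = 0"
  show "gX dvd A"
  proof (cases "A = 0")
    case False
    then have "1 \<le> xord A" using 0 unfolding xord_def ax_def
      by (metis One_nat_def Suc_leI gr0I nth_subdegree_nonzero ser_eq_0_iff)
    from gX_decomp[OF this] show ?thesis by (metis dvd_triv_left power_one_right)
  qed simp
qed (auto elim: dvdE)

lemma xord_mult: "A \<noteq> 0 \<Longrightarrow> B \<noteq> 0 \<Longrightarrow> xord (A * B) = xord A + xord B"
  unfolding xord_def times_germ.rep_eq by simp

lemma xord_gX [simp]: "xord gX = 1" by (simp add: xord_def gX.rep_eq)
lemma xord_one [simp]: "xord 1 = 0" by (simp add: xord_def one_germ.rep_eq)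
lemma xord_power: "A \<noteq> 0 \<Longrightarrow> xord (A ^ n) = n * xord A"
  by (induction n) (auto simp: xord_mult)
lemma xord_eq_0_iff: "xord A = 0 \<longleftrightarrow> A = 0 \<or> ax A \<noteq> 0"
  unfolding xord_def ax_def subdegree_eq_0_iff by simp

lemma xord_decomp:
  assumes "A \<noteq> 0" obtains B where "A = gX ^ xord A * B" "ax B \<noteq> 0"
proof -
  obtain B where B: "A = gX ^ xord A * B" by (rule gX_decomp[OF order_refl]) blast
  with assms have "B \<noteq> 0" by auto
  then have "xord A = xord A + xord B" using B by (metis add_cancel_right_right gX_nonzero
    mult.right_neutral power_not_zero xord_gX xord_mult xord_power)
  then have "xord B = 0" by simp
  with \<open>B \<noteq> 0\<close> B that show ?thesis by (simp add: xord_eq_0_iff)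
qed

lemma gX_prime: "gX dvd A * B \<Longrightarrow> gX dvd A \<or> gX dvd B"
  by (simp add: gX_dvd_iff)

lemma hpoly_eq_0_iff: "hpoly A n = 0 \<longleftrightarrow> (\<forall>j\<le>n. cf A (n - j) j = 0)"
  by (auto simp: poly_eq_iff coeff_hpoly)

lemma ser_blow_eq_0_iff: "ser (blow t A) $ n = 0 \<longleftrightarrow> hpoly A n = 0"
  unfolding ser_blow by (simp add: fps_of_poly_eq_iff[of _ 0, simplified] pcompose_eq_0_iff)

text \<open>Translation by \<open>t\<close> maps no nonzero polynomial to 0, so the lowest nonzero
  homogeneous part decides for every slope.\<close>

lemma xord_blow: "xord (blow t A) = xord (blow 0 A)"
proof -
  have "(ser (blow t A) = 0) = (ser (blow 0 A) = 0)"
    by (simp only: fps_eq_iff[of "ser _" 0] fps_zero_nth ser_blow_eq_0_iff)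
  then show ?thesis
    unfolding xord_def subdegree_def by (simp only: ser_blow_eq_0_iff)
qed

lemma blow_eq_0_iff [simp]: "blow t A = 0 \<longleftrightarrow> A = 0"
proof -
  have "A = 0" if "\<And>n. hpoly A n = 0"
  proof (rule germ_eqI)
    show "cf A i j = cf 0 i j" for i j
      using that[of "i + j"] unfolding hpoly_eq_0_iff by (force dest: spec[of _ j])
  qed
  moreover have "hpoly A n = 0" if "blow t A = 0" for n
    using ser_blow_eq_0_iff[of t A n] that by (simp add: zero_germ.rep_eq)
  ultimately show ?thesis by auto
qed

lemma blowV_eq_0_iff [simp]: "blowV A = 0 \<longleftrightarrow> A = 0"
  by (simp add: blowV_def)

text \<open>The multiplicity at the origin, taken as the order of the total transform along the
  exceptional line; additivity on products is then inherited from \<open>xord\<close>.\<close>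

definition ord :: "germ \<Rightarrow> nat" where "ord A = xord (blow 0 A)"

lemma ord_mult: "A \<noteq> 0 \<Longrightarrow> B \<noteq> 0 \<Longrightarrow> ord (A * B) = ord A + ord B"
  by (simp add: ord_def xord_mult)

lemma ord_le: assumes "cf A i j \<noteq> 0" shows "ord A \<le> i + j"
proof -
  have "hpoly A (i + j) \<noteq> 0" using assms unfolding hpoly_eq_0_iff by (metis add_diff_cancel_right' le_add2)
  then show ?thesis unfolding ord_def xord_def
    by (intro subdegree_leI) (simp add: ser_blow_eq_0_iff)
qed

lemma cf_eq_0_less_ord: "i + j < ord A \<Longrightarrow> cf A i j = 0"
  using ord_le[of A i j] by linarith

lemma ord_attained: assumes "A \<noteq> 0" obtains i j where "cf A i j \<noteq> 0" "i + j = ord A"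
proof -
  have "ser (blow 0 A) $ ord A \<noteq> 0"
    unfolding ord_def xord_def using assms by simp
  then show ?thesis
    unfolding ser_blow_eq_0_iff hpoly_eq_0_iff using that by (metis le_add_diff_inverse2)
qed

lemma ord_sw [simp]: "ord (sw A) = ord A"
proof (cases "A = 0")
  case False
  have "ord (sw A) \<le> ord A" if "A \<noteq> 0" for A
    by (metis add.commute cf_sw ord_attained ord_le that)
  from this[of A] this[of "sw A"] False show ?thesis by simp
qed simp

lemma ord_eq_0_iff: "ord A = 0 \<longleftrightarrow> A = 0 \<or> val A \<noteq> 0"
proof (cases "A = 0")
  case False
  then obtain i j where "cf A i j \<noteq> 0" "i + j = ord A" by (rule ord_attained)
  then show ?thesis using False ord_le[of A 0 0] by (auto simp: val_def)
qed (simp add: ord_def xord_def zero_germ.rep_eq)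

lemma xord_blow_ord: "xord (blow t A) = ord A"
  unfolding ord_def by (rule xord_blow)

text \<open>\<open>B\<close> is the strict transform; on the exceptional line it is the leading
  form, translated to the slope \<open>t\<close>.\<close>

lemma blow_decomp:
  assumes "A \<noteq> 0"
  obtains B where "blow t A = gX ^ ord A * B" "ax B = fps_of_poly (pcompose (hpoly A (ord A)) [:t, 1:])"
proof -
  obtain B where B: "blow t A = gX ^ ord A * B" "\<And>i j. cf B i j = cf (blow t A) (i + ord A) j"
    using gX_decomp[of "ord A" "blow t A"] by (metis order_refl xord_blow_ord)
  have "ax B = fps_of_poly (pcompose (hpoly A (ord A)) [:t, 1:])" unfolding ser_blow[symmetric]
    by (rule fps_ext) (simp only: ax_nth B(2), simp add: cf_def)
  with B(1) show ?thesis by (rule that)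
qed

lemma hpoly_ord_nonzero: "A \<noteq> 0 \<Longrightarrow> hpoly A (ord A) \<noteq> 0"
  using ser_blow_eq_0_iff[of 0 A "ord A"] by (simp add: ord_def xord_def)

subsection \<open>Weierstrass division\<close>

lemma geometric_convolution:
  fixes K R :: real
  shows "(K - R) * (\<Sum>k<n. K ^ k * R ^ (n - k)) = R * (K ^ n - R ^ n)"
proof (induction n)
  case (Suc n)
  have "(\<Sum>k<Suc n. K ^ k * R ^ (Suc n - k)) = R * (\<Sum>k<n. K ^ k * R ^ (n - k)) + K ^ n * R"
    by (simp add: sum_distrib_left Suc_diff_le mult_ac)
  then have "(K - R) * (\<Sum>k<Suc n. K ^ k * R ^ (Suc n - k)) =
      R * ((K - R) * (\<Sum>k<n. K ^ k * R ^ (n - k))) + (K - R) * K ^ n * R"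
    by (simp add: algebra_simps)
  then show ?case unfolding Suc.IH by (simp add: algebra_simps)
qed simp

lemma geometric_convolution_le:
  fixes K R :: real
  assumes "0 \<le> R" "R < K"
  shows "(\<Sum>k<n. K ^ k * R ^ (n - k)) \<le> R * K ^ n / (K - R)"
proof -
  have "(K - R) * (\<Sum>k<n. K ^ k * R ^ (n - k)) \<le> R * K ^ n"
    unfolding geometric_convolution using assms by (intro mult_left_mono) auto
  then show ?thesis using assms by (simp add: field_simps)
qed

lemma fps_inverse_geometric:
  fixes f :: "real fps"
  assumes f: "\<And>n. \<bar>f $ n\<bar> \<le> M * R ^ n" and R: "R > 0" and M: "M > 0" and f0: "f $ 0 \<noteq> 0"
  obtains M' R' where "M' > 0" "R' > 0" "\<And>n. \<bar>inverse f $ n\<bar> \<le> M' * R' ^ n"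
proof -
  define c where "c = M / \<bar>f $ 0\<bar>"
  \<comment> \<open>With this \<open>K\<close> the factor \<open>c * R / (K - R)\<close> of the
    recursive estimate equals 1, and the induction closes.\<close>
  define K where "K = R * (1 + c)"
  have c: "c > 0" using M f0 by (simp add: c_def)
  have K: "0 < K" "R < K" "K - R = R * c" using R c by (auto simp: K_def algebra_simps add_pos_pos)
  have "\<bar>inverse f $ n\<bar> \<le> inverse \<bar>f $ 0\<bar> * K ^ n" for n
  proof (induction n rule: less_induct)
    case (less n)
    show ?case
    proof (cases n)
      case 0 then show ?thesis by simp
    next
      case (Suc n')
      have "(f * inverse f) $ n = 0" using f0 Suc by (simp add: inverse_mult_eq_1')
      then have "f $ 0 * inverse f $ n + (\<Sum>i=1..n. f $ i * inverse f $ (n - i)) = 0"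
        unfolding fps_mult_nth by (simp add: sum.atLeast_Suc_atMost)
      then have "\<bar>f $ 0\<bar> * \<bar>inverse f $ n\<bar> = \<bar>\<Sum>i=1..n. f $ i * inverse f $ (n - i)\<bar>"
        by (metis abs_minus_cancel abs_mult add_eq_0_iff)
      also have "\<dots> \<le> (\<Sum>i=1..n. (M * R ^ i) * (inverse \<bar>f $ 0\<bar> * K ^ (n - i)))"
        by (rule order_trans[OF sum_abs], rule sum_mono, unfold abs_mult, intro mult_mono f less)
          (use R M in auto)
      also have "\<dots> = (\<Sum>k<n. (M * R ^ (n - k)) * (inverse \<bar>f $ 0\<bar> * K ^ k))"
        by (rule sum.reindex_bij_witness[of _ "\<lambda>k. n - k" "\<lambda>i. n - i"]) auto
      also have "\<dots> = c * (\<Sum>k<n. K ^ k * R ^ (n - k))"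
        by (simp add: c_def sum_distrib_left field_simps)
      also have "\<dots> \<le> c * (R * K ^ n / (K - R))"
        by (intro mult_left_mono geometric_convolution_le) (use c R K in auto)
      also have "\<dots> = K ^ n" using c R by (simp add: K)
      finally show ?thesis using f0 by (simp add: field_simps)
    qed
  qed
  then show ?thesis using that[of "inverse \<bar>f $ 0\<bar>" K] K f0 by auto
qed

lemma fps_mult_geometric:
  fixes a b :: "real fps"
  assumes "\<And>j. \<bar>a $ j\<bar> \<le> \<alpha> * L ^ j" "\<And>j. \<bar>b $ j\<bar> \<le> \<beta> * R ^ j" "0 < R" "2 * R \<le> L" "0 \<le> \<alpha>" "0 \<le> \<beta>"
  shows "\<bar>(a * b) $ j\<bar> \<le> 2 * \<alpha> * \<beta> * L ^ j"
proof -
  have "\<bar>(a * b) $ j\<bar> \<le> (\<Sum>l=0..j. (\<alpha> * L ^ l) * (\<beta> * R ^ (j - l)))"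
    unfolding fps_mult_nth
    by (rule order_trans[OF sum_abs], rule sum_mono, unfold abs_mult, intro mult_mono assms) (use assms in auto)
  also have "\<dots> = \<alpha> * \<beta> * (L ^ j + (\<Sum>l<j. L ^ l * R ^ (j - l)))"
    by (simp add: sum_distrib_left atLeast0AtMost lessThan_Suc_atMost[symmetric] algebra_simps)
  also have "\<dots> \<le> \<alpha> * \<beta> * (L ^ j + L ^ j)"
  proof (intro mult_left_mono add_left_mono order_trans[OF geometric_convolution_le])
    have "R / (L - R) \<le> 1" using assms by simp
    then show "R * L ^ j / (L - R) \<le> L ^ j"
      using mult_right_mono[of "R / (L - R)" 1 "L ^ j"] assms by simp
  qed (use assms in auto)
  finally show ?thesis by simp
qed

text \<open>Obtained by comparing coefficients of \<open>x ^ i\<close> in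
  \<open>A = q * r + s\<close>, where \<open>ax r = e * y ^ m\<close> with a unit \<open>e\<close>:
  the terms of the bracket of degree at least \<open>m\<close> in \<open>y\<close> must equal
  \<open>e * y ^ m\<close> times the coefficient of \<open>q\<close>. The parameter \<open>g\<close>
  stands for the inverse of \<open>e\<close>.\<close>

fun weierstrass_quotient :: "real fps \<Rightarrow> nat \<Rightarrow> real fps fps \<Rightarrow> real fps fps \<Rightarrow> nat \<Rightarrow> real fps" where
  "weierstrass_quotient g m r A i =
    g * fps_shift m (A $ i - (\<Sum>k<i. weierstrass_quotient g m r A k * r $ (i - k)))"

declare weierstrass_quotient.simps [simp del]

theorem weierstrass_division:
  assumes "ax r \<noteq> 0"
  obtains q s where "A = q * r + s" "\<And>i j. j \<ge> subdegree (ax r) \<Longrightarrow> cf s i j = 0"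
proof -
  define m where "m = subdegree (ax r)"
  define e where "e = fps_shift m (ax r)"
  define g where "g = inverse e"
  have e0: "e $ 0 \<noteq> 0" using assms by (simp add: e_def m_def)
  have axr: "ax r = e * fps_X ^ m"
    using fps_shift_times_fps_X_power[of m "ax r"] by (simp add: e_def m_def)
  have ge: "g * e = 1" using e0 by (simp add: g_def inverse_mult_eq_1)
  define q where "q = weierstrass_quotient g m (ser r) (ser A)"
  define D where "D i = ser A $ i - (\<Sum>k<i. q k * ser r $ (i - k))" for i
  have q: "q i = g * fps_shift m (D i)" for i
    unfolding q_def D_def by (subst weierstrass_quotient.simps) simp
  obtain M R where MR: "M > 0" "R \<ge> 1" "\<And>i j. \<bar>ser A $ i $ j\<bar> \<le> M * R ^ (i + j)"
    "\<And>i j. \<bar>ser r $ i $ j\<bar> \<le> M * R ^ (i + j)"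
    by (rule geometrically_bounded_common[OF ser[THEN CollectD] ser[THEN CollectD], of A r]) blast
  have "\<bar>e $ n\<bar> \<le> (M * R ^ m) * R ^ n" for n
    using MR(4)[of 0 "n + m"] by (simp add: e_def ax_def power_add mult_ac)
  then obtain M' R' where M': "M' > 0" "R' > 0" "\<And>n. \<bar>g $ n\<bar> \<le> M' * R' ^ n"
    unfolding g_def by (rule fps_inverse_geometric) (use MR e0 in auto)
  define L where "L = 2 * R + 2 * R'"
  have L: "L \<ge> 2 * R" "L \<ge> 2 * R'" "L > 1" "R \<le> L" using MR M' by (auto simp: L_def)
  define c where "c = 2 * M' * L ^ m * M"
  have c: "c > 0" using M' L MR by (simp add: c_def)
  \<comment> \<open>Then the convolution sum \<open>S\<close> is at most
    \<open>K ^ i / (4 * c)\<close>, so that the earlier coefficients of \<open>q\<close> contribute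
    at most \<open>M * K ^ i * L ^ j\<close> to \<open>D i\<close>. The constant \<open>c\<close>
    collects what the multiplication by \<open>g\<close> and the shift by \<open>m\<close>
    cost.\<close>
  define K where "K = R + 4 * c * R"
  have cR: "4 * c * R > 0" using c MR by simp
  have K: "R < K" "K > 1" "K - R = 4 * c * R" using MR(2) cR by (simp_all add: K_def del: zero_less_mult_iff mult_pos_pos, linarith)
  have bound: "\<bar>q i $ j\<bar> \<le> (2 * c * K ^ i) * L ^ j" for i j
  proof (induction i arbitrary: j rule: less_induct)
    case (less i)
    define S where "S = (\<Sum>k<i. K ^ k * R ^ (i - k))"
    have S: "S \<le> K ^ i / (4 * c)"
      unfolding S_def using geometric_convolution_le[of R K i] K MR c by simp
    have P: "\<bar>(q k * ser r $ (i - k)) $ j\<bar> \<le> 2 * (2 * c * K ^ k) * (M * R ^ (i - k)) * L ^ j" if "k < i" for k j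
      by (rule fps_mult_geometric[of _ _ _ _ _ R])
        (use less[OF that] MR L K c in \<open>auto simp: power_add mult.assoc\<close>)
    have "\<bar>D i $ j\<bar> \<le> M * R ^ i * L ^ j + (\<Sum>k<i. 2 * (2 * c * K ^ k) * (M * R ^ (i - k)) * L ^ j)" for j
    proof -
      have "\<bar>D i $ j\<bar> \<le> \<bar>ser A $ i $ j\<bar> + (\<Sum>k<i. \<bar>(q k * ser r $ (i - k)) $ j\<bar>)"
        unfolding D_def fps_sub_nth fps_sum_nth
        by (rule order_trans[OF abs_triangle_ineq4]) (simp add: sum_abs)
      moreover have "\<bar>ser A $ i $ j\<bar> \<le> M * R ^ i * L ^ j"
        by (rule order_trans[OF MR(3)]) (use MR L in \<open>auto simp: power_add intro!: mult_left_mono power_mono\<close>)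
      moreover have "(\<Sum>k<i. \<bar>(q k * ser r $ (i - k)) $ j\<bar>) \<le>
          (\<Sum>k<i. 2 * (2 * c * K ^ k) * (M * R ^ (i - k)) * L ^ j)"
        by (rule sum_mono) (use P in auto)
      ultimately show ?thesis by linarith
    qed
    moreover have "(\<Sum>k<i. 2 * (2 * c * K ^ k) * (M * R ^ (i - k)) * L ^ j) = 4 * c * M * S * L ^ j" for j
      unfolding S_def sum_distrib_left sum_distrib_right by (rule sum.cong) auto
    ultimately have "\<bar>D i $ j\<bar> \<le> (M * R ^ i + 4 * c * M * S) * L ^ j" for j
      by (simp add: algebra_simps)
    moreover have "M * R ^ i + 4 * c * M * S \<le> 2 * M * K ^ i"
    proof -
      have "R ^ i \<le> K ^ i" using K MR by (intro power_mono) auto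
      then have "M * R ^ i \<le> M * K ^ i" using MR by simp
      moreover have "4 * c * M * S \<le> 4 * c * M * (K ^ i / (4 * c))"
        using S c MR by (intro mult_left_mono) auto
      ultimately show ?thesis using c by simp
    qed
    ultimately have Db: "\<bar>D i $ j\<bar> \<le> (2 * M * K ^ i) * L ^ j" for j
      using L by (meson mult_right_mono order_trans zero_le_power less_imp_le zero_less_one less_trans)
    have "\<bar>fps_shift m (D i) $ j\<bar> \<le> (2 * M * K ^ i * L ^ m) * L ^ j" for j
      using Db[of "j + m"] by (simp add: power_add mult_ac)
    from fps_mult_geometric[OF this M'(3) M'(2) L(2), of j] show ?case
      unfolding q using MR K L M' by (simp add: c_def mult_ac)
  qed
  have "geometrically_bounded (Abs_fps q)"
  proof (rule geometrically_boundedI)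
    fix i j
    have "2 * c * K ^ i * L ^ j \<le> 2 * c * (K + L) ^ i * (K + L) ^ j"
      using K L c by (intro mult_mono power_mono) auto
    with bound[of i j] show "\<bar>Abs_fps q $ i $ j\<bar> \<le> 2 * c * (K + L) ^ (i + j)"
      by (simp add: power_add mult.assoc)
  qed
  then have sq: "ser (mk_germ (Abs_fps q)) = Abs_fps q" by (simp add: mk_germ_inverse)
  show ?thesis
  proof (rule that)
    show "A = mk_germ (Abs_fps q) * r + (A - mk_germ (Abs_fps q) * r)" by simp
    fix i j assume j: "j \<ge> subdegree (ax r)"
    have "(Abs_fps q * ser r) $ i = q i * ser r $ 0 + (\<Sum>k<i. q k * ser r $ (i - k))"
      unfolding fps_mult_nth atLeast0AtMost lessThan_Suc_atMost[symmetric] by simp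
    then have "ser (A - mk_germ (Abs_fps q) * r) $ i = D i - q i * ax r"
      unfolding D_def minus_germ.rep_eq times_germ.rep_eq sq ax_def by simp
    also have "q i * ax r = (g * e) * (fps_shift m (D i) * fps_X ^ m)"
      unfolding q axr by (simp add: mult_ac)
    also have "\<dots> = fps_shift m (D i) * fps_X ^ m" unfolding ge by simp
    finally show "cf (A - mk_germ (Abs_fps q) * r) i j = 0"
      using j unfolding cf_def m_def by (simp add: fps_X_power_mult_right_nth)
  qed
qed

text \<open>If \<open>val A\<close> is not 0, the remainder of 1 on division by \<open>A\<close> has
  no term of degree 0 or more in \<open>y\<close>, so it is 0.\<close>

lemma dvd_1_iff: "A dvd 1 \<longleftrightarrow> val A \<noteq> 0"
proof
  assume v: "val A \<noteq> 0"
  then have "ax A $ 0 \<noteq> 0" by simp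
  then have ax: "ax A \<noteq> 0" "subdegree (ax A) = 0" by (metis fps_zero_nth, rule subdegree_eq_0)
  obtain q s where "1 = q * A + s" "\<And>i j. cf s i j = 0"
    by (rule weierstrass_division[OF ax(1), of 1]) (use ax(2) in auto)
  then have "1 = q * A" by (metis add.right_neutral cf_simps(1) germ_eqI)
  then show "A dvd 1" by (metis dvd_triv_right)
next
  assume "A dvd 1"
  then obtain B where "1 = A * B" by (auto elim: dvdE)
  then have "val A * val B = 1" by (metis val_simps(2,6))
  then show "val A \<noteq> 0" by auto
qed

lemma unit_inverse: assumes "val A \<noteq> 0" obtains B where "A * B = 1" "val B \<noteq> 0"
  using assms unfolding dvd_1_iff[symmetric] by (metis dvdE dvd_triv_right)

section \<open>Division by smooth curves\<close>

definition xonly :: "germ \<Rightarrow> bool" where "xonly \<psi> \<longleftrightarrow> (\<forall>i j. j > 0 \<longrightarrow> cf \<psi> i j = 0)"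

lemma division_by_smooth:
  assumes "val D = 0" "cf D 0 1 \<noteq> 0"
  obtains q s where "A = q * D + s" "xonly s"
proof -
  have sd: "subdegree (ax D) = 1"
    by (rule subdegreeI) (use assms in \<open>auto simp: ax_nth val_def\<close>)
  then have "ax D \<noteq> 0" by auto
  then obtain q s where "A = q * D + s" "\<And>i j. j \<ge> subdegree (ax D) \<Longrightarrow> cf s i j = 0"
    by (rule weierstrass_division[of D A]) blast
  then show ?thesis using that sd by (auto simp: xonly_def)
qed

text \<open>Dividing \<open>gY\<close> by \<open>D\<close> gives \<open>gY - s = q * D\<close> with
  \<open>s\<close> depending on \<open>x\<close> only; the coefficient of \<open>y\<close> on both
  sides forces \<open>q\<close> to be a unit.\<close>

lemma implicit_function:
  assumes D: "val D = 0" "cf D 0 1 \<noteq> 0"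
  obtains e \<psi> where "D = e * (gY - \<psi>)" "xonly \<psi>" "val \<psi> = 0" "val e \<noteq> 0"
proof -
  obtain q s where qs: "gY = q * D + s" "xonly s" by (rule division_by_smooth[OF D]) blast
  have v: "val s = 0" using arg_cong[OF qs(1), of val] D by simp
  have axs: "ax s = 0"
    using qs(2) v by (intro fps_ext) (metis ax_nth fps_zero_nth neq0_conv val_def xonly_def)
  have "(ax q * ax D) $ 1 = 1" using arg_cong[OF qs(1), of "\<lambda>A. ax A $ 1"] axs by simp
  then have "val q * cf D 0 1 = 1"
    using D(1) by (simp add: fps_mult_nth_1 ax_nth val_def)
  then have "val q \<noteq> 0" by auto
  then obtain e where e: "q * e = 1" "val e \<noteq> 0" by (rule unit_inverse)
  have "D = e * (gY - s)"
    unfolding qs(1) using e(1) by (simp add: mult.assoc[symmetric] mult.commute[of e])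
  with qs(2) v e show ?thesis using that by blast
qed

subsection \<open>Coprime germs\<close>

definition cop :: "germ \<Rightarrow> germ \<Rightarrow> bool" where
  "cop A B \<longleftrightarrow> (\<forall>D. D dvd A \<longrightarrow> D dvd B \<longrightarrow> val D \<noteq> 0)"

lemma cop_sym: "cop A B \<Longrightarrow> cop B A" by (auto simp: cop_def)
lemma cop_sw: "cop (sw A) (sw B) \<longleftrightarrow> cop A B"
  unfolding cop_def by (metis sw_dvd_iff sw_simps(9) sw_sw)

text \<open>Take an element of least order in \<open>Y\<close> among the \<open>r\<close> not divisible by \<open>X\<close> for
  which some \<open>X\<^sup>k r\<close> lies in the ideal \<open>(A, B)\<close>. Division by \<open>r\<close> shows that it is a common
  divisor, hence a unit.\<close>

theorem coprime_power_X:
  assumes "cop A B"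
  obtains k \<alpha> \<beta> where "gX ^ k = \<alpha> * A + \<beta> * B"
proof -
  define J where "J = {r. \<exists>k \<alpha> \<beta>. gX ^ k * r = \<alpha> * A + \<beta> * B}"
  have AJ: "A \<in> J" and BJ: "B \<in> J"
    unfolding J_def by (force intro: exI[of _ 0] exI[of _ 1])+
  have diffJ: "r - q * s \<in> J" if rs: "r \<in> J" "s \<in> J" for r s q
  proof -
    obtain k \<alpha> \<beta> k' \<alpha>' \<beta>' where e: "gX ^ k * r = \<alpha> * A + \<beta> * B" "gX ^ k' * s = \<alpha>' * A + \<beta>' * B"
      using rs unfolding J_def by blast
    have "gX ^ (k + k') * (r - q * s) = gX ^ k' * (\<alpha> * A + \<beta> * B) - q * gX ^ k * (\<alpha>' * A + \<beta>' * B)"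
      unfolding e[symmetric] by (simp add: power_add algebra_simps)
    also have "\<dots> = (gX ^ k' * \<alpha> - q * gX ^ k * \<alpha>') * A + (gX ^ k' * \<beta> - q * gX ^ k * \<beta>') * B"
      by (simp add: algebra_simps)
    finally show ?thesis unfolding J_def by blast
  qed
  have satJ: "r \<in> J" if rn: "gX ^ n * r \<in> J" for n r
  proof -
    obtain k \<alpha> \<beta> where "gX ^ k * (gX ^ n * r) = \<alpha> * A + \<beta> * B" using rn unfolding J_def by blast
    then have "gX ^ (k + n) * r = \<alpha> * A + \<beta> * B" by (simp add: power_add mult.assoc)
    then show ?thesis unfolding J_def by blast
  qed
  have "\<not> (gX dvd A \<and> gX dvd B)" using assms by (auto simp: cop_def)
  then have ex: "\<exists>r. r \<in> J \<and> ax r \<noteq> 0" using AJ BJ unfolding gX_dvd_iff by blast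
  define m where "m = (LEAST m. \<exists>r. r \<in> J \<and> ax r \<noteq> 0 \<and> subdegree (ax r) = m)"
  have "\<exists>r. r \<in> J \<and> ax r \<noteq> 0 \<and> subdegree (ax r) = m"
    unfolding m_def by (rule LeastI_ex) (use ex in blast)
  then obtain r where r: "r \<in> J" "ax r \<noteq> 0" "subdegree (ax r) = m" by blast
  have least: "m \<le> subdegree (ax r')" if "r' \<in> J" "ax r' \<noteq> 0" for r'
    unfolding m_def by (rule Least_le) (use that in blast)
  have "r dvd C" if C: "C \<in> J" for C
  proof -
    obtain q s where qs: "C = q * r + s" "\<And>i j. j \<ge> m \<Longrightarrow> cf s i j = 0"
      using weierstrass_division[OF r(2), of C] r(3) by metis
    have "s = 0"
    proof (rule ccontr)
      assume "s \<noteq> 0"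
      then obtain s' where s': "s = gX ^ xord s * s'" "ax s' \<noteq> 0" by (rule xord_decomp)
      have "s \<in> J" using diffJ[OF C r(1), of q] qs(1) by simp
      then have "s' \<in> J" using satJ s'(1) by metis
      then have "m \<le> subdegree (ax s')" using least s'(2) by blast
      obtain s'' where s'': "s = gX ^ xord s * s''" "\<And>i j. cf s'' i j = cf s (i + xord s) j"
        by (rule gX_decomp[OF order_refl]) blast
      have "s'' = s'" using s'(1) s''(1) by (metis gX_nonzero mult_left_cancel power_not_zero)
      then have "ax s' $ subdegree (ax s') = 0"
        using s''(2) qs(2) \<open>m \<le> _\<close> by (simp add: ax_nth)
      with s'(2) show False by simp
    qed
    then show ?thesis using qs(1) by simp
  qed
  then have "val r \<noteq> 0" using assms AJ BJ unfolding cop_def by blast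
  then obtain r' where r': "r * r' = 1" by (rule unit_inverse)
  obtain k \<alpha> \<beta> where k: "gX ^ k * r = \<alpha> * A + \<beta> * B" using r(1) unfolding J_def by blast
  have "gX ^ k = (gX ^ k * r) * r'" using r' by (simp add: mult.assoc)
  also have "\<dots> = (\<alpha> * r') * A + (\<beta> * r') * B" unfolding k by (simp add: algebra_simps)
  finally show ?thesis by (rule that)
qed

lemma coprime_power_Y:
  assumes "cop A B"
  obtains k \<alpha> \<beta> where "gY ^ k = \<alpha> * A + \<beta> * B"
proof -
  from assms have "cop (sw A) (sw B)" by (simp add: cop_sw)
  then obtain k \<alpha> \<beta> where "gX ^ k = \<alpha> * sw A + \<beta> * sw B" by (rule coprime_power_X)
  from arg_cong[OF this, of sw] show ?thesis by (intro that) simp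
qed

text \<open>Powers of both coordinates lie in the ideal generated by \<open>A\<close> and
  \<open>B\<close>.\<close>

lemma coprime_isolated_zero:
  assumes "cop A B"
  shows "\<forall>\<^sub>F z in nhds 0. ev A z = 0 \<longrightarrow> ev B z = 0 \<longrightarrow> z = 0"
proof -
  obtain k \<alpha> \<beta> where 1: "gX ^ k = \<alpha> * A + \<beta> * B" using assms by (rule coprime_power_X)
  obtain l \<gamma> \<delta> where 2: "gY ^ l = \<gamma> * A + \<delta> * B" using assms by (rule coprime_power_Y)
  show ?thesis
    using ev_power[of gX k] ev_power[of gY l] ev_add[of "\<alpha> * A" "\<beta> * B"] ev_add[of "\<gamma> * A" "\<delta> * B"]
      ev_mult[of \<alpha> A] ev_mult[of \<beta> B] ev_mult[of \<gamma> A] ev_mult[of \<delta> B]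
  proof eventually_elim
    case (elim z)
    show ?case
    proof (intro impI)
      assume "ev A z = 0" "ev B z = 0"
      with elim 1 2 have "fst z ^ k = 0" "snd z ^ l = 0" by simp_all
      then show "z = 0" by (simp add: prod_eq_iff)
    qed
  qed
qed

text \<open>A greatest common divisor is split off without unique factorisation: removing a common
  non-unit lowers the order of a nonzero germ, so the process stops.\<close>

lemma coprime_part:
  assumes "A \<noteq> 0 \<or> B \<noteq> 0"
  obtains K A' B' where "K \<noteq> 0" "A = K * A'" "B = K * B'" "cop A' B'"
proof -
  have main: "\<exists>K A' B'. K \<noteq> 0 \<and> A = K * A' \<and> B = K * B' \<and> cop A' B'" if "A \<noteq> 0" for A B
    using that
  proof (induction "ord A" arbitrary: A B rule: less_induct)
    case less
    show ?case
    proof (cases "cop A B")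
      case True
      then show ?thesis by (intro exI[of _ 1] exI[of _ A] exI[of _ B]) auto
    next
      case False
      then obtain D where D: "D dvd A" "D dvd B" "val D = 0" unfolding cop_def by blast
      then obtain A1 B1 where AB: "A = D * A1" "B = D * B1" by (auto elim!: dvdE)
      then have nz: "D \<noteq> 0" "A1 \<noteq> 0" using less.prems by auto
      have "ord D > 0" using D(3) nz(1) by (metis gr0I ord_eq_0_iff)
      then have "ord A1 < ord A" using nz by (simp add: AB ord_mult)
      from less.hyps[OF this nz(2), of B1] show ?thesis
        using nz(1) by (metis AB mult.assoc mult_eq_0_iff)
    qed
  qed
  show ?thesis
  proof (cases "A = 0")
    case True
    with assms have "B \<noteq> 0" by simp
    from main[OF this, of A] show ?thesis using that cop_sym by metis
  next
    case False
    from main[OF this, of B] show ?thesis using that by metis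
  qed
qed

subsection \<open>Translation to function germs\<close>

lemma same_germ_refl [simp]: "same_germ f f" by (simp add: same_germ_def)
lemma same_germ_sym: "same_germ f g \<Longrightarrow> same_germ g f"
  unfolding same_germ_def by (simp add: eq_commute)
lemma same_germ_trans: "same_germ f g \<Longrightarrow> same_germ g h \<Longrightarrow> same_germ f h"
  unfolding same_germ_def by (erule (1) eventually_elim2) simp

lemma same_germ_ev_iff [simp]: "same_germ (ev A) (ev B) \<longleftrightarrow> A = B"
  using ev_eq_imp by (auto simp: same_germ_def)

lemma same_germ_ev_0 [simp]: "same_germ (ev A) (\<lambda>_. 0) \<longleftrightarrow> A = 0"
  using ev_eq_0_imp by (auto simp: same_germ_def)

lemma same_germ_val: "same_germ f (ev A) \<Longrightarrow> f 0 = val A"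
  unfolding same_germ_def ev_at_0[symmetric] by (rule eventually_nhds_x_imp_x)

lemma same_germ_mult: "same_germ f (ev A) \<Longrightarrow> same_germ g (ev B) \<Longrightarrow> same_germ (\<lambda>z. f z * g z) (ev (A * B))"
proof -
  assume "same_germ f (ev A)" "same_germ g (ev B)"
  then show ?thesis unfolding same_germ_def using ev_mult[of A B] by eventually_elim simp
qed
lemma same_germ_diff: "same_germ f (ev A) \<Longrightarrow> same_germ g (ev B) \<Longrightarrow> same_germ (\<lambda>z. f z - g z) (ev (A - B))"
proof -
  assume "same_germ f (ev A)" "same_germ g (ev B)"
  then show ?thesis unfolding same_germ_def using ev_diff[of A B] by eventually_elim simp
qed

lemma germ_dvd_iff:
  assumes "same_germ f (ev A)" "same_germ g (ev B)"
  shows "germ_dvd f g \<longleftrightarrow> A dvd B"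
proof
  assume "germ_dvd f g"
  then obtain e E where "same_germ g (\<lambda>z. f z * e z)" "same_germ e (ev E)"
    unfolding germ_dvd_def analytic_germ_iff by blast
  then have "same_germ (ev B) (ev (A * E))"
    using same_germ_trans[OF same_germ_trans[OF same_germ_sym[OF assms(2)]] same_germ_mult[OF assms(1)]] by blast
  then show "A dvd B" by simp
next
  assume "A dvd B"
  then obtain E where "B = A * E" by (auto elim: dvdE)
  then have "same_germ g (\<lambda>z. f z * ev E z)"
    using same_germ_trans[OF assms(2), of "\<lambda>z. f z * ev E z"]
      same_germ_sym[OF same_germ_mult[OF assms(1) same_germ_refl, of E]] by simp
  then show "germ_dvd f g" unfolding germ_dvd_def by blast
qed

lemma coprime_germs_iff:
  assumes "same_germ f (ev A)" "same_germ g (ev B)"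
  shows "coprime_germs f g \<longleftrightarrow> cop A B"
proof
  assume "coprime_germs f g"
  then show "cop A B"
    unfolding coprime_germs_def cop_def
  proof (intro allI impI)
    fix D assume "\<forall>d. analytic_germ d \<longrightarrow> germ_dvd d f \<longrightarrow> germ_dvd d g \<longrightarrow> d 0 \<noteq> 0" "D dvd A" "D dvd B"
    then show "val D \<noteq> 0"
      using germ_dvd_iff[OF same_germ_refl assms(1), of D] germ_dvd_iff[OF same_germ_refl assms(2), of D]
      by (metis analytic_ev ev_at_0)
  qed
next
  assume "cop A B"
  then show "coprime_germs f g"
    unfolding coprime_germs_def cop_def analytic_germ_iff
  proof (intro allI impI)
    fix d assume *: "\<forall>D. D dvd A \<longrightarrow> D dvd B \<longrightarrow> val D \<noteq> 0" "\<exists>D. same_germ d (ev D)" "germ_dvd d f" "germ_dvd d g"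
    then obtain D where D: "same_germ d (ev D)" by blast
    from germ_dvd_iff[OF D assms(1)] germ_dvd_iff[OF D assms(2)] * have "val D \<noteq> 0" by blast
    then show "d 0 \<noteq> 0" using same_germ_val[OF D] by simp
  qed
qed

text \<open>For fixed \<open>y\<close> the rows are the coefficients of a power series in
  \<open>x\<close>, which is differentiated term by term.\<close>

lemma ev_has_derivative_x:
  "\<forall>\<^sub>F z in nhds 0. ((\<lambda>s. ev A (s, snd z)) has_real_derivative ev (dX A) z) (at (fst z))"
proof -
  obtain r where r: "r > 0"
    "\<And>y i. \<bar>y\<bar> < r \<Longrightarrow> ((\<lambda>j. cf A i j * y ^ j) has_sum row A i y) UNIV"
    "\<And>x y. \<bar>x\<bar> < r \<Longrightarrow> \<bar>y\<bar> < r \<Longrightarrow> (\<lambda>i. row A i y * x ^ i) sums ev A (x, y)"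
    by (rule rows_sum[of A]) blast
  obtain r' where r': "r' > 0"
    "\<And>y i. \<bar>y\<bar> < r' \<Longrightarrow> ((\<lambda>j. cf (dX A) i j * y ^ j) has_sum row (dX A) i y) UNIV"
    "\<And>x y. \<bar>x\<bar> < r' \<Longrightarrow> \<bar>y\<bar> < r' \<Longrightarrow> (\<lambda>i. row (dX A) i y * x ^ i) sums ev (dX A) (x, y)"
    by (rule rows_sum[of "dX A"]) blast
  define s where "s = min r r' / 2"
  have s: "s > 0" "s < r" "s < r'" using r(1) r'(1) by (auto simp: s_def)
  have "((\<lambda>s. ev A (s, y)) has_real_derivative ev (dX A) (x, y)) (at x)" if xy: "\<bar>x\<bar> < s" "\<bar>y\<bar> < s" for x y
  proof -
    have row: "row (dX A) i y = real (Suc i) * row A (Suc i) y" for i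
      unfolding row_def cf_dX mult.assoc by (simp add: infsum_cmult_right' del: of_nat_Suc)
    have "summable (\<lambda>i. row A i y * s ^ i)" using r(3)[of s y] s xy by (auto simp: sums_iff)
    then have "DERIV (\<lambda>x. \<Sum>i. row A i y * x ^ i) x :> (\<Sum>i. diffs (\<lambda>i. row A i y) i * x ^ i)"
      by (rule termdiffs_strong) (use xy s in auto)
    moreover have "(\<Sum>i. diffs (\<lambda>i. row A i y) i * x ^ i) = ev (dX A) (x, y)"
      using r'(3)[of x y] xy s by (simp add: diffs_def row sums_iff del: of_nat_Suc)
    moreover have "\<forall>\<^sub>F x' in nhds x. (\<Sum>i. row A i y * x' ^ i) = ev A (x', y)"
    proof (rule eventually_mono[OF eventually_nhds_in_open[of "{-s<..<s}" x]])
      show "x \<in> {-s<..<s}" using xy(1) by auto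
      show "(\<Sum>i. row A i y * x' ^ i) = ev A (x', y)" if "x' \<in> {-s<..<s}" for x'
        using r(3)[of x' y] xy s that by (simp add: sums_iff abs_less_iff)
    qed simp
    ultimately show ?thesis using DERIV_cong_ev[of x x "\<lambda>x. \<Sum>i. row A i y * x ^ i" "\<lambda>x. ev A (x, y)"] by simp
  qed
  then show ?thesis unfolding eventually_square using s by auto
qed

lemma partial_u_same_germ:
  assumes "same_germ f (ev A)" shows "same_germ (partial_u f) (ev (dX A))"
proof -
  have "\<forall>\<^sub>F z in nhds 0. \<forall>\<^sub>F w in nhds z. f w = ev A w"
    using assms unfolding same_germ_def by (simp add: eventually_eventually)
  then have "\<forall>\<^sub>F z in nhds 0. partial_u f z = ev (dX A) z"
    using ev_has_derivative_x[of A]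
  proof eventually_elim
    case (elim z)
    have "((\<lambda>s. (s, snd z)) \<longlongrightarrow> (fst z, snd z)) (nhds (fst z))"
      by (intro tendsto_intros filterlim_ident)
    then have "\<forall>\<^sub>F s in nhds (fst z). f (s, snd z) = ev A (s, snd z)"
      unfolding filterlim_iff prod.collapse using elim(1) by fast
    from DERIV_cong_ev[OF refl this refl] elim(2) show ?case
      by (simp add: partial_u_def case_prod_unfold DERIV_imp_deriv)
  qed
  then show ?thesis by (simp add: same_germ_def)
qed

lemma partial_v_same_germ:
  assumes "same_germ f (ev A)" shows "same_germ (partial_v f) (ev (dY A))"
proof -
  have "same_germ (\<lambda>z. f (snd z, fst z)) (ev (sw A))"
    using eventually_swap[OF assms[unfolded same_germ_def]] unfolding same_germ_def
    by eventually_elim (metis ev_sw prod.collapse)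
  from partial_u_same_germ[OF this]
  have "\<forall>\<^sub>F z in nhds 0. partial_u (\<lambda>z. f (snd z, fst z)) (snd z, fst z) = ev (dX (sw A)) (snd z, fst z)"
    unfolding same_germ_def by (rule eventually_swap)
  then show ?thesis unfolding same_germ_def
    by eventually_elim (simp add: partial_u_def partial_v_def case_prod_unfold dY_def ev_sw[of "dX (sw A)" "fst z" "snd z" for z, simplified])
qed

section \<open>Local resolution\<close>

lemma xonly_0 [simp]: "xonly 0" and xonly_cst [simp]: "xonly (cst c)"
  by (simp_all add: xonly_def cf_cst)
lemma xonly_diff: "xonly a \<Longrightarrow> xonly b \<Longrightarrow> xonly (a - b)" by (simp add: xonly_def)

lemma xonly_ax: "xonly \<psi> \<Longrightarrow> val \<psi> = 0 \<Longrightarrow> ax \<psi> = 0"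
  by (rule fps_ext) (metis ax_nth fps_zero_nth neq0_conv val_def xonly_def)

lemma xonly_blow: assumes "xonly \<psi>" shows "blow t \<psi> = \<psi>"
proof (rule germ_eqI)
  fix n l
  have "hpoly \<psi> n = [:cf \<psi> n 0:]"
    by (rule poly_eqI) (use assms in \<open>auto simp: coeff_hpoly coeff_pCons xonly_def split: nat.split\<close>)
  then show "cf (blow t \<psi>) n l = cf \<psi> n l"
    using assms by (cases l) (auto simp: cf_blow xonly_def)
qed

lemma gX_mult_decomp:
  assumes "xonly (gX ^ n * B)" shows "xonly B"
proof -
  have "n \<le> xord (gX ^ n * B) \<or> B = 0" by (cases "B = 0") (auto simp: xord_mult xord_power)
  then show ?thesis
  proof
    assume "n \<le> xord (gX ^ n * B)"
    then obtain C where C: "gX ^ n * B = gX ^ n * C" "\<And>i j. cf C i j = cf (gX ^ n * B) (i + n) j"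
      by (rule gX_decomp) blast
    then have "B = C" by simp
    then show ?thesis using C(2) assms by (simp add: xonly_def)
  qed simp
qed

lemma xonly_tail:
  assumes "xonly \<psi>" "val \<psi> = 0" obtains \<psi>' where "\<psi> = gX * \<psi>'" "xonly \<psi>'"
proof -
  obtain \<psi>' where "\<psi> = gX * \<psi>'" using xonly_ax[OF assms] unfolding gX_dvd_iff[symmetric] by (auto elim: dvdE)
  moreover from this assms(1) have "xonly \<psi>'" using gX_mult_decomp[of 1 \<psi>'] by simp
  ultimately show ?thesis by (rule that)
qed

text \<open>After removal of a power of \<open>gX\<close>, a nonzero multiple of
  \<open>gY - \<psi>\<close> restricts to a nonzero multiple of \<open>y\<close> on
  \<open>x = 0\<close>, so it cannot depend on \<open>x\<close> only.\<close>

lemma smooth_division_unique: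
  assumes "Q * (gY - \<psi>) = \<sigma>" "xonly \<sigma>" "xonly \<psi>" "val \<psi> = 0"
  shows "\<sigma> = 0" "Q = 0"
proof -
  show "Q = 0"
  proof (rule ccontr)
    assume "Q \<noteq> 0"
    then obtain Q' where Q': "Q = gX ^ xord Q * Q'" "ax Q' \<noteq> 0" by (rule xord_decomp)
    have "xonly (gX ^ xord Q * (Q' * (gY - \<psi>)))"
      using assms(1,2) by (simp add: mult.assoc[symmetric] Q'(1)[symmetric])
    then have "xonly (Q' * (gY - \<psi>))" by (rule gX_mult_decomp)
    then have "ax (Q' * (gY - \<psi>)) $ Suc (subdegree (ax Q')) = 0"
      unfolding ax_nth by (simp add: xonly_def)
    moreover have "ax (Q' * (gY - \<psi>)) = ax Q' * fps_X" using xonly_ax[OF assms(3,4)] by simp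
    ultimately show False using Q'(2) by simp
  qed
  with assms(1) show "\<sigma> = 0" by simp
qed

lemma blow_curve:
  assumes "xonly \<psi>'"
  shows "blow t (gY - gX * \<psi>') = gX * (gY - (\<psi>' - cst t))"
  using xonly_blow[OF assms] by (simp add: algebra_simps)

lemma blowV_curve: "blowV (gY - gX * \<psi>') = gY * (1 - gX * blowV \<psi>')"
  by (simp add: algebra_simps)

text \<open>Normal crossings at a point of the divisor. The flag \<open>fv\<close> tells that
  \<open>v = 0\<close> belongs to the divisor: then only monomials are allowed. Otherwise one smooth
  curve transversal to \<open>u = 0\<close>, the graph of \<open>\<psi>\<close>, may take the place
  of \<open>v = 0\<close>.\<close>

definition good :: "bool \<Rightarrow> germ \<Rightarrow> bool" where
  "good fv F \<longleftrightarrow> (\<exists>i j U. val U \<noteq> 0 \<and> F = gX ^ i * gY ^ j * U) \<or>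
    (\<not> fv \<and> (\<exists>i c \<psi> U. val U \<noteq> 0 \<and> xonly \<psi> \<and> val \<psi> = 0 \<and> F = gX ^ i * (gY - \<psi>) ^ c * U))"

lemma good_cases:
  assumes "good fv F"
  obtains i c \<psi> U where "val U \<noteq> 0" "xonly \<psi>" "val \<psi> = 0" "F = gX ^ i * (gY - \<psi>) ^ c * U" "\<psi> = 0 \<or> \<not> fv"
  using assms unfolding good_def by (metis diff_zero val_simps(1) xonly_0)

lemma good_curveI:
  "val U \<noteq> 0 \<Longrightarrow> xonly \<psi> \<Longrightarrow> val \<psi> = 0 \<Longrightarrow> \<psi> = 0 \<or> \<not> fv \<Longrightarrow> good fv (gX ^ i * (gY - \<psi>) ^ c * U)"
  unfolding good_def by (metis diff_zero)

lemma good_monomialI: "val U \<noteq> 0 \<Longrightarrow> good fv (gX ^ i * gY ^ j * U)"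
  unfolding good_def by blast

lemma good_unit_mult: "good fv M \<Longrightarrow> val V \<noteq> 0 \<Longrightarrow> good fv (M * V)"
  by (erule good_cases) (metis (no_types, lifting) good_curveI mult.assoc no_zero_divisors val_simps(6))

lemma good_gX_power: "good fv M \<Longrightarrow> good fv (M * gX ^ n)"
proof (erule good_cases)
  fix i c \<psi> U assume *: "val U \<noteq> 0" "xonly \<psi>" "val \<psi> = 0" "M = gX ^ i * (gY - \<psi>) ^ c * U" "\<psi> = 0 \<or> \<not> fv"
  have "M * gX ^ n = gX ^ (i + n) * (gY - \<psi>) ^ c * U" by (simp add: *(4) power_add mult_ac)
  then show ?thesis using good_curveI[OF *(1,2,3,5)] by simp
qed

lemma good_mono: "good True M \<Longrightarrow> good fv M" unfolding good_def by blast

lemma blow_monomial: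
  assumes "val U \<noteq> 0" "t \<noteq> 0"
  obtains U' where "blow t (gX ^ i * gY ^ j * U) = gX ^ (i + j) * U'" "val U' \<noteq> 0"
proof
  show "blow t (gX ^ i * gY ^ j * U) = gX ^ (i + j) * ((cst t + gY) ^ j * blow t U)"
    by (simp add: power_add power_mult_distrib mult_ac)
qed (use assms in simp)

text \<open>In the new chart \<open>v = 0\<close> is the strict transform of the old
  \<open>v = 0\<close> if \<open>t = 0\<close>, and no component otherwise; hence the new flag. The
  graph of \<open>\<psi>\<close> passes only through the point whose slope is the derivative of
  \<open>\<psi>\<close>; elsewhere its equation is a power of \<open>u\<close> times a unit.\<close>

lemma good_blow: assumes "good fv M" shows "good (fv \<and> t = 0) (blow t M)"
  using assms
proof (rule good_cases)
  fix i c \<psi> U assume *: "val U \<noteq> 0" "xonly \<psi>" "val \<psi> = 0" "M = gX ^ i * (gY - \<psi>) ^ c * U" "\<psi> = 0 \<or> \<not> fv"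
  obtain \<psi>' where p: "\<psi> = gX * \<psi>'" "xonly \<psi>'" using *(2,3) by (rule xonly_tail)
  have eq: "blow t M = gX ^ (i + c) * (gY - (\<psi>' - cst t)) ^ c * blow t U"
    unfolding *(4) p(1) blow_mult blow_power blow_curve[OF p(2)] by (simp add: power_add power_mult_distrib mult_ac)
  show ?thesis
  proof (cases "val \<psi>' = t")
    case True
    have "\<psi> = 0 \<Longrightarrow> \<psi>' - cst t = 0" using True p(1) by auto
    then show ?thesis unfolding eq
      by (intro good_curveI xonly_diff p(2) xonly_cst) (use * True in auto)
  next
    case False
    have "good (fv \<and> t = 0) (gX ^ (i + c) * gY ^ 0 * ((gY - (\<psi>' - cst t)) ^ c * blow t U))"
      by (rule good_monomialI) (use * False in auto)
    then show ?thesis unfolding eq by (simp add: mult.assoc)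
  qed
qed

lemma blowV_good: assumes "good fv M" obtains i j U where "val U \<noteq> 0" "blowV M = gX ^ i * gY ^ j * U"
  using assms
proof (rule good_cases)
  fix i c \<psi> U assume *: "val U \<noteq> 0" "xonly \<psi>" "val \<psi> = 0" "M = gX ^ i * (gY - \<psi>) ^ c * U" "\<psi> = 0 \<or> \<not> fv"
  obtain \<psi>' where p: "\<psi> = gX * \<psi>'" "xonly \<psi>'" using *(2,3) by (rule xonly_tail)
  have "blowV M = gX ^ i * gY ^ (i + c) * ((1 - gX * blowV \<psi>') ^ c * blowV U)"
    unfolding *(4) p(1) blowV_simps(2,10) blowV_curve by (simp add: power_add power_mult_distrib mult_ac)
  then show ?thesis by (rule that[rotated]) (use *(1) in simp)
qed

text \<open>A well-founded tree of blow-ups: a node continues at all points of the new exceptional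
  line, and every path ends at a normal crossing. The vertical chart has the flag
  \<open>True\<close>, since there \<open>v = 0\<close> is the new component.\<close>

inductive res :: "bool \<Rightarrow> germ \<Rightarrow> bool" where
  leaf: "good fv F \<Longrightarrow> res fv F"
| node: "(\<And>t. res (fv \<and> t = 0) (blow t F)) \<Longrightarrow> res True (blowV F) \<Longrightarrow> res fv F"

text \<open>On the exceptional line the strict transform is a polynomial of degree at most
  \<open>ord f\<close>, so the order does not rise. If it stays equal, the degree is
  \<open>ord f\<close>, and the leading coefficient gives the monomial
  \<open>v ^ ord f\<close>.\<close>

lemma strict_slope:
  assumes "f \<noteq> 0"
  obtains g where "blow t f = gX ^ ord f * g" "g \<noteq> 0" "ord g \<le> ord f"
    "ord g = ord f \<Longrightarrow> cf g 0 (ord f) \<noteq> 0" "t = 0 \<Longrightarrow> val g = cf f (ord f) 0"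
proof -
  obtain g where g: "blow t f = gX ^ ord f * g" "ax g = fps_of_poly (pcompose (hpoly f (ord f)) [:t, 1:])"
    using assms by (rule blow_decomp)
  define p where "p = pcompose (hpoly f (ord f)) [:t, 1:]"
  have cf: "cf g 0 l = coeff p l" for l using arg_cong[OF g(2), of "\<lambda>a. a $ l"] by (simp add: ax_nth p_def)
  have p0: "p \<noteq> 0" unfolding p_def using hpoly_ord_nonzero[OF assms] by (simp add: pcompose_eq_0_iff)
  have deg: "degree p \<le> ord f" unfolding p_def using degree_hpoly[of f "ord f"] by (simp add: degree_pcompose)
  have lc: "cf g 0 (degree p) \<noteq> 0" using p0 unfolding cf by simp
  have le: "ord g \<le> degree p" using ord_le[OF lc] by simp
  show ?thesis
  proof (rule that[OF g(1)])
    show "g \<noteq> 0" using lc by auto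
    show "ord g \<le> ord f" using le deg by simp
    show "cf g 0 (ord f) \<noteq> 0" if "ord g = ord f" using that le deg lc by (metis le_antisym)
    show "val g = cf f (ord f) 0" if "t = 0"
      using cf[of 0] that by (simp add: p_def val_def coeff_hpoly)
  qed
qed

lemma strict_vertical:
  assumes "f \<noteq> 0"
  obtains g where "blowV f = gY ^ ord f * g" "g \<noteq> 0" "ord g \<le> ord f"
    "ord g = ord f \<Longrightarrow> cf g (ord f) 0 \<noteq> 0" "val g = cf f 0 (ord f)"
proof -
  have "sw f \<noteq> 0" using assms by simp
  then obtain g where g: "blow 0 (sw f) = gX ^ ord (sw f) * g" "g \<noteq> 0" "ord g \<le> ord (sw f)"
    "ord g = ord (sw f) \<Longrightarrow> cf g 0 (ord (sw f)) \<noteq> 0" "val g = cf (sw f) (ord (sw f)) 0"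
    by (rule strict_slope[of "sw f" 0]) blast
  show ?thesis by (rule that[of "sw g"]) (use g in \<open>auto simp: blowV_def\<close>)
qed

lemma ax_blowV: "ax (blowV A) = ax A"
  by (rule fps_ext) (simp add: ax_nth blowV_def cf_blow coeff_hpoly)

lemma cf_dY_iterate: "cf ((dY ^^ k) A) i j = fact (j + k) / fact j * cf A i (j + k)"
proof (induction k arbitrary: j)
  case (Suc k)
  show ?case by (simp add: cf_dY Suc.IH)
qed simp

lemma dY_gX_power: "dY (gX ^ n) = 0"
  by (cases n) (simp_all only: dY_power dY_simps power_0 mult_zero_right)

lemma dY_iterate_gX: "(dY ^^ k) (gX ^ n * A) = gX ^ n * (dY ^^ k) A"
proof (induction k)
  case (Suc k)
  show ?case by (simp add: Suc.IH dY_gX_power)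
qed simp

lemma dY_iterate_blow: "(dY ^^ k) (blow t A) = gX ^ k * blow t ((dY ^^ k) A)"
proof (induction k)
  case (Suc k)
  show ?case by (simp add: Suc.IH dY_blow dY_gX_power mult_ac)
qed simp

text \<open>One step of the induction on the multiplicity: \<open>lower\<close> is the induction
  hypothesis for orders below \<open>\<nu>\<close>.\<close>

context
  fixes \<nu> :: nat
  assumes pos: "\<nu> > 0"
    and lower: "\<And>fv M f. good fv M \<Longrightarrow> f \<noteq> 0 \<Longrightarrow> ord f < \<nu> \<Longrightarrow> res fv (M * f)"
begin

text \<open>At the point on the curve \<open>y = \<psi>\<close> the remainder \<open>\<rho>\<close>
  of \<open>f\<close> modulo \<open>gY - \<psi>\<close> is divided by \<open>gX ^ \<nu>\<close>, so
  its order in \<open>x\<close> drops. Once it is 0, \<open>f\<close> is a multiple of the equation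
  of the curve and the cofactor has smaller order. \<open>T\<close> is a property that
  \<open>stay\<close> carries along the curve, and \<open>esc\<close> settles the points off the
  curve at which the order has not dropped.\<close>

lemma res_along_curve:
  assumes esc: "\<And>\<psi> f \<psi>' t g k U. T \<psi> f \<Longrightarrow> \<psi> = gX * \<psi>' \<Longrightarrow> xonly \<psi>' \<Longrightarrow> t \<noteq> val \<psi>' \<Longrightarrow> ord f = \<nu> \<Longrightarrow>
      blow t f = gX ^ \<nu> * g \<Longrightarrow> ord g = \<nu> \<Longrightarrow> cf g 0 \<nu> \<noteq> 0 \<Longrightarrow> val U \<noteq> 0 \<Longrightarrow> res False (gX ^ k * U * g)"
    and stay: "\<And>\<psi> f \<psi>' g. T \<psi> f \<Longrightarrow> \<psi> = gX * \<psi>' \<Longrightarrow> xonly \<psi>' \<Longrightarrow> ord f = \<nu> \<Longrightarrow>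
      blow (val \<psi>') f = gX ^ \<nu> * g \<Longrightarrow> ord g = \<nu> \<Longrightarrow> T (\<psi>' - cst (val \<psi>')) g"
    and st: "T \<psi> f" "ord f = \<nu>" "cf f 0 \<nu> \<noteq> 0" "xonly \<psi>" "val \<psi> = 0" "\<psi> = 0 \<or> \<not> fv" "val U \<noteq> 0"
      "M = gX ^ i * (gY - \<psi>) ^ c * U"
    and div: "f = q * (gY - \<psi>) + \<rho>" "xonly \<rho>"
  shows "res fv (M * f)"
  using st div
proof (induction "xord \<rho>" arbitrary: \<psi> f fv M i c U q \<rho> rule: less_induct)
  case less
  note T = less.prems(1) and f = less.prems(2,3) and psi = less.prems(4,5,6) and U = less.prems(7) and M = less.prems(8) and dv = less.prems(9,10)
  have f0: "f \<noteq> 0" using f(2) by auto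
  have goodM: "good fv M" unfolding M using U psi by (intro good_curveI)
  show ?case
  proof (cases "\<rho> = 0")
    case True
    have q0: "q \<noteq> 0" using f0 dv True by auto
    have W0: "gY - \<psi> \<noteq> 0" using dv True f0 by auto
    have "ord (gY - \<psi>) > 0" using W0 psi(2) by (metis gr0I ord_eq_0_iff diff_zero val_simps(4,9))
    then have "ord q < \<nu>" using ord_mult[OF q0 W0] f dv True by simp
    moreover have "good fv (M * (gY - \<psi>))"
      using good_curveI[OF U psi, of i "Suc c"] by (simp add: M mult_ac)
    ultimately have "res fv (M * (gY - \<psi>) * q)" using lower q0 by blast
    then show ?thesis using dv True by (simp add: mult_ac)
  next
    case False
    obtain \<psi>' where p: "\<psi> = gX * \<psi>'" "xonly \<psi>'" using psi(1,2) by (rule xonly_tail)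
    show ?thesis
    proof (rule res.node)
      fix t
      obtain g where g: "blow t f = gX ^ ord f * g" "g \<noteq> 0" "ord g \<le> ord f" "ord g = ord f \<Longrightarrow> cf g 0 (ord f) \<noteq> 0"
        using f0 by (rule strict_slope[of f t]) blast
      have bM: "blow t (M * f) = (blow t M * gX ^ \<nu>) * g" using g(1) f(1) by (simp add: mult.assoc)
      have gM: "good (fv \<and> t = 0) (blow t M * gX ^ \<nu>)" by (intro good_gX_power good_blow goodM)
      have eqM: "blow t M * gX ^ \<nu> = gX ^ (i + c + \<nu>) * (gY - (\<psi>' - cst t)) ^ c * blow t U"
        unfolding M p(1) blow_mult blow_power blow_curve[OF p(2)] by (simp add: power_add power_mult_distrib mult_ac)
      show "res (fv \<and> t = 0) (blow t (M * f))"
      proof (cases "ord g < \<nu>")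
        case True
        then show ?thesis unfolding bM using lower gM g(2) by blast
      next
        case False
        with g f have og: "ord g = \<nu>" "cf g 0 \<nu> \<noteq> 0" by auto
        show ?thesis
        proof (cases "t = val \<psi>'")
          case True
          define \<psi>1 where "\<psi>1 = \<psi>' - cst t"
          have psi1: "xonly \<psi>1" "val \<psi>1 = 0" "\<psi>1 = 0 \<or> \<not> (fv \<and> t = 0)" "gY - (\<psi>' - cst t) = gY - \<psi>1"
            using True p psi(3) by (auto simp: \<psi>1_def intro!: xonly_diff)
          have T1: "T \<psi>1 g" using stay[OF T p f(1) _ og(1)] g(1) f(1) True by (simp add: \<psi>1_def)
          have "val (gY - \<psi>1) = 0" "cf (gY - \<psi>1) 0 1 \<noteq> 0"
            using psi1 by (auto simp: cf_gY xonly_def)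
          then obtain q1 \<rho>1 where d1: "g = q1 * (gY - \<psi>1) + \<rho>1" "xonly \<rho>1" by (rule division_by_smooth)
          have "blow t f = blow t q * (gX * (gY - \<psi>1)) + \<rho>"
            unfolding dv(1) p(1) blow_add blow_mult blow_curve[OF p(2)] xonly_blow[OF dv(2)] psi1(4) by simp
          then have "(gX ^ \<nu> * q1 - blow t q * gX) * (gY - \<psi>1) = \<rho> - gX ^ \<nu> * \<rho>1"
            using g(1) f(1) d1(1) by (simp add: algebra_simps)
          moreover have "xonly (\<rho> - gX ^ \<nu> * \<rho>1)"
          proof (rule xonly_diff[OF dv(2)])
            show "xonly (gX ^ \<nu> * \<rho>1)"
            proof (induction \<nu>)
              case (Suc n)
              have "cf (gX * B) i j = (if i = 0 then 0 else cf B (i - 1) j)" for B i j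
                unfolding cf_def times_germ.rep_eq gX.rep_eq by simp
              with Suc show ?case by (simp add: xonly_def mult.assoc)
            qed (simp add: d1(2))
          qed
          ultimately have "\<rho> - gX ^ \<nu> * \<rho>1 = 0" using smooth_division_unique(1) psi1(1,2) by blast
          then have r: "\<rho> = gX ^ \<nu> * \<rho>1" by simp
          with \<open>\<rho> \<noteq> 0\<close> have "xord \<rho>1 < xord \<rho>" using pos by (auto simp: xord_mult xord_power)
          moreover have "val (blow t U) \<noteq> 0" using U by simp
          ultimately show ?thesis unfolding bM
            by (rule less.hyps[OF _ T1 og psi1(1,2,3)]) (use d1 eqM psi1(4) in auto)
        next
          case False
          have "res False (gX ^ (i + c + \<nu>) * ((gY - (\<psi>' - cst t)) ^ c * blow t U) * g)"
            by (rule esc[OF T p False f(1) _ og]) (use g(1) f(1) U False in auto)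
          moreover have "(fv \<and> t = 0) = False" using False p psi(3) by auto
          ultimately show ?thesis unfolding bM eqM by (simp only: mult.assoc)
        qed
      qed
    next
      obtain g where g: "blowV f = gY ^ ord f * g" "val g = cf f 0 (ord f)"
        using f0 by (rule strict_vertical)
      obtain k j V where V: "val V \<noteq> 0" "blowV M = gX ^ k * gY ^ j * V" by (rule blowV_good[OF goodM]) blast
      have "blowV (M * f) = gX ^ k * gY ^ (j + \<nu>) * (V * g)" using g(1) f(1) V(2) by (simp add: power_add mult_ac)
      then show "res True (blowV (M * f))"
        by (intro res.leaf) (use V(1) g(2) f in \<open>auto intro!: good_monomialI\<close>)
    qed
  qed
qed

text \<open>Along a curve of maximal contact (Tschirnhausen) the order can stay equal to \<open>\<nu>\<close> only at the points
  of the curve.\<close>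

lemma res_transversal_free:
  assumes "ord f = \<nu>" "cf f 0 \<nu> \<noteq> 0" "val U \<noteq> 0"
  shows "res False (gX ^ k * U * f)"
proof -
  \<comment> \<open>Maximal contact: the derivative of order \<open>\<nu> - 1\<close> in
    \<open>y\<close> has order one and is therefore the equation of a smooth curve up to a
    unit.\<close>
  define T where "T \<psi> f \<longleftrightarrow> (\<exists>e. val e \<noteq> 0 \<and> (dY ^^ (\<nu> - 1)) f = e * (gY - \<psi>))" for \<psi> f
  have key: "(dY ^^ (\<nu> - 1)) g = blow t e * (gY - (\<psi>' - cst t))"
    if "(dY ^^ (\<nu> - 1)) f = e * (gY - gX * \<psi>')" "xonly \<psi>'" "blow t f = gX ^ \<nu> * g" for f e \<psi>' t g
  proof -
    have "gX ^ \<nu> * (dY ^^ (\<nu> - 1)) g = gX ^ (\<nu> - 1) * blow t ((dY ^^ (\<nu> - 1)) f)"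
      using dY_iterate_gX[of "\<nu> - 1" \<nu> g] dY_iterate_blow[of "\<nu> - 1" t f] that(3) by simp
    also have "blow t ((dY ^^ (\<nu> - 1)) f) = gX * (blow t e * (gY - (\<psi>' - cst t)))"
      unfolding that(1) blow_mult blow_curve[OF that(2)] by (simp add: mult_ac)
    also have "gX ^ (\<nu> - 1) * (gX * (blow t e * (gY - (\<psi>' - cst t)))) = gX ^ \<nu> * (blow t e * (gY - (\<psi>' - cst t)))"
      using pos by (cases \<nu>) (auto simp: mult_ac)
    finally show ?thesis by simp
  qed
  have v0: "val ((dY ^^ (\<nu> - 1)) g) = 0" if "ord g = \<nu>" for g
    using cf_eq_0_less_ord[of 0 "\<nu> - 1" g] that pos by (simp add: val_def cf_dY_iterate)
  have "cf ((dY ^^ (\<nu> - 1)) f) 0 1 \<noteq> 0" using assms(2) pos by (simp add: cf_dY_iterate)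
  with v0[OF assms(1)] obtain e \<psi> where e: "(dY ^^ (\<nu> - 1)) f = e * (gY - \<psi>)" "xonly \<psi>" "val \<psi> = 0" "val e \<noteq> 0"
    by (rule implicit_function)
  have "val (gY - \<psi>) = 0" "cf (gY - \<psi>) 0 1 \<noteq> 0" using e by (auto simp: cf_gY xonly_def)
  then obtain q \<rho> where d: "f = q * (gY - \<psi>) + \<rho>" "xonly \<rho>" by (rule division_by_smooth)
  show ?thesis
  proof (rule res_along_curve[of T])
    show "T \<psi> f" using e by (auto simp: T_def)
    show "gX ^ k * U = gX ^ k * (gY - \<psi>) ^ 0 * U" by simp
    show "f = q * (gY - \<psi>) + \<rho>" by (rule d(1))
  next
    fix \<psi> f \<psi>' t g k U assume a: "T \<psi> f" "\<psi> = gX * \<psi>'" "xonly \<psi>'" "t \<noteq> val \<psi>'"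
      "blow t f = gX ^ \<nu> * g" "ord g = \<nu>"
    then obtain e where "val e \<noteq> 0" "(dY ^^ (\<nu> - 1)) f = e * (gY - gX * \<psi>')" unfolding T_def by blast
    \<comment> \<open>Off the curve the right-hand side of \<open>key\<close> has nonzero value,
      whereas the order \<open>\<nu>\<close> of \<open>g\<close> forces the value 0, so this case
      does not occur.\<close>
    with key[OF this(2) a(3,5)] v0[OF a(6)] a(4) show "res False (gX ^ k * U * g)" by simp
  next
    fix \<psi> f \<psi>' g assume a: "T \<psi> f" "\<psi> = gX * \<psi>'" "xonly \<psi>'" "blow (val \<psi>') f = gX ^ \<nu> * g"
    then obtain e where "val e \<noteq> 0" "(dY ^^ (\<nu> - 1)) f = e * (gY - gX * \<psi>')" unfolding T_def by blast
    with key[OF this(2) a(3,4)] show "T (\<psi>' - cst (val \<psi>')) g"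
      unfolding T_def by (intro exI[of _ "blow (val \<psi>') e"]) simp
  qed (use assms e d in auto)
qed

text \<open>The curve to follow is now the one contained in \<open>M\<close>, so that
  \<open>M\<close> keeps its form. Off this curve \<open>M\<close> is a power of \<open>u\<close>
  times a unit, and maximal contact can be used.\<close>

lemma res_transversal:
  assumes "ord f = \<nu>" "cf f 0 \<nu> \<noteq> 0" "good fv M"
  shows "res fv (M * f)"
proof -
  obtain i c \<psi> U where M: "val U \<noteq> 0" "xonly \<psi>" "val \<psi> = 0" "M = gX ^ i * (gY - \<psi>) ^ c * U" "\<psi> = 0 \<or> \<not> fv"
    using assms(3) by (rule good_cases)
  have "val (gY - \<psi>) = 0" "cf (gY - \<psi>) 0 1 \<noteq> 0" using M by (auto simp: cf_gY xonly_def)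
  then obtain q \<rho> where d: "f = q * (gY - \<psi>) + \<rho>" "xonly \<rho>" by (rule division_by_smooth)
  show ?thesis
    by (rule res_along_curve[of "\<lambda>_ _. True" \<psi> f fv U M i c q \<rho>])
      (use assms M d res_transversal_free in auto)
qed

text \<open>The order can persist at the vertical point, but there the intersection number of
  \<open>f\<close> with the line \<open>x = 0\<close>, which is the order of \<open>ax f\<close>,
  drops by \<open>\<nu>\<close>. For slope 0 the strict transform is a unit. For any other slope at
  which the order persists, \<open>M\<close> is a power of \<open>u\<close> times a unit and maximal
  contact applies.\<close>

lemma res_vertical:
  assumes "ord f = \<nu>" "cf f \<nu> 0 \<noteq> 0" "val U \<noteq> 0"
  shows "res fv (gX ^ i * gY ^ j * U * f)"
  using assms
proof (induction "subdegree (ax f)" arbitrary: f U i j fv rule: less_induct)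
  case less
  note f = less.prems(1,2) and U = less.prems(3)
  have f0: "f \<noteq> 0" using f(2) by auto
  define M where "M = gX ^ i * gY ^ j * U"
  have goodM: "good fv M" for fv unfolding M_def using U by (rule good_monomialI)
  show ?case
  proof (cases "ax f = 0")
    case True
    then obtain f' where f': "f = gX * f'" unfolding gX_dvd_iff[symmetric] by (auto elim: dvdE)
    with f0 have "f' \<noteq> 0" by auto
    moreover have "ord gX = 1" unfolding ord_def by simp
    ultimately have "ord f' < \<nu>" using f' f(1) by (simp add: ord_mult)
    moreover have "good fv (gX ^ Suc i * gY ^ j * U)" using U by (rule good_monomialI)
    ultimately have "res fv (gX ^ Suc i * gY ^ j * U * f')" using lower \<open>f' \<noteq> 0\<close> by blast
    then show ?thesis by (simp add: f' mult_ac)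
  next
    case False
    show ?thesis unfolding M_def[symmetric]
    proof (rule res.node)
      fix t
      obtain g where g: "blow t f = gX ^ ord f * g" "g \<noteq> 0" "ord g \<le> ord f" "ord g = ord f \<Longrightarrow> cf g 0 (ord f) \<noteq> 0"
         "t = 0 \<Longrightarrow> val g = cf f (ord f) 0"
        using f0 by (rule strict_slope[of f t]) blast
      have bM: "blow t (M * f) = (blow t M * gX ^ \<nu>) * g" using g(1) f(1) by (simp add: mult.assoc)
      have gM: "good (fv \<and> t = 0) (blow t M * gX ^ \<nu>)" by (intro good_gX_power good_blow goodM)
      consider "t = 0" | "t \<noteq> 0" "ord g < \<nu>" | "t \<noteq> 0" "ord g = \<nu>" using g(3) f(1) by linarith
      then show "res (fv \<and> t = 0) (blow t (M * f))"
      proof cases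
        case 1
        then have "val g \<noteq> 0" using g(5) f by simp
        then show ?thesis unfolding bM by (intro res.leaf good_unit_mult gM)
      next
        case 2
        then show ?thesis unfolding bM using lower gM g(2) by blast
      next
        case 3
        obtain U' where "blow t M = gX ^ (i + j) * U'" "val U' \<noteq> 0" unfolding M_def
          by (rule blow_monomial[OF U 3(1)])
        with res_transversal_free[OF 3(2), of U' "i + j + \<nu>"] g(4) 3 f show ?thesis unfolding bM
          by (simp add: power_add mult_ac)
      qed
    next
      obtain g where g: "blowV f = gY ^ ord f * g" "g \<noteq> 0" "ord g \<le> ord f" "ord g = ord f \<Longrightarrow> cf g (ord f) 0 \<noteq> 0"
        using f0 by (rule strict_vertical) blast
      have bM: "blowV (M * f) = gX ^ i * gY ^ (i + j + \<nu>) * blowV U * g"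
        using g(1) f(1) by (simp add: M_def power_add power_mult_distrib mult_ac)
      have vU: "val (blowV U) \<noteq> 0" using U by simp
      show "res True (blowV (M * f))"
      proof (cases "ord g < \<nu>")
        case True
        then show ?thesis unfolding bM using lower good_monomialI[OF vU] g(2) by blast
      next
        case False
        with g f have og: "ord g = \<nu>" "cf g \<nu> 0 \<noteq> 0" by auto
        have "ax f = fps_X ^ \<nu> * ax g" using arg_cong[OF g(1), of ax] f(1) by (simp add: ax_blowV)
        then have "subdegree (ax g) < subdegree (ax f)" using False pos \<open>ax f \<noteq> 0\<close>
          by (auto simp: subdegree_mult)
        then show ?thesis unfolding bM using less.hyps og vU by blast
      qed
    qed
  qed
qed

end

text \<open>After one blow-up the order has dropped or the strict transform is in a position treated
  above: \<open>res_transversal\<close> in slope charts, \<open>res_vertical\<close> in the vertical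
  chart.\<close>

theorem resolution:
  assumes "good fv M" "f \<noteq> 0" shows "res fv (M * f)"
  using assms
proof (induction "ord f" arbitrary: fv M f rule: less_induct)
  case less
  show ?case
  proof (cases "ord f = 0")
    case True
    then have "val f \<noteq> 0" using less.prems(2) by (simp add: ord_eq_0_iff)
    then show ?thesis using less.prems(1) by (intro res.leaf good_unit_mult)
  next
    case False
    define \<nu> where "\<nu> = ord f"
    have pos: "\<nu> > 0" using False by (simp add: \<nu>_def)
    have lower: "\<And>fv M f. good fv M \<Longrightarrow> f \<noteq> 0 \<Longrightarrow> ord f < \<nu> \<Longrightarrow> res fv (M * f)"
      using less.hyps unfolding \<nu>_def by blast
    show ?thesis
    proof (rule res.node)
      fix t
      obtain g where g: "blow t f = gX ^ ord f * g" "g \<noteq> 0" "ord g \<le> ord f" "ord g = ord f \<Longrightarrow> cf g 0 (ord f) \<noteq> 0"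
        using less.prems(2) by (rule strict_slope[of f t]) blast
      have bM: "blow t (M * f) = (blow t M * gX ^ \<nu>) * g" using g(1) by (simp add: mult.assoc \<nu>_def)
      have gM: "good (fv \<and> t = 0) (blow t M * gX ^ \<nu>)" by (intro good_gX_power good_blow less.prems(1))
      show "res (fv \<and> t = 0) (blow t (M * f))"
      proof (cases "ord g < \<nu>")
        case True
        then show ?thesis unfolding bM using lower gM g(2) by blast
      next
        case False
        then show ?thesis unfolding bM
          using res_transversal[OF pos lower _ _ gM, of g] g(3,4) by (simp add: \<nu>_def)
      qed
    next
      obtain g where g: "blowV f = gY ^ ord f * g" "g \<noteq> 0" "ord g \<le> ord f" "ord g = ord f \<Longrightarrow> cf g (ord f) 0 \<noteq> 0"
        using less.prems(2) by (rule strict_vertical) blast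
      obtain k j V where V: "val V \<noteq> 0" "blowV M = gX ^ k * gY ^ j * V" by (rule blowV_good[OF less.prems(1)]) blast
      have bM: "blowV (M * f) = gX ^ k * gY ^ (j + \<nu>) * V * g" using g(1) V(2) by (simp add: power_add mult_ac \<nu>_def)
      show "res True (blowV (M * f))"
      proof (cases "ord g < \<nu>")
        case True
        then show ?thesis unfolding bM using lower good_monomialI[OF V(1)] g(2) by blast
      next
        case False
        then show ?thesis unfolding bM
          using res_vertical[OF pos lower _ _ V(1), of g] g(3,4) by (simp add: \<nu>_def)
      qed
    qed
  qed
qed

corollary resolvable: "F \<noteq> 0 \<Longrightarrow> res fv F"
  using resolution[of fv 1 F] good_monomialI[of 1 fv 0 0] by simp

text \<open>Where the leading form does not vanish the strict transform is a unit. This keeps the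
  number of points that need further blow-ups finite.\<close>

lemma finite_not_good_blow:
  assumes "F \<noteq> 0" shows "finite {t. \<not> good fv (blow t F)}"
proof -
  have "{t. \<not> good fv (blow t F)} \<subseteq> {t. poly (hpoly F (ord F)) t = 0}"
  proof (clarify, rule ccontr)
    fix t assume t: "\<not> good fv (blow t F)" "poly (hpoly F (ord F)) t \<noteq> 0"
    obtain g where g: "blow t F = gX ^ ord F * g" "ax g = fps_of_poly (pcompose (hpoly F (ord F)) [:t, 1:])"
      using assms by (rule blow_decomp)
    have "val g = poly (hpoly F (ord F)) t"
      unfolding ax_nth_0[symmetric] g(2) by (simp add: poly_0_coeff_0[symmetric] poly_pcompose)
    then show False using t good_monomialI[of g fv "ord F" 0] g(1) by simp
  qed
  then show ?thesis using poly_roots_finite[OF hpoly_ord_nonzero[OF assms]] by (rule finite_subset)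
qed

section \<open>Points, surfaces and components\<close>

primrec ancestors :: "point \<Rightarrow> point set" where
  "ancestors (Base a) = {}"
| "ancestors (Exc p d) = insert p (ancestors p)"

primrec depth :: "point \<Rightarrow> nat" where
  "depth (Base a) = 0"
| "depth (Exc p d) = Suc (depth p)"

lemma depth_ancestor: "p \<in> ancestors q \<Longrightarrow> depth p < depth q" by (induction q) auto
lemma ancestor_irrefl [simp]: "q \<notin> ancestors q" using depth_ancestor by blast
lemma ancestors_trans: "p \<in> ancestors q \<Longrightarrow> q \<in> ancestors r \<Longrightarrow> p \<in> ancestors r" by (induction r) auto
lemma finite_ancestors [simp]: "finite (ancestors q)" by (induction q) auto
lemma proj_ancestor: "p \<in> ancestors q \<Longrightarrow> proj p = proj q" by (induction q) auto
lemma ancestors_linear: "p \<in> ancestors q \<Longrightarrow> r \<in> ancestors q \<Longrightarrow> p = r \<or> p \<in> ancestors r \<or> r \<in> ancestors p"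
  by (induction q) auto

text \<open>The possible sets of centres. The order of the blow-ups is irrelevant: the points of the
  resulting surface are the leaves collected in \<open>surf\<close>.\<close>

definition tree :: "point set \<Rightarrow> bool" where
  "tree C \<longleftrightarrow> finite C \<and> (\<forall>p\<in>C. proj p = 0 \<and> ancestors p \<subseteq> C)"

definition surf :: "point set \<Rightarrow> point set" where
  "surf C = {q. q \<notin> C \<and> ancestors q \<subseteq> C}"

lemma tree_chain: "proj q = 0 \<Longrightarrow> tree (insert q (ancestors q))"
  unfolding tree_def using ancestors_trans proj_ancestor by auto
lemma treeD: "tree C \<Longrightarrow> p \<in> C \<Longrightarrow> q \<in> ancestors p \<Longrightarrow> q \<in> C" unfolding tree_def by blast
lemma tree_insert: "tree C \<Longrightarrow> proj p = 0 \<Longrightarrow> ancestors p \<subseteq> C \<Longrightarrow> tree (insert p C)"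
  unfolding tree_def by auto
lemma tree_proj: "tree C \<Longrightarrow> p \<in> C \<Longrightarrow> proj p = 0" unfolding tree_def by blast

lemma Exc_in_surf_iff: "tree C \<Longrightarrow> Exc p d \<in> surf C \<longleftrightarrow> p \<in> C \<and> Exc p d \<notin> C"
  unfolding surf_def tree_def by auto

lemma surf_insert:
  assumes "tree C" "p \<in> surf C"
  shows "surf (insert p C) = (surf C - {p}) \<union> range (Exc p)"
proof -
  have ex: "Exc p d \<notin> C" for d using assms treeD[of C "Exc p d" p] by (auto simp: surf_def)
  have "q \<in> range (Exc p)" if "q \<in> surf (insert p C)" "q \<notin> surf C" for q
  proof (cases q)
    case (Base a) with that show ?thesis by (auto simp: surf_def)
  next
    case (Exc s d)
    with that assms show ?thesis unfolding surf_def using treeD[OF assms(1), of s] by auto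
  qed
  moreover have "range (Exc p) \<subseteq> surf (insert p C)"
    using assms ex by (auto simp: surf_def)
  moreover have "surf C - {p} \<subseteq> surf (insert p C)" by (auto simp: surf_def)
  moreover have "p \<notin> surf (insert p C)" by (auto simp: surf_def)
  ultimately show ?thesis by blast
qed

lemma surface_snoc: "surface (cs @ [p]) = (surface cs - {p}) \<union> range (Exc p)"
  by (simp add: surface_def blow_up_def)

lemma blowup_seq_props:
  "blowup_seq cs \<Longrightarrow> surface cs = surf (set cs) \<and> tree (set cs) \<and> distinct cs"
proof (induction rule: blowup_seq.induct)
  case Nil
  have "surf {} = range Base"
  proof safe
    fix q assume "q \<in> surf {}" then show "q \<in> range Base" by (cases q) (auto simp: surf_def)
  qed (auto simp: surf_def)
  then show ?case by (simp add: surface_def tree_def)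
next
  case (snoc cs p)
  then have p: "p \<in> surf (set cs)" "proj p = 0" by (auto simp: divisor_def)
  with snoc show ?case
    using surf_insert[of "set cs" p] tree_insert[of "set cs" p] by (auto simp: surface_snoc surf_def)
qed

lemma surface_eq: "blowup_seq cs \<Longrightarrow> surface cs = surf (set cs)"
  and tree_set: "blowup_seq cs \<Longrightarrow> tree (set cs)"
  and blowup_distinct: "blowup_seq cs \<Longrightarrow> distinct cs"
  using blowup_seq_props by blast+

lemma blowup_seq_snocD: "blowup_seq (cs @ [p]) \<Longrightarrow> blowup_seq cs \<and> p \<in> divisor cs"
  by (erule blowup_seq.cases) auto

lemma blowup_seq_appendD: "blowup_seq (cs @ ds) \<Longrightarrow> blowup_seq cs"
proof (induction ds rule: rev_induct)
  case (snoc p ds)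
  then show ?case using blowup_seq_snocD[of "cs @ ds" p] by simp
qed simp

lemma blowup_seq_extend:
  assumes "blowup_seq cs" "tree C" "set cs \<subseteq> C"
  obtains ds where "blowup_seq (cs @ ds)" "set (cs @ ds) = C"
proof -
  have "\<exists>ds. blowup_seq (cs @ ds) \<and> set (cs @ ds) = C"
    using assms
  proof (induction "card (C - set cs)" arbitrary: cs)
    case 0
    then have "C - set cs = {}" by (simp add: tree_def)
    with 0 show ?case by (intro exI[of _ "[]"]) auto
  next
    case (Suc n)
    then have "C - set cs \<noteq> {}" by (metis card.empty nat.distinct(1))
    \<comment> \<open>A missing centre of least depth has all its ancestors blown up
      already.\<close>
    then obtain p where p: "p \<in> C - set cs" "\<And>q. q \<in> C - set cs \<Longrightarrow> depth p \<le> depth q"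
      using ex_has_least_nat[of "\<lambda>p. p \<in> C - set cs" _ depth] by (metis ex_in_conv)
    have "ancestors p \<subseteq> set cs"
      using p Suc.prems(2) treeD depth_ancestor by (metis Diff_iff linorder_not_le subsetI)
    then have "p \<in> divisor cs"
      using p Suc.prems tree_proj surface_eq[OF Suc.prems(1)] by (auto simp: divisor_def surf_def)
    then have b: "blowup_seq (cs @ [p])" using Suc.prems(1) by (rule blowup_seq.snoc[rotated])
    have "C - set (cs @ [p]) = (C - set cs) - {p}" by auto
    then have "n = card (C - set (cs @ [p]))"
      using Suc.hyps(2) p(1) by (metis card_Diff_singleton diff_Suc_1)
    from Suc.hyps(1)[OF this b Suc.prems(2)] Suc.prems(3) p(1)
    obtain ds where "blowup_seq ((cs @ [p]) @ ds)" "set ((cs @ [p]) @ ds) = C" by auto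
    then show ?case by (intro exI[of _ "p # ds"]) auto
  qed
  then show ?thesis using that by blast
qed

lemma tree_blowup_seq: assumes "tree C" obtains cs where "blowup_seq cs" "set cs = C"
  using blowup_seq_extend[OF blowup_seq.Nil assms] by auto

text \<open>\<open>cu q\<close> and \<open>cv q\<close> are the centres of the components that are given by \<open>u = 0\<close> and \<open>v = 0\<close>
  in the chart at \<open>q\<close>.\<close>

primrec cu :: "point \<Rightarrow> point option" where
  "cu (Base a) = None"
| "cu (Exc p d) = (case d of Slope t \<Rightarrow> Some p | Vertical \<Rightarrow> cu p)"

primrec cv :: "point \<Rightarrow> point option" where
  "cv (Base a) = None"
| "cv (Exc p d) = (case d of Slope t \<Rightarrow> if t = 0 then cv p else None | Vertical \<Rightarrow> Some p)"

lemma cu_ancestor: "cu q = Some r \<Longrightarrow> r \<in> ancestors q"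
  by (induction q) (auto split: direction.splits)
lemma cv_ancestor: "cv q = Some r \<Longrightarrow> r \<in> ancestors q"
  by (induction q) (auto split: direction.splits if_splits)
lemma cu_neq_cv: "cu q = Some r \<Longrightarrow> cv q \<noteq> Some r"
  by (cases q) (auto split: direction.splits if_splits dest: cu_ancestor cv_ancestor)

section \<open>Components in the charts and as strict transforms\<close>

definition comps :: "point \<Rightarrow> point set" where
  "comps q = {r. cu q = Some r \<or> cv q = Some r}"

definition comp :: "point \<Rightarrow> point set \<Rightarrow> point set" where
  "comp r C = {q \<in> surf C. r \<in> comps q}"

lemma comps_ancestor: "r \<in> comps q \<Longrightarrow> r \<in> ancestors q"
  by (auto simp: comps_def dest: cu_ancestor cv_ancestor)
lemma comps_Exc: "p \<in> comps (Exc p d)" by (auto simp: comps_def split: direction.splits)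

lemma comps_Slope: "r \<in> comps (Exc p (Slope t)) \<longleftrightarrow> r = p \<or> (t = 0 \<and> cv p = Some r)"
  and comps_Vertical: "r \<in> comps (Exc p Vertical) \<longleftrightarrow> r = p \<or> cu p = Some r"
  by (auto simp: comps_def)

lemma chart_Slope: "chart (Exc p (Slope t)) (u, v) =
    (if u = 0 then Exc p (Slope (t + v)) else chart p (u, u * (t + v)))" by simp
lemma chart_Vertical: "chart (Exc p Vertical) (u, v) =
    (if v = 0 then Exc p (if u = 0 then Vertical else Slope (1 / u)) else chart p (u * v, v))" by simp
declare chart.simps(2) [simp del]

lemma eventually_blowV_map:
  assumes "\<forall>\<^sub>F z in nhds 0. P z" shows "\<forall>\<^sub>F z :: plane in nhds 0. P (fst z * snd z, snd z)"
  using eventually_swap[OF eventually_blow_map[OF eventually_swap[OF assms], of 0]]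
  by (simp add: mult.commute)

lemma eventually_fst_snd: "\<forall>\<^sub>F x in nhds 0. P x \<Longrightarrow> \<forall>\<^sub>F z :: plane in nhds 0. P (fst z) \<and> P (snd z)"
proof -
  assume P: "\<forall>\<^sub>F x in nhds 0. P x"
  have id: "((\<lambda>z. z) \<longlongrightarrow> (0 :: plane)) (nhds 0)" by (rule filterlim_ident)
  have lim: "((\<lambda>z. fst z) \<longlongrightarrow> 0) (nhds (0 :: plane))" "((\<lambda>z. snd z) \<longlongrightarrow> 0) (nhds (0 :: plane))"
    using tendsto_fst[OF id] tendsto_snd[OF id] by simp_all
  show ?thesis
    by (rule eventually_conj[OF eventually_compose_filterlim[OF P lim(1)] eventually_compose_filterlim[OF P lim(2)]])
qed

lemma eventually_not_in_finite:
  assumes "finite F" "(0 :: real) \<notin> F" shows "\<forall>\<^sub>F x in nhds 0. x \<notin> F"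
proof -
  have "open (- F)" using assms(1) by (simp add: finite_imp_closed open_Compl)
  from eventually_nhds_in_open[OF this, of 0] assms(2) show ?thesis by simp
qed

lemma eventually_comps_chart:
  "\<forall>\<^sub>F z in nhds 0. \<forall>r. r \<in> comps (chart q z) \<longleftrightarrow> (fst z = 0 \<and> cu q = Some r) \<or> (snd z = 0 \<and> cv q = Some r)"
proof (induction q)
  case (Base a)
  then show ?case by (simp add: comps_def)
next
  case (Exc p d)
  show ?case
  proof (cases d)
    \<comment> \<open>The component \<open>v = 0\<close> of the chart at \<open>p\<close> meets the
      exceptional line at \<open>v = - t\<close>, which for nonzero \<open>t\<close> is avoided by
      small \<open>v\<close>.\<close>
    case (Slope t)
    have "\<forall>\<^sub>F v in nhds 0. v \<notin> {- t} - {0}" by (rule eventually_not_in_finite) auto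
    from eventually_fst_snd[OF this] eventually_blow_map[OF Exc, of t] show ?thesis
    proof eventually_elim
      case (elim z)
      obtain u v where z: "z = (u, v)" by (cases z)
      show ?case
      proof (cases "u = 0")
        case True
        with elim(1) Slope z show ?thesis by (auto simp: chart_Slope comps_Slope)
      next
        case False
        with elim(2) Slope z have "r \<in> comps (chart (Exc p d) z) \<longleftrightarrow> t + v = 0 \<and> cv p = Some r" for r
          by (simp add: chart_Slope)
        with elim(1) False Slope z show ?thesis by auto
      qed
    qed
  next
    case Vertical
    from eventually_blowV_map[OF Exc] show ?thesis
    proof eventually_elim
      case (elim z)
      obtain u v where z: "z = (u, v)" by (cases z)
      show ?case
      proof (cases "v = 0")
        case True
        with Vertical z show ?thesis by (auto simp: chart_Vertical comps_Slope comps_Vertical)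
      next
        case False
        with elim Vertical z show ?thesis by (simp add: chart_Vertical)
      qed
    qed
  qed
qed

text \<open>Only finitely many points of an exceptional line are centres. The origin is excluded
  because the induction passes through \<open>p\<close>, which is itself a centre when
  \<open>Exc p d\<close> is considered.\<close>

lemma eventually_chart_surf_punctured:
  assumes C: "tree C"
  shows "ancestors q \<subseteq> C \<Longrightarrow> \<forall>\<^sub>F z in nhds 0. z \<noteq> 0 \<longrightarrow> chart q z \<in> surf C"
proof (induction q)
  case (Base a)
  have "\<forall>\<^sub>F z in nhds 0. z \<noteq> 0 \<longrightarrow> a + z \<noteq> 0"
  proof (cases "a = 0")
    case False
    have "open (- {- a})" by auto
    from eventually_nhds_in_open[OF this, of 0] False have "\<forall>\<^sub>F z in nhds 0. z \<noteq> - a" by simp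
    then show ?thesis by eventually_elim (auto simp: eq_neg_iff_add_eq_0 add.commute)
  qed simp
  then show ?case
  proof eventually_elim
    case (elim z)
    then show ?case using tree_proj[OF C, of "Base (a + z)"] by (auto simp: surf_def)
  qed
next
  case (Exc p d)
  have fin: "finite {x. Exc p (Slope (f x)) \<in> C}" if "inj f" for f
  proof -
    have "inj (\<lambda>x. Exc p (Slope (f x)))" using that by (auto simp: inj_def)
    then have "finite ((\<lambda>x. Exc p (Slope (f x))) -` C)" using C by (intro finite_vimageI) (auto simp: tree_def)
    then show ?thesis by (simp add: vimage_def)
  qed
  from Exc.prems have p: "p \<in> C" and IH: "\<forall>\<^sub>F z in nhds 0. z \<noteq> 0 \<longrightarrow> chart p z \<in> surf C" using Exc.IH by auto
  show ?case
  proof (cases d)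
    case (Slope t)
    have "\<forall>\<^sub>F v in nhds 0. v \<notin> {v. Exc p (Slope (t + v)) \<in> C} - {0}"
      by (rule eventually_not_in_finite) (use fin[of "\<lambda>v. t + v"] in \<open>auto simp: inj_def\<close>)
    from eventually_fst_snd[OF this] eventually_blow_map[OF IH, of t] show ?thesis
    proof eventually_elim
      case (elim z)
      then show ?case using Slope p C by (cases z) (auto simp: chart_Slope Exc_in_surf_iff zero_prod_def)
    qed
  next
    case Vertical
    have "\<forall>\<^sub>F u in nhds 0. u \<notin> {u. Exc p (Slope (1 / u)) \<in> C} - {0}"
      by (rule eventually_not_in_finite) (use fin[of "\<lambda>v. 1 / v"] in \<open>auto simp: inj_def divide_simps split: if_splits\<close>)
    from eventually_fst_snd[OF this] eventually_blowV_map[OF IH] show ?thesis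
    proof eventually_elim
      case (elim z)
      then show ?case using Vertical p C by (cases z) (auto simp: chart_Vertical Exc_in_surf_iff zero_prod_def)
    qed
  qed
qed

lemma eventually_chart_surf:
  assumes "tree C" "q \<in> surf C" shows "\<forall>\<^sub>F z in nhds 0. chart q z \<in> surf C"
proof -
  have "ancestors q \<subseteq> C" using assms(2) by (simp add: surf_def)
  from eventually_chart_surf_punctured[OF assms(1) this] show ?thesis
    by eventually_elim (use assms(2) in \<open>metis chart_0\<close>)
qed

lemma surf_minus_comp_open:
  assumes "blowup_seq cs" shows "surface_open cs (surf (set cs) - comp r (set cs))"
  unfolding surface_open_def surface_eq[OF assms]
proof safe
  fix q assume q: "q \<in> surf (set cs)" "q \<notin> comp r (set cs)"
  from eventually_comps_chart[of q] eventually_chart_surf[OF tree_set[OF assms] q(1)]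
  show "\<forall>\<^sub>F z in nhds 0. chart q z \<in> surf (set cs) - comp r (set cs)"
    by eventually_elim (use q in \<open>auto simp: comp_def comps_def\<close>)
qed

lemma topspace_surface: assumes "blowup_seq cs" shows "topspace (surface_topology cs) = surf (set cs)"
proof -
  have "surface_open cs (surf (set cs))"
    unfolding surface_open_def surface_eq[OF assms] using eventually_chart_surf[OF tree_set[OF assms]] by blast
  then show ?thesis unfolding topspace_def openin_surface_topology
    using surface_eq[OF assms] by (auto simp: surface_open_def)
qed

lemma comp_insert_eq:
  assumes "tree C" "p \<in> surf C" "y \<in> surf (insert p C)" "p \<notin> comps y" "r \<in> comps y"
  shows "y \<in> comp r C - {p}"
  using assms comps_Exc[of p] by (auto simp: surf_insert comp_def)

text \<open>A point that lies on the component of \<open>r\<close> and on the new exceptional curve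
  is a limit along the coordinate axis that is the component of \<open>r\<close>; the other
  direction holds because the complement of \<open>comp r\<close> is open.\<close>

lemma closure_comp:
  assumes "blowup_seq (cs @ [p])" "r \<in> set cs"
  shows "surface_topology (cs @ [p]) closure_of (comp r (set cs) - {p}) = comp r (insert p (set cs))"
proof -
  have cs: "blowup_seq cs" "p \<in> divisor cs" using blowup_seq_snocD[OF assms(1)] by auto
  note T = tree_set[OF cs(1)]
  have p: "p \<in> surf (set cs)" using cs surface_eq by (auto simp: divisor_def)
  then have rp: "r \<noteq> p" using assms(2) by (auto simp: surf_def)
  have C': "set (cs @ [p]) = insert p (set cs)" by simp
  note T' = tree_set[OF assms(1), unfolded C']
  have S': "surf (insert p (set cs)) = (surf (set cs) - {p}) \<union> range (Exc p)" by (rule surf_insert[OF T p])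
  show ?thesis
  proof (intro equalityI subsetI)
    fix x assume x: "x \<in> surface_topology (cs @ [p]) closure_of (comp r (set cs) - {p})"
    show "x \<in> comp r (insert p (set cs))"
    proof (rule ccontr)
      assume "x \<notin> comp r (insert p (set cs))"
      then have "x \<in> surf (insert p (set cs)) - comp r (insert p (set cs))"
        using x topspace_surface[OF assms(1)] by (auto simp: in_closure_of)
      then obtain y where "y \<in> comp r (set cs) - {p}" "y \<in> surf (insert p (set cs)) - comp r (insert p (set cs))"
        using x surf_minus_comp_open[OF assms(1), of r] unfolding in_closure_of openin_surface_topology C' by blast
      then show False by (auto simp: comp_def S')
    qed
  next
    fix x assume x: "x \<in> comp r (insert p (set cs))"
    show "x \<in> surface_topology (cs @ [p]) closure_of (comp r (set cs) - {p})"
      unfolding in_closure_of topspace_surface[OF assms(1)] openin_surface_topology C'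
    proof (intro conjI allI impI)
      show xs: "x \<in> surf (insert p (set cs))" using x by (auto simp: comp_def)
      fix U assume U: "x \<in> U \<and> surface_open (cs @ [p]) U"
      show "\<exists>y. y \<in> comp r (set cs) - {p} \<and> y \<in> U"
      proof (cases "p \<in> comps x")
        case False
        then show ?thesis using comp_insert_eq[OF T p xs False, of r] x U by (auto simp: comp_def)
      next
        case True
        have ev: "\<forall>\<^sub>F z in nhds 0. chart x z \<in> U \<and>
           (\<forall>r. r \<in> comps (chart x z) \<longleftrightarrow> (fst z = 0 \<and> cu x = Some r) \<or> (snd z = 0 \<and> cv x = Some r))"
          using U eventually_comps_chart[of x] unfolding surface_open_def by (intro eventually_conj) auto
        then obtain e where e: "e > 0" "\<And>u v. \<bar>u\<bar> < e \<Longrightarrow> \<bar>v\<bar> < e \<Longrightarrow> chart x (u, v) \<in> U \<and>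
           (\<forall>r. r \<in> comps (chart x (u, v)) \<longleftrightarrow> (u = 0 \<and> cu x = Some r) \<or> (v = 0 \<and> cv x = Some r))"
          unfolding eventually_square by auto
        from x have r: "cu x = Some r \<or> cv x = Some r" by (auto simp: comp_def comps_def)
        define z where "z = (if cu x = Some r then (0, e / 2) else (e / 2, 0))"
        have "chart x z \<in> U" "r \<in> comps (chart x z)" "p \<notin> comps (chart x z)"
          using e(1) e(2)[of 0 "e / 2"] e(2)[of "e / 2" 0] r rp by (auto simp: z_def)
        moreover have "U \<subseteq> surf (insert p (set cs))"
          using U surface_eq[OF assms(1)] by (auto simp: surface_open_def)
        ultimately show ?thesis using comp_insert_eq[OF T p, of "chart x z" r] by blast
      qed
    qed
  qed
qed

lemma strict_transform_comp:
  "blowup_seq (cs @ ds) \<Longrightarrow> r \<in> set cs \<Longrightarrow> strict_transform cs ds (comp r (set cs)) = comp r (set (cs @ ds))"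
proof (induction ds arbitrary: cs)
  case (Cons p ds)
  have b: "blowup_seq (cs @ [p])" using Cons.prems(1) blowup_seq_appendD[of "cs @ [p]" ds] by simp
  have "set (cs @ [p]) = insert p (set cs)" by simp
  with Cons.IH[of "cs @ [p]"] Cons.prems closure_comp[OF b Cons.prems(2)] show ?case by simp
qed simp

lemma range_Exc_comp:
  assumes "blowup_seq (cs @ [p])" shows "range (Exc p) = comp p (set (cs @ [p]))"
proof -
  have cs: "blowup_seq cs" "p \<in> divisor cs" using blowup_seq_snocD[OF assms] by auto
  then have p: "p \<in> surf (set cs)" using surface_eq by (auto simp: divisor_def)
  have "p \<notin> comps q" if "q \<in> surf (set cs)" for q
    using that p comps_ancestor by (auto simp: surf_def)
  with surf_insert[OF tree_set[OF cs(1)] p] show ?thesis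
    by (auto simp: comp_def comps_Exc)
qed

theorem components_eq:
  assumes "blowup_seq cs" shows "components cs = (\<lambda>r. comp r (set cs)) ` set cs"
proof -
  have *: "strict_transform (cs1 @ [p]) cs2 (range (Exc p)) = comp p (set cs)" if "cs = cs1 @ p # cs2" for cs1 p cs2
  proof -
    have b: "blowup_seq ((cs1 @ [p]) @ cs2)" using assms that by simp
    from strict_transform_comp[OF b, of p] range_Exc_comp[OF blowup_seq_appendD[OF b]] that
    show ?thesis by simp
  qed
  show ?thesis
  proof (intro equalityI subsetI)
    fix D assume "D \<in> components cs"
    then show "D \<in> (\<lambda>r. comp r (set cs)) ` set cs" unfolding components_def using * by auto
  next
    fix D assume "D \<in> (\<lambda>r. comp r (set cs)) ` set cs"
    then obtain p where p: "p \<in> set cs" "D = comp p (set cs)" by blast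
    then obtain cs1 cs2 where "cs = cs1 @ p # cs2" by (meson split_list)
    with * p show "D \<in> components cs" unfolding components_def by blast
  qed
qed

section \<open>Infinitesimal classes and isomorphisms\<close>

lemma analytic_fst: "analytic_germ fst" and analytic_snd: "analytic_germ snd"
proof -
  have "ev gX = fst" "ev gY = snd" by auto
  then show "analytic_germ fst" "analytic_germ snd" by (metis analytic_ev)+
qed

lemma identity_isomorphism:
  assumes "blowup_seq cs" "blowup_seq cs'" "set cs = set cs'"
  shows "seq_isomorphism cs cs' (\<lambda>q. q)"
proof -
  have s: "surface cs' = surface cs" using assms surface_eq by simp
  have "analytic_map_on (surface cs) \<Phi>" if \<Phi>: "\<And>q. q \<in> surface cs \<Longrightarrow> \<Phi> q = q" for \<Phi>
    unfolding analytic_map_on_def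
  proof
    fix q assume q: "q \<in> surface cs"
    then have "\<forall>\<^sub>F z in nhds 0. chart q z \<in> surface cs"
      using eventually_chart_surf[OF tree_set[OF assms(1)]] surface_eq[OF assms(1)] by simp
    then have "\<forall>\<^sub>F z in nhds 0. \<Phi> (chart q z) = chart (\<Phi> q) (fst z, snd z)"
      by eventually_elim (use \<Phi> q in simp)
    then show "\<exists>F G. analytic_germ F \<and> analytic_germ G \<and> F 0 = 0 \<and> G 0 = 0 \<and>
        (\<forall>\<^sub>F z in nhds 0. \<Phi> (chart q z) = chart (\<Phi> q) (F z, G z))"
      using analytic_fst analytic_snd by (intro exI[of _ fst] exI[of _ snd]) simp
  qed
  moreover have "inv_into (surface cs) (\<lambda>q. q) q = q" if "q \<in> surface cs" for q
    using that by (metis f_inv_into_f image_ident)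
  ultimately show ?thesis unfolding seq_isomorphism_def s by (auto simp: bij_betw_def)
qed

section \<open>Dependence of the classes on the centres only\<close>

lemma marked_comp: "blowup_seq cs \<Longrightarrow> r \<in> set cs \<Longrightarrow> marked_seq (cs, comp r (set cs))"
  unfolding marked_seq_def using components_eq by simp

lemma comparable_comp:
  assumes "blowup_seq cs" "blowup_seq cs'" "r \<in> set cs" "set cs \<subseteq> set cs'"
  shows "comparable (cs, comp r (set cs)) (cs', comp r (set cs'))"
proof -
  obtain ds where ds: "blowup_seq (cs @ ds)" "set (cs @ ds) = set cs'"
    using blowup_seq_extend[OF assms(1) tree_set[OF assms(2)] assms(4)] by blast
  have "refined_by (cs, comp r (set cs)) (cs', comp r (set cs'))"
    unfolding refined_by_def
    using ds identity_isomorphism[OF ds(1) assms(2) ds(2)] strict_transform_comp[OF ds(1) assms(3)]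
    by (intro exI[of _ ds] exI[of _ "\<lambda>q. q"]) simp
  then show ?thesis unfolding comparable_def using marked_comp assms by (metis subsetD)
qed

text \<open>Every sequence that blows up \<open>r\<close> refines, up to isomorphism, the shortest
  one, whose centres are \<open>r\<close> and its ancestors. Hence any two of them are linked by two
  comparisons.\<close>

lemma component_class_cong:
  assumes "blowup_seq cs" "blowup_seq cs'" "r \<in> set cs" "r \<in> set cs'"
  shows "component_class cs (comp r (set cs)) = component_class cs' (comp r (set cs'))"
proof -
  have sym: "comparable x y \<Longrightarrow> comparable y x" for x y unfolding comparable_def by blast
  have "proj r = 0" using tree_proj[OF tree_set[OF assms(1)] assms(3)] .
  then obtain ms where ms: "blowup_seq ms" "set ms = insert r (ancestors r)"
    using tree_blowup_seq[OF tree_chain] by blast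
  have sub: "set ms \<subseteq> set cs" "set ms \<subseteq> set cs'"
    using treeD[OF tree_set[OF assms(1)] assms(3)] treeD[OF tree_set[OF assms(2)] assms(4)] assms(3,4)
    by (auto simp: ms(2))
  have 1: "comparable (ms, comp r (set ms)) (cs, comp r (set cs))"
    and 2: "comparable (ms, comp r (set ms)) (cs', comp r (set cs'))"
    by (rule comparable_comp[OF ms(1) assms(1) _ sub(1)], simp add: ms(2),
        rule comparable_comp[OF ms(1) assms(2) _ sub(2)], simp add: ms(2))
  have *: "comparable\<^sup>*\<^sup>* (cs, comp r (set cs)) (cs', comp r (set cs'))"
    "comparable\<^sup>*\<^sup>* (cs', comp r (set cs')) (cs, comp r (set cs))"
    by (rule rtranclp.rtrancl_into_rtrancl[OF r_into_rtranclp[of comparable, OF sym[OF 1]] 2],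
        rule rtranclp.rtrancl_into_rtrancl[OF r_into_rtranclp[of comparable, OF sym[OF 2]] 1])
  show ?thesis unfolding component_class_def
    using rtranclp_trans[OF *(1)] rtranclp_trans[OF *(2)] by blast
qed

lemma union_class_cong:
  assumes "blowup_seq cs" "blowup_seq cs'" "P \<subseteq> set cs" "P \<subseteq> set cs'"
  shows "union_class cs ((\<lambda>r. comp r (set cs)) ` P) = union_class cs' ((\<lambda>r. comp r (set cs')) ` P)"
proof -
  have "component_class cs (comp r (set cs)) = component_class cs' (comp r (set cs'))" if "r \<in> P" for r
    using component_class_cong[OF assms(1,2)] assms(3,4) that by blast
  then show ?thesis unfolding union_class_def by simp
qed

text \<open>Isomorphisms over the plane are rigid: points that correspond to each other cannot be separated,
  hence one of them lies over the other one, and a bijection leaves only equality.\<close>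

definition bmap :: "direction \<Rightarrow> plane \<Rightarrow> plane" where
  "bmap d z = (case d of Slope t \<Rightarrow> (fst z, fst z * (t + snd z)) | Vertical \<Rightarrow> (fst z * snd z, snd z))"

definition exceptional_coord :: "direction \<Rightarrow> plane \<Rightarrow> real" where
  "exceptional_coord d z = (case d of Slope t \<Rightarrow> fst z | Vertical \<Rightarrow> snd z)"

lemma chart_Exc_Base:
  assumes "chart (Exc p d) z = Base w"
  shows "exceptional_coord d z \<noteq> 0" "chart p (bmap d z) = Base w"
  using assms by (cases z; cases d; auto simp: chart_Slope chart_Vertical exceptional_coord_def bmap_def split: if_splits)+

lemma bmap_inj: "exceptional_coord d z \<noteq> 0 \<Longrightarrow> exceptional_coord d z' \<noteq> 0 \<Longrightarrow> bmap d z = bmap d z' \<Longrightarrow> z = z'"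
  by (cases z; cases z'; cases d) (auto simp: exceptional_coord_def bmap_def)

lemma bmap_nonzero: "exceptional_coord d z \<noteq> 0 \<Longrightarrow> bmap d z \<noteq> 0"
  by (cases d) (auto simp: exceptional_coord_def bmap_def zero_prod_def)

lemma chart_inj_Base: "chart p z = Base w \<Longrightarrow> chart p z' = Base w \<Longrightarrow> z = z'"
proof (induction p arbitrary: z z')
  case (Exc p d)
  show ?case
    using chart_Exc_Base[OF Exc.prems(1)] chart_Exc_Base[OF Exc.prems(2)] Exc.IH bmap_inj by blast
qed auto

lemma chart_nonzero_Base: "chart p z = Base w \<Longrightarrow> proj p = 0 \<Longrightarrow> z \<noteq> 0 \<Longrightarrow> w \<noteq> 0"
proof (induction p arbitrary: z)
  case (Exc p d)
  show ?case
    using chart_Exc_Base[OF Exc.prems(1)] Exc.IH[of "bmap d z"] Exc.prems(2) bmap_nonzero by auto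
qed auto

lemma eventually_bmap: assumes "\<forall>\<^sub>F z in nhds 0. P z" shows "\<forall>\<^sub>F z in nhds 0. P (bmap d z)"
  using eventually_blow_map[OF assms] eventually_blowV_map[OF assms] by (cases d) (simp_all add: bmap_def)

definition small :: "real \<Rightarrow> plane \<Rightarrow> bool" where "small e z \<longleftrightarrow> \<bar>fst z\<bar> < e \<and> \<bar>snd z\<bar> < e"

lemma eventually_small: "e > 0 \<Longrightarrow> \<forall>\<^sub>F z in nhds 0. small e z"
  unfolding eventually_square small_def by auto

lemma small_bmap: assumes "e > 0" obtains e' where "e' > 0" "e' \<le> e" "\<And>z. small e' z \<Longrightarrow> small e (bmap d z)"
proof -
  obtain e' where "e' > 0" "\<forall>x y. \<bar>x\<bar> < e' \<longrightarrow> \<bar>y\<bar> < e' \<longrightarrow> small e (bmap d (x, y))"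
    using eventually_bmap[OF eventually_small[OF assms], of d] unfolding eventually_square by blast
  then show ?thesis using assms by (intro that[of "min e e'"]) (auto simp: small_def)
qed

lemma bmap_separated:
  assumes "d \<noteq> d'"
  obtains e where "e > 0" "\<And>z z'. small e z \<Longrightarrow> small e z' \<Longrightarrow> exceptional_coord d z \<noteq> 0 \<Longrightarrow>
    exceptional_coord d' z' \<noteq> 0 \<Longrightarrow> bmap d z \<noteq> bmap d' z'"
proof -
  \<comment> \<open>The two charts can agree only where the product of \<open>fst z'\<close> and
    \<open>t + snd z\<close> is 1; the bound on the coordinates keeps it smaller.\<close>
  have SV: "bmap (Slope t) z \<noteq> bmap Vertical z'"
    if s: "small (1 / (\<bar>t\<bar> + 2)) z" "small (1 / (\<bar>t\<bar> + 2)) z'" and nz: "fst z \<noteq> 0" for t z z'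
  proof
    assume "bmap (Slope t) z = bmap Vertical z'"
    then have "fst z = fst z' * snd z'" "snd z' = fst z * (t + snd z)" by (auto simp: bmap_def)
    then have "fst z * 1 = fst z * (fst z' * (t + snd z))" by (simp add: mult_ac)
    then have e1: "fst z' * (t + snd z) = 1" using nz by (metis mult_left_cancel)
    have lt: "1 / (\<bar>t\<bar> + 2) \<le> 1" by simp
    have "\<bar>snd z\<bar> < 1" using s(1) lt unfolding small_def by linarith
    then have b: "\<bar>t + snd z\<bar> \<le> \<bar>t\<bar> + 2" by linarith
    have "\<bar>fst z'\<bar> * \<bar>t + snd z\<bar> \<le> \<bar>fst z'\<bar> * (\<bar>t\<bar> + 2)" using b by (intro mult_left_mono) auto
    also have "\<dots> < 1" using s(2) unfolding small_def by (simp add: field_simps)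
    finally show False using e1 by (metis abs_mult abs_one less_irrefl)
  qed
  show ?thesis
  proof (cases d)
    case (Slope t)
    show ?thesis
    proof (cases d')
      case (Slope t')
      with \<open>d = Slope t\<close> assms have "t \<noteq> t'" by simp
      show ?thesis
      proof (rule that[of "\<bar>t - t'\<bar> / 2"])
        show "\<bar>t - t'\<bar> / 2 > 0" using \<open>t \<noteq> t'\<close> by simp
        fix z z' assume "small (\<bar>t - t'\<bar> / 2) z" "small (\<bar>t - t'\<bar> / 2) z'" "exceptional_coord d z \<noteq> 0"
        then have "t + snd z \<noteq> t' + snd z'" "fst z \<noteq> 0" using \<open>d = Slope t\<close>
          by (auto simp: small_def exceptional_coord_def abs_if split: if_splits)
        then show "bmap d z \<noteq> bmap d' z'" using \<open>d = Slope t\<close> Slope by (auto simp: bmap_def)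
      qed
    next
      case Vertical
      show ?thesis
      proof (rule that[of "1 / (\<bar>t\<bar> + 2)"])
        show "1 / (\<bar>t\<bar> + 2) > 0" by (simp add: add_nonneg_pos)
      qed (use SV[of t] Slope Vertical in \<open>auto simp: exceptional_coord_def\<close>)
    qed
  next
    case Vertical
    with assms obtain t where t: "d' = Slope t" by (cases d') auto
    show ?thesis
    proof (rule that[of "1 / (\<bar>t\<bar> + 2)"])
      show "1 / (\<bar>t\<bar> + 2) > 0" by (simp add: add_nonneg_pos)
    qed (use SV[of t] t Vertical in \<open>force simp: exceptional_coord_def\<close>)
  qed
qed

definition over :: "point \<Rightarrow> point \<Rightarrow> bool" where "over q p \<longleftrightarrow> q = p \<or> p \<in> ancestors q"

text \<open>Only points of the form \<open>Base w\<close> are compared, since they have the same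
  meaning in all surfaces.\<close>

definition separated :: "point \<Rightarrow> point \<Rightarrow> bool" where
  "separated q q' \<longleftrightarrow> (\<exists>e>0. \<forall>z z' w. small e z \<longrightarrow> small e z' \<longrightarrow> \<not> (chart q z = Base w \<and> chart q' z' = Base w))"

lemma separated_sym: "separated q q' \<Longrightarrow> separated q' q" unfolding separated_def by blast

lemma separated_Exc: assumes "separated p q'" shows "separated (Exc p d) q'"
proof -
  obtain e where e: "e > 0" "\<And>z z' w. small e z \<Longrightarrow> small e z' \<Longrightarrow> \<not> (chart p z = Base w \<and> chart q' z' = Base w)"
    using assms unfolding separated_def by blast
  obtain e' where e': "e' > 0" "e' \<le> e" "\<And>z. small e' z \<Longrightarrow> small e (bmap d z)"
    using small_bmap[OF e(1)] by blast
  have "small e z" if "small e' z" for z using that e'(2) by (auto simp: small_def)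
  then show ?thesis unfolding separated_def using e e' chart_Exc_Base by metis
qed

lemma separated_over: "separated p q' \<Longrightarrow> over q p \<Longrightarrow> separated q q'"
  by (induction q) (auto simp: over_def separated_Exc)

lemma separated_directions: assumes "d \<noteq> d'" shows "separated (Exc p d) (Exc p d')"
proof -
  obtain e where e: "e > 0" "\<And>z z'. small e z \<Longrightarrow> small e z' \<Longrightarrow> exceptional_coord d z \<noteq> 0 \<Longrightarrow>
    exceptional_coord d' z' \<noteq> 0 \<Longrightarrow> bmap d z \<noteq> bmap d' z'" using bmap_separated[OF assms] by blast
  show ?thesis unfolding separated_def
    by (intro exI[of _ e] conjI e(1)) (metis chart_Exc_Base chart_inj_Base e(2))
qed

lemma over_Exc: "p \<in> ancestors q \<Longrightarrow> \<exists>d. over q (Exc p d)"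
  by (induction q) (auto simp: over_def)

lemma over_trans: "over a b \<Longrightarrow> over b c \<Longrightarrow> over a c"
  unfolding over_def using ancestors_trans by blast

text \<open>The paths to the two points part at a common ancestor in different directions, and small
  neighbourhoods of different directions have no common image off the exceptional curve.\<close>

lemma incomparable_separated:
  assumes "proj q = proj q'" "\<not> over q q'" "\<not> over q' q" shows "separated q q'"
  using assms
proof (induction q)
  case (Base a)
  then have "over q' (Base a)" by (induction q') (auto simp: over_def)
  with Base show ?case by simp
next
  case (Exc p d)
  show ?case
  proof (cases "over q' p")
    case False
    moreover have "\<not> over p q'" using Exc.prems by (auto simp: over_def)
    ultimately show ?thesis using Exc separated_Exc by auto
  next
    case True
    with Exc.prems have "p \<in> ancestors q'" by (auto simp: over_def)
    then obtain d' where d': "over q' (Exc p d')" using over_Exc by blast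
    then have "d \<noteq> d'" using Exc.prems by auto
    then show ?thesis using d' separated_directions separated_over separated_sym by blast
  qed
qed

lemma chart_generic_Base:
  assumes "e > 0" obtains z w where "small e z" "z \<noteq> 0" "chart q z = Base w"
proof -
  have "\<forall>\<^sub>F z in nhds 0. fst z \<noteq> 0 \<longrightarrow> snd z \<noteq> 0 \<longrightarrow> comps (chart q z) = {}"
    using eventually_comps_chart[of q] by eventually_elim auto
  then obtain r where r: "r > 0" "\<And>x y. \<bar>x\<bar> < r \<Longrightarrow> \<bar>y\<bar> < r \<Longrightarrow> x \<noteq> 0 \<Longrightarrow> y \<noteq> 0 \<Longrightarrow> comps (chart q (x, y)) = {}"
    unfolding eventually_square by auto
  define x where "x = min e r / 2"
  have x: "x > 0" "x < e" "x < r" using assms r(1) by (auto simp: x_def)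
  then have "comps (chart q (x, x)) = {}" using r(2) by simp
  then obtain w where "chart q (x, x) = Base w" using comps_Exc by (cases "chart q (x, x)") auto
  then show ?thesis using x by (intro that[of "(x, x)"]) (auto simp: small_def zero_prod_def)
qed

lemma infinitely_many_slopes:
  assumes "finite C" "finite T" obtains t where "Exc p (Slope t) \<notin> C" "t \<notin> T"
proof -
  have "finite ((\<lambda>t. Exc p (Slope t)) -` C)" by (rule finite_vimageI[OF assms(1)]) (auto simp: inj_def)
  then have "finite ((\<lambda>t. Exc p (Slope t)) -` C \<union> T)" using assms(2) by simp
  then obtain t :: real where "t \<notin> (\<lambda>t. Exc p (Slope t)) -` C \<union> T"
    using ex_new_if_finite[OF infinite_UNIV_char_0] by blast
  then show ?thesis using that by auto
qed

lemma analytic_small: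
  assumes "analytic_germ F" "F 0 = 0" "e > 0" shows "\<forall>\<^sub>F z in nhds 0. \<bar>F z\<bar> < e"
proof -
  obtain A where A: "same_germ F (ev A)" using assms(1) unfolding analytic_germ_iff by blast
  have "ev A 0 = 0" using same_germ_val[OF A] assms(2) by (simp add: ev_at_0)
  then have "(ev A \<longlongrightarrow> 0) (at 0)" using isCont_0[of A] unfolding isCont_def by simp
  then have "(ev A \<longlongrightarrow> 0) (nhds 0)" using tendsto_at_iff_tendsto_nhds[of "ev A" 0] \<open>ev A 0 = 0\<close> by simp
  then have "\<forall>\<^sub>F z in nhds 0. dist (ev A z) 0 < e" using assms(3) by (rule tendstoD)
  with A[unfolded same_germ_def] show ?thesis by eventually_elim simp
qed

theorem isomorphic_set_eq:
  assumes "blowup_seq cs" "blowup_seq cs'" "seq_isomorphism cs cs' \<Phi>"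
  shows "set cs = set cs'"
proof -
  define C where "C = set cs"
  define C' where "C' = set cs'"
  note T = tree_set[OF assms(1), folded C_def] and T' = tree_set[OF assms(2), folded C'_def]
  have bij: "bij_betw \<Phi> (surf C) (surf C')" and pr: "\<And>q. q \<in> surf C \<Longrightarrow> proj (\<Phi> q) = proj q"
    and an: "analytic_map_on (surf C) \<Phi>"
    using assms(3) surface_eq[OF assms(1)] surface_eq[OF assms(2)] unfolding seq_isomorphism_def C_def C'_def by auto
  have surj: "\<exists>x\<in>surf C. \<Phi> x = y" if "y \<in> surf C'" for y
    using bij that unfolding bij_betw_def by (metis imageE)
  have im: "\<Phi> q \<in> surf C'" if "q \<in> surf C" for q using bij that by (auto simp: bij_betw_def)
  \<comment> \<open>Off the divisor an isomorphism over the plane is the identity.\<close>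
  have base: "\<Phi> (Base w) = Base w" if "Base w \<in> surf C" "w \<noteq> 0" for w
  proof -
    have "proj (\<Phi> (Base w)) = w" using pr[OF that(1)] by simp
    moreover have "ancestors (\<Phi> (Base w)) \<subseteq> C'" using im[OF that(1)] by (simp add: surf_def)
    ultimately show ?thesis using that(2) tree_proj[OF T'] by (cases "\<Phi> (Base w)") auto
  qed
  have cmp: "over q (\<Phi> q) \<or> over (\<Phi> q) q" if q: "q \<in> surf C" "proj q = 0" for q
  proof (rule ccontr)
    assume "\<not> ?thesis"
    then have "separated q (\<Phi> q)" using incomparable_separated pr[OF q(1)] by auto
    then obtain e where e: "e > 0" "\<And>z z' w. small e z \<Longrightarrow> small e z' \<Longrightarrow> \<not> (chart q z = Base w \<and> chart (\<Phi> q) z' = Base w)"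
      unfolding separated_def by blast
    obtain F G where FG: "analytic_germ F" "analytic_germ G" "F 0 = 0" "G 0 = 0"
      "\<forall>\<^sub>F z in nhds 0. \<Phi> (chart q z) = chart (\<Phi> q) (F z, G z)"
      using an q(1) unfolding analytic_map_on_def by blast
    have "\<forall>\<^sub>F z in nhds 0. small e (F z, G z) \<and> \<Phi> (chart q z) = chart (\<Phi> q) (F z, G z) \<and> chart q z \<in> surf C"
      using analytic_small[OF FG(1,3) e(1)] analytic_small[OF FG(2,4) e(1)] FG(5) eventually_chart_surf[OF T q(1)]
      by eventually_elim (simp add: small_def)
    then obtain r where r: "r > 0" "\<And>z. small r z \<Longrightarrow> small e (F z, G z) \<and> \<Phi> (chart q z) = chart (\<Phi> q) (F z, G z) \<and> chart q z \<in> surf C"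
      unfolding eventually_square by (force simp: small_def)
    have "min e r > 0" using e(1) r(1) by simp
    then obtain z w where z: "small (min e r) z" "z \<noteq> 0" "chart q z = Base w" by (rule chart_generic_Base)
    then have sm: "small e z" "small r z" by (auto simp: small_def)
    have "w \<noteq> 0" using chart_nonzero_Base[OF z(3) q(2) z(2)] .
    then have "\<Phi> (Base w) = Base w" using base[of w] r(2)[OF sm(2)] unfolding z(3) by blast
    then have "chart (\<Phi> q) (F z, G z) = Base w" using r(2)[OF sm(2)] z(3) by metis
    then show False using e(2) sm(1) r(2)[OF sm(2)] z(3) by blast
  qed
  have no: "a \<notin> ancestors b" if "a \<in> surf K" "b \<in> surf K" for a b K using that by (auto simp: surf_def)
  have id: "\<Phi> q = q" if q: "q \<in> surf C" "proj q = 0" for q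
  proof (rule ccontr)
    assume neq: "\<Phi> q \<noteq> q"
    define q' where "q' = \<Phi> q"
    have q': "q' \<in> surf C'" "proj q' = 0" using im pr q by (auto simp: q'_def)
    consider "q' \<in> ancestors q" | "q \<in> ancestors q'" using cmp[OF q] neq by (auto simp: over_def q'_def)
    then show False
    proof cases
      \<comment> \<open>If the image \<open>q'\<close> lies strictly below \<open>q\<close>, then
        all points of the exceptional curve of \<open>q'\<close> that are not centres are mapped to
        \<open>q'\<close>, against injectivity.\<close>
      case 1
      then have q'C: "q' \<in> C" using q(1) by (auto simp: surf_def)
      have *: "\<Phi> (Exc q' (Slope t)) = q'" if "Exc q' (Slope t) \<notin> C" for t
      proof -
        have e: "Exc q' (Slope t) \<in> surf C" using that q'C T by (simp add: Exc_in_surf_iff)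
        from cmp[OF this] q'(2) have "over (Exc q' (Slope t)) (\<Phi> (Exc q' (Slope t))) \<or> over (\<Phi> (Exc q' (Slope t))) (Exc q' (Slope t))" by simp
        then show ?thesis
        proof
          assume "over (\<Phi> (Exc q' (Slope t))) (Exc q' (Slope t))"
          then have "q' \<in> ancestors (\<Phi> (Exc q' (Slope t)))" unfolding over_def
            using ancestors_trans[of q' "Exc q' (Slope t)"] by auto
          then show ?thesis using no[OF q'(1) im[OF e]] by simp
        next
          assume "over (Exc q' (Slope t)) (\<Phi> (Exc q' (Slope t)))"
          then show ?thesis using no[OF im[OF e] q'(1)] no[OF q'(1) im[OF e]] by (auto simp: over_def)
        qed
      qed
      have "finite C" using T by (simp add: tree_def)
      then obtain t where t: "Exc q' (Slope t) \<notin> C" using infinitely_many_slopes[of C "{}" q'] by blast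
      obtain t' where t': "Exc q' (Slope t') \<notin> C" "t' \<notin> {t}" using infinitely_many_slopes[OF \<open>finite C\<close>, of "{t}" q'] by blast
      have "Exc q' (Slope t) \<in> surf C" "Exc q' (Slope t') \<in> surf C" using t t'(1) q'C T by (simp_all add: Exc_in_surf_iff)
      then show False using *[OF t] *[OF t'(1)] t'(2) bij unfolding bij_betw_def inj_on_def by fastforce
    next
      \<comment> \<open>If the image lies strictly above \<open>q\<close>, then every point of the
        exceptional curve of \<open>q\<close> that is not a centre would have to be the image of
        \<open>q\<close>.\<close>
      case 2
      then have qC: "q \<in> C'" using q'(1) by (auto simp: surf_def)
      have *: "\<Phi> q = Exc q (Slope t)" if "Exc q (Slope t) \<notin> C'" for t
      proof -
        have e: "Exc q (Slope t) \<in> surf C'" using that qC T' by (simp add: Exc_in_surf_iff)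
        then obtain x where x: "x \<in> surf C" "\<Phi> x = Exc q (Slope t)" using surj by blast
        then have "proj x = 0" using pr[OF x(1)] q(2) by simp
        from cmp[OF x(1) this] have "x = q"
          unfolding x(2) using no[OF q(1) x(1)] no[OF x(1) q(1)] ancestors_trans[of q "Exc q (Slope t)" x]
          by (auto simp: over_def)
        then show ?thesis using x(2) by simp
      qed
      have "finite C'" using T' by (simp add: tree_def)
      then obtain t where t: "Exc q (Slope t) \<notin> C'" using infinitely_many_slopes[of C' "{}" q] by blast
      obtain t' where t': "Exc q (Slope t') \<notin> C'" "t' \<notin> {t}" using infinitely_many_slopes[OF \<open>finite C'\<close>, of "{t}" q] by blast
      show False using *[OF t] *[OF t'(1)] t'(2) by simp
    qed
  qed
  have eq: "q \<in> surf C \<longleftrightarrow> q \<in> surf C'" if "proj q = 0" for q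
  proof
    assume "q \<in> surf C" then show "q \<in> surf C'" using im id that by metis
  next
    assume "q \<in> surf C'"
    then obtain x where "x \<in> surf C" "\<Phi> x = q" using surj by blast
    then show "q \<in> surf C" using id pr that by metis
  qed
  have mem: "p \<in> K \<longleftrightarrow> (\<exists>t. Exc p (Slope t) \<in> surf K)" if "tree K" for p K
  proof -
    have "finite K" using that by (simp add: tree_def)
    then obtain t where "Exc p (Slope t) \<notin> K" using infinitely_many_slopes[of K "{}" p] by blast
    then show ?thesis using that by (auto simp: Exc_in_surf_iff)
  qed
  have "C = C'"
  proof (intro set_eqI iffI)
    fix p assume "p \<in> C"
    then show "p \<in> C'" using mem[OF T] mem[OF T'] eq[of "Exc p (Slope t)" for t] tree_proj[OF T] by auto
  next
    fix p assume "p \<in> C'"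
    then show "p \<in> C" using mem[OF T] mem[OF T'] eq[of "Exc p (Slope t)" for t] tree_proj[OF T'] by auto
  qed
  then show ?thesis by (simp add: C_def C'_def)
qed

section \<open>Pullbacks of germs\<close>

definition bl :: "direction \<Rightarrow> germ \<Rightarrow> germ" where
  "bl d A = (case d of Slope t \<Rightarrow> blow t A | Vertical \<Rightarrow> blowV A)"

lemma bl_simps [simp]: "bl d (A + B) = bl d A + bl d B" "bl d (A * B) = bl d A * bl d B"
  "bl d (- A) = - bl d A" "bl d (A - B) = bl d A - bl d B" "bl d (cst c) = cst c" "bl d 0 = 0" "bl d 1 = 1"
  "bl d (A ^ n) = bl d A ^ n" "val (bl d A) = val A" "bl d A = 0 \<longleftrightarrow> A = 0"
  by (cases d; simp add: bl_def)+

primrec pull :: "point \<Rightarrow> germ \<Rightarrow> germ" where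
  "pull (Base a) A = A"
| "pull (Exc p d) A = bl d (pull p A)"

lemma pull_simps [simp]: "pull q (A + B) = pull q A + pull q B" "pull q (A * B) = pull q A * pull q B"
  "pull q (- A) = - pull q A" "pull q (A - B) = pull q A - pull q B" "pull q (cst c) = cst c" "pull q 0 = 0" "pull q 1 = 1"
  "pull q (A ^ n) = pull q A ^ n" "val (pull q A) = val A" "pull q A = 0 \<longleftrightarrow> A = 0"
  by (induction q) simp_all

lemma proj_chart_bmap: "proj (chart (Exc p d) z) = proj (chart p (bmap d z))"
proof -
  have "chart p (0, 0) = p" using chart_0[of p] by (simp add: zero_prod_def)
  then show ?thesis by (cases z; cases d) (auto simp: chart_Slope chart_Vertical bmap_def)
qed

lemma ev_bl: "\<forall>\<^sub>F z in nhds 0. ev (bl d A) z = ev A (bmap d z)"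
  using ev_blow[of _ A] ev_blowV[of A] by (cases d) (simp_all add: bl_def bmap_def)

lemma ev_pull: "proj q = 0 \<Longrightarrow> \<forall>\<^sub>F z in nhds 0. ev (pull q A) z = ev A (proj (chart q z))"
proof (induction q)
  case (Exc p d)
  from Exc have "\<forall>\<^sub>F z in nhds 0. ev (pull p A) z = ev A (proj (chart p z))" by simp
  from eventually_bmap[OF this, of d] ev_bl[of d "pull p A"] show ?case
    by eventually_elim (simp only: pull.simps proj_chart_bmap)
qed simp

lemma xord_blowV: "xord (blowV A) = xord A"
proof (cases "A = 0")
  case False
  then obtain B where B: "A = gX ^ xord A * B" "ax B \<noteq> 0" by (rule xord_decomp)
  then have nz: "B \<noteq> 0" by auto
  have y: "xord gY = 0" by (simp add: xord_eq_0_iff)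
  have "blowV A = gX ^ xord A * (gY ^ xord A * blowV B)"
    by (subst B(1)) (simp add: power_mult_distrib mult_ac)
  moreover have "xord (blowV B) = 0" using B(2) by (simp add: xord_eq_0_iff ax_blowV)
  ultimately show ?thesis using nz by (simp add: xord_mult xord_power y)
qed simp

definition yord :: "germ \<Rightarrow> nat" where "yord A = xord (sw A)"

text \<open>The blow-up at \<open>r\<close> gives the exceptional line the multiplicity at
  \<open>r\<close>; the further charts in which this component remains \<open>u = 0\<close> are the
  vertical ones, and they preserve the order in \<open>u\<close>.\<close>

lemma xord_pull: "cu q = Some r \<Longrightarrow> xord (pull q A) = ord (pull r A)"
  by (induction q) (auto simp: bl_def xord_blow_ord xord_blowV split: direction.splits)

lemma yord_pull: "cv q = Some r \<Longrightarrow> yord (pull q A) = ord (pull r A)"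
proof (induction q)
  case (Exc p d)
  have "xord (sw (blow 0 B)) = xord (sw B)" for B using xord_blowV[of "sw B"] by (simp add: blowV_def)
  moreover have "xord (sw (blowV B)) = ord B" for B by (simp add: blowV_def ord_def[symmetric])
  ultimately show ?case using Exc
    by (auto simp: bl_def yord_def split: direction.splits if_splits)
qed simp

definition ecoord :: "direction \<Rightarrow> germ" where
  "ecoord d = (case d of Slope t \<Rightarrow> gX | Vertical \<Rightarrow> gY)"

lemma val_ecoord [simp]: "val (ecoord d) = 0" by (cases d) (auto simp: ecoord_def)

text \<open>The differential of \<open>a\<close> at the origin, applied to a vector in the direction
  \<open>d\<close>.\<close>

definition lin :: "direction \<Rightarrow> germ \<Rightarrow> real" where
  "lin d a = (case d of Slope t \<Rightarrow> cf a 1 0 + t * cf a 0 1 | Vertical \<Rightarrow> cf a 0 1)"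

lemma cf_gX_mult: "cf (gX * A) i j = (if i = 0 then 0 else cf A (i - 1) j)"
  unfolding cf_def times_germ.rep_eq gX.rep_eq by simp

lemma hpoly_1: "hpoly a 1 = [:cf a 1 0, cf a 0 1:]"
  by (rule poly_eqI) (auto simp: coeff_hpoly coeff_pCons le_Suc_eq split: nat.split)

text \<open>The last clause keeps the derivative along the exceptional line. With it the next pair
  can be shown to have a nonzero Jacobian again.\<close>

lemma bl_first_order:
  assumes "val a = 0"
  obtains a' where "bl d a = ecoord d * a'" "val a' = lin d a"
    "case d of Slope t \<Rightarrow> cf a' 0 1 = cf a 0 1 | Vertical \<Rightarrow> cf a' 1 0 = cf a 1 0"
proof -
  have S: "\<exists>a'. blow t a = gX * a' \<and> val a' = cf a 1 0 + t * cf a 0 1 \<and> cf a' 0 1 = cf a 0 1"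
    if "val a = 0" for a t
  proof -
    have "ax (blow t a) = 0"
      by (rule fps_ext) (use that in \<open>simp add: ax_nth cf_blow hpoly_def val_def monom_0\<close>)
    then obtain a' where a': "blow t a = gX * a'" unfolding gX_dvd_iff[symmetric] by (auto elim: dvdE)
    have "cf a' 0 j = coeff (pcompose (hpoly a 1) [:t, 1:]) j" for j
      using cf_gX_mult[of a' 1 j] cf_blow[of t a 1 j] unfolding a' by simp
    then show ?thesis using a' unfolding hpoly_1 by (intro exI[of _ a']) (simp add: val_def pcompose_pCons)
  qed
  show ?thesis
  proof (cases d)
    case (Slope t)
    then show ?thesis using S[OF assms, of t] that by (auto simp: bl_def ecoord_def lin_def)
  next
    case Vertical
    have "val (sw a) = 0" using assms by simp
    from S[OF this, of 0] obtain a' where a': "blow 0 (sw a) = gX * a'" "val a' = cf a 0 1" "cf a' 0 1 = cf a 1 0" by auto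
    have "blowV a = gY * sw a'" unfolding blowV_def a'(1) by simp
    then show ?thesis using a'(2,3) Vertical by (intro that[of "sw a'"]) (auto simp: bl_def ecoord_def lin_def)
  qed
qed

section \<open>Functions with prescribed exponents along the components\<close>

definition jac :: "germ \<Rightarrow> germ \<Rightarrow> real" where
  "jac a b = cf a 1 0 * cf b 0 1 - cf a 0 1 * cf b 1 0"

lemma cf10: "cf A 1 0 = val (dX A)" and cf01: "cf A 0 1 = val (dY A)"
  by (simp_all add: val_def cf_dX cf_dY)

lemma lin_parallel: "lin d a * lin d' b - lin d b * lin d' a = 0 \<Longrightarrow> jac a b \<noteq> 0 \<Longrightarrow> d = d'"
proof (cases d; cases d')
  fix t t' assume "lin d a * lin d' b - lin d b * lin d' a = 0" "jac a b \<noteq> 0" "d = Slope t" "d' = Slope t'"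
  moreover from this have "(t' - t) * jac a b = 0" by (simp add: lin_def jac_def algebra_simps)
  ultimately show ?thesis by simp
qed (auto simp: lin_def jac_def algebra_simps)

lemma lin_nonzero: "jac a b \<noteq> 0 \<Longrightarrow> lin d a \<noteq> 0 \<or> lin d b \<noteq> 0"
proof (cases d)
  case (Slope t)
  assume j: "jac a b \<noteq> 0"
  show ?thesis
  proof (rule ccontr)
    assume "\<not> ?thesis"
    then have "cf a 1 0 = - t * cf a 0 1" "cf b 1 0 = - t * cf b 0 1" using Slope by (auto simp: lin_def)
    then show False using j by (simp add: jac_def)
  qed
qed (auto simp: lin_def jac_def)

text \<open>\<open>a = \<alpha> / \<delta>\<close> and \<open>b = \<beta> / \<delta>\<close> are local coordinates at \<open>p\<close>, and they have no common zero at the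
  points that do not lie under \<open>p\<close> (it suffices to look at the points where the path to \<open>p\<close> is left). With
  \<open>a, b\<close> rotated so that the direction of the next point \<open>p'\<close> is \<open>b = 0\<close>, the pair for \<open>p'\<close> is
  \<open>a + b\<^sup>2 / (a\<^sup>2 + b\<^sup>2)\<close> and \<open>a b / (a\<^sup>2 + b\<^sup>2)\<close>.\<close>

definition local_coordinates :: "point \<Rightarrow> germ \<Rightarrow> germ \<Rightarrow> germ \<Rightarrow> bool" where
  "local_coordinates p \<alpha> \<beta> \<delta> \<longleftrightarrow>
    (\<forall>\<^sub>F z in nhds 0. z \<noteq> 0 \<longrightarrow> ev \<delta> z \<noteq> 0 \<and> (ev \<alpha> z \<noteq> 0 \<or> ev \<beta> z \<noteq> 0)) \<and>
    (\<exists>a b. pull p \<alpha> = pull p \<delta> * a \<and> pull p \<beta> = pull p \<delta> * b \<and> val a = 0 \<and> val b = 0 \<and> jac a b \<noteq> 0) \<and>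
    (\<forall>s\<in>ancestors p. \<forall>d. \<not> over p (Exc s d) \<longrightarrow>
      (\<exists>a b. pull (Exc s d) \<alpha> = pull (Exc s d) \<delta> * a \<and> pull (Exc s d) \<beta> = pull (Exc s d) \<delta> * b \<and> (val a \<noteq> 0 \<or> val b \<noteq> 0)))"

text \<open>The passage to the next pair with cleared denominators: \<open>D\<close> stands for the
  pullback of the common denominator, \<open>E\<close> for the exceptional coordinate or, away from
  the current point, for 1, and \<open>N'\<close> inverts the sum of squares.\<close>

lemma next_coordinates:
  fixes D E a b :: germ
  assumes N: "(a * a + b * b) * N' = 1"
  shows "(D * (E * a)) * ((D * (E * a)) * (D * (E * a)) + (D * (E * b)) * (D * (E * b))) + (D * (E * b)) * (D * (E * b)) * D
      = (D * ((D * (E * a)) * (D * (E * a)) + (D * (E * b)) * (D * (E * b)))) * (E * a + b * b * N')"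
    "(D * (E * a)) * (D * (E * b)) * D
      = (D * ((D * (E * a)) * (D * (E * a)) + (D * (E * b)) * (D * (E * b)))) * (a * b * N')"
proof -
  let ?Z = "D * D * D * E * E"
  have "(D * ((D * (E * a)) * (D * (E * a)) + (D * (E * b)) * (D * (E * b)))) * (E * a + b * b * N')
     = ?Z * ((a * a + b * b) * E * a + b * b * ((a * a + b * b) * N'))" by (simp add: algebra_simps)
  also have "\<dots> = (D * (E * a)) * ((D * (E * a)) * (D * (E * a)) + (D * (E * b)) * (D * (E * b))) + (D * (E * b)) * (D * (E * b)) * D"
    unfolding N by (simp add: algebra_simps)
  finally show "(D * (E * a)) * ((D * (E * a)) * (D * (E * a)) + (D * (E * b)) * (D * (E * b))) + (D * (E * b)) * (D * (E * b)) * D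
      = (D * ((D * (E * a)) * (D * (E * a)) + (D * (E * b)) * (D * (E * b)))) * (E * a + b * b * N')" by (rule sym)
  have "(D * ((D * (E * a)) * (D * (E * a)) + (D * (E * b)) * (D * (E * b)))) * (a * b * N')
     = ?Z * (a * b * ((a * a + b * b) * N'))" by (simp add: algebra_simps)
  also have "\<dots> = (D * (E * a)) * (D * (E * b)) * D" unfolding N by (simp add: algebra_simps)
  finally show "(D * (E * a)) * (D * (E * b)) * D
      = (D * ((D * (E * a)) * (D * (E * a)) + (D * (E * b)) * (D * (E * b)))) * (a * b * N')" by (rule sym)
qed

lemma sum_squares_unit:
  assumes "val a \<noteq> 0 \<or> val b \<noteq> 0" obtains N' where "(a * a + b * b) * N' = 1" "val N' \<noteq> 0"
proof -
  have "val (a * a + b * b) \<noteq> 0" using assms by (simp add: sum_squares_eq_zero_iff)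
  then show ?thesis using unit_inverse that by blast
qed

lemma rotate_no_common_zero:
  fixes A0 B0 x y :: real
  assumes "A0 \<noteq> 0 \<or> B0 \<noteq> 0" "x \<noteq> 0 \<or> y \<noteq> 0" shows "A0 * x + B0 * y \<noteq> 0 \<or> - B0 * x + A0 * y \<noteq> 0"
proof (rule ccontr)
  assume "\<not> ?thesis"
  then have *: "A0 * x + B0 * y = 0" "- B0 * x + A0 * y = 0" by auto
  have "(A0 * A0 + B0 * B0) * x = A0 * (A0 * x + B0 * y) - B0 * (- B0 * x + A0 * y)"
    "(A0 * A0 + B0 * B0) * y = B0 * (A0 * x + B0 * y) + A0 * (- B0 * x + A0 * y)" by (simp_all add: algebra_simps)
  then have "(A0 * A0 + B0 * B0) * x = 0" "(A0 * A0 + B0 * B0) * y = 0" unfolding * by simp_all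
  moreover have "A0 * A0 + B0 * B0 \<noteq> 0" using assms(1) by (simp add: sum_squares_eq_zero_iff)
  ultimately show False using assms(2) by auto
qed

lemma local_coordinates_exist: "\<exists>\<alpha> \<beta> \<delta>. local_coordinates p \<alpha> \<beta> \<delta>"
proof (induction p)
  case (Base c)
  have "\<forall>\<^sub>F z :: plane in nhds 0. z \<noteq> 0 \<longrightarrow> fst z \<noteq> 0 \<or> snd z \<noteq> 0" by (simp add: prod_eq_iff)
  moreover have "jac gX gY \<noteq> 0" by (simp add: jac_def cf_gX cf_gY)
  ultimately have "local_coordinates (Base c) gX gY 1"
    unfolding local_coordinates_def by (auto intro!: exI[of _ gX] exI[of _ gY])
  then show ?case by blast
next
  case (Exc r d0)
  then obtain \<alpha> \<beta> \<delta> where L: "local_coordinates r \<alpha> \<beta> \<delta>" by blast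
  then obtain a b where ab: "pull r \<alpha> = pull r \<delta> * a" "pull r \<beta> = pull r \<delta> * b" "val a = 0" "val b = 0" "jac a b \<noteq> 0"
    unfolding local_coordinates_def by blast
  \<comment> \<open>The pair is rotated, up to scaling, by the values of the differentials on
    \<open>d0\<close>: the differential of the second member then vanishes on \<open>d0\<close>, and
    no common zero is created.\<close>
  define A0 B0 where "A0 = lin d0 a" and "B0 = lin d0 b"
  have AB0: "A0 \<noteq> 0 \<or> B0 \<noteq> 0" unfolding A0_def B0_def by (rule lin_nonzero[OF ab(5)])
  define \<alpha>' \<beta>' where "\<alpha>' = cst A0 * \<alpha> + cst B0 * \<beta>" and "\<beta>' = cst (- B0) * \<alpha> + cst A0 * \<beta>"
  define \<alpha>p \<beta>p \<delta>p where "\<alpha>p = \<alpha>' * (\<alpha>' * \<alpha>' + \<beta>' * \<beta>') + \<beta>' * \<beta>' * \<delta>" and "\<beta>p = \<alpha>' * \<beta>' * \<delta>"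
    and "\<delta>p = \<delta> * (\<alpha>' * \<alpha>' + \<beta>' * \<beta>')"
  have dir: "\<exists>a1 b1 N. pull (Exc r d) \<alpha>p = pull (Exc r d) \<delta>p * (ecoord d * a1 + b1 * b1 * N) \<and>
      pull (Exc r d) \<beta>p = pull (Exc r d) \<delta>p * (a1 * b1 * N) \<and> val N \<noteq> 0 \<and>
      (d \<noteq> d0 \<longrightarrow> val b1 \<noteq> 0) \<and> (d = d0 \<longrightarrow> val b1 = 0 \<and> val a1 \<noteq> 0 \<and>
        (case d of Slope t \<Rightarrow> cf b1 0 1 \<noteq> 0 | Vertical \<Rightarrow> cf b1 1 0 \<noteq> 0))" for d
  proof -
    define a' b' where "a' = cst A0 * a + cst B0 * b" and "b' = cst (- B0) * a + cst A0 * b"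
    have v: "val a' = 0" "val b' = 0" using ab by (auto simp: a'_def b'_def)
    have pr: "pull r \<alpha>' = pull r \<delta> * a'" "pull r \<beta>' = pull r \<delta> * b'"
      using ab by (simp_all add: \<alpha>'_def \<beta>'_def a'_def b'_def algebra_simps)
    obtain a1 where a1: "bl d a' = ecoord d * a1" "val a1 = lin d a'"
      "case d of Slope t \<Rightarrow> cf a1 0 1 = cf a' 0 1 | Vertical \<Rightarrow> cf a1 1 0 = cf a' 1 0"
      using v(1) by (rule bl_first_order)
    obtain b1 where b1: "bl d b' = ecoord d * b1" "val b1 = lin d b'"
      "case d of Slope t \<Rightarrow> cf b1 0 1 = cf b' 0 1 | Vertical \<Rightarrow> cf b1 1 0 = cf b' 1 0"
      using v(2) by (rule bl_first_order)
    have cfc: "cf (cst c * A) i j = c * cf A i j" for c A i j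
      unfolding cf_def times_germ.rep_eq cst.rep_eq by (simp add: fps_const_mult_apply_left)
    have jac': "jac a' b' = (A0 * A0 + B0 * B0) * jac a b"
      unfolding jac_def a'_def b'_def cf_simps cfc by (simp add: algebra_simps)
    have j': "jac a' b' \<noteq> 0" unfolding jac' using AB0 ab(5) by (simp add: sum_squares_eq_zero_iff)
    have la: "lin d a' = A0 * lin d a + B0 * lin d b" and lb: "lin d b' = - B0 * lin d a + A0 * lin d b"
      unfolding lin_def a'_def b'_def cf_simps cfc by (cases d; simp add: algebra_simps)+
    have "val a1 \<noteq> 0 \<or> val b1 \<noteq> 0" unfolding a1(2) b1(2) by (rule lin_nonzero[OF j'])
    then obtain N where N: "(a1 * a1 + b1 * b1) * N = 1" "val N \<noteq> 0" by (rule sum_squares_unit)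
    have pa: "pull (Exc r d) \<alpha>' = bl d (pull r \<delta>) * (ecoord d * a1)" "pull (Exc r d) \<beta>' = bl d (pull r \<delta>) * (ecoord d * b1)"
      "pull (Exc r d) \<delta> = bl d (pull r \<delta>)"
      by (simp_all add: pr a1 b1)
    show ?thesis
    proof (rule exI[of _ a1], rule exI[of _ b1], rule exI[of _ N], intro conjI impI)
      show "pull (Exc r d) \<alpha>p = pull (Exc r d) \<delta>p * (ecoord d * a1 + b1 * b1 * N)"
        "pull (Exc r d) \<beta>p = pull (Exc r d) \<delta>p * (a1 * b1 * N)"
        unfolding \<alpha>p_def \<beta>p_def \<delta>p_def pull_simps(1,2) pa by (rule next_coordinates[OF N(1)])+
      show "val N \<noteq> 0" by (rule N(2))
      show "val b1 \<noteq> 0" if "d \<noteq> d0"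
      proof
        assume "val b1 = 0"
        then have "lin d0 a * lin d b - lin d0 b * lin d a = 0" unfolding b1(2) lb A0_def B0_def by simp
        with lin_parallel[OF this ab(5)] that show False by simp
      qed
      assume d: "d = d0"
      have z: "val b1 = 0" unfolding b1(2) lb unfolding d A0_def B0_def by simp
      then show "val b1 = 0" .
      show "val a1 \<noteq> 0" using \<open>val a1 \<noteq> 0 \<or> val b1 \<noteq> 0\<close> z by simp
      show "case d of Slope t \<Rightarrow> cf b1 0 1 \<noteq> 0 | Vertical \<Rightarrow> cf b1 1 0 \<noteq> 0"
      proof (cases d)
        case (Slope t)
        have "cf b' 0 1 \<noteq> 0"
        proof
          assume "cf b' 0 1 = 0"
          moreover from this z b1(2) Slope have "cf b' 1 0 = 0" by (simp add: lin_def)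
          ultimately show False using j' by (simp add: jac_def)
        qed
        then show ?thesis using b1(3) Slope by simp
      next
        case Vertical
        then have "cf b' 0 1 = 0" using z b1(2) by (simp add: lin_def)
        then show ?thesis using b1(3) Vertical j' by (auto simp: jac_def)
      qed
    qed
  qed
  have "local_coordinates (Exc r d0) \<alpha>p \<beta>p \<delta>p"
    unfolding local_coordinates_def
  proof (intro conjI ballI allI impI)
    have "\<forall>\<^sub>F z in nhds 0. z \<noteq> 0 \<longrightarrow> ev \<delta> z \<noteq> 0 \<and> (ev \<alpha> z \<noteq> 0 \<or> ev \<beta> z \<noteq> 0)"
      using L unfolding local_coordinates_def by blast
    then show "\<forall>\<^sub>F z in nhds 0. z \<noteq> 0 \<longrightarrow> ev \<delta>p z \<noteq> 0 \<and> (ev \<alpha>p z \<noteq> 0 \<or> ev \<beta>p z \<noteq> 0)"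
      using ev_add[of "cst A0 * \<alpha>" "cst B0 * \<beta>"] ev_mult[of "cst A0" \<alpha>] ev_mult[of "cst B0" \<beta>]
        ev_add[of "cst (- B0) * \<alpha>" "cst A0 * \<beta>"] ev_mult[of "cst (- B0)" \<alpha>] ev_mult[of "cst A0" \<beta>]
        ev_add[of "\<alpha>' * (\<alpha>' * \<alpha>' + \<beta>' * \<beta>')" "\<beta>' * \<beta>' * \<delta>"] ev_mult[of "\<alpha>'" "\<alpha>' * \<alpha>' + \<beta>' * \<beta>'"]
        ev_add[of "\<alpha>' * \<alpha>'" "\<beta>' * \<beta>'"] ev_mult[of \<alpha>' \<alpha>'] ev_mult[of \<beta>' \<beta>'] ev_mult[of "\<beta>' * \<beta>'" \<delta>]
        ev_mult[of "\<alpha>' * \<beta>'" \<delta>] ev_mult[of \<alpha>' \<beta>'] ev_mult[of \<delta> "\<alpha>' * \<alpha>' + \<beta>' * \<beta>'"]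
    proof eventually_elim
      case (elim z)
      have r: "ev \<alpha>' z = A0 * ev \<alpha> z + B0 * ev \<beta> z" "ev \<beta>' z = - B0 * ev \<alpha> z + A0 * ev \<beta> z"
        unfolding \<alpha>'_def \<beta>'_def using elim by simp_all
      show ?case
      proof
        assume z: "z \<noteq> 0"
        then have nz: "ev \<delta> z \<noteq> 0" "ev \<alpha>' z \<noteq> 0 \<or> ev \<beta>' z \<noteq> 0"
          using elim(1) rotate_no_common_zero[OF AB0, of "ev \<alpha> z" "ev \<beta> z"] r by auto
        have s: "ev \<alpha>' z * ev \<alpha>' z + ev \<beta>' z * ev \<beta>' z \<noteq> 0"
          using nz(2) by (simp add: sum_squares_eq_zero_iff)
        have e: "ev \<delta>p z = ev \<delta> z * (ev \<alpha>' z * ev \<alpha>' z + ev \<beta>' z * ev \<beta>' z)"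
          "ev \<alpha>p z = ev \<alpha>' z * (ev \<alpha>' z * ev \<alpha>' z + ev \<beta>' z * ev \<beta>' z) + ev \<beta>' z * ev \<beta>' z * ev \<delta> z"
          "ev \<beta>p z = ev \<alpha>' z * ev \<beta>' z * ev \<delta> z"
          unfolding \<alpha>p_def \<beta>p_def \<delta>p_def using elim by simp_all
        \<comment> \<open>If one of the rotated values is 0, \<open>\<alpha>p\<close> reduces to a
          single nonzero term; if both are nonzero, so is \<open>\<beta>p\<close>.\<close>
        show "ev \<delta>p z \<noteq> 0 \<and> (ev \<alpha>p z \<noteq> 0 \<or> ev \<beta>p z \<noteq> 0)"
          using nz s unfolding e by (cases "ev \<alpha>' z = 0"; cases "ev \<beta>' z = 0") auto
      qed
    qed
  next
    obtain a1 b1 N where *: "pull (Exc r d0) \<alpha>p = pull (Exc r d0) \<delta>p * (ecoord d0 * a1 + b1 * b1 * N)"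
      "pull (Exc r d0) \<beta>p = pull (Exc r d0) \<delta>p * (a1 * b1 * N)" "val N \<noteq> 0" "val b1 = 0" "val a1 \<noteq> 0"
      "case d0 of Slope t \<Rightarrow> cf b1 0 1 \<noteq> 0 | Vertical \<Rightarrow> cf b1 1 0 \<noteq> 0"
      using dir[of d0] by blast
    have "jac (ecoord d0 * a1 + b1 * b1 * N) (a1 * b1 * N) \<noteq> 0"
      using *(3-6) unfolding jac_def cf10 cf01 by (cases d0) (simp_all add: ecoord_def)
    then show "\<exists>a b. pull (Exc r d0) \<alpha>p = pull (Exc r d0) \<delta>p * a \<and> pull (Exc r d0) \<beta>p = pull (Exc r d0) \<delta>p * b \<and>
        val a = 0 \<and> val b = 0 \<and> jac a b \<noteq> 0"
      using * by - (rule exI[of _ "ecoord d0 * a1 + b1 * b1 * N"], rule exI[of _ "a1 * b1 * N"], simp)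
  next
    fix s d assume s: "s \<in> ancestors (Exc r d0)" and nov: "\<not> over (Exc r d0) (Exc s d)"
    show "\<exists>a b. pull (Exc s d) \<alpha>p = pull (Exc s d) \<delta>p * a \<and> pull (Exc s d) \<beta>p = pull (Exc s d) \<delta>p * b \<and> (val a \<noteq> 0 \<or> val b \<noteq> 0)"
    proof (cases "s = r")
      case True
      with nov have "d \<noteq> d0" by (auto simp: over_def)
      with dir[of d] obtain a1 b1 N where *: "pull (Exc r d) \<alpha>p = pull (Exc r d) \<delta>p * (ecoord d * a1 + b1 * b1 * N)"
        "pull (Exc r d) \<beta>p = pull (Exc r d) \<delta>p * (a1 * b1 * N)" "val N \<noteq> 0" "val b1 \<noteq> 0" by blast
      then show ?thesis unfolding True
        by - (rule exI[of _ "ecoord d * a1 + b1 * b1 * N"], rule exI[of _ "a1 * b1 * N"], simp)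
    next
      case False
      with s have "s \<in> ancestors r" by simp
      moreover have "\<not> over r (Exc s d)" using nov by (auto simp: over_def)
      ultimately obtain a b where ab: "pull (Exc s d) \<alpha> = pull (Exc s d) \<delta> * a" "pull (Exc s d) \<beta> = pull (Exc s d) \<delta> * b"
        "val a \<noteq> 0 \<or> val b \<noteq> 0" using L unfolding local_coordinates_def by blast
      define a' b' where "a' = cst A0 * a + cst B0 * b" and "b' = cst (- B0) * a + cst A0 * b"
      have pr: "pull (Exc s d) \<alpha>' = pull (Exc s d) \<delta> * (1 * a')" "pull (Exc s d) \<beta>' = pull (Exc s d) \<delta> * (1 * b')"
        unfolding \<alpha>'_def \<beta>'_def a'_def b'_def pull_simps ab(1,2) by (simp_all add: algebra_simps)
      have v: "val a' \<noteq> 0 \<or> val b' \<noteq> 0"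
        using rotate_no_common_zero[OF AB0 ab(3)] by (simp add: a'_def b'_def)
      then obtain N where N: "(a' * a' + b' * b') * N = 1" "val N \<noteq> 0" by (rule sum_squares_unit)
      show ?thesis
      proof (rule exI[of _ "1 * a' + b' * b' * N"], rule exI[of _ "a' * b' * N"], intro conjI)
        show "pull (Exc s d) \<alpha>p = pull (Exc s d) \<delta>p * (1 * a' + b' * b' * N)"
          "pull (Exc s d) \<beta>p = pull (Exc s d) \<delta>p * (a' * b' * N)"
          unfolding \<alpha>p_def \<beta>p_def \<delta>p_def pull_simps(1,2) pr by (rule next_coordinates[OF N(1)])+
        show "val (1 * a' + b' * b' * N) \<noteq> 0 \<or> val (a' * b' * N) \<noteq> 0"
          using v N(2) by (cases "val a' = 0"; cases "val b' = 0") auto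
      qed
    qed
  qed
  then show ?case by blast
qed

text \<open>The multiplicity of the component of \<open>r\<close> in the total transform of the
  exceptional curve of \<open>p\<close>: at any centre other than \<open>p\<close> it is the sum of
  the multiplicities of the components through this centre.\<close>

function eps :: "point \<Rightarrow> point \<Rightarrow> nat" where
  "eps p r = (if r = p then 1 else
    (case cu r of None \<Rightarrow> 0 | Some s \<Rightarrow> eps p s) + (case cv r of None \<Rightarrow> 0 | Some s \<Rightarrow> eps p s))"
  by auto
termination
  by (relation "Wellfounded.measure (\<lambda>(p, r). depth r)") (auto dest!: cu_ancestor cv_ancestor depth_ancestor)

declare eps.simps [simp del]

definition oeps :: "point \<Rightarrow> point option \<Rightarrow> nat" where
  "oeps p x = (case x of None \<Rightarrow> 0 | Some s \<Rightarrow> eps p s)"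

lemma oeps_simps [simp]: "oeps p None = 0" "oeps p (Some s) = eps p s" by (simp_all add: oeps_def)
lemma eps_self [simp]: "eps p p = 1" by (subst eps.simps) simp
lemma eps_step: "r \<noteq> p \<Longrightarrow> eps p r = oeps p (cu r) + oeps p (cv r)" by (subst eps.simps) (simp add: oeps_def)

lemma eps_zero: "\<not> over r p \<Longrightarrow> eps p r = 0"
proof (induction "depth r" arbitrary: r rule: less_induct)
  case less
  have "eps p s = 0" if "s \<in> ancestors r" for s
    using less.hyps[of s] less.prems depth_ancestor[OF that] that ancestors_trans[of p s r] by (auto simp: over_def)
  then have "oeps p (cu r) = 0" "oeps p (cv r) = 0"
    by (cases "cu r"; cases "cv r"; simp add: cu_ancestor cv_ancestor)+
  then show ?case using less.prems by (subst eps_step) (auto simp: over_def)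
qed

text \<open>The quotient is \<open>a ^ 2 + b ^ 2\<close> for local coordinates \<open>a\<close>,
  \<open>b\<close> at \<open>p\<close>. On the exceptional curve of \<open>p\<close> it is the
  square of the exceptional coordinate times a unit, because a real sum of squares vanishes only if
  both terms do; from there on the exponents propagate as in \<open>eps\<close>. At the points that
  branch off the path to \<open>p\<close> it is a unit.\<close>

theorem prescribed_exponents:
  assumes "proj p = 0"
  obtains A D where "\<forall>\<^sub>F z in nhds 0. z \<noteq> 0 \<longrightarrow> ev A z \<noteq> 0 \<and> ev D z \<noteq> 0" "D \<noteq> 0"
    "\<And>q. proj q = 0 \<Longrightarrow> \<not> over p q \<Longrightarrow>
      \<exists>U. val U \<noteq> 0 \<and> pull q A = pull q D * (gX ^ (2 * oeps p (cu q)) * gY ^ (2 * oeps p (cv q)) * U)"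
proof -
  obtain \<alpha> \<beta> \<delta> where L: "local_coordinates p \<alpha> \<beta> \<delta>" using local_coordinates_exist by blast
  define A D where "A = \<alpha> * \<alpha> + \<beta> * \<beta>" and "D = \<delta> * \<delta>"
  have 1: "\<forall>\<^sub>F z in nhds 0. z \<noteq> 0 \<longrightarrow> ev A z \<noteq> 0 \<and> ev D z \<noteq> 0"
  proof -
    from L have "\<forall>\<^sub>F z in nhds 0. z \<noteq> 0 \<longrightarrow> ev \<delta> z \<noteq> 0 \<and> (ev \<alpha> z \<noteq> 0 \<or> ev \<beta> z \<noteq> 0)"
      unfolding local_coordinates_def by blast
    then show ?thesis unfolding A_def D_def
      using ev_add[of "\<alpha> * \<alpha>" "\<beta> * \<beta>"] ev_mult[of \<alpha> \<alpha>] ev_mult[of \<beta> \<beta>] ev_mult[of \<delta> \<delta>]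
      by eventually_elim (auto simp: sum_squares_eq_zero_iff)
  qed
  have D0: "D \<noteq> 0"
  proof
    assume "D = 0"
    have "\<forall>\<^sub>F z :: plane in nhds 0. z = 0" by (rule eventually_mono[OF 1]) (use \<open>D = 0\<close> in auto)
    then obtain r :: real where "r > 0" "\<And>x y. \<bar>x\<bar> < r \<Longrightarrow> \<bar>y\<bar> < r \<Longrightarrow> (x, y) = 0"
      unfolding eventually_square by blast
    from this(1) this(2)[of "r / 2" 0] show False by (simp add: zero_prod_def)
  qed
  have unit: "\<exists>U. val U \<noteq> 0 \<and> pull q A = pull q D * U"
    if "pull q \<alpha> = pull q \<delta> * a" "pull q \<beta> = pull q \<delta> * b" "val a \<noteq> 0 \<or> val b \<noteq> 0" for q a b
    using that by (intro exI[of _ "a * a + b * b"]) (auto simp: A_def D_def algebra_simps sum_squares_eq_zero_iff)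
  have 2: "\<exists>U. val U \<noteq> 0 \<and> pull q A = pull q D * (gX ^ (2 * oeps p (cu q)) * gY ^ (2 * oeps p (cv q)) * U)"
    if "proj q = 0" "\<not> over p q" for q
    using that
  proof (induction q)
    case (Base c)
    have "over p (Base c)" using Base assms by (induction p) (auto simp: over_def)
    with Base show ?case by simp
  next
    case (Exc s d)
    consider "\<not> over p s" | "s = p" | "s \<in> ancestors p" by (auto simp: over_def)
    then show ?case
    proof cases
      case 1
      with Exc obtain U where U: "val U \<noteq> 0" "pull s A = pull s D * (gX ^ (2 * oeps p (cu s)) * gY ^ (2 * oeps p (cv s)) * U)" by auto
      have e: "eps p s = oeps p (cu s) + oeps p (cv s)" using 1 by (intro eps_step) (auto simp: over_def)
      show ?thesis
      proof (cases d)
        case (Slope t)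
        show ?thesis
        proof (cases "t = 0")
          case True
          with Slope U show ?thesis
            by (intro exI[of _ "blow 0 U"]) (simp add: bl_def e power_mult_distrib power_add mult_ac)
        next
          case False
          with Slope U show ?thesis
            by (intro exI[of _ "(cst t + gY) ^ (2 * oeps p (cv s)) * blow t U"]) (simp add: bl_def e power_mult_distrib power_add mult_ac)
        qed
      next
        case Vertical
        with U show ?thesis
          by (intro exI[of _ "blowV U"]) (simp add: bl_def e power_mult_distrib power_add mult_ac)
      qed
    next
      case 2
      obtain a b where ab: "pull p \<alpha> = pull p \<delta> * a" "pull p \<beta> = pull p \<delta> * b" "val a = 0" "val b = 0" "jac a b \<noteq> 0"
        using L unfolding local_coordinates_def by blast
      obtain a1 where a1: "bl d a = ecoord d * a1" "val a1 = lin d a" using bl_first_order[OF ab(3), of d] by blast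
      obtain b1 where b1: "bl d b = ecoord d * b1" "val b1 = lin d b" using bl_first_order[OF ab(4), of d] by blast
      have v: "val (a1 * a1 + b1 * b1) \<noteq> 0" using lin_nonzero[OF ab(5), of d] by (simp add: a1 b1 sum_squares_eq_zero_iff)
      have "pull (Exc p d) A = pull (Exc p d) D * (ecoord d ^ 2 * (a1 * a1 + b1 * b1))"
        by (simp add: A_def D_def ab a1 b1 power2_eq_square algebra_simps)
      moreover have "oeps p (cu p) = 0" "oeps p (cv p) = 0"
      proof -
        have "\<not> over s' p" if "s' \<in> ancestors p" for s'
          using that ancestors_trans[of s' p s'] by (auto simp: over_def)
        then show "oeps p (cu p) = 0" "oeps p (cv p) = 0"
          by (cases "cu p"; cases "cv p"; simp add: eps_zero cu_ancestor cv_ancestor)+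
      qed
      ultimately show ?thesis unfolding 2 using v
        by (intro exI[of _ "a1 * a1 + b1 * b1"]) (cases d; auto simp: ecoord_def power2_eq_square)
    next
      case 3
      then obtain a b where "pull (Exc s d) \<alpha> = pull (Exc s d) \<delta> * a" "pull (Exc s d) \<beta> = pull (Exc s d) \<delta> * b" "val a \<noteq> 0 \<or> val b \<noteq> 0"
        using L Exc.prems(2) unfolding local_coordinates_def by blast
      then obtain U where U: "val U \<noteq> 0" "pull (Exc s d) A = pull (Exc s d) D * U" using unit by blast
      have z: "eps p x = 0" if "x \<in> ancestors (Exc s d)" for x
      proof (rule eps_zero)
        have "x \<in> ancestors p" using that 3 ancestors_trans[of x s p] by auto
        then show "\<not> over x p" using ancestors_trans[of x p x] by (auto simp: over_def)
      qed
      have "oeps p (cu (Exc s d)) = 0" "oeps p (cv (Exc s d)) = 0"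
        by (cases "cu (Exc s d)"; cases "cv (Exc s d)"; use z cu_ancestor cv_ancestor in \<open>simp del: cu.simps cv.simps ancestors.simps\<close>)+
      then show ?thesis using U by (intro exI[of _ U]) (simp del: cu.simps cv.simps pull.simps)
    qed
  qed
  show ?thesis by (rule that[OF 1 D0 2])
qed

section \<open>A meromorphic function with prescribed dicritical components\<close>

subsection \<open>Extending trees\<close>

text \<open>Pullback from the chart at \<open>q\<close> to the chart at a point over
  \<open>q\<close>, for germs at \<open>q\<close> that need not come from the plane.\<close>

primrec rpull :: "point \<Rightarrow> point \<Rightarrow> germ \<Rightarrow> germ" where
  "rpull q (Base a) E = E"
| "rpull q (Exc p d) E = (if Exc p d = q then E else bl d (rpull q p E))"

lemma rpull_self [simp]: "rpull q q E = E" by (cases q) auto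

lemma rpull_Exc: "over p q \<Longrightarrow> rpull q (Exc p d) E = bl d (rpull q p E)"
  by (auto simp: over_def dest: depth_ancestor)

lemma over_ExcD: "over (Exc p d) q \<Longrightarrow> Exc p d = q \<or> over p q" by (auto simp: over_def)
lemma over_refl [simp]: "over q q" by (simp add: over_def)

lemma rpull_pull: "over q' q \<Longrightarrow> rpull q q' (pull q A) = pull q' A"
  by (induction q') (auto simp: over_def)

lemma rpull_step: "over q' (Exc q d) \<Longrightarrow> rpull q q' E = rpull (Exc q d) q' (bl d E)"
proof (induction q')
  case (Exc p d')
  show ?case
  proof (cases "Exc p d' = Exc q d")
    case True
    then show ?thesis by (auto simp: over_def)
  next
    case False
    with Exc.prems have o: "over p (Exc q d)" using over_ExcD by blast
    then have "over p q" using over_trans[of p "Exc q d" q] by (simp add: over_def)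
    with False o Exc.IH show ?thesis by (simp add: rpull_Exc del: rpull.simps)
  qed
qed (simp add: over_def)

lemma rpull_simps: "val (rpull q q' E) = val E" "rpull q q' E = 0 \<longleftrightarrow> E = 0"
  by (induction q') auto

lemma rpull_equation:
  assumes "over q' q" "pull q F = pull q G * (cst c + E)"
  shows "pull q' F = pull q' G * (cst c + rpull q q' E)"
  using assms
proof (induction q')
  case (Exc p d)
  show ?case
  proof (cases "Exc p d = q")
    case False
    with Exc.prems(1) have "over p q" using over_ExcD by blast
    with Exc show ?thesis by (simp add: rpull_Exc del: rpull.simps)
  qed (use Exc in \<open>auto simp del: pull.simps\<close>)
qed (auto simp: over_def)

lemma direction_unique: assumes "over y (Exc q d)" "over y (Exc q d')" shows "d = d'"
proof -
  have "Exc q d = Exc q d' \<or> Exc q d \<in> ancestors (Exc q d') \<or> Exc q d' \<in> ancestors (Exc q d)"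
    using assms ancestors_linear unfolding over_def by blast
  then show ?thesis by (auto dest: depth_ancestor)
qed

text \<open>The part over \<open>q\<close> of a larger set of centres; \<open>Q\<close> is the
  property achieved at the leaves over \<open>q\<close>.\<close>

definition subtree :: "point \<Rightarrow> point set \<Rightarrow> (point \<Rightarrow> bool) \<Rightarrow> bool" where
  "subtree q K Q \<longleftrightarrow> finite K \<and> (\<forall>x\<in>K. over x q \<and> (\<forall>y\<in>ancestors x. over y q \<longrightarrow> y \<in> K)) \<and>
    (\<forall>q'. over q' q \<longrightarrow> q' \<notin> K \<longrightarrow> (\<forall>y\<in>ancestors q'. over y q \<longrightarrow> y \<in> K) \<longrightarrow> Q q')"

lemma finite_not_good_direction:
  assumes "E \<noteq> 0" shows "finite {d. \<not> good (cv (Exc q d) \<noteq> None) (bl d E)}"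
proof -
  have "{d. \<not> good (cv (Exc q d) \<noteq> None) (bl d E)} \<subseteq> insert Vertical (Slope ` {t. \<not> good True (blow t E)})"
  proof
    fix d assume "d \<in> {d. \<not> good (cv (Exc q d) \<noteq> None) (bl d E)}"
    then show "d \<in> insert Vertical (Slope ` {t. \<not> good True (blow t E)})"
      using good_mono by (cases d) (auto simp: bl_def)
  qed
  then show ?thesis using finite_not_good_blow[OF assms, of True] by (simp add: finite_subset)
qed

text \<open>\<open>res\<close> branches over all directions, but only the finitely many in which the
  germ is not yet good have to be followed, so the union of their subtrees is finite.\<close>

lemma resolution_subtree:
  assumes "res fv E" "E \<noteq> 0" "fv \<longleftrightarrow> cv q \<noteq> None"
  shows "\<exists>K. subtree q K (\<lambda>q'. good (cv q' \<noteq> None) (rpull q q' E))"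
  using assms
proof (induction arbitrary: q rule: res.induct)
  case (leaf fv F)
  have "subtree q {} (\<lambda>q'. good (cv q' \<noteq> None) (rpull q q' F))"
    unfolding subtree_def using leaf by (auto simp: over_def)
  then show ?case by blast
next
  case (node fv F)
  define B where "B = {d. \<not> good (cv (Exc q d) \<noteq> None) (bl d F)}"
  have fB: "finite B" unfolding B_def using node.prems(1) by (rule finite_not_good_direction)
  have "\<exists>K. subtree (Exc q d) K (\<lambda>q'. good (cv q' \<noteq> None) (rpull (Exc q d) q' (bl d F)))" for d
  proof (cases d)
    case (Slope t)
    show ?thesis using node.IH(1)[of t "Exc q d"] node.prems Slope by (simp add: bl_def)
  next
    case Vertical
    show ?thesis using node.IH(2)[of "Exc q d"] node.prems Vertical by (simp add: bl_def)
  qed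
  then obtain K where K: "\<And>d. subtree (Exc q d) (K d) (\<lambda>q'. good (cv q' \<noteq> None) (rpull (Exc q d) q' (bl d F)))"
    by metis
  define L where "L = insert q (\<Union>d\<in>B. K d)"
  have Kover: "over x (Exc q d)" if "x \<in> K d" for x d using K[of d] that unfolding subtree_def by blast
  have up: "over y (Exc q d) \<Longrightarrow> over y q" for y d using over_trans[of y "Exc q d" q] by (simp add: over_def)
  have "subtree q L (\<lambda>q'. good (cv q' \<noteq> None) (rpull q q' F))"
    unfolding subtree_def
  proof (intro conjI ballI allI impI)
    show "finite L" using fB K by (auto simp: L_def subtree_def)
    fix x assume x: "x \<in> L"
    show "over x q" using x Kover up unfolding L_def by auto
    fix y assume y: "y \<in> ancestors x" "over y q"
    show "y \<in> L"
    proof (cases "x = q")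
      case True
      with y have False unfolding over_def using depth_ancestor[of y q] depth_ancestor[of q y] by auto
      then show ?thesis ..
    next
      case False
      with x obtain d where d: "d \<in> B" "x \<in> K d" by (auto simp: L_def)
      then have ox: "over x (Exc q d)" using K unfolding subtree_def by blast
      show ?thesis
      proof (cases "y = q")
        case False
        with y(2) have "q \<in> ancestors y" by (simp add: over_def)
        then obtain d' where d': "over y (Exc q d')" using over_Exc by blast
        then have "over x (Exc q d')" using y(1) over_trans[of x y] by (simp add: over_def)
        then have "over y (Exc q d)" using d' direction_unique[OF ox] by blast
        then have "y \<in> K d" using K[of d] d(2) y(1) unfolding subtree_def by blast
        then show ?thesis using d(1) by (auto simp: L_def)
      qed (simp add: L_def)
    qed
  next
    fix q' assume q': "over q' q" "q' \<notin> L" and anc: "\<forall>y\<in>ancestors q'. over y q \<longrightarrow> y \<in> L"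
    then have "q \<in> ancestors q'" by (auto simp: over_def L_def)
    then obtain d where d: "over q' (Exc q d)" using over_Exc by blast
    have mem: "y \<in> K d \<and> d \<in> B" if y: "y \<in> L" "over y (Exc q d)" for y
    proof -
      have "y \<noteq> q" using y(2) unfolding over_def using depth_ancestor by fastforce
      then obtain d' where d': "d' \<in> B" "y \<in> K d'" using y(1) by (auto simp: L_def)
      then show ?thesis using direction_unique[OF y(2)] Kover by blast
    qed
    show "good (cv q' \<noteq> None) (rpull q q' F)"
    proof (cases "d \<in> B")
      case True
      have "q' \<notin> K d" using q'(2) True by (auto simp: L_def)
      moreover have "y \<in> K d" if "y \<in> ancestors q'" "over y (Exc q d)" for y
        using anc mem up that by blast
      ultimately show ?thesis unfolding rpull_step[OF d]
        using K[of d, unfolded subtree_def, THEN conjunct2, THEN conjunct2, rule_format, OF d] by blast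
    next
      case False
      have "q' = Exc q d"
      proof (rule ccontr)
        assume "q' \<noteq> Exc q d"
        then have "Exc q d \<in> ancestors q'" using d by (simp add: over_def)
        then have "Exc q d \<in> L" using anc up over_refl by blast
        then show False using mem[OF _ over_refl] False by blast
      qed
      then show ?thesis unfolding rpull_step[OF d] using False by (simp add: B_def)
    qed
  qed
  then show ?case by blast
qed

text \<open>Leaves of a surface never lie over each other, so the subtrees over different leaves do
  not interfere.\<close>

lemma extend_tree:
  assumes C: "tree C" and B: "finite B" "B \<subseteq> surf C" "\<And>q. q \<in> B \<Longrightarrow> proj q = 0"
    and K: "\<And>q. q \<in> B \<Longrightarrow> \<exists>K. subtree q K (Q q)"
  obtains C' where "tree C'" "C \<subseteq> C'" "\<And>x. x \<in> C' - C \<Longrightarrow> \<exists>q\<in>B. over x q"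
    "\<And>q'. q' \<in> surf C' \<Longrightarrow> (q' \<in> surf C \<and> q' \<notin> B) \<or> (\<exists>q\<in>B. over q' q \<and> Q q q')"
proof -
  obtain K where K: "\<And>q. q \<in> B \<Longrightarrow> subtree q (K q) (Q q)" using K by metis
  define C' where "C' = C \<union> (\<Union>q\<in>B. K q)"
  have surfB: "q \<notin> C" "\<And>y. y \<in> ancestors q \<Longrightarrow> y \<in> C" if "q \<in> B" for q using that B(2) by (auto simp: surf_def)
  have notC: "y \<notin> C" if "q \<in> B" "over y q" for y q
    using that surfB(1)[of q] treeD[OF C, of y q] by (auto simp: over_def)
  have uniq: "q = q2" if "q \<in> B" "q2 \<in> B" "over y q" "over y q2" for y q q2
  proof -
    have "q = q2 \<or> q \<in> ancestors q2 \<or> q2 \<in> ancestors q" using that(3,4) ancestors_linear unfolding over_def by blast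
    then show ?thesis using surfB that by blast
  qed
  show ?thesis
  proof (rule that)
    show "C \<subseteq> C'" by (auto simp: C'_def)
    show "\<exists>q\<in>B. over x q" if "x \<in> C' - C" for x using that K unfolding C'_def subtree_def by blast
    show "tree C'" unfolding tree_def
    proof (intro conjI ballI subsetI)
      show "finite C'" using C B(1) K by (auto simp: C'_def tree_def subtree_def)
      fix x assume x: "x \<in> C'"
      show "proj x = 0"
      proof (cases "x \<in> C")
        case True then show ?thesis using C tree_proj by blast
      next
        case False
        then obtain q where "q \<in> B" "over x q" using x K unfolding C'_def subtree_def by blast
        then show ?thesis using B(3) proj_ancestor unfolding over_def by metis
      qed
      fix y assume y: "y \<in> ancestors x"
      show "y \<in> C'"
      proof (cases "x \<in> C")
        case True then show ?thesis using C treeD y by (auto simp: C'_def)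
      next
        case False
        then obtain q where q: "q \<in> B" "x \<in> K q" using x by (auto simp: C'_def)
        then have ov: "over x q" using K unfolding subtree_def by blast
        show ?thesis
        proof (cases "over y q")
          case True
          then have "y \<in> K q" using K[OF q(1)] q(2) y unfolding subtree_def by blast
          then show ?thesis using q(1) by (auto simp: C'_def)
        next
          case False
          then have "y \<in> ancestors q" using ov y ancestors_linear[of y x q] by (auto simp: over_def)
          then show ?thesis using surfB(2)[OF q(1)] by (simp add: C'_def)
        qed
      qed
    qed
    fix q' assume q': "q' \<in> surf C'"
    show "(q' \<in> surf C \<and> q' \<notin> B) \<or> (\<exists>q\<in>B. over q' q \<and> Q q q')"
    proof (cases "q' \<in> surf C \<and> q' \<notin> B")
      case False
      have "\<exists>q\<in>B. over q' q"
      proof (cases "q' \<in> surf C")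
        case True
        with False show ?thesis by (intro bexI[of _ q']) auto
      next
        case False
        then obtain x where x: "x \<in> ancestors q'" "x \<notin> C" using q' by (auto simp: surf_def C'_def)
        with q' obtain q where "q \<in> B" "over x q" using K unfolding surf_def C'_def subtree_def by blast
        then show ?thesis using x over_trans[of q' x q] by (auto simp: over_def)
      qed
      then obtain q where q: "q \<in> B" "over q' q" by blast
      have "q' \<notin> K q" using q' q(1) by (auto simp: surf_def C'_def)
      moreover have "y \<in> K q" if y: "y \<in> ancestors q'" "over y q" for y
      proof -
        have "y \<in> C'" using y q' by (auto simp: surf_def)
        then obtain q2 where q2: "q2 \<in> B" "y \<in> K q2" using notC[OF q(1) y(2)] by (auto simp: C'_def)
        then have "over y q2" using K unfolding subtree_def by blast
        then show ?thesis using uniq[OF q(1) q2(1) y(2)] q2(2) by simp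
      qed
      ultimately have "Q q q'" using K[OF q(1)] q(2) unfolding subtree_def by blast
      then show ?thesis using q by blast
    qed simp
  qed
qed

lemma finite_bad_leaves:
  assumes "tree C" "Base 0 \<in> C" "\<And>s. s \<in> C \<Longrightarrow> finite {d. Exc s d \<notin> C \<and> \<not> Q (Exc s d)}"
  shows "finite {q \<in> surf C. proj q = 0 \<and> \<not> Q q}"
proof -
  have sub: "{q \<in> surf C. proj q = 0 \<and> \<not> Q q} \<subseteq> (\<Union>s\<in>C. Exc s ` {d. Exc s d \<notin> C \<and> \<not> Q (Exc s d)})"
  proof
    fix q assume q: "q \<in> {q \<in> surf C. proj q = 0 \<and> \<not> Q q}"
    then show "q \<in> (\<Union>s\<in>C. Exc s ` {d. Exc s d \<notin> C \<and> \<not> Q (Exc s d)})"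
    proof (cases q)
      case (Base a) with q assms(2) show ?thesis by (auto simp: surf_def)
    next
      case (Exc s d) with q show ?thesis by (auto simp: surf_def)
    qed
  qed
  have "finite C" using assms(1) by (simp add: tree_def)
  then have fin: "finite (\<Union>s\<in>C. Exc s ` {d. Exc s d \<notin> C \<and> \<not> Q (Exc s d)})"
    using assms(3) by (intro finite_UN_I finite_imageI) auto
  show ?thesis by (rule finite_subset[OF sub fin])
qed

lemma resolving_tree:
  assumes C: "tree C" "Base 0 \<in> C" and f: "f \<noteq> 0"
  obtains C' where "tree C'" "C \<subseteq> C'" "\<And>q. q \<in> surf C' \<Longrightarrow> proj q = 0 \<Longrightarrow> good (cv q \<noteq> None) (pull q f)"
proof -
  define B where "B = {q \<in> surf C. proj q = 0 \<and> \<not> good (cv q \<noteq> None) (pull q f)}"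
  have "finite {d. Exc s d \<notin> C \<and> \<not> good (cv (Exc s d) \<noteq> None) (pull (Exc s d) f)}" for s
    by (rule finite_subset[OF _ finite_not_good_direction[of "pull s f" s]]) (use f in auto)
  then have fB: "finite B" unfolding B_def by (intro finite_bad_leaves C)
  have K: "\<exists>K. subtree q K (\<lambda>q'. good (cv q' \<noteq> None) (rpull q q' (pull q f)))" for q
    by (rule resolution_subtree[OF resolvable]) (use f in auto)
  have B1: "B \<subseteq> surf C" and B2: "\<And>q. q \<in> B \<Longrightarrow> proj q = 0" by (auto simp: B_def)
  obtain C' where C': "tree C'" "C \<subseteq> C'" "\<And>q'. q' \<in> surf C' \<Longrightarrow> (q' \<in> surf C \<and> q' \<notin> B) \<or>
      (\<exists>q\<in>B. over q' q \<and> good (cv q' \<noteq> None) (rpull q q' (pull q f)))"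
    by (rule extend_tree[OF C(1) fB B1, where Q = "\<lambda>q q'. good (cv q' \<noteq> None) (rpull q q' (pull q f))"])
      (erule B2, rule K, blast)
  show ?thesis
  proof (rule that[OF C'(1,2)])
    fix q assume "q \<in> surf C'" "proj q = 0"
    then show "good (cv q \<noteq> None) (pull q f)"
      using C'(3)[of q] rpull_pull by (auto simp: B_def)
  qed
qed

subsection \<open>Exponents\<close>

text \<open>Ordered by depth, the matrix \<open>eps\<close> is triangular with ones on the diagonal,
  hence invertible over the integers.\<close>

lemma solve_exponents:
  assumes "finite C"
  shows "\<exists>n :: point \<Rightarrow> int. \<forall>r\<in>C. (\<Sum>p\<in>C. n p * int (eps p r)) = v r"
  using assms
proof (induction rule: finite_ranking_induct[where f = depth])
  case (insert x S)
  show ?case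
  proof (cases "x \<in> S")
    case True
    with insert show ?thesis by (simp add: insert_absorb)
  next
    case False
    from insert obtain n :: "point \<Rightarrow> int" where n: "\<And>r. r \<in> S \<Longrightarrow> (\<Sum>p\<in>S. n p * int (eps p r)) = v r" by auto
    define n' where "n' = n(x := v x - (\<Sum>p\<in>S. n p * int (eps p x)))"
    have s: "(\<Sum>p\<in>S. n' p * int (eps p r)) = (\<Sum>p\<in>S. n p * int (eps p r))" for r
      by (rule sum.cong) (use False in \<open>auto simp: n'_def\<close>)
    have "(\<Sum>p\<in>insert x S. n' p * int (eps p r)) = v r" if "r \<in> insert x S" for r
    proof (cases "r = x")
      case True
      then show ?thesis using False insert.hyps(1) s[of x] by (simp add: n'_def)
    next
      case r: False
      have "eps x r = 0"
        by (rule eps_zero) (use r that insert.hyps(2)[of r] depth_ancestor[of x r] in \<open>auto simp: over_def\<close>)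
      then show ?thesis using False insert.hyps(1) s[of r] n[of r] r that by simp
    qed
    then show ?thesis by blast
  qed
qed simp

text \<open>The hypothesis is the vanishing of the Wronskian. Leading coefficients force nonzero
  polynomials satisfying it to have the same degree as \<open>d\<close>, and subtracting the right
  multiple of \<open>d\<close> lowers the degree, which leaves only 0.\<close>

lemma proportional_polys:
  fixes n d :: "real poly"
  assumes w: "pderiv n * d = n * pderiv d" and d: "d \<noteq> 0"
  obtains c where "n = smult c d"
proof -
  have deg: "degree m = degree d" if m: "m \<noteq> 0" "pderiv m * d = m * pderiv d" for m :: "real poly"
  proof (cases "degree m = 0 \<or> degree d = 0")
    case True
    then have "pderiv m = 0 \<or> pderiv d = 0" by (simp add: pderiv_eq_0_iff)
    then have "pderiv m = 0" "pderiv d = 0" using m d by auto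
    then show ?thesis by (simp add: pderiv_eq_0_iff)
  next
    case False
    have lc: "lead_coeff (pderiv p) = real (degree p) * lead_coeff p" if "degree p \<noteq> 0" for p :: "real poly"
      using that by (simp add: degree_pderiv coeff_pderiv)
    have "lead_coeff (pderiv m) * lead_coeff d = lead_coeff m * lead_coeff (pderiv d)"
      using arg_cong[OF m(2), of lead_coeff] by (simp only: lead_coeff_mult)
    then have "real (degree m) * (lead_coeff m * lead_coeff d) = real (degree d) * (lead_coeff m * lead_coeff d)"
      using False lc[of m] lc[of d] by (simp add: mult_ac)
    then show ?thesis using m(1) d by simp
  qed
  define c where "c = (if n = 0 then 0 else lead_coeff n / lead_coeff d)"
  define m where "m = n - smult c d"
  have "m = 0"
  proof (rule ccontr)
    assume m0: "m \<noteq> 0"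
    have "pderiv m * d = m * pderiv d"
      using w unfolding m_def by (simp add: pderiv_diff pderiv_smult algebra_simps)
    then have dm: "degree m = degree d" using deg m0 by blast
    have "coeff m (degree d) = 0"
    proof (cases "n = 0")
      case False
      then show ?thesis using deg[OF False w] d by (simp add: m_def c_def)
    qed (use m0 m_def c_def in simp)
    then show False using m0 dm by (metis leading_coeff_0_iff)
  qed
  then show ?thesis using that[of c] by (simp add: m_def)
qed

lemma hpoly_linear: "hpoly (A - cst c * B) n = hpoly A n - smult c (hpoly B n)"
proof -
  have "cf (cst c * B) i j = c * cf B i j" for i j
    unfolding cf_def times_germ.rep_eq cst.rep_eq by (simp add: fps_const_mult_apply_left)
  then show ?thesis by (intro poly_eqI) (simp add: coeff_hpoly)
qed

text \<open>Near \<open>q\<close> the quotient is \<open>c + E\<close>, with \<open>c\<close> its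
  value at \<open>q\<close> and \<open>E\<close> a normal crossing. Along a component of
  \<open>P\<close> the germ \<open>E\<close> must not vanish identically; this is what makes the
  foliation transversal to it.\<close>

definition leaf_form :: "point set \<Rightarrow> germ \<Rightarrow> germ \<Rightarrow> point \<Rightarrow> bool" where
  "leaf_form P F G q \<longleftrightarrow> (\<exists>c E. pull q F = pull q G * (cst c + E) \<and> val E = 0 \<and> E \<noteq> 0 \<and> good (cv q \<noteq> None) E \<and>
    (\<forall>p\<in>P. cu q = Some p \<longrightarrow> \<not> gX dvd E) \<and> (\<forall>p\<in>P. cv q = Some p \<longrightarrow> \<not> gY dvd E))"

lemma gX_dvd_xord: "A \<noteq> 0 \<Longrightarrow> gX dvd A \<longleftrightarrow> xord A > 0"
  using xord_eq_0_iff[of A] by (auto simp: gX_dvd_iff)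
lemma gY_dvd_yord: "A \<noteq> 0 \<Longrightarrow> gY dvd A \<longleftrightarrow> yord A > 0"
  using gX_dvd_xord[of "sw A"] sw_dvd_iff[of gX "sw A"] by (simp add: yord_def)

lemma yord_mult: "A \<noteq> 0 \<Longrightarrow> B \<noteq> 0 \<Longrightarrow> yord (A * B) = yord A + yord B"
  by (simp add: yord_def xord_mult)

lemma prod_monomials:
  assumes "finite C" "\<And>p. p \<in> C \<Longrightarrow> M p = gX ^ (2 * e p) * gY ^ (2 * e' p) * U p" "\<And>p. p \<in> C \<Longrightarrow> val (U p) \<noteq> 0"
  shows "\<exists>V. val V \<noteq> 0 \<and> (\<Prod>p\<in>C. M p ^ k p) = gX ^ (2 * (\<Sum>p\<in>C. k p * e p)) * gY ^ (2 * (\<Sum>p\<in>C. k p * e' p)) * V"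
  using assms
proof (induction rule: finite_induct)
  case empty
  show ?case by (intro exI[of _ 1]) simp
next
  case (insert x S)
  then obtain V where "val V \<noteq> 0" "(\<Prod>p\<in>S. M p ^ k p) = gX ^ (2 * (\<Sum>p\<in>S. k p * e p)) * gY ^ (2 * (\<Sum>p\<in>S. k p * e' p)) * V" by auto
  then show ?case using insert
    by (intro exI[of _ "U x ^ k x * V"])
      (simp add: power_mult_distrib power_mult[symmetric] power_add algebra_simps)
qed

lemma pull_prod: "finite C \<Longrightarrow> pull q (\<Prod>p\<in>C. h p) = (\<Prod>p\<in>C. pull q (h p))"
  by (induction rule: finite_induct) auto

lemma ax_unit: "val U \<noteq> 0 \<Longrightarrow> ax U \<noteq> 0" by (metis ax_nth_0 fps_zero_nth)

lemma ax_curve: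
  assumes "val U \<noteq> 0" "xonly \<psi>" "val \<psi> = 0" shows "ax ((gY - \<psi>) ^ y * U) \<noteq> 0"
  using ax_unit[OF assms(1)] xonly_ax[OF assms(2,3)] by simp

lemma xord_curve:
  assumes "val U \<noteq> 0" "xonly \<psi>" "val \<psi> = 0" shows "xord (gX ^ x * (gY - \<psi>) ^ y * U) = x"
proof -
  have nz: "(gY - \<psi>) ^ y * U \<noteq> 0" using ax_curve[OF assms, of y] by auto
  have "xord ((gY - \<psi>) ^ y * U) = 0" using ax_curve[OF assms, of y] by (simp add: xord_eq_0_iff)
  then show ?thesis using nz by (simp add: mult.assoc xord_mult xord_power)
qed

lemma yord_monomial: assumes "val U \<noteq> 0" shows "yord (gX ^ x * gY ^ y * U) = y"
  using xord_curve[of "sw U" 0 y x] assms by (simp add: yord_def mult_ac)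

lemma curve_nonzero:
  assumes "val U \<noteq> 0" "xonly \<psi>" "val \<psi> = 0" shows "gX ^ x * (gY - \<psi>) ^ y * U \<noteq> 0"
  using ax_curve[OF assms, of y] by (auto simp: mult.assoc)

text \<open>The quotient gets order \<open>2 * T r\<close> along the component of \<open>r\<close>.
  Sums of squares contribute even orders, and since \<open>f\<close> is squared, halving leaves an
  integer system for \<open>solve_exponents\<close>.\<close>

lemma prescribed_orders:
  fixes T :: "point \<Rightarrow> nat"
  assumes C: "tree C" "Base 0 \<in> C" and f: "f \<noteq> 0"
    and res: "\<And>q. q \<in> surf C \<Longrightarrow> proj q = 0 \<Longrightarrow> good (cv q \<noteq> None) (pull q f)"
  obtains A G where "\<forall>\<^sub>F z in nhds 0. z \<noteq> 0 \<longrightarrow> ev A z \<noteq> 0 \<and> ev G z \<noteq> 0" "A \<noteq> 0" "G \<noteq> 0"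
    "\<And>q. q \<in> surf C \<Longrightarrow> proj q = 0 \<Longrightarrow> \<exists>H. pull q (f * f * A) = pull q G * H \<and> H \<noteq> 0 \<and> good (cv q \<noteq> None) H \<and>
      (\<forall>r. cu q = Some r \<longrightarrow> (gX dvd H \<longleftrightarrow> T r \<noteq> 0)) \<and> (\<forall>r. cv q = Some r \<longrightarrow> (gY dvd H \<longleftrightarrow> T r \<noteq> 0))"
proof -
  have finC: "finite C" using C(1) by (simp add: tree_def)
  define PE where "PE p A D \<longleftrightarrow> (\<forall>\<^sub>F z in nhds 0. z \<noteq> 0 \<longrightarrow> ev A z \<noteq> 0 \<and> ev D z \<noteq> 0) \<and> D \<noteq> 0 \<and>
    (\<forall>q. proj q = 0 \<longrightarrow> \<not> over p q \<longrightarrow>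
      (\<exists>U. val U \<noteq> 0 \<and> pull q A = pull q D * (gX ^ (2 * oeps p (cu q)) * gY ^ (2 * oeps p (cv q)) * U)))" for p A D
  have "\<exists>A D. PE p A D" if "p \<in> C" for p
  proof (rule prescribed_exponents[OF tree_proj[OF C(1) that]])
    fix A D
    assume "\<forall>\<^sub>F z in nhds 0. z \<noteq> 0 \<longrightarrow> ev A z \<noteq> 0 \<and> ev D z \<noteq> 0" "D \<noteq> 0"
      "\<And>q. proj q = 0 \<Longrightarrow> \<not> over p q \<Longrightarrow>
        \<exists>U. val U \<noteq> 0 \<and> pull q A = pull q D * (gX ^ (2 * oeps p (cu q)) * gY ^ (2 * oeps p (cv q)) * U)"
    then have "PE p A D" unfolding PE_def by blast
    then show ?thesis by blast
  qed
  then obtain A D where AD: "\<And>p. p \<in> C \<Longrightarrow> PE p (A p) (D p)" by metis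
  obtain n :: "point \<Rightarrow> int" where n: "\<And>r. r \<in> C \<Longrightarrow> (\<Sum>p\<in>C. n p * int (eps p r)) = int (T r) - int (ord (pull r f))"
    using solve_exponents[OF finC, of "\<lambda>r. int (T r) - int (ord (pull r f))"] by blast
  \<comment> \<open>Positive and negative parts of the exponents: a negative power of
    \<open>A p / D p\<close> is a positive power of its inverse, so both products stay
    germs.\<close>
  define N M where "N p = nat (n p)" and "M p = nat (- n p)" for p
  have NM: "int (N p) - int (M p) = n p" for p by (simp add: N_def M_def)
  define AA where "AA = (\<Prod>p\<in>C. A p ^ N p) * (\<Prod>p\<in>C. D p ^ M p)"
  define G where "G = (\<Prod>p\<in>C. D p ^ N p) * (\<Prod>p\<in>C. A p ^ M p)"
  have nonvan: "\<forall>\<^sub>F z in nhds 0. z \<noteq> 0 \<longrightarrow> ev (\<Prod>p\<in>S. h p ^ k p) z \<noteq> 0"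
    if "finite S" "\<And>p. p \<in> S \<Longrightarrow> \<forall>\<^sub>F z in nhds 0. z \<noteq> 0 \<longrightarrow> ev (h p) z \<noteq> 0" for S h and k :: "point \<Rightarrow> nat"
    using that
  proof (induction rule: finite_induct)
    case (insert x S)
    have "\<forall>\<^sub>F z in nhds 0. z \<noteq> 0 \<longrightarrow> ev (h x) z \<noteq> 0" "\<forall>\<^sub>F z in nhds 0. z \<noteq> 0 \<longrightarrow> ev (\<Prod>p\<in>S. h p ^ k p) z \<noteq> 0"
      using insert by auto
    with ev_mult[of "h x ^ k x" "\<Prod>p\<in>S. h p ^ k p"] ev_power[of "h x" "k x"]
    have "\<forall>\<^sub>F z in nhds 0. z \<noteq> 0 \<longrightarrow> ev (h x ^ k x * (\<Prod>p\<in>S. h p ^ k p)) z \<noteq> 0"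
      by eventually_elim auto
    then show ?case using insert.hyps by simp
  qed simp
  have A: "\<forall>\<^sub>F z in nhds 0. z \<noteq> 0 \<longrightarrow> ev (A p) z \<noteq> 0" and D: "\<forall>\<^sub>F z in nhds 0. z \<noteq> 0 \<longrightarrow> ev (D p) z \<noteq> 0" if "p \<in> C" for p
    using AD[OF that] unfolding PE_def by (auto elim: eventually_mono)
  have nvA: "\<forall>\<^sub>F z in nhds 0. z \<noteq> 0 \<longrightarrow> ev (\<Prod>p\<in>C. A p ^ k p) z \<noteq> 0"
    and nvD: "\<forall>\<^sub>F z in nhds 0. z \<noteq> 0 \<longrightarrow> ev (\<Prod>p\<in>C. D p ^ k p) z \<noteq> 0" for k
    by (rule nonvan[OF finC A], assumption, rule nonvan[OF finC D], assumption)
  have nz: "\<forall>\<^sub>F z in nhds 0. z \<noteq> 0 \<longrightarrow> ev AA z \<noteq> 0 \<and> ev G z \<noteq> 0"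
    using nvA[of N] nvA[of M] nvD[of N] nvD[of M]
      ev_mult[of "\<Prod>p\<in>C. A p ^ N p" "\<Prod>p\<in>C. D p ^ M p"] ev_mult[of "\<Prod>p\<in>C. D p ^ N p" "\<Prod>p\<in>C. A p ^ M p"]
    unfolding AA_def G_def by eventually_elim auto
  have ne0: "B \<noteq> 0" if "\<forall>\<^sub>F z in nhds 0. z \<noteq> 0 \<longrightarrow> ev B z \<noteq> 0" for B
  proof
    assume "B = 0"
    have "\<forall>\<^sub>F z :: plane in nhds 0. z = 0" by (rule eventually_mono[OF that]) (use \<open>B = 0\<close> in auto)
    then obtain r :: real where "r > 0" "\<And>x y. \<bar>x\<bar> < r \<Longrightarrow> \<bar>y\<bar> < r \<Longrightarrow> (x, y) = 0"
      unfolding eventually_square by blast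
    from this(1) this(2)[of "r / 2" 0] show False by (simp add: zero_prod_def)
  qed
  have AA0: "AA \<noteq> 0" and G0: "G \<noteq> 0"
    by (rule ne0, rule eventually_mono[OF nz], simp)+
  show ?thesis
  proof (rule that[OF nz AA0 G0])
    fix q assume q: "q \<in> surf C" "proj q = 0"
    have nov: "\<not> over p q" if "p \<in> C" for p
      using that q(1) treeD[OF C(1) that] by (auto simp: over_def surf_def)
    define e e' where "e p = oeps p (cu q)" and "e' p = oeps p (cv q)" for p
    have "\<exists>U. val U \<noteq> 0 \<and> pull q (A p) = pull q (D p) * (gX ^ (2 * e p) * gY ^ (2 * e' p) * U)" if "p \<in> C" for p
      using AD[OF that] q(2) nov[OF that] unfolding PE_def e_def e'_def by blast
    then obtain U where U: "\<And>p. p \<in> C \<Longrightarrow> val (U p) \<noteq> 0"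
      "\<And>p. p \<in> C \<Longrightarrow> pull q (A p) = pull q (D p) * (gX ^ (2 * e p) * gY ^ (2 * e' p) * U p)" by metis
    define m where "m p = gX ^ (2 * e p) * gY ^ (2 * e' p) * U p" for p
    define W where "W = (\<Prod>p\<in>C. pull q (D p) ^ N p) * (\<Prod>p\<in>C. pull q (D p) ^ M p)"
    define a b a' b' where "a = (\<Sum>p\<in>C. N p * e p)" and "b = (\<Sum>p\<in>C. N p * e' p)"
      and "a' = (\<Sum>p\<in>C. M p * e p)" and "b' = (\<Sum>p\<in>C. M p * e' p)"
    obtain V where V: "val V \<noteq> 0" "(\<Prod>p\<in>C. m p ^ N p) = gX ^ (2 * a) * gY ^ (2 * b) * V"
      using prod_monomials[where M = m and e = e and e' = e' and U = U and k = N, OF finC m_def U(1)] unfolding a_def b_def by blast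
    obtain V' where V': "val V' \<noteq> 0" "(\<Prod>p\<in>C. m p ^ M p) = gX ^ (2 * a') * gY ^ (2 * b') * V'"
      using prod_monomials[where M = m and e = e and e' = e' and U = U and k = M, OF finC m_def U(1)] unfolding a'_def b'_def by blast
    obtain V'' where V'': "V' * V'' = 1" "val V'' \<noteq> 0" using V'(1) by (rule unit_inverse)
    have pA: "pull q (\<Prod>p\<in>C. A p ^ k p) = (\<Prod>p\<in>C. pull q (D p) ^ k p) * (\<Prod>p\<in>C. m p ^ k p)" for k
      unfolding pull_prod[OF finC] prod.distrib[symmetric]
      by (rule prod.cong) (simp_all add: U(2) m_def power_mult_distrib)
    have pAA: "pull q AA = W * (gX ^ (2 * a) * gY ^ (2 * b) * V)"
      unfolding AA_def pull_simps(2) pA V(2) by (simp add: W_def pull_prod[OF finC] mult_ac)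
    have pG: "pull q G = W * (gX ^ (2 * a') * gY ^ (2 * b') * V')"
      unfolding G_def pull_simps(2) pA V'(2) by (simp add: W_def pull_prod[OF finC] mult_ac)
    obtain i c \<psi> Uf where fq: "val Uf \<noteq> 0" "xonly \<psi>" "val \<psi> = 0" "pull q f = gX ^ i * (gY - \<psi>) ^ c * Uf"
      "\<psi> = 0 \<or> \<not> cv q \<noteq> None" using res[OF q] by (rule good_cases)
    have diff: "int (\<Sum>p\<in>C. N p * g p) - int (\<Sum>p\<in>C. M p * g p) = (\<Sum>p\<in>C. n p * int (g p))" for g
      by (simp add: sum_subtractf[symmetric] NM[symmetric] left_diff_distrib)
    have anc: "r \<in> C" if "r \<in> ancestors q" for r using q(1) that by (auto simp: surf_def)
    \<comment> \<open>Half the exponents of \<open>H\<close>: the prescribed ones where the axis is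
      a component, those of \<open>f\<close> elsewhere.\<close>
    define x where "x = (case cu q of None \<Rightarrow> i | Some r \<Rightarrow> T r)"
    define y where "y = (case cv q of None \<Rightarrow> c | Some r \<Rightarrow> T r)"
    have x: "i + a = x + a'"
    proof (cases "cu q")
      case None
      then show ?thesis by (simp add: x_def a_def a'_def e_def)
    next
      case (Some r)
      have "xord (pull q f) = i" unfolding fq(4) by (rule xord_curve[OF fq(1-3)])
      then have "i = ord (pull r f)" using xord_pull[OF Some] by simp
      moreover have "int a - int a' = int (T r) - int (ord (pull r f))"
        unfolding a_def a'_def diff using n[OF anc[OF cu_ancestor[OF Some]]] Some by (simp add: e_def)
      ultimately show ?thesis using Some by (simp add: x_def)
    qed
    have y: "(gY - \<psi>) ^ (2 * c) * gY ^ (2 * b) = (gY - \<psi>) ^ (2 * y) * gY ^ (2 * b')"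
    proof (cases "cv q")
      case None
      then show ?thesis by (simp add: y_def b_def b'_def e'_def)
    next
      case (Some r)
      with fq(5) have p0: "\<psi> = 0" by simp
      have "yord (pull q f) = c" unfolding fq(4) p0 diff_zero by (rule yord_monomial[OF fq(1)])
      then have "c = ord (pull r f)" using yord_pull[OF Some] by simp
      moreover have "int b - int b' = int (T r) - int (ord (pull r f))"
        unfolding b_def b'_def diff using n[OF anc[OF cv_ancestor[OF Some]]] Some by (simp add: e'_def)
      ultimately have "c + b = y + b'" using Some by (simp add: y_def)
      then have "2 * c + 2 * b = 2 * y + 2 * b'" by simp
      then show ?thesis unfolding p0 diff_zero power_add[symmetric] by simp
    qed
    define UU where "UU = Uf * Uf * V * V''"
    have UU: "val UU \<noteq> 0" using fq(1) V(1) V''(2) by (simp add: UU_def)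
    define H where "H = gX ^ (2 * x) * (gY - \<psi>) ^ (2 * y) * UU"
    have xx: "gX ^ (2 * i) * gX ^ (2 * a) = gX ^ (2 * x) * gX ^ (2 * a')"
      unfolding power_add[symmetric] using x by (metis add_mult_distrib2)
    have "pull q (f * f * AA) = W * Uf * Uf * V * (gX ^ (2 * i) * gX ^ (2 * a)) * ((gY - \<psi>) ^ (2 * c) * gY ^ (2 * b))"
      unfolding pull_simps(2) pAA fq(4) by (simp add: power_mult power2_eq_square power_mult_distrib mult_ac)
    also have "\<dots> = W * Uf * Uf * V * (gX ^ (2 * x) * gX ^ (2 * a')) * ((gY - \<psi>) ^ (2 * y) * gY ^ (2 * b')) * (V' * V'')"
      unfolding xx y V''(1) by simp
    also have "\<dots> = pull q G * H" unfolding pG H_def UU_def by (simp add: mult_ac)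
    finally have eq: "pull q (f * f * AA) = pull q G * H" .
    have H0: "H \<noteq> 0" unfolding H_def by (rule curve_nonzero[OF UU fq(2,3)])
    have goodH: "good (cv q \<noteq> None) H" unfolding H_def by (rule good_curveI[OF UU fq(2,3,5)])
    have gx: "gX dvd H \<longleftrightarrow> x \<noteq> 0"
      unfolding gX_dvd_xord[OF H0] by (simp add: H_def xord_curve[OF UU fq(2,3)])
    have gy: "gY dvd H \<longleftrightarrow> y \<noteq> 0" if "cv q \<noteq> None"
    proof -
      have "\<psi> = 0" using fq(5) that by simp
      then show ?thesis unfolding gY_dvd_yord[OF H0] by (simp add: H_def yord_monomial[OF UU])
    qed
    show "\<exists>H. pull q (f * f * AA) = pull q G * H \<and> H \<noteq> 0 \<and> good (cv q \<noteq> None) H \<and>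
      (\<forall>r. cu q = Some r \<longrightarrow> (gX dvd H \<longleftrightarrow> T r \<noteq> 0)) \<and> (\<forall>r. cv q = Some r \<longrightarrow> (gY dvd H \<longleftrightarrow> T r \<noteq> 0))"
      using eq H0 goodH gx gy by (intro exI[of _ H]) (auto simp: x_def y_def)
  qed
qed

text \<open>From the vertical point over \<open>p\<close> the component of \<open>p\<close> is
  followed through points of slope 0 to a leaf. The last centre on this path is not in
  \<open>C0\<close>, since over a centre in \<open>C0\<close> the point of slope 0 is blown up too.
  Thus the component of \<open>p\<close> meets one with centre outside \<open>C0\<close>.\<close>

lemma corner_leaf:
  assumes C: "tree C" and p: "p \<in> C0" "Exc p Vertical \<in> C" and sl: "\<And>r. r \<in> C0 \<Longrightarrow> Exc r (Slope 0) \<in> C"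
  obtains q s where "q \<in> surf C" "cv q = Some p" "cu q = Some s" "s \<notin> C0" "proj q = 0"
proof -
  have "\<exists>q s. q \<in> surf C \<and> cv q = Some p \<and> cu q = Some s \<and> s \<notin> C0" if "s1 \<in> C" "cv s1 = Some p" for s1
    using that
  proof (induction "Max (depth ` C) - depth s1" arbitrary: s1 rule: less_induct)
    case less
    show ?case
    proof (cases "Exc s1 (Slope 0) \<in> C")
      case True
      have "depth (Exc s1 (Slope 0)) \<le> Max (depth ` C)"
        using C True by (intro Max_ge) (auto simp: tree_def simp del: depth.simps)
      then have "Max (depth ` C) - depth (Exc s1 (Slope 0)) < Max (depth ` C) - depth s1" by simp
      from less.hyps[OF this True] less.prems show ?thesis by simp
    next
      case False
      then have "s1 \<notin> C0" using sl by blast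
      then show ?thesis using False less.prems C
        by (intro exI[of _ "Exc s1 (Slope 0)"] exI[of _ s1]) (simp add: Exc_in_surf_iff)
    qed
  qed
  from this[OF p(2)] obtain q s where "q \<in> surf C" "cv q = Some p" "cu q = Some s" "s \<notin> C0" by auto
  moreover from this have "proj q = 0"
    using proj_ancestor[OF cv_ancestor] tree_proj[OF C] C p(2) treeD[OF C p(2), of p] by force
  ultimately show ?thesis by (rule that)
qed

section \<open>Construction of the function\<close>

theorem model:
  assumes C0: "tree C0" "P \<subseteq> C0" and f: "f \<noteq> 0"
  obtains A G C where "\<forall>\<^sub>F z in nhds 0. z \<noteq> 0 \<longrightarrow> ev A z \<noteq> 0 \<and> ev G z \<noteq> 0" "A \<noteq> 0" "G \<noteq> 0"
    "tree C" "C0 \<subseteq> C" "Base 0 \<in> C"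
    "\<And>q. q \<in> surf C \<Longrightarrow> proj q = 0 \<Longrightarrow> leaf_form P (f * f * A) G q"
    "\<And>r. r \<in> C - P \<Longrightarrow> \<exists>c. f * f * A - cst c * G \<noteq> 0 \<and> ord (pull r G) < ord (pull r (f * f * A - cst c * G))"
    "\<And>q. q \<in> surf C \<Longrightarrow> proj q = 0 \<Longrightarrow> \<exists>p\<in>P. cu q = Some p \<or> cv q = Some p \<Longrightarrow>
      \<not> (\<exists>p\<in>P. \<exists>p'\<in>P. cu q = Some p \<and> cv q = Some p')"
proof -
  define C00 where "C00 = insert (Base 0) C0"
  \<comment> \<open>Both axis points over every centre are added. Then no two components with
    centres in \<open>C00\<close> meet, and \<open>corner_leaf\<close> applies to each of
    them.\<close>
  define C0' where "C0' = C00 \<union> (\<lambda>r. Exc r (Slope 0)) ` C00 \<union> (\<lambda>r. Exc r Vertical) ` C00"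
  have t00: "tree C00" unfolding C00_def by (rule tree_insert[OF C0(1)]) auto
  have t0': "tree C0'"
    using t00 treeD[OF t00] unfolding C0'_def by (auto simp: tree_def)
  have b0: "Base 0 \<in> C0'" by (auto simp: C0'_def C00_def)
  obtain C1 where C1: "tree C1" "C0' \<subseteq> C1" "\<And>q. q \<in> surf C1 \<Longrightarrow> proj q = 0 \<Longrightarrow> good (cv q \<noteq> None) (pull q f)"
    using resolving_tree[OF t0' b0 f] by blast
  have b1: "Base 0 \<in> C1" using b0 C1(2) by blast
  have ch: "Exc r (Slope 0) \<in> C1" "Exc r Vertical \<in> C1" "r \<in> C1" if "r \<in> C00" for r
    using that C1(2) by (auto simp: C0'_def)
  have P00: "P \<subseteq> C00" using C0(2) by (auto simp: C00_def)
  \<comment> \<open>Order 0 of the quotient along the prescribed components, order 2 along the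
    others.\<close>
  define T :: "point \<Rightarrow> nat" where "T r = (if r \<in> P then 0 else 1)" for r
  obtain A G where AG: "\<forall>\<^sub>F z in nhds 0. z \<noteq> 0 \<longrightarrow> ev A z \<noteq> 0 \<and> ev G z \<noteq> 0" "A \<noteq> 0" "G \<noteq> 0"
    and exH: "\<And>q. q \<in> surf C1 \<Longrightarrow> proj q = 0 \<Longrightarrow> \<exists>H. pull q (f * f * A) = pull q G * H \<and> H \<noteq> 0 \<and> good (cv q \<noteq> None) H \<and>
      (\<forall>r. cu q = Some r \<longrightarrow> (gX dvd H \<longleftrightarrow> T r \<noteq> 0)) \<and> (\<forall>r. cv q = Some r \<longrightarrow> (gY dvd H \<longleftrightarrow> T r \<noteq> 0))"
    by (rule prescribed_orders[OF C1(1) b1 f C1(3), where T = T]) (assumption, assumption, rule that)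
  define R where "R q H \<longleftrightarrow> pull q (f * f * A) = pull q G * H \<and> H \<noteq> 0 \<and> good (cv q \<noteq> None) H \<and>
      (\<forall>r. cu q = Some r \<longrightarrow> (gX dvd H \<longleftrightarrow> r \<notin> P)) \<and> (\<forall>r. cv q = Some r \<longrightarrow> (gY dvd H \<longleftrightarrow> r \<notin> P))" for q H
  have T0: "T r \<noteq> 0 \<longleftrightarrow> r \<notin> P" for r by (simp add: T_def)
  have "\<exists>H. R q H" if "q \<in> surf C1" "proj q = 0" for q
    using exH[OF that] unfolding R_def T0 .
  then obtain H where "\<And>q. q \<in> surf C1 \<Longrightarrow> proj q = 0 \<Longrightarrow> R q (H q)" by metis
  note H = this[unfolded R_def]
  define F where "F = f * f * A"
  have F0: "F \<noteq> 0" using f AG(2) by (simp add: F_def)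
  have dvd_val: "val B = 0" if "gX dvd B \<or> gY dvd B" for B using that by (auto elim!: dvdE)
  have generic: "\<exists>t. Exc p (Slope t) \<in> surf C1" if "p \<in> C1" for p
  proof -
    have "finite C1" using C1(1) by (simp add: tree_def)
    then obtain t where "Exc p (Slope t) \<notin> C1" using infinitely_many_slopes[of C1 "{}" p] by blast
    then show ?thesis using that C1(1) by (auto simp: Exc_in_surf_iff)
  qed
  \<comment> \<open>At a corner with a component outside \<open>C00\<close> the quotient has value 0
    but does not vanish along the component of \<open>p\<close>. So it is not constant there, and
    subtracting a constant never raises the order along \<open>p\<close> above that of
    \<open>G\<close>.\<close>
  have N: "F - cst c * G \<noteq> 0 \<and> ord (pull p (F - cst c * G)) \<le> ord (pull p G)" if p: "p \<in> P" for p c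
  proof -
    have p': "p \<in> C00" using p P00 by blast
    obtain q s where q: "q \<in> surf C1" "cv q = Some p" "cu q = Some s" "s \<notin> C00" "proj q = 0"
      using corner_leaf[OF C1(1) p' ch(2)[OF p'] ch(1)] by blast
    have eq: "pull q (F - cst c * G) = pull q G * (H q - cst c)"
      using H[OF q(1,5)] by (simp add: F_def algebra_simps)
    have gx: "gX dvd H q" and gy: "\<not> gY dvd H q" and H0: "H q \<noteq> 0"
      using H[OF q(1,5)] q P00 p by auto
    have v: "val (H q) = 0" using gx dvd_val by blast
    have "\<not> gY dvd H q - cst c"
    proof
      assume *: "gY dvd H q - cst c"
      then have "val (H q - cst c) = 0" using dvd_val by blast
      then have "c = 0" using v by simp
      with * gy show False by simp
    qed
    then have nz: "H q - cst c \<noteq> 0" by (metis dvd_0_right)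
    with \<open>\<not> gY dvd H q - cst c\<close> have y0: "yord (H q - cst c) = 0" using gY_dvd_yord by blast
    have "pull q (F - cst c * G) \<noteq> 0" unfolding eq using nz AG(3) by simp
    then have "F - cst c * G \<noteq> 0" by (metis pull_simps(6))
    moreover have "yord (pull q (F - cst c * G)) = yord (pull q G)"
      unfolding eq using nz AG(3) y0 by (simp add: yord_mult)
    ultimately show ?thesis unfolding yord_pull[OF q(2)] by simp
  qed
  define E where "E q = H q - cst (val (H q))" for q
  \<comment> \<open>Where the quotient has value 0 it is already good, with \<open>c = 0\<close> and
    \<open>E = H q\<close>. Bad points can therefore occur only where the value is not 0.\<close>
  define B where "B = {q \<in> surf C1. proj q = 0 \<and> \<not> (val (H q) = 0 \<or> good (cv q \<noteq> None) (E q))}"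
  have leaf: "\<exists>p\<in>P. \<exists>t. q = Exc p (Slope t) \<and> cu q = Some p \<and> cv q = None \<and> E q \<noteq> 0 \<and> \<not> gX dvd E q"
    if q: "q \<in> surf C1" "proj q = 0" and v: "val (H q) \<noteq> 0" for q
  proof -
    obtain s d where q_eq: "q = Exc s d" "s \<in> C1"
      using q b1 by (cases q) (auto simp: surf_def)
    have mem: "r \<in> P" if "cu q = Some r \<or> cv q = Some r" for r
      using H[OF q] v dvd_val that by blast
    have sP: "s \<in> P" using mem[of s] q_eq by (auto split: direction.splits)
    then have "Exc s (Slope 0) \<in> C1" "Exc s Vertical \<in> C1" using ch P00 by auto
    then obtain t where t: "d = Slope t" "t \<noteq> 0" using q q_eq by (cases d) (auto simp: surf_def)
    have cu: "cu q = Some s" using q_eq t by simp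
    have eq: "pull q (F - cst (val (H q)) * G) = pull q G * E q"
      using H[OF q] by (simp add: F_def E_def algebra_simps)
    have nz: "E q \<noteq> 0"
    proof
      assume "E q = 0"
      then have "pull q (F - cst (val (H q)) * G) = 0" unfolding eq by simp
      then have "F - cst (val (H q)) * G = 0" by (simp only: pull_simps(10))
      then show False using N[OF sP] by blast
    qed
    have "xord (pull q (F - cst (val (H q)) * G)) \<le> xord (pull q G)"
      unfolding xord_pull[OF cu] using N[OF sP] by blast
    then have "xord (E q) = 0" unfolding eq using nz AG(3) by (simp add: xord_mult)
    then have "\<not> gX dvd E q" using gX_dvd_xord[OF nz] by simp
    then show ?thesis using sP q_eq t cu nz by auto
  qed
  have finB: "finite B"
  proof -
    have "finite {d. Exc s d \<notin> C1 \<and> \<not> (proj (Exc s d) = 0 \<longrightarrow> val (H (Exc s d)) = 0 \<or> good (cv (Exc s d) \<noteq> None) (E (Exc s d)))}" (is "finite ?S")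
      if s: "s \<in> C1" for s
    proof (cases "s \<in> P")
      case False
      have "?S = {}"
      proof (rule ccontr)
        assume "?S \<noteq> {}"
        then obtain d where d: "Exc s d \<notin> C1" "proj (Exc s d) = 0" "val (H (Exc s d)) \<noteq> 0" by auto
        then have "Exc s d \<in> surf C1" using s C1(1) by (simp add: Exc_in_surf_iff)
        from leaf[OF this d(2,3)] False show False by auto
      qed
      then show ?thesis by (metis finite.emptyI)
    next
      case True
      define \<nu> where "\<nu> = ord (pull s F)"
      \<comment> \<open>On the component of \<open>s\<close> the quotient is the rational function
        \<open>a / b\<close> of the slope, which is not constant by \<open>N\<close>.\<close>
      define a b where "a = hpoly (pull s F) \<nu>" and "b = hpoly (pull s G) \<nu>"
      have GF: "ord (pull s G) = \<nu>"
      proof -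
        obtain t where t: "Exc s (Slope t) \<in> surf C1" using generic[OF s] by blast
        have pr: "proj (Exc s (Slope t)) = 0" using tree_proj[OF C1(1) s] by simp
        have "\<not> gX dvd H (Exc s (Slope t))" "H (Exc s (Slope t)) \<noteq> 0" using H[OF t pr] True by auto
        then have "xord (H (Exc s (Slope t))) = 0" using gX_dvd_xord by blast
        moreover have "pull (Exc s (Slope t)) F = pull (Exc s (Slope t)) G * H (Exc s (Slope t))"
          using H[OF t pr] unfolding F_def by blast
        ultimately have "xord (pull (Exc s (Slope t)) F) = xord (pull (Exc s (Slope t)) G)"
          using \<open>H (Exc s (Slope t)) \<noteq> 0\<close> AG(3) by (metis add.right_neutral pull_simps(10) xord_mult)
        then show ?thesis using xord_pull[of "Exc s (Slope t)" s] by (simp add: \<nu>_def)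
      qed
      have ab0: "a \<noteq> 0" "b \<noteq> 0"
        using hpoly_ord_nonzero[of "pull s F"] hpoly_ord_nonzero[of "pull s G"] F0 AG(3) GF
        by (simp_all add: a_def b_def \<nu>_def)
      have np: "a \<noteq> smult c b" for c
      proof
        assume *: "a = smult c b"
        have lower: "hpoly (pull s F) k = 0" "hpoly (pull s G) k = 0" if "k < \<nu>" for k
          using that cf_eq_0_less_ord[of _ _ "pull s F"] cf_eq_0_less_ord[of _ _ "pull s G"] GF
          unfolding hpoly_eq_0_iff \<nu>_def by auto
        define X where "X = pull s (F - cst c * G)"
        have X: "X = pull s F - cst c * pull s G" by (simp add: X_def)
        have "X \<noteq> 0" "ord X \<le> \<nu>" unfolding X_def pull_simps(10) using N[OF True, of c] GF by auto
        moreover have "hpoly X k = 0" if "k \<le> \<nu>" for k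
          unfolding X hpoly_linear using lower[of k] * that by (cases "k = \<nu>") (auto simp: a_def b_def)
        ultimately show False using hpoly_ord_nonzero by blast
      qed
      \<comment> \<open>The numerator of the derivative of \<open>a / b\<close>. Where it does not
        vanish, the quotient minus its value is, up to a unit, the equation of a smooth curve
        transversal to the component, hence good.\<close>
      define w where "w = pderiv a * b - a * pderiv b"
      have w0: "w \<noteq> 0"
        using proportional_polys[OF _ ab0(2), of a] np by (auto simp: w_def)
      have "?S \<subseteq> insert Vertical (Slope ` {t. poly w t = 0})"
      proof
        fix d assume "d \<in> ?S"
        then have d: "Exc s d \<notin> C1" "proj (Exc s d) = 0" "val (H (Exc s d)) \<noteq> 0" "\<not> good (cv (Exc s d) \<noteq> None) (E (Exc s d))" by auto
        then have sf: "Exc s d \<in> surf C1" using s C1(1) by (simp add: Exc_in_surf_iff)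
        obtain p t where t: "d = Slope t" "cv (Exc s d) = None" using leaf[OF sf d(2,3)] by auto
        define h where "h = H (Exc s d)"
        have eq: "blow t (pull s F) = blow t (pull s G) * h" using H[OF sf d(2)] t(1) by (simp add: F_def h_def bl_def)
        have v1: "cf h 0 1 = 0"
        proof (rule ccontr)
          assume nz: "cf h 0 1 \<noteq> 0"
          have "val (E (Exc s d)) = 0" "cf (E (Exc s d)) 0 1 \<noteq> 0" using nz by (simp_all add: E_def h_def cf_cst)
          then obtain e \<psi> where e: "E (Exc s d) = e * (gY - \<psi>)" "xonly \<psi>" "val \<psi> = 0" "val e \<noteq> 0" by (rule implicit_function)
          have "good False (gX ^ 0 * (gY - \<psi>) ^ 1 * e)" using e by (intro good_curveI) auto
          then show False using d(4) t(2) e(1) by (simp add: mult.commute)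
        qed
        obtain F1 where F1: "blow t (pull s F) = gX ^ \<nu> * F1" "ax F1 = fps_of_poly (pcompose a [:t, 1:])"
          using blow_decomp[of "pull s F" t] F0 unfolding \<nu>_def a_def by auto
        obtain G1 where G1: "blow t (pull s G) = gX ^ \<nu> * G1" "ax G1 = fps_of_poly (pcompose b [:t, 1:])"
          using blow_decomp[of "pull s G" t] AG(3) GF unfolding b_def by auto
        have "F1 = G1 * h" using eq unfolding F1(1) G1(1) by (simp add: mult.assoc)
        then have ax: "fps_of_poly (pcompose a [:t, 1:]) = fps_of_poly (pcompose b [:t, 1:]) * ax h"
          using F1(2) G1(2) by (metis ax_simps(6))
        have c0: "coeff (pcompose p [:t, 1:]) 0 = poly p t" for p :: "real poly"
          by (simp add: poly_0_coeff_0[symmetric] poly_pcompose)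
        have c1: "coeff (pcompose p [:t, 1:]) 1 = poly (pderiv p) t" for p :: "real poly"
        proof -
          have "coeff (pcompose p [:t, 1:]) 1 = poly (pderiv (pcompose p [:t, 1:])) 0"
            by (simp add: poly_0_coeff_0 coeff_pderiv)
          also have "\<dots> = poly (pderiv p) t" by (simp add: pderiv_pcompose pderiv_pCons poly_pcompose)
          finally show ?thesis .
        qed
        have 0: "poly a t = poly b t * val h" using arg_cong[OF ax, of "\<lambda>x. x $ 0"] by (simp add: c0)
        have "ax h $ 1 = 0" using v1 by (simp add: ax_nth)
        then have 1: "poly (pderiv a) t = poly (pderiv b) t * val h"
          using arg_cong[OF ax, of "\<lambda>x. x $ 1"] c1 by (simp add: fps_mult_nth_1)
        have "poly w t = 0" unfolding w_def by (simp add: 0 1)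
        then show "d \<in> insert Vertical (Slope ` {t. poly w t = 0})" using t(1) by auto
      qed
      then show ?thesis using poly_roots_finite[OF w0] by (simp add: finite_subset)
    qed
    from finite_bad_leaves[OF C1(1) b1 this] show ?thesis
      unfolding B_def by (rule rev_finite_subset) auto
  qed
  have Bleaf: "q \<in> surf C1" "proj q = 0" "cv q = None" "E q \<noteq> 0" "\<not> gX dvd E q" "\<exists>p\<in>P. cu q = Some p" if "q \<in> B" for q
    using that leaf[of q] by (auto simp: B_def)
  have K: "\<exists>K. subtree q K (\<lambda>q'. good (cv q' \<noteq> None) (rpull q q' (E q)))" if "q \<in> B" for q
    by (rule resolution_subtree[OF resolvable]) (use Bleaf[OF that] in auto)
  have BS: "B \<subseteq> surf C1" and BP: "\<And>q. q \<in> B \<Longrightarrow> proj q = 0" by (auto simp: B_def)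
  \<comment> \<open>A second round of blow-ups resolves the quotient minus its value at each of the
    finitely many bad points.\<close>
  obtain C where C: "tree C" "C1 \<subseteq> C" "\<And>x. x \<in> C - C1 \<Longrightarrow> \<exists>q\<in>B. over x q"
    "\<And>q'. q' \<in> surf C \<Longrightarrow> (q' \<in> surf C1 \<and> q' \<notin> B) \<or> (\<exists>q\<in>B. over q' q \<and> good (cv q' \<noteq> None) (rpull q q' (E q)))"
    by (rule extend_tree[OF C1(1) finB BS, where Q = "\<lambda>q q'. good (cv q' \<noteq> None) (rpull q q' (E q))"])
      (erule BP, erule K, blast)
  have Pover: "\<not> over p q" if "p \<in> P" "q \<in> B" for p q
  proof -
    have "p \<in> C1" using that P00 ch(3) by blast
    then show ?thesis using Bleaf(1)[OF that(2)] treeD[OF C1(1), of p q] by (auto simp: over_def surf_def)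
  qed
  \<comment> \<open>A component with centre not over \<open>q\<close> reaches a point over
    \<open>q\<close> only as a strict transform that stays a coordinate axis, so the order along it
    does not change.\<close>
  have rx: "cu q = Some p \<and> xord (rpull q q' X) = xord X" if "over q' q" "cu q' = Some p" "\<not> over p q" for q q' p X
    using that
  proof (induction q')
    case (Exc x d)
    show ?case
    proof (cases "Exc x d = q")
      case False
      with Exc.prems(1) have o: "over x q" using over_ExcD by blast
      with Exc.prems have "d = Vertical" by (cases d) auto
      then show ?thesis using Exc o by (simp add: rpull_Exc bl_def xord_blowV del: rpull.simps)
    qed (use Exc in auto)
  qed (simp add: over_def)
  have ry: "cv q = Some p" if "over q' q" "cv q' = Some p" "\<not> over p q" for q q' p
    using that
  proof (induction q')
    case (Exc x d)
    show ?case
    proof (cases "Exc x d = q")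
      case False
      with Exc.prems(1) have o: "over x q" using over_ExcD by blast
      with Exc show ?thesis by (cases d) (auto split: if_splits)
    qed (use Exc in auto)
  qed (simp add: over_def)
  have eqE: "pull q F = pull q G * (cst (val (H q)) + E q)" if "q \<in> surf C1" "proj q = 0" for q
    using H[OF that] by (simp add: F_def E_def)
  have F1: "leaf_form P F G q'" if q': "q' \<in> surf C" "proj q' = 0" for q'
    using C(4)[OF q'(1)]
  proof (elim disjE bexE conjE)
    assume q: "q' \<in> surf C1" "q' \<notin> B"
    show ?thesis
    proof (cases "val (H q') = 0")
      case True
      then show ?thesis unfolding leaf_form_def using H[OF q(1) q'(2)] eqE[OF q(1) q'(2)]
        by (intro exI[of _ 0] exI[of _ "H q'"]) (auto simp: F_def)
    next
      case False
      then have "good (cv q' \<noteq> None) (E q')" using q q'(2) by (auto simp: B_def)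
      then show ?thesis unfolding leaf_form_def using leaf[OF q(1) q'(2) False] eqE[OF q(1) q'(2)]
        by (intro exI[of _ "val (H q')"] exI[of _ "E q'"]) (auto simp: E_def)
    qed
  next
    fix q assume q: "q \<in> B" "over q' q" "good (cv q' \<noteq> None) (rpull q q' (E q))"
    have nd: "\<not> gX dvd rpull q q' (E q)" if p: "p \<in> P" "cu q' = Some p" for p
      using rx[OF q(2) p(2) Pover[OF p(1) q(1)], of "E q"] Bleaf(4,5)[OF q(1)] gX_dvd_xord
      by (metis rpull_simps(2))
    have nv: "cv q' \<noteq> Some p" if p: "p \<in> P" for p
      using ry[OF q(2) _ Pover[OF p q(1)]] Bleaf(3)[OF q(1)] by auto
    show ?thesis unfolding leaf_form_def
      using rpull_equation[OF q(2) eqE[OF Bleaf(1,2)[OF q(1)]]] q(3) nd nv Bleaf(4)[OF q(1)]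
      by (intro exI[of _ "val (H q)"] exI[of _ "rpull q q' (E q)"]) (auto simp: rpull_simps E_def)
  qed
  have F2: "\<exists>c. F - cst c * G \<noteq> 0 \<and> ord (pull r G) < ord (pull r (F - cst c * G))" if r: "r \<in> C - P" for r
  proof (cases "r \<in> C1")
    case True
    obtain t where t: "Exc r (Slope t) \<in> surf C1" using generic[OF True] by blast
    have pr: "proj (Exc r (Slope t)) = 0" using tree_proj[OF C1(1) True] by simp
    define q where "q = Exc r (Slope t)"
    have Hq: "gX dvd H q" "H q \<noteq> 0" "pull q F = pull q G * H q" "cu q = Some r"
      using H[OF t pr] r by (auto simp: F_def q_def)
    then have "xord (pull q G) < xord (pull q F)" using AG(3) gX_dvd_xord[of "H q"] by (simp add: xord_mult)
    then show ?thesis using xord_pull[OF Hq(4)] F0 by (intro exI[of _ 0]) simp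
  next
    case False
    then obtain q where q: "q \<in> B" "over r q" using C(3) r by blast
    have "pull r F = pull r G * (cst (val (H q)) + rpull q r (E q))"
      using rpull_equation[OF q(2) eqE[OF Bleaf(1,2)[OF q(1)]]] .
    then have eq: "pull r (F - cst (val (H q)) * G) = pull r G * rpull q r (E q)" by (simp add: algebra_simps)
    have nz: "rpull q r (E q) \<noteq> 0" "val (rpull q r (E q)) = 0" using Bleaf(4)[OF q(1)] by (simp_all add: rpull_simps E_def)
    then have "ord (rpull q r (E q)) > 0" using ord_eq_0_iff by blast
    moreover have "pull r (F - cst (val (H q)) * G) \<noteq> 0" unfolding eq using nz AG(3) by simp
    then have "F - cst (val (H q)) * G \<noteq> 0" by (metis pull_simps(6))
    ultimately show ?thesis using eq nz AG(3)
      by (intro exI[of _ "val (H q)"]) (simp add: ord_mult del: pull_simps(4))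
  qed
  have F3: False if q: "q \<in> surf C" "cu q = Some p" "cv q = Some p'" "p \<in> P" "p' \<in> P" for q p p'
  proof -
    obtain s d where s: "q = Exc s d" using q(2) by (cases q) auto
    have "s = p \<or> s = p'" using q(2,3) s by (cases d) (auto split: if_splits)
    then have "s \<in> C00" using q P00 by auto
    moreover have "d = Slope 0 \<or> d = Vertical" using q(3) s by (cases d) (auto split: if_splits)
    ultimately have "q \<in> C1" using ch s by auto
    then show False using q(1) C(2) by (auto simp: surf_def)
  qed
  have C0C: "C0 \<subseteq> C" using C1(2) C(2) by (auto simp: C0'_def C00_def)
  have bC: "Base 0 \<in> C" using b1 C(2) by blast
  show ?thesis
    by (rule that[OF AG C(1) C0C bC F1[unfolded F_def] F2[unfolded F_def]]) (use F3 in blast)+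
qed

section \<open>Foliations\<close>

definition Lu :: "germ \<Rightarrow> germ \<Rightarrow> germ" where "Lu F G = G * dX F - F * dX G"
definition Lv :: "germ \<Rightarrow> germ \<Rightarrow> germ" where "Lv F G = G * dY F - F * dY G"

definition fol :: "germ \<Rightarrow> germ \<Rightarrow> germ \<Rightarrow> germ \<Rightarrow> bool" where
  "fol F G A B \<longleftrightarrow> cop A B \<and> (\<exists>K. K \<noteq> 0 \<and> Lu F G = K * A \<and> Lv F G = K * B)"

lemma level_form_same_germ:
  assumes "same_germ f (ev F)" "same_germ g (ev G)"
  shows "same_germ (fst (level_form (f, g))) (ev (Lu F G))" "same_germ (snd (level_form (f, g))) (ev (Lv F G))"
  using same_germ_diff[OF same_germ_mult[OF assms(2) partial_u_same_germ[OF assms(1)]] same_germ_mult[OF assms(1) partial_u_same_germ[OF assms(2)]]]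
    same_germ_diff[OF same_germ_mult[OF assms(2) partial_v_same_germ[OF assms(1)]] same_germ_mult[OF assms(1) partial_v_same_germ[OF assms(2)]]]
  unfolding level_form_def Lu_def Lv_def by simp_all

lemma lift_same_germ:
  assumes "proj q = 0"
  shows "same_germ (fst (lift_germ (ev F, ev G) q)) (ev (pull q F))"
    "same_germ (snd (lift_germ (ev F, ev G) q)) (ev (pull q G))"
  using ev_pull[OF assms, of F] ev_pull[OF assms, of G]
  unfolding same_germ_def lift_germ_def by (auto elim: eventually_mono)

lemma foliation_form_iff:
  assumes q: "proj q = 0"
  shows "foliation_form (ev F, ev G) q a b \<longleftrightarrow>
    (\<exists>A B. same_germ a (ev A) \<and> same_germ b (ev B) \<and> fol (pull q F) (pull q G) A B)"
proof -
  let ?L = "level_form (lift_germ (ev F, ev G) q)"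
  have L: "same_germ (fst ?L) (ev (Lu (pull q F) (pull q G)))" "same_germ (snd ?L) (ev (Lv (pull q F) (pull q G)))"
    using level_form_same_germ[OF lift_same_germ[OF q, of F G]] by simp_all
  have mult: "same_germ l (\<lambda>z. k z * a z) \<longleftrightarrow> M = K * A"
    if "same_germ l (ev M)" "same_germ k (ev K)" "same_germ a (ev A)" for l k a M K A
  proof -
    have "same_germ l (\<lambda>z. k z * a z) \<longleftrightarrow> same_germ (ev M) (ev (K * A))"
      using that(1) same_germ_mult[OF that(2,3)] by (meson same_germ_sym same_germ_trans)
    then show ?thesis by simp
  qed
  show ?thesis
  proof
    assume "foliation_form (ev F, ev G) q a b"
    then obtain A B k K where *: "same_germ a (ev A)" "same_germ b (ev B)" "coprime_germs a b" "same_germ k (ev K)"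
      "\<not> same_germ k (\<lambda>_. 0)" "same_germ (fst ?L) (\<lambda>z. k z * a z)" "same_germ (snd ?L) (\<lambda>z. k z * b z)"
      unfolding foliation_form_def analytic_germ_iff by blast
    have "K \<noteq> 0"
    proof
      assume "K = 0"
      then have "same_germ (ev K) (\<lambda>_. 0)" by simp
      with *(4) have "same_germ k (\<lambda>_. 0)" by (rule same_germ_trans)
      with *(5) show False by simp
    qed
    then show "\<exists>A B. same_germ a (ev A) \<and> same_germ b (ev B) \<and> fol (pull q F) (pull q G) A B"
      unfolding fol_def using * coprime_germs_iff[OF *(1,2)] mult[OF L(1) *(4,1)] mult[OF L(2) *(4,2)] by blast
  next
    assume "\<exists>A B. same_germ a (ev A) \<and> same_germ b (ev B) \<and> fol (pull q F) (pull q G) A B"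
    then obtain A B K where *: "same_germ a (ev A)" "same_germ b (ev B)" "cop A B" "K \<noteq> 0"
      "Lu (pull q F) (pull q G) = K * A" "Lv (pull q F) (pull q G) = K * B" unfolding fol_def by blast
    show "foliation_form (ev F, ev G) q a b"
      unfolding foliation_form_def
      using * coprime_germs_iff[OF *(1,2)] mult[OF L(1) same_germ_refl *(1)] mult[OF L(2) same_germ_refl *(2)]
      by (intro conjI exI[of _ "ev K"]) (auto simp: analytic_germ_iff)
  qed
qed

subsection \<open>Forms of functions\<close>

lemma fol_sw: "fol (sw F) (sw G) (sw B) (sw A) \<longleftrightarrow> fol F G A B"
proof -
  have imp: "fol (sw F) (sw G) (sw B) (sw A)" if fol: "fol F G A B" for F G A B
  proof -
    obtain K where K: "cop A B" "K \<noteq> 0" "Lu F G = K * A" "Lv F G = K * B" using fol unfolding fol_def by blast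
    have L: "Lu (sw F) (sw G) = sw (Lv F G)" "Lv (sw F) (sw G) = sw (Lu F G)" by (simp_all add: Lu_def Lv_def dX_sw dY_sw)
    have c: "cop (sw B) (sw A)" using cop_sym[OF K(1)] cop_sw by blast
    show ?thesis unfolding fol_def L K(3,4) using K(2) c by (intro conjI exI[of _ "sw K"]) simp_all
  qed
  show ?thesis using imp[of F G A B] imp[of "sw F" "sw G" "sw B" "sw A"] by auto
qed

lemma Lu_diff: "Lu (F - cst c * G) G = Lu F G" and Lv_diff: "Lv (F - cst c * G) G = Lv F G"
  by (simp_all add: Lu_def Lv_def algebra_simps)

lemma Lu_multiple: "Lu (G * (cst c + E)) G = G * G * dX E" and Lv_multiple: "Lv (G * (cst c + E)) G = G * G * dY E"
  by (simp_all add: Lu_def Lv_def algebra_simps)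

lemma fol_exists:
  assumes "Lu F G \<noteq> 0 \<or> Lv F G \<noteq> 0" obtains A B where "fol F G A B"
  using coprime_part[OF assms] unfolding fol_def by metis

lemma fol_nonzero: "fol F G A B \<Longrightarrow> Lu F G \<noteq> 0 \<or> Lv F G \<noteq> 0"
proof -
  assume "fol F G A B"
  then obtain K where K: "cop A B" "K \<noteq> 0" "Lu F G = K * A" "Lv F G = K * B" unfolding fol_def by blast
  have "\<not> (A = 0 \<and> B = 0)" using K(1) unfolding cop_def by (metis dvd_refl val_simps(1))
  then show ?thesis using K by auto
qed

text \<open>Two presentations of one form satisfy \<open>A0 * B = A * B0\<close>. If
  \<open>A0\<close> is a unit, then \<open>A\<close> divides \<open>B\<close>, and coprimality makes
  \<open>A\<close> a unit; the case of \<open>B0\<close> is symmetric.\<close>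

lemma fol_nonsingular:
  assumes "K0 \<noteq> 0" "Lu F G = K0 * A0" "Lv F G = K0 * B0" "val A0 \<noteq> 0 \<or> val B0 \<noteq> 0" and fol: "fol F G A B"
  shows "val A \<noteq> 0 \<or> val B \<noteq> 0" "val A0 * val B = val A * val B0"
proof -
  obtain K where K: "cop A B" "K \<noteq> 0" "Lu F G = K * A" "Lv F G = K * B" using fol unfolding fol_def by blast
  have 1: "K0 * A0 = K * A" "K0 * B0 = K * B" using K assms by simp_all
  have "K0 * K * (A0 * B) = (K0 * A0) * (K * B)" by (simp add: mult_ac)
  also have "\<dots> = (K * A) * (K0 * B0)" unfolding 1 by simp
  also have "\<dots> = K0 * K * (A * B0)" by (simp add: mult_ac)
  finally have e: "A0 * B = A * B0" using assms(1) K(2) by simp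
  then show "val A0 * val B = val A * val B0" by (metis val_simps(6))
  show "val A \<noteq> 0 \<or> val B \<noteq> 0"
  proof (cases "val A0 = 0")
    case False
    then obtain A1 where A1: "A0 * A1 = 1" by (rule unit_inverse)
    have "B = (A0 * A1) * B" unfolding A1 by simp
    also have "\<dots> = A * (A1 * B0)" using e by (simp add: mult_ac)
    finally have "A dvd B" by (rule dvdI)
    with dvd_refl[of A] K(1) have "val A \<noteq> 0" unfolding cop_def by metis
    then show ?thesis ..
  next
    case True
    with assms(4) have "val B0 \<noteq> 0" by simp
    then obtain B1 where B1: "B0 * B1 = 1" by (rule unit_inverse)
    have "A = A * (B0 * B1)" unfolding B1 by simp
    also have "\<dots> = B * (A0 * B1)" using e by (simp add: mult.assoc[symmetric] mult.commute[of B])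
    finally have "B dvd A" by (rule dvdI)
    with dvd_refl[of B] K(1) have "val B \<noteq> 0" unfolding cop_def by metis
    then show ?thesis ..
  qed
qed

lemma cop_unit: "val A \<noteq> 0 \<or> val B \<noteq> 0 \<Longrightarrow> cop A B"
  unfolding cop_def by (auto elim!: dvdE)

text \<open>A common divisor vanishing at the origin would make both differentials multiples of its
  own.\<close>

lemma cop_jac: assumes "val A = 0" "val B = 0" "jac A B \<noteq> 0" shows "cop A B"
  unfolding cop_def
proof (intro allI impI notI)
  fix D assume "D dvd A" "D dvd B" "val D = 0"
  then obtain A' B' where *: "A = D * A'" "B = D * B'" by (auto elim!: dvdE)
  have "jac A B = 0" unfolding jac_def cf10 cf01 * using \<open>val D = 0\<close> by simp
  with assms(3) show False by simp
qed

text \<open>\<open>\<alpha>\<close> and \<open>\<beta>\<close> are the eigenvalues of the linear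
  part of the vector field \<open>(B, - A)\<close>, given through trace and determinant.\<close>

definition simple_pair :: "germ \<Rightarrow> germ \<Rightarrow> bool" where
  "simple_pair A B \<longleftrightarrow> val A = 0 \<and> val B = 0 \<and> (\<exists>\<alpha> \<beta>. \<alpha> + \<beta> = cf B 1 0 - cf A 0 1 \<and>
    \<alpha> * \<beta> = cf B 0 1 * cf A 1 0 - cf B 1 0 * cf A 0 1 \<and>
    \<not> (\<alpha> = 0 \<and> \<beta> = 0) \<and> \<not> (\<exists>r\<in>\<rat>. r > 0 \<and> \<alpha> = r * \<beta>))"

lemma simple_pairI:
  assumes "val A = 0" "val B = 0" "\<alpha> + \<beta> = cf B 1 0 - cf A 0 1"
    "\<alpha> * \<beta> = cf B 0 1 * cf A 1 0 - cf B 1 0 * cf A 0 1"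
    "\<not> (\<alpha> = 0 \<and> \<beta> = 0)" "\<not> (\<exists>r\<in>\<rat>. r > 0 \<and> \<alpha> = r * \<beta>)"
  shows "simple_pair A B"
  using assms unfolding simple_pair_def by metis

lemma xonly_dY: "xonly \<psi> \<Longrightarrow> dY \<psi> = 0"
  by (rule germ_eqI) (simp add: cf_dY xonly_def)

text \<open>The form is \<open>G ^ 2 dE\<close>. If both exponents are positive, \<open>dE\<close>
  is \<open>gX ^ (i - 1) * W ^ (c - 1)\<close> times a coprime pair with eigenvalues
  \<open>c * val U\<close> and \<open>- i * val U\<close>, whose ratio is negative. If only one is
  positive, the form is nonsingular after division.\<close>

lemma normal_crossing_form:
  assumes E: "E = gX ^ i * (gY - \<psi>) ^ c * U" "val U \<noteq> 0" "xonly \<psi>" "val \<psi> = 0" "val E = 0" and G: "G \<noteq> 0"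
    and F: "F = G * (cst k + E)"
  obtains K A B where "K \<noteq> 0" "Lu F G = K * A" "Lv F G = K * B"
    "(i > 0 \<and> c > 0 \<and> simple_pair A B \<and> cop A B) \<or> (i > 0 \<and> c = 0 \<and> val A \<noteq> 0) \<or> (i = 0 \<and> c > 0 \<and> val B \<noteq> 0)"
proof -
  define W where "W = gY - \<psi>"
  have W: "dY W = 1" "dX W = - dX \<psi>" "val W = 0" using E(3,4) by (simp_all add: W_def xonly_dY)
  have W0: "W \<noteq> 0" using W(1) by auto
  have G2: "G * G \<noteq> 0" using G by simp
  have L: "Lu F G = G * G * dX E" "Lv F G = G * G * dY E" unfolding F by (rule Lu_multiple, rule Lv_multiple)
  have EW: "E = gX ^ i * W ^ c * U" using E(1) by (simp add: W_def)
  show ?thesis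
  proof (cases i)
    case 0
    then obtain c' where c: "c = Suc c'" using E(2,5) EW by (cases c) auto
    have EW': "E = W ^ Suc c' * U" using EW 0 c by simp
    have dx: "dX E = W ^ c' * (cst (real c) * dX W * U + W * dX U)"
      unfolding EW' dX_simps(9) dX_power c by (simp add: algebra_simps)
    have dy: "dY E = W ^ c' * (cst (real c) * U + W * dY U)"
      unfolding EW' dY_simps(9) dY_power c W(1) by (simp add: algebra_simps)
    show ?thesis
      by (rule that[of "G * G * W ^ c'" "cst (real c) * dX W * U + W * dX U" "cst (real c) * U + W * dY U"])
        (use G W0 E(2) c W 0 in \<open>auto simp: L dx dy mult.assoc\<close>)
  next
    case (Suc i')
    show ?thesis
    proof (cases c)
      case 0
      have EW': "E = gX ^ Suc i' * U" using EW 0 Suc by simp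
      have dx: "dX E = gX ^ i' * (cst (real i) * U + gX * dX U)"
        unfolding EW' dX_simps(9) dX_power Suc by (simp add: algebra_simps)
      have dy: "dY E = gX ^ i' * (gX * dY U)"
        unfolding EW' dY_simps(9) dY_gX_power by (simp add: algebra_simps)
      show ?thesis
        by (rule that[of "G * G * gX ^ i'" "cst (real i) * U + gX * dX U" "gX * dY U"])
          (use G E(2) Suc 0 in \<open>auto simp: L dx dy mult.assoc\<close>)
    next
      case c: (Suc c')
      define A B where "A = cst (real i) * W * U + cst (real c) * gX * dX W * U + gX * W * dX U"
        and "B = cst (real c) * gX * U + gX * W * dY U"
      have EW': "E = gX ^ Suc i' * (W ^ Suc c' * U)" using EW c Suc by (simp add: mult_ac)
      have dx: "dX E = gX ^ i' * W ^ c' * A"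
        unfolding EW' dX_simps(9)[of "gX ^ Suc i'"] dX_simps(9)[of "W ^ Suc c'"] dX_power A_def Suc c by (simp add: algebra_simps)
      have dy: "dY E = gX ^ i' * W ^ c' * B"
        unfolding EW' dY_simps(9)[of "gX ^ Suc i'"] dY_simps(9)[of "W ^ Suc c'"] dY_power dY_gX_power B_def c W(1) by (simp add: algebra_simps)
      have v: "val A = 0" "val B = 0" using W(3) by (simp_all add: A_def B_def)
      have d: "cf A 0 1 = real i * val U" "cf B 1 0 = real c * val U" "cf B 0 1 = 0"
        unfolding cf01 cf10 A_def B_def using W by (simp_all del: of_nat_Suc)
      have "jac A B \<noteq> 0" unfolding jac_def d using E(2) Suc c by simp
      then have cop: "cop A B" using cop_jac v by blast
      have "simple_pair A B"
      proof (rule simple_pairI[of _ _ "real c * val U" "- (real i * val U)", OF v, unfolded d])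
        show "\<not> (\<exists>r\<in>\<rat>. 0 < r \<and> real c * val U = r * - (real i * val U))"
        proof clarify
          fix r :: real assume r: "r > 0" "real c * val U = r * - (real i * val U)"
          then have "(real c + r * real i) * val U = 0" by (simp add: algebra_simps)
          moreover have "real c + r * real i > 0" using r(1) c Suc by (intro add_pos_nonneg) auto
          ultimately show False using E(2) by simp
        qed
      qed (use E(2) Suc c in auto)
      then show ?thesis
        by (intro that[of "G * G * (gX ^ i' * W ^ c')" A B]) (use G W0 c Suc cop in \<open>auto simp: L dx dy mult.assoc\<close>)
    qed
  qed
qed

definition fol_singular :: "germ \<Rightarrow> germ \<Rightarrow> bool" where
  "fol_singular F G \<longleftrightarrow> (\<exists>A B. fol F G A B \<and> val A = 0 \<and> val B = 0)"

text \<open>If \<open>u = 0\<close> is a component of \<open>P\<close>, then \<open>gX\<close> does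
  not divide \<open>E\<close>, so \<open>i = 0\<close>: the foliation is nonsingular and transversal
  to this axis. The same holds for \<open>v = 0\<close>.\<close>

lemma leaf_form_cases:
  assumes leaf: "leaf_form P F G q" and G: "G \<noteq> 0"
  defines "Fq \<equiv> pull q F" and "Gq \<equiv> pull q G"
  obtains A B where "fol Fq Gq A B" "fol_singular Fq Gq \<Longrightarrow> simple_pair A B"
    "\<And>p. p \<in> P \<Longrightarrow> cu q = Some p \<Longrightarrow> \<not> fol_singular Fq Gq \<and> (\<forall>A B. fol Fq Gq A B \<longrightarrow> val B \<noteq> 0)"
    "\<And>p. p \<in> P \<Longrightarrow> cv q = Some p \<Longrightarrow> \<not> fol_singular Fq Gq \<and> (\<forall>A B. fol Fq Gq A B \<longrightarrow> val A \<noteq> 0)"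
proof -
  obtain k E where kE: "Fq = Gq * (cst k + E)" "val E = 0" "E \<noteq> 0" "good (cv q \<noteq> None) E"
    "\<And>p. p \<in> P \<Longrightarrow> cu q = Some p \<Longrightarrow> \<not> gX dvd E" "\<And>p. p \<in> P \<Longrightarrow> cv q = Some p \<Longrightarrow> \<not> gY dvd E"
    using leaf unfolding leaf_form_def Fq_def Gq_def by blast
  obtain i c \<psi> U where E: "val U \<noteq> 0" "xonly \<psi>" "val \<psi> = 0" "E = gX ^ i * (gY - \<psi>) ^ c * U" "\<psi> = 0 \<or> \<not> cv q \<noteq> None"
    using kE(4) by (rule good_cases)
  have Gq: "Gq \<noteq> 0" using G by (simp add: Gq_def)
  obtain K A B where K: "K \<noteq> 0" "Lu Fq Gq = K * A" "Lv Fq Gq = K * B"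
    and cases: "(i > 0 \<and> c > 0 \<and> simple_pair A B \<and> cop A B) \<or> (i > 0 \<and> c = 0 \<and> val A \<noteq> 0) \<or> (i = 0 \<and> c > 0 \<and> val B \<noteq> 0)"
    using normal_crossing_form[OF E(4,1,2,3) kE(2) Gq kE(1)] by blast
  have "cop A B" using cases cop_unit by blast
  then have fol: "fol Fq Gq A B" using K unfolding fol_def by blast
  have ns: "\<not> fol_singular Fq Gq" "\<And>A' B'. fol Fq Gq A' B' \<Longrightarrow> val A * val B' = val A' * val B"
    "\<And>A' B'. fol Fq Gq A' B' \<Longrightarrow> val A' \<noteq> 0 \<or> val B' \<noteq> 0"
    if "val A \<noteq> 0 \<or> val B \<noteq> 0"
    using fol_nonsingular[OF K that] unfolding fol_singular_def by blast+
  show ?thesis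
  proof (rule that[OF fol])
    show "simple_pair A B" if "fol_singular Fq Gq" using that cases ns(1) by blast
    fix p assume p: "p \<in> P"
    show "\<not> fol_singular Fq Gq \<and> (\<forall>A B. fol Fq Gq A B \<longrightarrow> val B \<noteq> 0)" if "cu q = Some p"
    proof -
      have "\<not> gX dvd E" using kE(5) p that by blast
      then have "i = 0" using E(4) by (cases i) (auto simp: mult.assoc)
      then have vB: "val B \<noteq> 0" using cases by blast
      have "val B' \<noteq> 0" if "fol Fq Gq A' B'" for A' B'
        using ns(2)[OF _ that] ns(3)[OF _ that] vB by auto
      then show ?thesis using ns(1) vB by blast
    qed
    show "\<not> fol_singular Fq Gq \<and> (\<forall>A B. fol Fq Gq A B \<longrightarrow> val A \<noteq> 0)" if "cv q = Some p"
    proof -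
      have "\<psi> = 0" using E(5) that by simp
      moreover have "\<not> gY dvd E" using kE(6) p that by blast
      ultimately have "c = 0" using E(4) by (cases c) (auto simp: mult_ac)
      then have vA: "val A \<noteq> 0" using cases by blast
      have "val A' \<noteq> 0" if "fol Fq Gq A' B'" for A' B'
        using ns(2)[OF _ that] ns(3)[OF _ that] vA by auto
      then show ?thesis using ns(1) vA by blast
    qed
  qed
qed

subsection \<open>Invariant components\<close>

lemma gX_dX_power: "gX * dX (gX ^ n * f) = gX ^ n * (cst (real n) * f + gX * dX f)"
  by (cases n) (simp_all only: dX_simps dX_power power_0, simp_all add: algebra_simps)

text \<open>The quotient has the constant value \<open>c\<close> on \<open>u = 0\<close>. With
  orders \<open>\<alpha> > \<gamma>\<close> of \<open>F - cst c * G\<close> and \<open>G\<close>,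
  the product \<open>gX * Lu\<close> has order exactly \<open>\<alpha> + \<gamma>\<close>, as its
  leading part carries the factor \<open>\<alpha> - \<gamma>\<close>, while a nonzero
  \<open>Lv\<close> has at least this order. Hence \<open>gX\<close> divides
  \<open>B\<close>.\<close>

lemma invariant_axis_u:
  assumes x: "F - cst c * G \<noteq> 0" "G \<noteq> 0" "xord G < xord (F - cst c * G)" and fol: "fol F G A B"
  shows "val B = 0"
proof (cases "B = 0")
  case False
  obtain K where K: "K \<noteq> 0" "Lu F G = K * A" "Lv F G = K * B" using fol unfolding fol_def by blast
  define F' where "F' = F - cst c * G"
  define \<alpha> \<gamma> where "\<alpha> = xord F'" and "\<gamma> = xord G"
  obtain f where f: "F' = gX ^ \<alpha> * f" "ax f \<noteq> 0" unfolding \<alpha>_def using x(1) unfolding F'_def[symmetric] by (rule xord_decomp)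
  obtain g where g: "G = gX ^ \<gamma> * g" "ax g \<noteq> 0" unfolding \<gamma>_def using x(2) by (rule xord_decomp)
  define M where "M = cst (real \<alpha> - real \<gamma>) * f * g + gX * (g * dX f - f * dX g)"
  define M' where "M' = g * dY f - f * dY g"
  have "gX * Lu F' G = G * (gX * dX F') - F' * (gX * dX G)" by (simp add: Lu_def algebra_simps)
  also have "\<dots> = gX ^ (\<alpha> + \<gamma>) * M"
    unfolding f(1) g(1) gX_dX_power M_def by (simp add: power_add algebra_simps cst_diff)
  finally have 1: "gX * (K * A) = gX ^ (\<alpha> + \<gamma>) * M" unfolding F'_def Lu_diff K(2) .
  have "Lv F' G = gX ^ (\<alpha> + \<gamma>) * M'"
    unfolding Lv_def f(1) g(1) M'_def dY_simps dY_gX_power by (simp add: power_add algebra_simps)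
  then have 2: "K * B = gX ^ (\<alpha> + \<gamma>) * M'" unfolding F'_def Lv_diff K(3) .
  have "ax M \<noteq> 0"
  proof -
    have "real \<alpha> - real \<gamma> \<noteq> 0" using x(3) unfolding \<alpha>_def \<gamma>_def F'_def by simp
    then show ?thesis using f(2) g(2) by (simp add: M_def)
  qed
  then have M: "M \<noteq> 0" "xord M = 0" by (auto simp: xord_eq_0_iff)
  then have A0: "A \<noteq> 0" using 1 by auto
  have M'0: "M' \<noteq> 0" using 2 K(1) False by auto
  have "1 + (xord K + xord A) = \<alpha> + \<gamma>"
    using arg_cong[OF 1, of xord] K(1) A0 M by (simp add: xord_mult xord_power)
  moreover have "xord K + xord B \<ge> \<alpha> + \<gamma>"
    using arg_cong[OF 2, of xord] K(1) False M'0 by (simp add: xord_mult xord_power)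
  ultimately have "xord B > 0" by linarith
  then have "gX dvd B" using gX_dvd_xord[OF False] by simp
  then show ?thesis by (auto elim: dvdE)
qed simp

lemma invariant_axis_v:
  assumes x: "F - cst c * G \<noteq> 0" "G \<noteq> 0" "yord G < yord (F - cst c * G)" and fol: "fol F G A B"
  shows "val A = 0"
proof -
  have "fol (sw F) (sw G) (sw B) (sw A)" using fol fol_sw by blast
  moreover have "sw F - cst c * sw G = sw (F - cst c * G)" by simp
  ultimately have "val (sw A) = 0"
    using invariant_axis_u[of "sw F" c "sw G" "sw B" "sw A"] x by (simp add: yord_def sw_eq_0_iff del: sw_simps(4))
  then show ?thesis by simp
qed

subsection \<open>Pullback of forms\<close>

lemma Lu_blow: "Lu (blow t F) (blow t G) = blow t (Lu F G) + (cst t + gY) * blow t (Lv F G)"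
  and Lv_blow: "Lv (blow t F) (blow t G) = gX * blow t (Lv F G)"
  by (simp_all add: Lu_def Lv_def dX_blow dY_blow algebra_simps)

lemma Lu_sw: "Lu (sw F) (sw G) = sw (Lv F G)" and Lv_sw: "Lv (sw F) (sw G) = sw (Lu F G)"
  by (simp_all add: Lu_def Lv_def dX_sw dY_sw)

lemma L_nonzero_pull:
  assumes "Lu (pull q F) (pull q G) \<noteq> 0 \<or> Lv (pull q F) (pull q G) \<noteq> 0"
  shows "Lu F G \<noteq> 0 \<or> Lv F G \<noteq> 0"
  using assms
proof (induction q)
  case (Exc p d)
  show ?case
  proof (rule Exc.IH, rule ccontr)
    assume z: "\<not> (Lu (pull p F) (pull p G) \<noteq> 0 \<or> Lv (pull p F) (pull p G) \<noteq> 0)"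
    have "Lu (bl d (pull p F)) (bl d (pull p G)) = 0 \<and> Lv (bl d (pull p F)) (bl d (pull p G)) = 0"
      using z by (cases d) (simp_all add: bl_def Lu_blow Lv_blow blowV_def Lu_sw Lv_sw)
    with Exc.prems show False by simp
  qed
qed simp

lemma pull_L_nonzero:
  assumes "Lu F G \<noteq> 0 \<or> Lv F G \<noteq> 0"
  shows "Lu (pull q F) (pull q G) \<noteq> 0 \<or> Lv (pull q F) (pull q G) \<noteq> 0"
proof (induction q)
  case (Exc p d)
  have S: "Lu (blow t F) (blow t G) \<noteq> 0 \<or> Lv (blow t F) (blow t G) \<noteq> 0" if "Lu F G \<noteq> 0 \<or> Lv F G \<noteq> 0" for t F G
    using that unfolding Lu_blow Lv_blow by (cases "Lv F G = 0") auto
  show ?case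
  proof (cases d)
    case (Slope t)
    then show ?thesis using S[OF Exc] by (simp add: bl_def)
  next
    case Vertical
    have "Lu (sw (pull p F)) (sw (pull p G)) \<noteq> 0 \<or> Lv (sw (pull p F)) (sw (pull p G)) \<noteq> 0"
      using Exc by (auto simp: Lu_sw Lv_sw)
    from S[OF this, of 0] show ?thesis using Vertical by (auto simp: bl_def blowV_def Lu_sw Lv_sw)
  qed
qed (use assms in simp)

lemma blow_decomp_le:
  assumes "\<And>k. k < n \<Longrightarrow> hpoly A k = 0"
  obtains B where "blow t A = gX ^ n * B" "ax B = fps_of_poly (pcompose (hpoly A n) [:t, 1:])"
proof (cases "A = 0")
  case True
  then show ?thesis by (intro that[of 0]) (simp_all add: hpoly_def)
next
  case False
  have "n \<le> ord A"
  proof (rule ccontr)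
    assume "\<not> n \<le> ord A"
    then show False using assms[of "ord A"] hpoly_ord_nonzero[OF False] by simp
  qed
  then obtain B where B: "blow t A = gX ^ n * B" "\<And>i j. cf B i j = cf (blow t A) (i + n) j"
    using gX_decomp[of n "blow t A"] by (metis xord_blow_ord)
  have "ax B = fps_of_poly (pcompose (hpoly A n) [:t, 1:])" unfolding ser_blow[symmetric]
    by (rule fps_ext) (simp only: ax_nth B(2), simp add: cf_def)
  with B(1) show ?thesis by (rule that)
qed

text \<open>The polynomial \<open>p\<close> is the contraction of the leading form with the radial
  vector field. Off its roots the strict transform is nonsingular. If it is 0, one more power of
  \<open>gX\<close> divides out, and the roots of \<open>hpoly b n\<close> take over.\<close>

lemma finite_singular_slopes:
  assumes L: "Lu F G \<noteq> 0 \<or> Lv F G \<noteq> 0"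
  shows "finite {t. fol_singular (blow t F) (blow t G)}"
proof -
  define a b where "a = Lu F G" and "b = Lv F G"
  have ex: "\<exists>n. hpoly a n \<noteq> 0 \<or> hpoly b n \<noteq> 0"
    using L hpoly_ord_nonzero unfolding a_def b_def by blast
  define n where "n = (LEAST n. hpoly a n \<noteq> 0 \<or> hpoly b n \<noteq> 0)"
  have n: "hpoly a n \<noteq> 0 \<or> hpoly b n \<noteq> 0" unfolding n_def using LeastI_ex[OF ex] .
  have low: "hpoly a k = 0" "hpoly b k = 0" if "k < n" for k using not_less_Least[OF that[unfolded n_def]] by auto
  define p where "p = hpoly a n + [:0, 1:] * hpoly b n"
  define w where "w = (if p = 0 then hpoly b n else p)"
  have w0: "w \<noteq> 0" using n by (auto simp: w_def p_def)
  have "\<not> fol_singular (blow t F) (blow t G)" if t: "poly w t \<noteq> 0" for t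
  proof -
    obtain a1 where a1: "blow t a = gX ^ n * a1" "ax a1 = fps_of_poly (pcompose (hpoly a n) [:t, 1:])"
      using blow_decomp_le[OF low(1)] by blast
    obtain b1 where b1: "blow t b = gX ^ n * b1" "ax b1 = fps_of_poly (pcompose (hpoly b n) [:t, 1:])"
      using blow_decomp_le[OF low(2)] by blast
    define c1 where "c1 = a1 + (cst t + gY) * b1"
    have Lu: "Lu (blow t F) (blow t G) = gX ^ n * c1" and Lv: "Lv (blow t F) (blow t G) = gX ^ n * (gX * b1)"
      unfolding Lu_blow Lv_blow a_def[symmetric] b_def[symmetric] a1(1) b1(1) c1_def by (simp_all add: algebra_simps)
    have axc: "ax c1 = fps_of_poly (pcompose p [:t, 1:])"
      by (simp add: c1_def a1(2) b1(2) p_def pcompose_add pcompose_mult pcompose_pCons fps_of_poly_add fps_of_poly_mult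
          fps_of_poly_linear add.commute)
    have c0: "fps_of_poly (pcompose p [:t, 1:]) $ 0 = poly p t" for p :: "real poly"
      by (simp add: poly_0_coeff_0[symmetric] poly_pcompose)
    have "\<exists>K A B. K \<noteq> 0 \<and> Lu (blow t F) (blow t G) = K * A \<and> Lv (blow t F) (blow t G) = K * B \<and> (val A \<noteq> 0 \<or> val B \<noteq> 0)"
    proof (cases "p = 0")
      case False
      then have "val c1 \<noteq> 0" unfolding ax_nth_0[symmetric] axc c0 using t by (simp add: w_def)
      then show ?thesis using Lu Lv by (metis gX_nonzero power_not_zero)
    next
      case True
      then have "ax c1 = 0" using axc by simp
      then obtain c2 where c2: "c1 = gX * c2" unfolding gX_dvd_iff[symmetric] by (auto elim: dvdE)
      have "val b1 \<noteq> 0" unfolding ax_nth_0[symmetric] b1(2) c0 using t True by (simp add: w_def)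
      moreover have "Lu (blow t F) (blow t G) = gX ^ Suc n * c2" "Lv (blow t F) (blow t G) = gX ^ Suc n * b1"
        using Lu Lv by (simp_all add: c2 mult_ac)
      ultimately show ?thesis by (metis gX_nonzero power_not_zero)
    qed
    then show ?thesis using fol_nonsingular(1) unfolding fol_singular_def by blast
  qed
  then have "{t. fol_singular (blow t F) (blow t G)} \<subseteq> {t. poly w t = 0}" by auto
  then show ?thesis using poly_roots_finite[OF w0] by (rule finite_subset)
qed

subsection \<open>Nonsingular points and simple singularities stay so under blow-ups\<close>

definition fol_simple :: "germ \<Rightarrow> germ \<Rightarrow> bool" where
  "fol_simple F G \<longleftrightarrow> (\<exists>A B. fol F G A B \<and> (val A \<noteq> 0 \<or> val B \<noteq> 0 \<or> simple_pair A B))"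

lemma fol_simple_sw: "fol_simple F G \<Longrightarrow> fol_simple (sw F) (sw G)"
proof -
  assume "fol_simple F G"
  then obtain A B where AB: "fol F G A B" "val A \<noteq> 0 \<or> val B \<noteq> 0 \<or> simple_pair A B" unfolding fol_simple_def by blast
  have "simple_pair (sw B) (sw A)" if sp: "simple_pair A B"
  proof -
    obtain \<alpha> \<beta> where ab: "val A = 0" "val B = 0" "\<alpha> + \<beta> = cf B 1 0 - cf A 0 1" "\<alpha> * \<beta> = cf B 0 1 * cf A 1 0 - cf B 1 0 * cf A 0 1"
      "\<not> (\<alpha> = 0 \<and> \<beta> = 0)" "\<not> (\<exists>r\<in>\<rat>. r > 0 \<and> \<alpha> = r * \<beta>)" using sp unfolding simple_pair_def by blast
    show ?thesis
      by (rule simple_pairI[of _ _ "- \<alpha>" "- \<beta>"]) (use ab in \<open>auto simp: algebra_simps\<close>)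
  qed
  moreover have "fol (sw F) (sw G) (sw B) (sw A)" using AB(1) fol_sw by blast
  ultimately show "fol_simple (sw F) (sw G)" unfolding fol_simple_def using AB(2) by (metis val_simps sw_simps(9))
qed

lemma dvd_gX_power: "D dvd gX ^ n \<Longrightarrow> val D \<noteq> 0 \<or> gX dvd D"
proof (induction n)
  case 0
  then show ?case by (simp add: dvd_1_iff)
next
  case (Suc n)
  then obtain E where E: "gX * gX ^ n = D * E" by (auto elim: dvdE)
  then have "gX dvd D * E" by (metis dvd_triv_left)
  then consider "gX dvd D" | "gX dvd E" using gX_prime by blast
  then show ?case
  proof cases
    case 2
    then obtain E' where "E = gX * E'" by (auto elim: dvdE)
    with E have "gX * gX ^ n = gX * (D * E')" by (simp add: mult_ac)
    then have "gX ^ n = D * E'" by (metis gX_nonzero mult_left_cancel)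
    then show ?thesis using Suc.IH by simp
  qed simp
qed

text \<open>Some power of \<open>gX\<close> lies in the ideal of \<open>A\<close> and
  \<open>B\<close>; pulled back, it shows that a common divisor of \<open>A'\<close> and
  \<open>B'\<close> divides a power of \<open>gX\<close>. Such a divisor is a unit or divisible by
  \<open>gX\<close>, and the latter is excluded by \<open>ax A'\<close>.\<close>

lemma cop_blow:
  assumes "cop A B" "gX ^ n * A' = blow t A + (cst t + gY) * blow t B" "gX ^ n * B' = gX * blow t B" "ax A' \<noteq> 0"
  shows "cop A' B'"
  unfolding cop_def
proof (intro allI impI)
  fix D assume D: "D dvd A'" "D dvd B'"
  obtain k \<alpha> \<beta> where k: "gX ^ k = \<alpha> * A + \<beta> * B" using assms(1) by (rule coprime_power_X)
  have "gX * blow t A = gX * (gX ^ n * A') - (cst t + gY) * (gX ^ n * B')"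
    unfolding assms(2,3) by (simp add: algebra_simps)
  then have 1: "D dvd gX * blow t A" using D by (simp add: dvd_mult)
  have 2: "D dvd gX * blow t B" unfolding assms(3)[symmetric] using D by (simp add: dvd_mult)
  have "gX ^ Suc k = blow t \<alpha> * (gX * blow t A) + blow t \<beta> * (gX * blow t B)"
    using arg_cong[OF k, of "blow t"] by (simp add: algebra_simps)
  then have "D dvd gX ^ Suc k" using 1 2 by (metis dvd_add dvd_mult)
  then have "val D \<noteq> 0 \<or> gX dvd D" by (rule dvd_gX_power)
  moreover have "\<not> gX dvd D" using D(1) assms(4) dvd_trans unfolding gX_dvd_iff[symmetric] by blast
  ultimately show "val D \<noteq> 0" by blast
qed

text \<open>The value \<open>val B = 0\<close> says that the exceptional line is invariant. Over a
  nonsingular point a singularity appears only in the tangent direction, with eigenvalue ratio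
  \<open>- 1\<close>. Over a simple singularity with eigenvalues \<open>l\<close> and
  \<open>m\<close> it appears only in eigendirections, with eigenvalues \<open>l\<close> and
  \<open>m - l\<close>; their ratio is again not a positive rational.\<close>

lemma fol_simple_blow:
  assumes "fol_simple F G"
  obtains A B where "fol (blow t F) (blow t G) A B" "val B = 0" "fol_simple (blow t F) (blow t G)"
proof -
  obtain A B K where AB: "cop A B" "K \<noteq> 0" "Lu F G = K * A" "Lv F G = K * B"
    "val A \<noteq> 0 \<or> val B \<noteq> 0 \<or> simple_pair A B" using assms unfolding fol_simple_def fol_def by blast
  have form: "fol (blow t F) (blow t G) A' B'"
    if "gX ^ n * A' = blow t A + (cst t + gY) * blow t B" "gX ^ n * B' = gX * blow t B" "ax A' \<noteq> 0" for A' B' n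
    unfolding fol_def
  proof (intro conjI exI[of _ "blow t K * gX ^ n"])
    show "cop A' B'" using cop_blow[OF AB(1) that] .
    have "Lu (blow t F) (blow t G) = blow t K * (blow t A + (cst t + gY) * blow t B)"
      unfolding Lu_blow AB(3,4) by (simp add: algebra_simps)
    then show "Lu (blow t F) (blow t G) = blow t K * gX ^ n * A'" unfolding that(1)[symmetric] by (simp add: mult.assoc)
    have "Lv (blow t F) (blow t G) = blow t K * (gX * blow t B)"
      unfolding Lv_blow AB(3,4) by (simp add: algebra_simps)
    then show "Lv (blow t F) (blow t G) = blow t K * gX ^ n * B'" unfolding that(2)[symmetric] by (simp add: mult.assoc)
  qed (use AB(2) in simp)
  show ?thesis
  proof (cases "val A \<noteq> 0 \<or> val B \<noteq> 0")
    case True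
    define A' B' where "A' = blow t A + (cst t + gY) * blow t B" and "B' = gX * blow t B"
    have axb: "ax (blow t C) = fps_const (val C)" for C
      by (rule fps_ext) (simp add: ax_nth cf_blow hpoly_def val_def monom_0 coeff_pCons split: nat.split)
    have n: "ax A' $ 1 = val B" "ax A' $ 0 = val A + t * val B"
      by (simp_all add: A'_def axb fps_mult_nth_1)
    have ax: "ax A' \<noteq> 0"
    proof
      assume "ax A' = 0"
      with n have "val B = 0" "val A + t * val B = 0" by (metis fps_zero_nth)+
      with True show False by simp
    qed
    have fol: "fol (blow t F) (blow t G) A' B'" by (rule form[of 0]) (use ax in \<open>simp_all add: A'_def B'_def\<close>)
    have vB: "val B' = 0" by (simp add: B'_def)
    have "val A' \<noteq> 0 \<or> simple_pair A' B'"
    proof (cases "val A' = 0")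
      case z: True
      then have "val A + t * val B = 0" by (simp add: A'_def)
      then have b: "val B \<noteq> 0" using True by auto
      have d: "cf B' 1 0 = val B" "cf B' 0 1 = 0" "cf A' 0 1 = val B"
        unfolding cf10 cf01 A'_def B'_def by (simp_all add: dY_blow)
      have "simple_pair A' B'"
      proof (rule simple_pairI[of _ _ "val B" "- val B", OF z vB, unfolded d])
        show "\<not> (\<exists>r\<in>\<rat>. 0 < r \<and> val B = r * - val B)"
        proof clarify
          fix r :: real assume "r > 0" "val B = r * - val B"
          then have "(1 + r) * val B = 0" by (simp add: algebra_simps)
          with \<open>r > 0\<close> b show False by simp
        qed
      qed (use b in auto)
      then show ?thesis ..
    qed simp
    then show ?thesis using that[OF fol vB] fol unfolding fol_simple_def by blast
  next
    case False
    with AB(5) have sp: "simple_pair A B" by blast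
    obtain \<alpha> \<beta> where ab: "\<alpha> + \<beta> = cf B 1 0 - cf A 0 1" "\<alpha> * \<beta> = cf B 0 1 * cf A 1 0 - cf B 1 0 * cf A 0 1"
      "\<not> (\<alpha> = 0 \<and> \<beta> = 0)" "\<not> (\<exists>r\<in>\<rat>. r > 0 \<and> \<alpha> = r * \<beta>)" using sp unfolding simple_pair_def by blast
    have v: "val A = 0" "val B = 0" using False by auto
    define a1 a2 b1 b2 where "a1 = cf A 1 0" and "a2 = cf A 0 1" and "b1 = cf B 1 0" and "b2 = cf B 0 1"
    have low: "hpoly C k = 0" if "val C = 0" "k < 1" for C k using that by (simp add: hpoly_def val_def monom_0)
    obtain P where P: "blow t A = gX ^ 1 * P" "ax P = fps_of_poly (pcompose (hpoly A 1) [:t, 1:])"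
      using blow_decomp_le[of 1 A t] low[OF v(1)] by blast
    obtain Q where Q: "blow t B = gX ^ 1 * Q" "ax Q = fps_of_poly (pcompose (hpoly B 1) [:t, 1:])"
      using blow_decomp_le[of 1 B t] low[OF v(2)] by blast
    define A' B' where "A' = P + (cst t + gY) * Q" and "B' = gX * Q"
    have "ax A' = fps_of_poly (pcompose ([:a1, a2:] + [:0, 1:] * [:b1, b2:]) [:t, 1:])"
      unfolding A'_def a1_def a2_def b1_def b2_def using P(2) Q(2) unfolding hpoly_1
      by (simp add: pcompose_add pcompose_mult pcompose_pCons fps_of_poly_add fps_of_poly_mult fps_of_poly_linear algebra_simps)
    also have "pcompose ([:a1, a2:] + [:0, 1:] * [:b1, b2:]) [:t, 1:] =
        [:a1 + (a2 + b1) * t + b2 * t * t, a2 + b1 + 2 * b2 * t, b2:]"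
      by (simp add: pcompose_pCons algebra_simps)
    finally have axA: "ax A' = fps_of_poly [:a1 + (a2 + b1) * t + b2 * t * t, a2 + b1 + 2 * b2 * t, b2:]" .
    \<comment> \<open>The polynomial in the slope vanishes identically only for a scalar linear
      part, whose eigenvalues would have the forbidden ratio 1.\<close>
    have ax: "ax A' \<noteq> 0"
    proof
      assume "ax A' = 0"
      then have "[:a1 + (a2 + b1) * t + b2 * t * t, a2 + b1 + 2 * b2 * t, b2:] = 0"
        unfolding axA using fps_of_poly_eq_iff[of _ "0 :: real poly"] by (metis fps_of_poly_0)
      then have z: "b2 = 0" "a2 = - b1" "a1 = 0" by auto
      then have "\<alpha> + \<beta> = 2 * b1" "\<alpha> * \<beta> = b1 * b1" using ab(1,2) by (simp_all add: a1_def a2_def b1_def b2_def)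
      then have "(\<alpha> - \<beta>) * (\<alpha> - \<beta>) = 0" by algebra
      then have "\<alpha> = 1 * \<beta>" by simp
      then show False using ab(4) by (metis Rats_1 zero_less_one)
    qed
    have fol: "fol (blow t F) (blow t G) A' B'"
      by (rule form[of 1]) (use ax in \<open>simp_all add: A'_def B'_def P Q algebra_simps\<close>)
    have vB: "val B' = 0" by (simp add: B'_def)
    have "val A' \<noteq> 0 \<or> simple_pair A' B'"
    proof (cases "val A' = 0")
      case z: True
      have z': "a1 + (a2 + b1) * t + b2 * t * t = 0" using z unfolding ax_nth_0[symmetric] axA by simp
      \<comment> \<open>The slope \<open>t\<close> is an eigendirection with eigenvalue
        \<open>l\<close>, and \<open>m\<close> is the other eigenvalue.\<close>
      define l m where "l = b1 + b2 * t" and "m = - a2 - b2 * t"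
      have "val Q = l" unfolding ax_nth_0[symmetric] Q(2) hpoly_1 by (simp add: l_def b1_def b2_def pcompose_pCons)
      then have d: "cf B' 1 0 = l" "cf B' 0 1 = 0" unfolding cf10 cf01 B'_def by simp_all
      have "cf A' 0 1 = a2 + b1 + 2 * b2 * t" unfolding ax_nth[symmetric] axA by simp
      then have d': "cf A' 0 1 = l - m" by (simp add: l_def m_def)
      have sum: "\<alpha> + \<beta> = l + m" using ab(1) by (simp add: l_def m_def a2_def b1_def)
      have "l * m = b2 * (- (a2 + b1) * t - b2 * t * t) - b1 * a2" by (simp add: l_def m_def algebra_simps)
      also have "- (a2 + b1) * t - b2 * t * t = a1" using z' by (simp add: algebra_simps)
      finally have prod: "\<alpha> * \<beta> = l * m" using ab(2) by (simp add: a1_def a2_def b1_def b2_def)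
      have "(\<alpha> - l) * (\<alpha> - m) = 0" using sum prod by algebra
      then have lm: "(\<alpha> = l \<and> \<beta> = m) \<or> (\<alpha> = m \<and> \<beta> = l)" using sum by auto
      have no: "l \<noteq> r * m" if "r \<in> \<rat>" "r > 0" for r
      proof
        assume e: "l = r * m"
        then have "m = inverse r * l" using that(2) by simp
        moreover have "inverse r \<in> \<rat>" "inverse r > 0" using that by auto
        ultimately show False using lm e that ab(4) by blast
      qed
      have "simple_pair A' B'"
      proof (rule simple_pairI[of _ _ l "m - l", OF z vB, unfolded d d'])
        show "\<not> (l = 0 \<and> m - l = 0)" using lm ab(3) by auto
        show "\<not> (\<exists>r\<in>\<rat>. 0 < r \<and> l = r * (m - l))"
        proof clarify
          fix r :: real assume r: "r \<in> \<rat>" "0 < r" "l = r * (m - l)"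
          then have "(1 + r) * l = r * m" by (simp add: algebra_simps)
          then have "l = (r / (1 + r)) * m" using r(2) by (simp add: field_simps)
          moreover have "r / (1 + r) \<in> \<rat>" "r / (1 + r) > 0" using r by auto
          ultimately show False using no by blast
        qed
      qed (auto simp: algebra_simps)
      then show ?thesis ..
    qed simp
    then show ?thesis using that[OF fol vB] fol unfolding fol_simple_def by blast
  qed
qed

lemma fol_simple_pull_over:
  assumes "fol_simple (pull q F) (pull q G)" "over q' q" shows "fol_simple (pull q' F) (pull q' G)"
  using assms(2)
proof (induction q')
  case (Exc p d)
  show ?case
  proof (cases "Exc p d = q")
    case False
    with Exc.prems have "over p q" using over_ExcD by blast
    then have IH: "fol_simple (pull p F) (pull p G)" by (rule Exc.IH)
    show ?thesis
    proof (cases d)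
      case (Slope t)
      then show ?thesis using fol_simple_blow[OF IH, of t] by (auto simp: bl_def)
    next
      case Vertical
      obtain A B where "fol_simple (blow 0 (sw (pull p F))) (blow 0 (sw (pull p G)))"
        using fol_simple_blow[OF fol_simple_sw[OF IH], of 0] by blast
      from fol_simple_sw[OF this] Vertical show ?thesis by (simp add: bl_def blowV_def)
    qed
  qed (use assms(1) in simp)
qed (use assms(1) in \<open>auto simp: over_def\<close>)

section \<open>Branches\<close>

lemma set_germ_eq_iff: "set_germ A = set_germ B \<longleftrightarrow> (\<forall>\<^sub>F z in nhds 0. z \<in> A \<longleftrightarrow> z \<in> B)"
proof
  assume "set_germ A = set_germ B"
  moreover have "B \<in> set_germ B" by (simp add: set_germ_def)
  ultimately have "B \<in> set_germ A" by simp
  then show "\<forall>\<^sub>F z in nhds 0. z \<in> A \<longleftrightarrow> z \<in> B" by (simp add: set_germ_def same_germ_def)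
next
  assume *: "\<forall>\<^sub>F z in nhds 0. z \<in> A \<longleftrightarrow> z \<in> B"
  have "(\<forall>\<^sub>F z in nhds 0. (z \<in> A) = (z \<in> C)) \<longleftrightarrow> (\<forall>\<^sub>F z in nhds 0. (z \<in> B) = (z \<in> C))" for C
    by (rule eventually_cong[OF *]) auto
  then show "set_germ A = set_germ B" by (simp add: set_germ_def same_germ_def)
qed

definition zs :: "germ \<Rightarrow> plane set" where "zs g = {z. ev g z = 0}"

definition below :: "germ \<Rightarrow> germ \<Rightarrow> bool" where
  "below g f \<longleftrightarrow> (\<forall>\<^sub>F z in nhds 0. ev g z = 0 \<longrightarrow> ev f z = 0)"

lemma below_refl [simp]: "below g g" by (simp add: below_def)

lemma below_trans: "below f g \<Longrightarrow> below g h \<Longrightarrow> below f h"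
  unfolding below_def by (erule (1) eventually_elim2) simp

lemma below_multL: "below g a \<Longrightarrow> below g (a * b)"
  unfolding below_def by (erule eventually_elim2[OF _ ev_mult[of a b]]) auto

lemma below_multR: "below g b \<Longrightarrow> below g (a * b)"
  using below_multL[of g b a] by (simp add: mult.commute)

lemma set_germ_zs_eq_iff: "set_germ (zs f) = set_germ (zs g) \<longleftrightarrow> below f g \<and> below g f"
  unfolding set_germ_eq_iff zs_def below_def eventually_conj_iff[symmetric] by (rule arg_cong[where f = "\<lambda>P. eventually P _"]) auto

lemma analytic_set_germ_zs [simp]: "analytic_set_germ (zs f)"
  unfolding analytic_set_germ_def zs_def by blast

text \<open>Irreducibility of the zero set, expressed as primality of the ideal of germs vanishing
  on it; the germ \<open>g\<close> itself may well be reducible.\<close>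

definition irr :: "germ \<Rightarrow> bool" where
  "irr g \<longleftrightarrow> g \<noteq> 0 \<and> \<not> (\<forall>\<^sub>F z in nhds 0. ev g z = 0 \<longrightarrow> z = 0) \<and>
    (\<forall>a b. below g (a * b) \<longrightarrow> below g a \<or> below g b)"

lemma ev_sum_squares: "\<forall>\<^sub>F z in nhds 0. ev (a * a + b * b) z = 0 \<longleftrightarrow> ev a z = 0 \<and> ev b z = 0"
  using ev_mult[of a a] ev_mult[of b b] ev_add[of "a * a" "b * b"] by eventually_elim simp

text \<open>If \<open>a * b\<close> vanishes on the branch, the branch is the union of the zero sets
  of \<open>g * g + a * a\<close> and \<open>g * g + b * b\<close>, and one of them is
  everything.\<close>

lemma branch_irr:
  assumes "\<Gamma> \<in> branches" obtains g where "\<Gamma> = set_germ (zs g)" "irr g"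
proof -
  obtain A where A: "\<Gamma> = set_germ A" "analytic_set_germ A" "irreducible_set_germ A" "one_dimensional_germ A"
    using assms unfolding branches_def by blast
  obtain f g where f: "set_germ A = set_germ {z. f z = 0}" "same_germ f (ev g)"
    using A(2) unfolding analytic_set_germ_def analytic_germ_iff by blast
  have "set_germ {z. f z = 0} = set_germ (zs g)"
    using f(2) unfolding set_germ_eq_iff same_germ_def zs_def by (rule eventually_mono) simp
  then have Ag: "set_germ A = set_germ (zs g)" using f(1) by simp
  then have ev: "\<forall>\<^sub>F z in nhds 0. z \<in> A \<longleftrightarrow> ev g z = 0" by (simp add: set_germ_eq_iff zs_def)
  have "g \<noteq> 0"
  proof
    assume "g = 0"
    then have "set_germ A = set_germ UNIV"
      using ev ev_0 unfolding set_germ_eq_iff by (auto elim: eventually_elim2)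
    with A(4) show False by (simp add: one_dimensional_germ_def)
  qed
  moreover have "\<not> (\<forall>\<^sub>F z in nhds 0. ev g z = 0 \<longrightarrow> z = 0)"
  proof
    assume "\<forall>\<^sub>F z in nhds 0. ev g z = 0 \<longrightarrow> z = 0"
    with ev have "\<forall>\<^sub>F z in nhds 0. z \<noteq> 0 \<longrightarrow> z \<notin> A" by eventually_elim auto
    then have "\<not> 0 islimpt A" by (simp add: islimpt_iff_eventually eventually_at_filter)
    with A(4) show False by (simp add: one_dimensional_germ_def)
  qed
  moreover have "below g a \<or> below g b" if ab: "below g (a * b)" for a b
  proof -
    let ?a = "g * g + a * a" and ?b = "g * g + b * b"
    have "\<forall>\<^sub>F z in nhds 0. z \<in> A \<longleftrightarrow> z \<in> zs ?a \<union> zs ?b"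
      using ev ab[unfolded below_def] ev_mult[of a b] ev_sum_squares[of g a] ev_sum_squares[of g b]
      by eventually_elim (auto simp: zs_def)
    then have "set_germ A = set_germ (zs ?a) \<or> set_germ A = set_germ (zs ?b)"
      using A(3) unfolding irreducible_set_germ_def set_germ_eq_iff[symmetric] by simp
    moreover have "below g c" if "set_germ (zs g) = set_germ (zs (g * g + c * c))" for c
      using that ev_sum_squares[of g c] unfolding set_germ_eq_iff zs_def below_def
      by eventually_elim (simp only: mem_Collect_eq, blast)
    ultimately show ?thesis unfolding Ag by blast
  qed
  ultimately have "irr g" by (simp add: irr_def)
  with A(1) Ag show ?thesis by (intro that) simp
qed

lemma irr_not_below_unit:
  assumes "irr g" "\<forall>\<^sub>F z in nhds 0. z \<noteq> 0 \<longrightarrow> ev A z \<noteq> 0" shows "\<not> below g A"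
proof
  assume "below g A"
  with assms(2) have "\<forall>\<^sub>F z in nhds 0. ev g z = 0 \<longrightarrow> z = 0" unfolding below_def by eventually_elim auto
  with assms(1) show False by (simp add: irr_def)
qed

lemma irr_not_below_coprime:
  assumes "irr g" "cop a b" "below g a" "below g b" shows False
proof -
  have "\<forall>\<^sub>F z in nhds 0. ev g z = 0 \<longrightarrow> z = 0"
    using assms(3,4)[unfolded below_def] coprime_isolated_zero[OF assms(2)] by eventually_elim auto
  with assms(1) show False by (simp add: irr_def)
qed

lemma irr_mult: "irr g \<Longrightarrow> below g (a * b) \<longleftrightarrow> below g a \<or> below g b"
  using below_multL below_multR unfolding irr_def by blast

text \<open>Take a germ of least order with the same zero set as \<open>f\<close>. If its greatest common divisor with \<open>g\<close>
  did not vanish on this zero set, then dividing by it would give such a germ of smaller order.\<close>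

lemma irr_below_eq:
  assumes "irr f" "irr g" "below g f" shows "set_germ (zs f) = set_germ (zs g)"
proof -
  define R where "R F \<longleftrightarrow> F \<noteq> 0 \<and> below f F \<and> below F f" for F
  have "R f" using assms(1) by (simp add: R_def irr_def)
  then obtain F where F: "R F" "\<And>F'. R F' \<Longrightarrow> ord F \<le> ord F'" using ex_has_least_nat[of R f ord] by blast
  have F': "F \<noteq> 0" "below f F" "below F f" using F(1) by (auto simp: R_def)
  then obtain K A B where K: "K \<noteq> 0" "F = K * A" "g = K * B" "cop A B" using coprime_part[of F g] by blast
  have gF: "below g F" using below_trans[OF assms(3) F'(2)] .
  have "below g K"
  proof -
    have "below g K \<or> below g B" using irr_mult[OF assms(2)] K(3) below_refl by metis
    moreover have "below g K \<or> below g A" using irr_mult[OF assms(2)] gF K(2) by blast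
    ultimately show ?thesis using irr_not_below_coprime[OF assms(2) K(4)] by blast
  qed
  have "below f K \<or> below f A" using irr_mult[OF assms(1)] F'(2) K(2) by blast
  then show ?thesis
  proof
    assume "below f K"
    then have "below f g" unfolding K(3) by (rule below_multL)
    with assms(3) show ?thesis by (simp add: set_germ_zs_eq_iff)
  next
    assume A: "below f A"
    have A0: "A \<noteq> 0" using F'(1) K(2) by auto
    have "below A F" unfolding K(2) by (rule below_multR) simp
    then have "below A f" using F'(3) by (rule below_trans)
    with A A0 have "R A" unfolding R_def by simp
    then have "ord F \<le> ord A" by (rule F(2))
    then have "ord K = 0" using ord_mult[OF K(1) A0] K(2) by simp
    then have "val K \<noteq> 0" using K(1) by (simp add: ord_eq_0_iff)
    with isCont_0[of K] have "\<forall>\<^sub>F z in at 0. ev K z \<noteq> 0"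
      by (intro tendsto_imp_eventually_ne[of _ "ev K 0"]) (auto simp: isCont_def ev_at_0)
    then have "\<forall>\<^sub>F z in nhds 0. z \<noteq> 0 \<longrightarrow> ev K z \<noteq> 0" by (simp add: eventually_at_filter)
    with \<open>below g K\<close> irr_not_below_unit[OF assms(2)] show ?thesis by blast
  qed
qed

lemma equation_of_branches:
  assumes "finite S" "S \<subseteq> branches"
  obtains f where "f \<noteq> 0" "\<And>g. irr g \<Longrightarrow> set_germ (zs g) \<in> branches \<Longrightarrow> below g f \<longleftrightarrow> set_germ (zs g) \<in> S"
proof -
  have "\<exists>f. f \<noteq> 0 \<and> (\<forall>g. irr g \<longrightarrow> (below g f \<longleftrightarrow> set_germ (zs g) \<in> S))"
    using assms
  proof (induction S)
    case empty
    have "\<not> below g 1" if "irr g" for g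
      using irr_not_below_unit[OF that, of 1] ev_one by (auto elim: eventually_mono)
    then show ?case by (intro exI[of _ 1]) simp
  next
    case (insert \<Gamma> S)
    then have "\<Gamma> \<in> branches" "\<exists>f. f \<noteq> 0 \<and> (\<forall>g. irr g \<longrightarrow> (below g f \<longleftrightarrow> set_germ (zs g) \<in> S))" by simp_all
    then obtain f where f: "f \<noteq> 0 \<and> (\<forall>g. irr g \<longrightarrow> (below g f \<longleftrightarrow> set_germ (zs g) \<in> S))" by (elim exE) (rule that)
    obtain k where k: "\<Gamma> = set_germ (zs k)" "irr k" using \<open>\<Gamma> \<in> branches\<close> by (rule branch_irr)
    have "below g (k * f) \<longleftrightarrow> set_germ (zs g) \<in> insert \<Gamma> S" if g: "irr g" for g
    proof -
      have "below g k \<longleftrightarrow> set_germ (zs g) = \<Gamma>"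
        using irr_below_eq[OF k(2) g] set_germ_zs_eq_iff k(1) by auto
      then show ?thesis using conjunct2[OF f] g unfolding irr_mult[OF g] by simp
    qed
    then show ?case using conjunct1[OF f] k(2) by (intro exI[of _ "k * f"]) (simp add: irr_def)
  qed
  then show ?thesis using that by blast
qed

section \<open>Zero and pole branches of the constructed function\<close>

lemma branches_of_iff:
  assumes "same_germ \<phi> (ev f)"
  shows "set_germ (zs g) \<in> branches_of \<phi> \<longleftrightarrow> set_germ (zs g) \<in> branches \<and> below g f"
proof -
  have "(\<exists>A\<in>set_germ (zs g). \<forall>z\<in>A. \<phi> z = 0) \<longleftrightarrow> below g f"
  proof
    assume "\<exists>A\<in>set_germ (zs g). \<forall>z\<in>A. \<phi> z = 0"
    then obtain A where A: "\<forall>\<^sub>F z in nhds 0. z \<in> zs g \<longleftrightarrow> z \<in> A" "\<forall>z\<in>A. \<phi> z = 0"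
      unfolding set_germ_def same_germ_def by blast
    show "below g f" unfolding below_def using A(1) assms[unfolded same_germ_def]
      by eventually_elim (use A(2) in \<open>auto simp: zs_def\<close>)
  next
    assume b: "below g f"
    have "\<forall>\<^sub>F z in nhds 0. z \<in> zs g \<longleftrightarrow> z \<in> zs g \<inter> {z. \<phi> z = 0}"
      using b[unfolded below_def] assms[unfolded same_germ_def] by eventually_elim (auto simp: zs_def)
    then have "zs g \<inter> {z. \<phi> z = 0} \<in> set_germ (zs g)" by (simp add: set_germ_def same_germ_def)
    then show "\<exists>A\<in>set_germ (zs g). \<forall>z\<in>A. \<phi> z = 0" by (rule bexI[rotated]) simp
  qed
  then show ?thesis by (simp add: branches_of_def)
qed

lemma reduced_form_germs:
  "reduced_form (ev F, ev G) \<phi> \<psi> \<longleftrightarrow>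
    (\<exists>a b. same_germ \<phi> (ev a) \<and> same_germ \<psi> (ev b) \<and> b \<noteq> 0 \<and> cop a b \<and> F * b = a * G)"
proof -
  have *: "reduced_form (ev F, ev G) \<phi> \<psi> \<longleftrightarrow> b \<noteq> 0 \<and> cop a b \<and> F * b = a * G"
    if ab: "same_germ \<phi> (ev a)" "same_germ \<psi> (ev b)" for a b
  proof -
    have 0: "same_germ \<psi> (\<lambda>_. 0) \<longleftrightarrow> b = 0"
      using ab(2) by (metis same_germ_ev_0 same_germ_sym same_germ_trans)
    have "same_germ (\<lambda>z. ev F z * \<psi> z) (\<lambda>z. \<phi> z * ev G z) \<longleftrightarrow> same_germ (ev (F * b)) (ev (a * G))"
      using same_germ_mult[OF same_germ_refl ab(2), of F] same_germ_mult[OF ab(1) same_germ_refl, of G]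
      by (meson same_germ_sym same_germ_trans)
    with ab show ?thesis unfolding reduced_form_def meromorphic_germ_def
      by (auto simp: 0 coprime_germs_iff[OF ab] analytic_germ_iff)
  qed
  show ?thesis
  proof
    assume r: "reduced_form (ev F, ev G) \<phi> \<psi>"
    then obtain a b where "same_germ \<phi> (ev a)" "same_germ \<psi> (ev b)"
      unfolding reduced_form_def meromorphic_germ_def analytic_germ_iff by auto
    with r * show "\<exists>a b. same_germ \<phi> (ev a) \<and> same_germ \<psi> (ev b) \<and> b \<noteq> 0 \<and> cop a b \<and> F * b = a * G" by blast
  qed (use * in blast)
qed

text \<open>On a branch neither \<open>A\<close> nor \<open>G\<close> vanishes identically. For a
  reduced form \<open>a / b\<close> the relation \<open>F * b = a * G\<close> then keeps
  \<open>b\<close> from vanishing on any branch and lets \<open>a\<close> vanish exactly where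
  \<open>f\<close> does.\<close>

lemma zero_pole_branches:
  assumes f: "\<And>g. irr g \<Longrightarrow> set_germ (zs g) \<in> branches \<Longrightarrow> below g f \<longleftrightarrow> set_germ (zs g) \<in> S" "S \<subseteq> branches"
    and AG: "\<forall>\<^sub>F z in nhds 0. z \<noteq> 0 \<longrightarrow> ev A z \<noteq> 0 \<and> ev G z \<noteq> 0" "G \<noteq> 0"
  shows "zero_branches (ev (f * f * A), ev G) \<union> pole_branches (ev (f * f * A), ev G) = S"
proof -
  define F where "F = f * f * A"
  have A: "\<not> below g A" and G: "\<not> below g G" if "irr g" for g
    by (rule irr_not_below_unit[OF that eventually_mono[OF AG(1)]], simp)+
  have "\<Gamma> \<in> S" if r: "reduced_form (ev F, ev G) \<phi> \<psi>" and \<Gamma>: "\<Gamma> \<in> branches_of \<phi> \<union> branches_of \<psi>" for \<phi> \<psi> \<Gamma>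
  proof -
    obtain a b where ab: "same_germ \<phi> (ev a)" "same_germ \<psi> (ev b)" "cop a b" "F * b = a * G"
      using r unfolding reduced_form_germs by blast
    have br: "\<Gamma> \<in> branches" using \<Gamma> by (auto simp: branches_of_def)
    then obtain g where g: "\<Gamma> = set_germ (zs g)" "irr g" by (rule branch_irr)
    have "\<not> below g b"
    proof
      assume b: "below g b"
      then have "below g (a * G)" unfolding ab(4)[symmetric] by (rule below_multR)
      then have "below g a" using irr_mult[OF g(2)] G[OF g(2)] by blast
      then show False using irr_not_below_coprime[OF g(2) ab(3) _ b] by blast
    qed
    then have "below g a" using \<Gamma> unfolding g(1) Un_iff branches_of_iff[OF ab(1)] branches_of_iff[OF ab(2)] by blast
    then have "below g (F * b)" unfolding ab(4) by (rule below_multL)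
    then have "below g F" using irr_mult[OF g(2)] \<open>\<not> below g b\<close> by blast
    then have "below g f" unfolding F_def using irr_mult[OF g(2)] A[OF g(2)] by blast
    then show ?thesis using f(1)[OF g(2)] br g(1) by blast
  qed
  then have 1: "zero_branches (ev F, ev G) \<union> pole_branches (ev F, ev G) \<subseteq> S"
    unfolding zero_branches_def pole_branches_def by blast
  obtain K a b where K: "F = K * a" "G = K * b" "cop a b" using coprime_part[of F G] AG(2) by blast
  have red: "reduced_form (ev F, ev G) (ev a) (ev b)"
    unfolding reduced_form_germs using AG(2) K by - (rule exI[of _ a], rule exI[of _ b], auto simp: mult_ac)
  have "S \<subseteq> zero_branches (ev F, ev G)"
  proof
    fix \<Gamma> assume \<Gamma>: "\<Gamma> \<in> S"
    then have br: "\<Gamma> \<in> branches" using f(2) by blast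
    then obtain g where g: "\<Gamma> = set_germ (zs g)" "irr g" by (rule branch_irr)
    have "below g f" using f(1)[OF g(2)] br \<Gamma> g(1) by blast
    then have "below g (K * a)" unfolding K(1)[symmetric] F_def by (intro below_multL)
    moreover have "\<not> below g K" using G[OF g(2)] below_multL unfolding K(2) by blast
    ultimately have "below g a" using irr_mult[OF g(2)] by blast
    then have "\<Gamma> \<in> branches_of (ev a)" unfolding g(1) using branches_of_iff[OF same_germ_refl] br g(1) by blast
    with red show "\<Gamma> \<in> zero_branches (ev F, ev G)" unfolding zero_branches_def by blast
  qed
  with 1 show ?thesis unfolding F_def by blast
qed

section \<open>The foliation by the levels of a quotient of germs\<close>

text \<open>In the chart the component is the axis \<open>l = 0\<close>: a curve in it has its
  derivative in the kernel of \<open>l\<close>, and straight lines realise the whole kernel.\<close>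

lemma tangent_vector_comp:
  assumes C: "tree C" "q \<in> surf C" and l: "(l = fst \<and> cu q = Some r) \<or> (l = snd \<and> cv q = Some r)"
  shows "tangent_vector (comp r C) q w \<longleftrightarrow> l w = 0"
proof -
  have lin: "bounded_linear l" using l bounded_linear_fst bounded_linear_snd by auto
  have L: "\<forall>\<^sub>F z in nhds 0. chart q z \<in> comp r C \<longleftrightarrow> l z = 0"
    using eventually_comps_chart[of q] eventually_chart_surf[OF C]
    by eventually_elim (use l cu_neq_cv[of q r] in \<open>auto simp: comp_def\<close>)
  show ?thesis
  proof
    assume "tangent_vector (comp r C) q w"
    then obtain \<gamma> where \<gamma>: "\<gamma> 0 = 0" "(\<gamma> has_vector_derivative w) (at 0)" "\<forall>\<^sub>F s in nhds 0. chart q (\<gamma> s) \<in> comp r C"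
      unfolding tangent_vector_def by blast
    have "(\<gamma> \<longlongrightarrow> 0) (nhds 0)"
      using has_vector_derivative_continuous[OF \<gamma>(2)] \<gamma>(1) tendsto_at_iff_tendsto_nhds[of \<gamma> 0]
      by (simp add: isCont_def)
    from eventually_compose_filterlim[OF L this] \<gamma>(3) have z: "\<forall>\<^sub>F s in nhds 0. l (\<gamma> s) = 0"
      by eventually_elim blast
    have "((\<lambda>s. l (\<gamma> s)) has_vector_derivative l w) (at 0)"
      using bounded_linear.has_vector_derivative[OF lin \<gamma>(2)] .
    moreover have "((\<lambda>s. l (\<gamma> s)) has_vector_derivative 0) (at 0)"
    proof -
      have "\<forall>\<^sub>F s in nhds 0. s \<in> UNIV \<longrightarrow> l (\<gamma> s) = 0" using z by simp
      moreover have "l (\<gamma> 0) = 0" using z by (rule eventually_nhds_x_imp_x)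
      ultimately show ?thesis using has_vector_derivative_cong_ev[where S = UNIV and x = "0 :: real" and f = "\<lambda>s. l (\<gamma> s)" and g = "\<lambda>_. 0" and f' = 0]
        by simp
    qed
    ultimately show "l w = 0" by (rule vector_derivative_unique_at)
  next
    assume w: "l w = 0"
    define \<gamma> where "\<gamma> s = s *\<^sub>R w" for s :: real
    have d: "(\<gamma> has_vector_derivative w) (at s)" for s
      unfolding \<gamma>_def by (auto intro!: derivative_eq_intros)
    then have "(\<gamma> \<longlongrightarrow> 0) (nhds 0)"
      using has_vector_derivative_continuous[OF d, of 0] tendsto_at_iff_tendsto_nhds[of \<gamma> 0]
      by (simp add: isCont_def \<gamma>_def)
    from eventually_compose_filterlim[OF L this] have "\<forall>\<^sub>F s in nhds 0. chart q (\<gamma> s) \<in> comp r C"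
      by (rule eventually_mono) (use w linear_cmul[OF bounded_linear.linear[OF lin]] in \<open>simp add: \<gamma>_def\<close>)
    with d show "tangent_vector (comp r C) q w" unfolding tangent_vector_def
      by (intro exI[of _ \<gamma>]) (simp add: \<gamma>_def)
  qed
qed

lemma tangent_at_comp:
  assumes C: "tree C" "q \<in> surf C" and q: "proj q = 0"
  shows "cu q = Some r \<Longrightarrow> tangent_at (ev F, ev G) (comp r C) q \<longleftrightarrow> (\<exists>A B. fol (pull q F) (pull q G) A B \<and> val B = 0)"
    and "cv q = Some r \<Longrightarrow> tangent_at (ev F, ev G) (comp r C) q \<longleftrightarrow> (\<exists>A B. fol (pull q F) (pull q G) A B \<and> val A = 0)"
proof -
  have 1: "(\<forall>w :: plane. fst w = 0 \<longrightarrow> a * fst w + b * snd w = 0) \<longleftrightarrow> b = 0"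
    and 2: "(\<forall>w :: plane. snd w = 0 \<longrightarrow> a * fst w + b * snd w = 0) \<longleftrightarrow> a = 0" for a b :: real
    by auto
  have ex: "(\<exists>a b. foliation_form (ev F, ev G) q a b \<and> R (a 0) (b 0)) \<longleftrightarrow>
      (\<exists>A B. fol (pull q F) (pull q G) A B \<and> R (val A) (val B))" for R
    unfolding foliation_form_iff[OF q] using same_germ_val same_germ_refl by metis
  show "tangent_at (ev F, ev G) (comp r C) q \<longleftrightarrow> (\<exists>A B. fol (pull q F) (pull q G) A B \<and> val B = 0)" if "cu q = Some r"
    unfolding tangent_at_def using tangent_vector_comp[OF C, of fst r] that by (simp only: 1 ex[of "\<lambda>_ b. b = 0"] simp_thms)
  show "tangent_at (ev F, ev G) (comp r C) q \<longleftrightarrow> (\<exists>A B. fol (pull q F) (pull q G) A B \<and> val A = 0)" if "cv q = Some r"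
    unfolding tangent_at_def using tangent_vector_comp[OF C, of snd r] that by (simp only: 2 ex[of "\<lambda>a _. a = 0"] simp_thms)
qed

lemma singular_point_iff:
  "proj q = 0 \<Longrightarrow> singular_point (ev F, ev G) q \<longleftrightarrow> fol_singular (pull q F) (pull q G)"
  unfolding singular_point_def fol_singular_def foliation_form_iff using same_germ_val same_germ_refl by metis

lemma det_linear_part:
  assumes "same_germ a (ev A)" "same_germ b (ev B)"
  shows "(\<forall>x. det (linear_part a b - mat x) = (\<alpha> - x) * (\<beta> - x)) \<longleftrightarrow>
    \<alpha> + \<beta> = cf B 1 0 - cf A 0 1 \<and> \<alpha> * \<beta> = cf B 0 1 * cf A 1 0 - cf B 1 0 * cf A 0 1"
proof -
  have p: "partial_u a 0 = cf A 1 0" "partial_v a 0 = cf A 0 1" "partial_u b 0 = cf B 1 0" "partial_v b 0 = cf B 0 1"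
    using same_germ_val[OF partial_u_same_germ[OF assms(1)]] same_germ_val[OF partial_v_same_germ[OF assms(1)]]
      same_germ_val[OF partial_u_same_germ[OF assms(2)]] same_germ_val[OF partial_v_same_germ[OF assms(2)]]
    by (simp_all only: cf10 cf01)
  have det: "det (linear_part a b - mat x) = (cf B 1 0 - x) * (- cf A 0 1 - x) + cf B 0 1 * cf A 1 0" for x
    by (simp add: det_2 linear_part_def p mat_def)
  show ?thesis
  proof
    assume *: "\<forall>x. det (linear_part a b - mat x) = (\<alpha> - x) * (\<beta> - x)"
    from spec[OF *, of 0] spec[OF *, of 1]
    show "\<alpha> + \<beta> = cf B 1 0 - cf A 0 1 \<and> \<alpha> * \<beta> = cf B 0 1 * cf A 1 0 - cf B 1 0 * cf A 0 1"
      unfolding det by (simp add: algebra_simps)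
  next
    assume *: "\<alpha> + \<beta> = cf B 1 0 - cf A 0 1 \<and> \<alpha> * \<beta> = cf B 0 1 * cf A 1 0 - cf B 1 0 * cf A 0 1"
    have "(\<alpha> - x) * (\<beta> - x) = \<alpha> * \<beta> - (\<alpha> + \<beta>) * x + x * x" for x by (simp add: algebra_simps)
    then show "\<forall>x. det (linear_part a b - mat x) = (\<alpha> - x) * (\<beta> - x)"
      unfolding det using * by (simp add: algebra_simps)
  qed
qed

lemma simple_singularity_iff:
  assumes "proj q = 0"
  shows "simple_singularity (ev F, ev G) q \<longleftrightarrow> (\<exists>A B. fol (pull q F) (pull q G) A B \<and> simple_pair A B)"
proof -
  have *: "a 0 = 0 \<and> b 0 = 0 \<and> (\<exists>\<alpha> \<beta>. (\<forall>x. det (linear_part a b - mat x) = (\<alpha> - x) * (\<beta> - x)) \<and>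
      \<not> (\<alpha> = 0 \<and> \<beta> = 0) \<and> \<not> (\<exists>r\<in>\<rat>. r > 0 \<and> \<alpha> = r * \<beta>)) \<longleftrightarrow> simple_pair A B"
    if "same_germ a (ev A)" "same_germ b (ev B)" for a b A B
    unfolding simple_pair_def det_linear_part[OF that] same_germ_val[OF that(1)] same_germ_val[OF that(2)] by simp
  show ?thesis
  proof
    assume "simple_singularity (ev F, ev G) q"
    then show "\<exists>A B. fol (pull q F) (pull q G) A B \<and> simple_pair A B"
      unfolding simple_singularity_def foliation_form_iff[OF assms]
      by (elim exE conjE) (rule exI, rule exI, rule conjI, assumption, rule iffD1[OF *], assumption+, blast)
  next
    assume "\<exists>A B. fol (pull q F) (pull q G) A B \<and> simple_pair A B"
    then obtain A B where "fol (pull q F) (pull q G) A B" "simple_pair A B" by blast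
    with *[of "ev A" A "ev B" B] show "simple_singularity (ev F, ev G) q"
      unfolding simple_singularity_def foliation_form_iff[OF assms]
      by - (rule exI[of _ "ev A"], rule exI[of _ "ev B"], auto)
  qed
qed

section \<open>Reduction of singularities\<close>

text \<open>The facts delivered by \<open>model\<close>, with \<open>F\<close> for
  \<open>f * f * A\<close>; the reduction of singularities is derived from them alone.\<close>

locale resolution =
  fixes P C :: "point set" and F G :: germ
  assumes tree: "tree C" and base: "Base 0 \<in> C" and sub: "P \<subseteq> C" and G: "G \<noteq> 0"
    and leaf: "\<And>q. q \<in> surf C \<Longrightarrow> proj q = 0 \<Longrightarrow> leaf_form P F G q"
    and level: "\<And>r. r \<in> C - P \<Longrightarrow> \<exists>c. F - cst c * G \<noteq> 0 \<and> ord (pull r G) < ord (pull r (F - cst c * G))"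
    and corner: "\<And>q p p'. q \<in> surf C \<Longrightarrow> proj q = 0 \<Longrightarrow> cu q = Some p \<Longrightarrow> cv q = Some p' \<Longrightarrow> p \<in> P \<Longrightarrow> p' \<notin> P"
begin

abbreviation "h \<equiv> (ev F, ev G)"

lemma generic_leaf:
  assumes "p \<in> C" obtains t where "Exc p (Slope t) \<in> surf C"
proof -
  obtain t where "Exc p (Slope t) \<notin> C"
    using infinitely_many_slopes[of C "{}" p] tree unfolding tree_def by blast
  then show ?thesis using Exc_in_surf_iff[OF tree] assms that by blast
qed

lemma L_nonzero: "Lu (pull q F) (pull q G) \<noteq> 0 \<or> Lv (pull q F) (pull q G) \<noteq> 0"
proof -
  obtain t where t: "Exc (Base 0) (Slope t) \<in> surf C" using generic_leaf[OF base] .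
  obtain A B where "fol (pull (Exc (Base 0) (Slope t)) F) (pull (Exc (Base 0) (Slope t)) G) A B"
    by (rule leaf_form_cases[OF leaf[OF t] G]) simp_all
  then show ?thesis by (intro pull_L_nonzero L_nonzero_pull[OF fol_nonzero])
qed

lemma nonsingular_noninvariant:
  assumes "q \<in> surf C" "proj q = 0" "p \<in> P"
  shows "cu q = Some p \<Longrightarrow> \<not> fol_singular (pull q F) (pull q G) \<and> (\<forall>A B. fol (pull q F) (pull q G) A B \<longrightarrow> val B \<noteq> 0)"
    and "cv q = Some p \<Longrightarrow> \<not> fol_singular (pull q F) (pull q G) \<and> (\<forall>A B. fol (pull q F) (pull q G) A B \<longrightarrow> val A \<noteq> 0)"
  using leaf_form_cases[OF leaf[OF assms(1,2)] G] assms(3) by metis+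

lemma comp_proj: "tree C' \<Longrightarrow> r \<in> C' \<Longrightarrow> q \<in> comp r C' \<Longrightarrow> q \<in> surf C' \<and> proj q = 0 \<and> (cu q = Some r \<or> cv q = Some r)"
  using comps_ancestor[of r q] proj_ancestor[of r q] tree_proj[of C' r] by (auto simp: comp_def comps_def)

lemma invariant_comp:
  assumes C': "tree C'" "C' \<subseteq> C" and r: "r \<in> C'" "r \<notin> P"
  shows "invariant_component h (comp r C')"
  unfolding invariant_component_def
proof
  fix q assume "q \<in> comp r C'"
  then have q: "q \<in> surf C'" "proj q = 0" "cu q = Some r \<or> cv q = Some r" using comp_proj[OF C'(1) r(1)] by auto
  obtain c where c: "F - cst c * G \<noteq> 0" "ord (pull r G) < ord (pull r (F - cst c * G))"
    using level[of r] r C'(2) by blast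
  have e: "pull q (F - cst c * G) = pull q F - cst c * pull q G" by (simp only: pull_simps)
  have nz: "pull q F - cst c * pull q G \<noteq> 0" "pull q G \<noteq> 0" unfolding e[symmetric] using c(1) G by (metis pull_simps(10))+
  obtain A B where AB: "fol (pull q F) (pull q G) A B" using fol_exists[OF L_nonzero] .
  from q(3) show "tangent_at h (comp r C') q"
  proof
    assume u: "cu q = Some r"
    have "val B = 0" using invariant_axis_u[OF nz _ AB] c(2) unfolding e[symmetric] xord_pull[OF u] by blast
    then show ?thesis using tangent_at_comp(1)[OF C'(1) q(1,2) u] AB by blast
  next
    assume v: "cv q = Some r"
    have "val A = 0" using invariant_axis_v[OF nz _ AB] c(2) unfolding e[symmetric] yord_pull[OF v] by blast
    then show ?thesis using tangent_at_comp(2)[OF C'(1) q(1,2) v] AB by blast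
  qed
qed

text \<open>A generic point of the component is also a leaf of the full tree \<open>C\<close>, with
  the same chart and the same foliation, so transversality known there carries over to the smaller
  tree.\<close>

lemma noninvariant_comp:
  assumes C': "tree C'" "C' \<subseteq> C" and p: "p \<in> C'" "p \<in> P"
  shows "\<not> invariant_component h (comp p C')"
proof -
  have pC: "p \<in> C" using sub p(2) by blast
  then obtain t where t: "Exc p (Slope t) \<in> surf C" by (rule generic_leaf)
  let ?q = "Exc p (Slope t)"
  have q: "?q \<in> surf C'" using t C' p(1) Exc_in_surf_iff[OF C'(1)] Exc_in_surf_iff[OF tree] by blast
  have pr: "proj ?q = 0" using tree_proj[OF C'(1) p(1)] by simp
  have "\<not> tangent_at h (comp p C') ?q"
    using tangent_at_comp(1)[OF C'(1) q pr] nonsingular_noninvariant(1)[OF t pr p(2)] by auto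
  moreover have "?q \<in> comp p C'" using q comps_Exc by (simp add: comp_def)
  ultimately show ?thesis unfolding invariant_component_def by blast
qed

lemma dicritical_components_eq:
  assumes "blowup_seq cs" "set cs \<subseteq> C"
  shows "dicritical_components h cs = (\<lambda>p. comp p (set cs)) ` (P \<inter> set cs)"
  unfolding dicritical_components_def components_eq[OF assms(1)]
  using invariant_comp[OF tree_set[OF assms(1)] assms(2)] noninvariant_comp[OF tree_set[OF assms(1)] assms(2)] by blast

lemma divisor_eq: "blowup_seq cs \<Longrightarrow> divisor cs = {q \<in> surf (set cs). proj q = 0}"
  by (simp add: divisor_def surface_eq)

lemma finite_singular: "finite {q \<in> surf C. proj q = 0 \<and> \<not> \<not> fol_singular (pull q F) (pull q G)}"
proof (rule finite_bad_leaves[OF tree base])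
  fix s
  have "{d. Exc s d \<notin> C \<and> \<not> \<not> fol_singular (pull (Exc s d) F) (pull (Exc s d) G)}
      \<subseteq> insert Vertical (Slope ` {t. fol_singular (blow t (pull s F)) (blow t (pull s G))})"
  proof
    fix d assume "d \<in> {d. Exc s d \<notin> C \<and> \<not> \<not> fol_singular (pull (Exc s d) F) (pull (Exc s d) G)}"
    then show "d \<in> insert Vertical (Slope ` {t. fol_singular (blow t (pull s F)) (blow t (pull s G))})"
      by (cases d) (auto simp: bl_def)
  qed
  then show "finite {d. Exc s d \<notin> C \<and> \<not> \<not> fol_singular (pull (Exc s d) F) (pull (Exc s d) G)}"
    using finite_singular_slopes[OF L_nonzero[of s]] by (simp add: finite_subset)
qed

lemma reduces:
  assumes cs: "blowup_seq cs" "set cs = C"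
  shows "reduces_singularities h cs"
  unfolding reduces_singularities_def
proof (intro conjI ballI impI)
  have "Lu F G \<noteq> 0 \<or> Lv F G \<noteq> 0" using L_nonzero[of "Base 0"] by simp
  then show "nonconstant_germ h"
    unfolding nonconstant_germ_def
    using level_form_same_germ[OF same_germ_refl same_germ_refl, of F G]
    by (metis same_germ_ev_0 same_germ_sym same_germ_trans)
  show "blowup_seq cs" by fact
  have "{q \<in> divisor cs. singular_point h q} = {q \<in> surf C. proj q = 0 \<and> \<not> \<not> fol_singular (pull q F) (pull q G)}"
    unfolding divisor_eq[OF cs(1)] cs(2) using singular_point_iff by auto
  then show "finite {q \<in> divisor cs. singular_point h q}" using finite_singular by simp
next
  fix q assume q: "q \<in> divisor cs" "singular_point h q"
  then have q': "q \<in> surf C" "proj q = 0" using divisor_eq[OF cs(1)] cs(2) by auto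
  show "simple_singularity h q"
    using leaf_form_cases[OF leaf[OF q'] G] q(2) unfolding simple_singularity_iff[OF q'(2)] singular_point_iff[OF q'(2)] by metis
next
  fix D q assume D: "D \<in> dicritical_components h cs" and qD: "q \<in> D"
  then obtain p where p: "p \<in> P" "p \<in> C" "D = comp p C" unfolding dicritical_components_eq[OF cs(1) equalityD1[OF cs(2)]] cs(2) by blast
  have q: "q \<in> surf C" "proj q = 0" "cu q = Some p \<or> cv q = Some p" using comp_proj[OF tree p(2)] qD p(3) by auto
  show "\<not> singular_point h q"
    using q(3) nonsingular_noninvariant[OF q(1,2) p(1)] unfolding singular_point_iff[OF q(2)] by blast
  show "\<not> tangent_at h D q"
    unfolding p(3) using q(3) nonsingular_noninvariant[OF q(1,2) p(1)] tangent_at_comp[OF tree q(1,2)] by blast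
next
  have "q \<notin> comp p' C" if "p \<in> P" "p' \<in> P" "p \<noteq> p'" "q \<in> comp p C" for p p' q
  proof
    assume q': "q \<in> comp p' C"
    have "p \<in> C" "p' \<in> C" using that sub by auto
    with comp_proj[OF tree _ that(4)] comp_proj[OF tree _ q'] corner[of q] that(1,2,3) show False by auto
  qed
  then show "pairwise disjnt (dicritical_components h cs)"
    unfolding dicritical_components_eq[OF cs(1) equalityD1[OF cs(2)]] cs(2) pairwise_def disjnt_def by blast
qed

text \<open>Minimality in \<open>real_reduction\<close> is meant up to isomorphism. By
  \<open>isomorphic_set_eq\<close> a shorter reduction refined by \<open>cs\<close> would also have
  its centres in \<open>C\<close>, against the least length of \<open>cs\<close>.\<close>

lemma exists_real_reduction:
  obtains cs where "real_reduction h cs" "blowup_seq cs" "set cs \<subseteq> C"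
proof -
  define R where "R cs \<longleftrightarrow> reduces_singularities h cs \<and> set cs \<subseteq> C" for cs
  obtain cs0 where "blowup_seq cs0" "set cs0 = C" using tree_blowup_seq[OF tree] .
  then have "R cs0" using reduces by (simp add: R_def)
  then obtain cs where cs: "R cs" "\<And>cs'. R cs' \<Longrightarrow> length cs \<le> length cs'" using ex_has_least_nat[of R cs0 length] by blast
  have b: "blowup_seq cs" using cs(1) by (simp add: R_def reduces_singularities_def)
  have "real_reduction h cs" unfolding real_reduction_def
  proof (intro conjI notI)
    show "reduces_singularities h cs" using cs(1) by (simp add: R_def)
    assume "\<exists>cs' ds \<Phi>. reduces_singularities h cs' \<and> ds \<noteq> [] \<and> blowup_seq (cs' @ ds) \<and> seq_isomorphism (cs' @ ds) cs \<Phi>"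
    then obtain cs' ds \<Phi> where *: "reduces_singularities h cs'" "ds \<noteq> []" "blowup_seq (cs' @ ds)" "seq_isomorphism (cs' @ ds) cs \<Phi>"
      by blast
    have s: "set (cs' @ ds) = set cs" using isomorphic_set_eq[OF *(3) b *(4)] .
    then have "set cs' \<subseteq> C" using cs(1) by (auto simp: R_def)
    then have "length cs \<le> length cs'" using cs(2) *(1) by (simp add: R_def)
    moreover have "length (cs' @ ds) = length cs"
      using distinct_card[OF blowup_distinct[OF *(3)]] distinct_card[OF blowup_distinct[OF b]] s by simp
    ultimately show False using *(2) by (cases ds) simp_all
  qed
  with b cs(1)[unfolded R_def] show ?thesis by (intro that) blast+
qed

lemma exists_leaf_below: "tree C' \<Longrightarrow> p \<notin> C' \<Longrightarrow> \<exists>q\<in>surf C'. over p q"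
proof (induction p)
  case (Base a)
  then show ?case by (auto simp: surf_def over_def)
next
  case (Exc p d)
  show ?case
  proof (cases "p \<in> C'")
    case True
    then show ?thesis using Exc.prems Exc_in_surf_iff[of C' p d] by (auto simp: over_def)
  next
    case False
    then obtain q where q: "q \<in> surf C'" "over p q" using Exc by blast
    have "over (Exc p d) p" by (simp add: over_def)
    then show ?thesis using q over_trans by blast
  qed
qed

text \<open>If a reduction did not blow up \<open>p \<in> P\<close>, then \<open>p\<close> would lie over a point where the foliation is
  nonsingular or has a simple singularity, and all components created over such a point are invariant.\<close>

lemma centres_of_reduction:
  assumes "reduces_singularities h cs" "set cs \<subseteq> C"
  shows "P \<subseteq> set cs"
proof
  fix p assume p: "p \<in> P"
  have b: "blowup_seq cs" using assms(1) by (simp add: reduces_singularities_def)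
  show "p \<in> set cs"
  proof (rule ccontr)
    assume "p \<notin> set cs"
    then obtain q where q: "q \<in> surf (set cs)" "over p q" using exists_leaf_below[OF tree_set[OF b]] by blast
    have pC: "p \<in> C" using p sub by blast
    then have pr: "proj p = 0" using tree_proj[OF tree] by blast
    have qpr: "proj q = 0" using q(2) pr proj_ancestor by (auto simp: over_def)
    then have qd: "q \<in> divisor cs" using q(1) by (simp add: divisor_eq[OF b])
    have "fol_simple (pull q F) (pull q G)"
    proof (cases "singular_point h q")
      case True
      then have "simple_singularity h q" using assms(1) qd unfolding reduces_singularities_def by blast
      then show ?thesis unfolding simple_singularity_iff[OF qpr] fol_simple_def by blast
    next
      case False
      obtain A B where "fol (pull q F) (pull q G) A B" using fol_exists[OF L_nonzero] .
      with False show ?thesis unfolding singular_point_iff[OF qpr] fol_simple_def fol_singular_def by blast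
    qed
    then have s: "fol_simple (pull p F) (pull p G)" using q(2) by (rule fol_simple_pull_over)
    obtain t where t: "Exc p (Slope t) \<in> surf C" using pC by (rule generic_leaf)
    obtain A B where "fol (blow t (pull p F)) (blow t (pull p G)) A B" "val B = 0" using fol_simple_blow[OF s] .
    then show False using nonsingular_noninvariant(1)[OF t _ p] pr by (auto simp: bl_def)
  qed
qed

text \<open>The reduction need not be related to \<open>cs0\<close> otherwise than by blowing up
  \<open>P\<close> too; this is enough, since the class depends only on the centres of the
  components.\<close>

lemma indeterminacy_structure:
  assumes "blowup_seq cs0" "P \<subseteq> set cs0"
  shows "indeterminacy_structure_given_by h (union_class cs0 ((\<lambda>p. comp p (set cs0)) ` P))"
proof -
  obtain cs where cs: "real_reduction h cs" "blowup_seq cs" "set cs \<subseteq> C" using exists_real_reduction .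
  then have P: "P \<subseteq> set cs" by (intro centres_of_reduction) (simp_all add: real_reduction_def)
  then have "dicritical_components h cs = (\<lambda>p. comp p (set cs)) ` P"
    using dicritical_components_eq[OF cs(2,3)] by (simp add: Int_absorb2)
  then show ?thesis unfolding indeterminacy_structure_given_by_def
    using cs(1) union_class_cong[OF cs(2) assms(1) P assms(2)] by metis
qed

end

theorem theorem5:
  fixes \<kappa> :: "(point list \<times> point set set) set"
    and S :: "plane set set set"
  assumes "real_infinitesimal_class \<kappa>"
    and "finite S" and "S \<subseteq> branches"
  shows "\<exists>h. meromorphic_germ h \<and> indeterminacy_structure_given_by h \<kappa> \<and>
    zero_branches h \<union> pole_branches h = S"
proof -
  obtain cs \<D> where cs: "blowup_seq cs" "\<D> \<subseteq> components cs" "\<kappa> = union_class cs \<D>"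
    using assms(1) unfolding real_infinitesimal_class_def by blast
  define P where "P = {r \<in> set cs. comp r (set cs) \<in> \<D>}"
  have P: "P \<subseteq> set cs" "\<D> = (\<lambda>p. comp p (set cs)) ` P"
    using cs(2) unfolding components_eq[OF cs(1)] P_def by auto
  obtain f where f: "f \<noteq> 0" "\<And>g. irr g \<Longrightarrow> set_germ (zs g) \<in> branches \<Longrightarrow> below g f \<longleftrightarrow> set_germ (zs g) \<in> S"
    using equation_of_branches[OF assms(2,3)] by blast
  obtain A G C where AG: "\<forall>\<^sub>F z in nhds 0. z \<noteq> 0 \<longrightarrow> ev A z \<noteq> 0 \<and> ev G z \<noteq> 0" "A \<noteq> 0" "G \<noteq> 0"
    and C: "tree C" "set cs \<subseteq> C" "Base 0 \<in> C" "\<And>q. q \<in> surf C \<Longrightarrow> proj q = 0 \<Longrightarrow> leaf_form P (f * f * A) G q"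
      "\<And>r. r \<in> C - P \<Longrightarrow> \<exists>c. f * f * A - cst c * G \<noteq> 0 \<and> ord (pull r G) < ord (pull r (f * f * A - cst c * G))"
      "\<And>q. q \<in> surf C \<Longrightarrow> proj q = 0 \<Longrightarrow> \<exists>p\<in>P. cu q = Some p \<or> cv q = Some p \<Longrightarrow>
        \<not> (\<exists>p\<in>P. \<exists>p'\<in>P. cu q = Some p \<and> cv q = Some p')"
    using tree_set[OF cs(1)] P(1) f(1) by (rule model) (rule that)
  interpret resolution P C "f * f * A" G
  proof
    show "p' \<notin> P" if "q \<in> surf C" "proj q = 0" "cu q = Some p" "cv q = Some p'" "p \<in> P" for q p p'
      using C(6)[OF that(1,2)] that(3-5) by blast
  qed (use C P(1) AG(3) in auto)
  have "meromorphic_germ h" using AG(3) by (simp add: meromorphic_germ_def)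
  moreover have "indeterminacy_structure_given_by h \<kappa>"
    unfolding cs(3) P(2) using cs(1) P(1) by (rule indeterminacy_structure)
  moreover have "zero_branches h \<union> pole_branches h = S" using zero_pole_branches[OF f(2) assms(3) AG(1,3)] .
  ultimately show ?thesis by blast
qed

end
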